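(* Let $M\ge0$ be an integer. There exist positive constants $C_1,C_2,\delta_0,\epsilon_0$ such that for all $0<\delta<\delta_0$ and all $h>0$, $\tau>0$ and integers $K\ge1$ such that $h+\frac1{h^2}e^{-C_1Kh}\le\epsilon_0$ and the CFL condition $$(2M+3)\frac{\tau}{h^2}<\frac{2\pi}{3}$$ is satisfied, the following holds. If $\psi^0=(\psi^0_j)_{j=-K}^K\in V_{h,K}$ satisfies $$\operatorname{dist}(i_{h,K}\psi^0,\Gamma)\le\delta,$$ then for all integers $n\ge0$ with $n\tau\le\tau^{-M}$, $$\operatorname{dist}\big(i_{h,K}(\Phi_A^\tau\circ\Phi_P^\tau)^n\psi^0,\Gamma\big)\le C_2\Big(\delta+h+\frac{\tau}{h}+\frac1{h^2}e^{-C_1Kh}\Big).$$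
   Context: Let $H(\psi)=\int_{\mathbb{R}}\big[|\psi_x|^2-\tfrac12|\psi|^4\big]dx$ and $N(\psi)=\int_{\mathbb{R}}|\psi|^2dx$ for $\psi\in H^1(\mathbb{R};\mathbb{C})$. Let $\eta$ be the positive even minimizer of $H$ under the constraint $N=1$, explicitly $\eta(x)=\frac{1}{2\sqrt2}\,\mathrm{sech}(x/4)$, and let $\Gamma=\{e^{i\alpha}\eta:\alpha\in\mathbb{R}\}$. The distance $\operatorname{dist}(\varphi,\Gamma)=\inf_{\nu\in\Gamma}\|\varphi-\nu\|_{H^1}$ is measured in the norm $\|\varphi\|_{H^1}^2=\int_{\mathbb{R}}(|\varphi|^2+|\partial_x\varphi|^2)\,dx$. For $h>0$ and an integer $K\ge1$, $V_{h,K}$ is the space of complex sequences $(\psi_j)_{j\in\mathbb{Z}}$ with $\psi_j=\psi_{-j}$ for all $j$ and $\psi_j=0$ for $|j|\ge K+1$; its elements are written $(\psi_j)_{j=-K}^K$, with implicit extension by $0$. Let $s:\mathbb{R}\to\mathbb{R}$, $s(x)=\max(0,1-|x|)$. The map $i_{h,K}:V_{h,K}\to H^1(\mathbb{R};\mathbb{C})$ is $(i_{h,K}\psi)(x)=\sum_{j\in\mathbb{Z}}\psi_j\,s\!\left(\frac{x}{h}-j\right)$. The flows on $V_{h,K}$ are: $\Phi_P^\tau$, the exact time-$\tau$ flow of $i\dot\psi_\ell=-|\psi_\ell|^2\psi_\ell$, $\ell=-K,\dots,K$, i.e. $\Phi_P^\tau(\psi)_\ell=\exp(i\tau|\psi_\ell|^2)\psi_\ell$;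 and $\Phi_A^\tau$, the exact time-$\tau$ flow of $i\dot\psi_\ell=-\frac1{h^2}(\psi_{\ell+1}+\psi_{\ell-1}-2\psi_\ell)$, $\ell=-K,\dots,K$, with the convention $\psi_\ell=0$ for $|\ell|\ge K+1$. *)

theory Defs
  imports "HOL-Analysis.Analysis"
begin

section \<open>The space $H^1(\mathbb{R};\mathbb{C})$\<close>

definition test_function :: "(real \<Rightarrow> real) \<Rightarrow> bool" where
  "test_function \<phi> \<longleftrightarrow>
     (\<forall>k x. (deriv ^^ k) \<phi> field_differentiable at x) \<and>
     (\<exists>R. \<forall>x. \<bar>x\<bar> > R \<longrightarrow> \<phi> x = 0)"

definition square_integrable :: "(real \<Rightarrow> complex) \<Rightarrow> bool" where
  "square_integrable f \<longleftrightarrow>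
     f \<in> borel_measurable lebesgue \<and> integrable lebesgue (\<lambda>x. (norm (f x))\<^sup>2)"

definition has_weak_derivative :: "(real \<Rightarrow> complex) \<Rightarrow> (real \<Rightarrow> complex) \<Rightarrow> bool" where
  "has_weak_derivative f g \<longleftrightarrow>
     (\<forall>\<phi>. test_function \<phi> \<longrightarrow>
        (LINT x|lebesgue. f x * of_real (deriv \<phi> x)) = - (LINT x|lebesgue. g x * of_real (\<phi> x)))"

definition H1 :: "(real \<Rightarrow> complex) set" where
  "H1 = {f. square_integrable f \<and> (\<exists>g. square_integrable g \<and> has_weak_derivative f g)}"

text \<open>Elements of \<^term>\<open>H1\<close> are functions rather than classes modulo null sets, so the weak
  derivative below is an arbitrary representative of its class. The choice does not affect
  \<open>H1_norm\<close>, which is meaningful on \<^term>\<open>H1\<close> only.\<close>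

definition weak_derivative :: "(real \<Rightarrow> complex) \<Rightarrow> real \<Rightarrow> complex" where
  "weak_derivative f = (SOME g. square_integrable g \<and> has_weak_derivative f g)"

definition H1_norm :: "(real \<Rightarrow> complex) \<Rightarrow> real" where
  "H1_norm f = sqrt (LINT x|lebesgue. (norm (f x))\<^sup>2 + (norm (weak_derivative f x))\<^sup>2)"

definition H1_dist :: "(real \<Rightarrow> complex) \<Rightarrow> (real \<Rightarrow> complex) set \<Rightarrow> real" where
  "H1_dist f S = (INF \<nu>\<in>S. H1_norm (\<lambda>x. f x - \<nu> x))"

section \<open>The ground state and its orbit\<close>

text \<open>The positive even minimizer of $\int |\psi_x|^2 - \frac12 |\psi|^4$ under the constraint
  $\int |\psi|^2 = 1$, through its explicit formula $\frac{1}{2\sqrt2}\,\mathrm{sech}(x/4)$.\<close>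

definition ground_state :: "real \<Rightarrow> real" where
  "ground_state x = 1 / (2 * sqrt 2) * (1 / cosh (x / 4))"

definition ground_orbit :: "(real \<Rightarrow> complex) set" where
  "ground_orbit = {\<lambda>x. exp (\<i> * of_real \<alpha>) * of_real (ground_state x) | \<alpha>::real. True}"

section \<open>The discrete space and its embedding\<close>

text \<open>The mesh size $h$ does not enter the underlying set of $V_{h,K}$, nor does $K$ enter the
  formula for $i_{h,K}$; these parameters are dropped.\<close>

definition V :: "nat \<Rightarrow> (int \<Rightarrow> complex) set" where
  "V K = {\<psi>. (\<forall>j. \<psi> j = \<psi> (- j)) \<and> (\<forall>j. \<bar>j\<bar> \<ge> int K + 1 \<longrightarrow> \<psi> j = 0)}"

definition hat :: "real \<Rightarrow> real" where
  "hat x = max 0 (1 - \<bar>x\<bar>)"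

definition interp :: "real \<Rightarrow> (int \<Rightarrow> complex) \<Rightarrow> real \<Rightarrow> complex" where
  "interp h \<psi> x = (\<Sum>\<^sub>\<infinity>j\<in>UNIV. \<psi> j * of_real (hat (x / h - of_int j)))"

section \<open>The two flows\<close>

definition Phi_P :: "real \<Rightarrow> (int \<Rightarrow> complex) \<Rightarrow> int \<Rightarrow> complex" where
  "Phi_P \<tau> \<psi> l = exp (\<i> * of_real \<tau> * of_real ((norm (\<psi> l))\<^sup>2)) * \<psi> l"

definition solves_A :: "real \<Rightarrow> nat \<Rightarrow> (real \<Rightarrow> int \<Rightarrow> complex) \<Rightarrow> bool" where
  "solves_A h K u \<longleftrightarrow>
     (\<forall>t. u t \<in> V K \<and>
       (\<forall>l\<in>{- int K..int K}. \<exists>v. ((\<lambda>s. u s l) has_vector_derivative v) (at t) \<and>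
          \<i> * v = - (of_real (1 / h\<^sup>2) * (u t (l + 1) + u t (l - 1) - 2 * u t l))))"

text \<open>Existence and uniqueness of the solution, for any initial value in \<^term>\<open>V K\<close>, are
  proved in \<open>solves_A_ex1\<close> below.\<close>

definition Phi_A :: "real \<Rightarrow> nat \<Rightarrow> real \<Rightarrow> (int \<Rightarrow> complex) \<Rightarrow> int \<Rightarrow> complex" where
  "Phi_A h K \<tau> \<psi> = (THE u. solves_A h K u \<and> u 0 = \<psi>) \<tau>"

subsection \<open>Well-definedness\<close>

lemma Phi_P_flow:
  "Phi_P 0 \<psi> = \<psi>"
  "\<exists>v. ((\<lambda>t. Phi_P t \<psi> l) has_vector_derivative v) (at \<tau>) \<and>
       \<i> * v = - (of_real ((norm (Phi_P \<tau> \<psi> l))\<^sup>2) * Phi_P \<tau> \<psi> l)"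
proof -
  show "Phi_P 0 \<psi> = \<psi>"
    by (auto simp: Phi_P_def)
next
  define c :: real where "c = (norm (\<psi> l))\<^sup>2"
  have n: "norm (Phi_P \<tau> \<psi> l) = norm (\<psi> l)"
    by (simp add: Phi_P_def norm_mult)
  have "((\<lambda>z. exp (\<i> * z * of_real c) * \<psi> l) has_field_derivative
          (\<i> * of_real c * (exp (\<i> * of_real \<tau> * of_real c) * \<psi> l))) (at (of_real \<tau>))"
    by (auto intro!: derivative_eq_intros)
  from has_vector_derivative_real_field[OF this]
  have "((\<lambda>t. Phi_P t \<psi> l) has_vector_derivative (\<i> * of_real c * Phi_P \<tau> \<psi> l)) (at \<tau>)"
    by (simp add: Phi_P_def c_def)
  then show "\<exists>v. ((\<lambda>t. Phi_P t \<psi> l) has_vector_derivative v) (at \<tau>) \<and>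
       \<i> * v = - (of_real ((norm (Phi_P \<tau> \<psi> l))\<^sup>2) * Phi_P \<tau> \<psi> l)"
    unfolding n by (intro exI[of _ "\<i> * of_real c * Phi_P \<tau> \<psi> l"]) (simp add: c_def flip: mult.assoc)
qed

definition gen_A :: "real \<Rightarrow> nat \<Rightarrow> (int \<Rightarrow> complex) \<Rightarrow> int \<Rightarrow> complex" where
  "gen_A h K \<psi> l = (if \<bar>l\<bar> \<le> int K
     then \<i> * of_real (1 / h\<^sup>2) * (\<psi> (l + 1) + \<psi> (l - 1) - 2 * \<psi> l) else 0)"

lemma solves_A_iff:
  "solves_A h K u \<longleftrightarrow>
     (\<forall>t. u t \<in> V K) \<and> (\<forall>t l. ((\<lambda>s. u s l) has_vector_derivative gen_A h K (u t) l) (at t))"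
  (is "?L \<longleftrightarrow> ?R")
proof
  assume L: ?L
  have "((\<lambda>s. u s l) has_vector_derivative gen_A h K (u t) l) (at t)" for t l
  proof (cases "\<bar>l\<bar> \<le> int K")
    case True
    then have "l \<in> {- int K..int K}" by auto
    with L obtain v where v: "((\<lambda>s. u s l) has_vector_derivative v) (at t)"
      "\<i> * v = - (of_real (1 / h\<^sup>2) * (u t (l + 1) + u t (l - 1) - 2 * u t l))"
      unfolding solves_A_def by blast
    have "v = - (\<i> * (\<i> * v))" by simp
    also have "\<dots> = gen_A h K (u t) l"
      unfolding v(2) using True by (simp add: gen_A_def)
    finally show ?thesis using v(1) by simp
  next
    case False
    with L have "(\<lambda>s. u s l) = (\<lambda>_. 0)"
      by (auto simp: solves_A_def V_def)
    with False show ?thesis by (simp add: gen_A_def)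
  qed
  with L show ?R by (auto simp: solves_A_def)
next
  assume R: ?R
  have "\<exists>v. ((\<lambda>s. u s l) has_vector_derivative v) (at t) \<and>
          \<i> * v = - (of_real (1 / h\<^sup>2) * (u t (l + 1) + u t (l - 1) - 2 * u t l))"
    if "l \<in> {- int K..int K}" for t l
  proof (intro exI conjI)
    show "((\<lambda>s. u s l) has_vector_derivative gen_A h K (u t) l) (at t)" using R by blast
    have "\<i> * gen_A h K (u t) l
        = (\<i> * \<i>) * (of_real (1 / h\<^sup>2) * (u t (l + 1) + u t (l - 1) - 2 * u t l))"
      using that by (simp only: gen_A_def mult.assoc) auto
    then show "\<i> * gen_A h K (u t) l
        = - (of_real (1 / h\<^sup>2) * (u t (l + 1) + u t (l - 1) - 2 * u t l))"
      by (simp only: i_squared mult_minus1)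
  qed
  with R show ?L by (auto simp: solves_A_def)
qed

lemma gen_A_in_V: "\<psi> \<in> V K \<Longrightarrow> gen_A h K \<psi> \<in> V K"
proof -
  assume "\<psi> \<in> V K"
  then have e: "\<psi> (- j) = \<psi> j" for j by (simp add: V_def)
  have "\<psi> (- j + 1) = \<psi> (j - 1)" for j
    using e[of "j - 1"] by (simp add: add.commute)
  moreover have "\<psi> (- j - 1) = \<psi> (j + 1)" for j
  proof -
    have "- j - 1 = - (j + 1)" by linarith
    then show ?thesis by (metis e)
  qed
  ultimately have "gen_A h K \<psi> (- j) = gen_A h K \<psi> j" for j
    using e[of j] unfolding gen_A_def by (metis abs_minus_cancel add.commute)
  then show ?thesis by (auto simp: V_def gen_A_def)
qed

lemma sum_shift_V:
  fixes d :: "int \<Rightarrow> complex"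
  assumes "d \<in> V K"
  shows "(\<Sum>l=-int K..int K. cnj (d l) * d (l - 1)) = (\<Sum>l=-int K..int K. cnj (d (l + 1)) * d l)"
proof -
  have z: "d l = 0" if "\<bar>l\<bar> \<ge> int K + 1" for l using assms that by (simp add: V_def)
  have "(\<Sum>l=-int K..int K. cnj (d l) * d (l - 1)) = (\<Sum>l=-int K..int K+1. cnj (d l) * d (l - 1))"
    by (rule sum.mono_neutral_left) (auto simp: z)
  also have "\<dots> = (\<Sum>l=-int K-1..int K. cnj (d (l + 1)) * d l)"
    by (rule sum.reindex_bij_witness[of _ "\<lambda>l. l + 1" "\<lambda>l. l - 1"]) auto
  also have "\<dots> = (\<Sum>l=-int K..int K. cnj (d (l + 1)) * d l)"
    by (rule sum.mono_neutral_right) (auto simp: z)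
  finally show ?thesis .
qed

lemma gen_A_skew:
  assumes "d \<in> V K"
  shows "Re (\<Sum>l=-int K..int K. cnj (d l) * gen_A h K d l) = 0"
proof -
  let ?I = "{-int K..int K}"
  have "(\<Sum>l\<in>?I. cnj (d l) * gen_A h K d l) =
      (\<Sum>l\<in>?I. \<i> * of_real (1 / h\<^sup>2) * (cnj (d l) * d (l + 1) + cnj (d l) * d (l - 1) - 2 * (cnj (d l) * d l)))"
    by (rule sum.cong) (auto simp: gen_A_def algebra_simps)
  also have "\<dots> = \<i> * of_real (1 / h\<^sup>2) * ((\<Sum>l\<in>?I. cnj (d l) * d (l + 1)) +
      (\<Sum>l\<in>?I. cnj (d l) * d (l - 1)) - 2 * (\<Sum>l\<in>?I. cnj (d l) * d l))"
    by (simp only: sum_distrib_left[symmetric] sum.distrib sum_subtractf)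
  also have "\<dots> = \<i> * of_real (1 / h\<^sup>2) * ((\<Sum>l\<in>?I. cnj (d l) * d (l + 1) + cnj (d (l + 1)) * d l)
      - 2 * (\<Sum>l\<in>?I. cnj (d l) * d l))"
    by (simp only: sum_shift_V[OF assms] sum.distrib)
  finally show ?thesis
    by (simp add: Re_divide_of_real Im_divide_of_real)
qed

lemma gen_A_diff: "gen_A h K (\<lambda>l. f l - g l) l = gen_A h K f l - gen_A h K g l"
  by (simp add: gen_A_def algebra_simps)

lemma solves_A_unique:
  assumes "solves_A h K u" "solves_A h K w" "u 0 = w 0"
  shows "u = w"
proof -
  define d where "d t l = u t l - w t l" for t l
  have dV: "d t \<in> V K" for t
    using assms(1,2) by (simp add: solves_A_def V_def d_def)
  have dd: "((\<lambda>s. d s l) has_vector_derivative gen_A h K (d t) l) (at t)" for t l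
    using assms(1,2) unfolding solves_A_iff d_def gen_A_diff
    by (intro has_vector_derivative_diff) auto
  define E where "E t = (\<Sum>l=-int K..int K. d t l \<bullet> d t l)" for t
  have "(E has_real_derivative 0) (at t)" for t
  proof -
    have "((\<lambda>s. d s l \<bullet> d s l) has_real_derivative 2 * Re (cnj (d t l) * gen_A h K (d t) l)) (at t)" for l
    proof -
      have "((\<lambda>s. d s l \<bullet> d s l) has_vector_derivative
              (d t l \<bullet> gen_A h K (d t) l + gen_A h K (d t) l \<bullet> d t l)) (at t)"
        by (rule bounded_bilinear.has_vector_derivative[OF bounded_bilinear_inner dd dd])
      then show ?thesis
        by (simp add: has_real_derivative_iff_has_vector_derivative inner_complex_def algebra_simps)
    qed
    then have "(E has_real_derivative (\<Sum>l=-int K..int K. 2 * Re (cnj (d t l) * gen_A h K (d t) l))) (at t)"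
      unfolding E_def by (intro DERIV_sum)
    moreover have "(\<Sum>l=-int K..int K. 2 * Re (cnj (d t l) * gen_A h K (d t) l)) = 0"
      using gen_A_skew[OF dV[of t], of h] by (simp only: Re_sum sum_distrib_left[symmetric])
    ultimately show ?thesis by simp
  qed
  then have "E t = E 0" for t
    using DERIV_isconst_all by blast
  moreover have "E 0 = 0"
    using assms(3) by (simp add: E_def d_def)
  ultimately have E0: "E t = 0" for t by metis
  have "u t l = w t l" for t l
  proof (cases "\<bar>l\<bar> \<le> int K")
    case True
    have "\<forall>l\<in>{-int K..int K}. d t l \<bullet> d t l = 0"
      using E0[of t] unfolding E_def by (subst (asm) sum_nonneg_eq_0_iff) auto
    then have "d t l \<bullet> d t l = 0" using True by (intro bspec[of _ _ l]) auto
    then show ?thesis by (simp add: d_def)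
  next
    case False
    with assms(1,2) show ?thesis by (simp add: solves_A_def V_def)
  qed
  then show ?thesis by blast
qed

lemma solves_A_exists:
  assumes "\<psi> \<in> V K"
  shows "\<exists>u. solves_A h K u \<and> u 0 = \<psi>"
proof -
  define a where "a n = (gen_A h K ^^ n) \<psi>" for n
  have aV: "a n \<in> V K" for n
    by (induction n) (auto simp: a_def assms gen_A_in_V)
  have a_Suc: "a (Suc n) = gen_A h K (a n)" for n by (simp add: a_def)
  define B where "B = Max ((\<lambda>j. norm (\<psi> j)) ` {-int K..int K})"
  define L where "L = 4 / h\<^sup>2"
  have L0: "L \<ge> 0" by (simp add: L_def)
  have bound: "norm (a n l) \<le> L ^ n * B" for n l
  proof (induction n arbitrary: l)
    case 0
    have B: "norm (\<psi> j) \<le> B" if "\<bar>j\<bar> \<le> int K" for j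
      unfolding B_def by (rule Max_ge[OF finite_imageI[OF finite_atLeastAtMost_int]], rule imageI, use that in auto)
    have "0 \<le> B" using B[of 0] order_trans[OF norm_ge_zero] by auto
    then show ?case
      using B[of l] assms by (cases "\<bar>l\<bar> \<le> int K") (auto simp: a_def V_def)
  next
    case (Suc n)
    have B0: "0 \<le> L ^ n * B" using Suc[of 0] norm_ge_zero order_trans by blast
    show ?case
    proof (cases "\<bar>l\<bar> \<le> int K")
      case True
      have "norm (a n (l + 1) + a n (l - 1) - 2 * a n l)
          \<le> norm (a n (l + 1)) + norm (a n (l - 1)) + 2 * norm (a n l)"
        using norm_triangle_ineq4[of "a n (l + 1) + a n (l - 1)" "2 * a n l"]
          norm_triangle_ineq[of "a n (l + 1)" "a n (l - 1)"] norm_mult[of 2 "a n l"]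
        by simp
      also have "\<dots> \<le> 4 * (L ^ n * B)"
        using Suc[of "l + 1"] Suc[of "l - 1"] Suc[of l] by linarith
      finally have "norm (a n (l + 1) + a n (l - 1) - 2 * a n l) / h\<^sup>2 \<le> 4 * (L ^ n * B) / h\<^sup>2"
        by (intro divide_right_mono) auto
      moreover have "norm (a (Suc n) l) = norm (a n (l + 1) + a n (l - 1) - 2 * a n l) / h\<^sup>2"
        using True by (simp add: a_Suc gen_A_def norm_mult norm_divide norm_power)
      ultimately show ?thesis by (simp add: L_def)
    next
      case False
      then have "a (Suc n) l = 0" by (simp add: a_Suc gen_A_def)
      then show ?thesis using mult_nonneg_nonneg[OF L0 B0] by (simp add: mult.assoc)
    qed
  qed
  define c where "c l n = a n l / fact n" for l n
  have summ: "summable (\<lambda>n. c l n * z ^ n)" for l z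
  proof (rule summable_comparison_test')
    show "summable (\<lambda>n. B * ((L * norm z) ^ n /\<^sub>R fact n))"
      by (intro summable_mult summable_exp_generic)
    fix n :: nat
    have "norm (c l n * z ^ n) = norm (a n l) * (norm z ^ n / fact n)"
      by (simp add: c_def norm_mult norm_divide norm_power)
    also have "\<dots> \<le> (L ^ n * B) * (norm z ^ n / fact n)"
      by (intro mult_right_mono bound) auto
    also have "\<dots> = B * ((L * norm z) ^ n /\<^sub>R fact n)"
      by (simp add: power_mult_distrib divide_inverse)
    finally show "norm (c l n * z ^ n) \<le> B * ((L * norm z) ^ n /\<^sub>R fact n)" .
  qed
  define u where "u t l = (\<Sum>n. c l n * of_real t ^ n)" for t :: real and l
  have diffs: "diffs (c l) n = a (Suc n) l / fact n" for l n
    by (simp add: diffs_def c_def field_simps del: of_nat_Suc)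
  have gen: "(\<Sum>n. diffs (c l) n * of_real t ^ n) = gen_A h K (u t) l" for t l
  proof (cases "\<bar>l\<bar> \<le> int K")
    case True
    let ?g = "\<i> * of_real (1 / h\<^sup>2) :: complex"
    have s: "(\<lambda>n. c j n * of_real t ^ n) sums u t j" for j
      unfolding u_def using summ by (rule summable_sums)
    have "(\<lambda>n. ?g * (c (l + 1) n * of_real t ^ n + c (l - 1) n * of_real t ^ n - 2 * (c l n * of_real t ^ n)))
        sums (?g * (u t (l + 1) + u t (l - 1) - 2 * u t l))"
      by (intro sums_mult sums_add sums_diff s)
    also have "(\<lambda>n. ?g * (c (l + 1) n * of_real t ^ n + c (l - 1) n * of_real t ^ n - 2 * (c l n * of_real t ^ n)))
        = (\<lambda>n. diffs (c l) n * of_real t ^ n)"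
      using True by (intro ext) (simp add: diffs a_Suc gen_A_def c_def add_divide_distrib diff_divide_distrib algebra_simps)
    finally show ?thesis using True by (simp add: gen_A_def sums_iff)
  next
    case False
    then show ?thesis by (simp add: diffs a_Suc gen_A_def)
  qed
  have "((\<lambda>s. u s l) has_vector_derivative gen_A h K (u t) l) (at t)" for t l
    using has_vector_derivative_real_field[OF termdiffs_strong_converges_everywhere[OF summ], of l t]
    unfolding gen u_def by simp
  moreover have "u t \<in> V K" for t
    using aV by (auto simp: V_def u_def c_def)
  moreover have "u 0 = \<psi>"
  proof
    fix l
    show "u 0 l = \<psi> l"
      using powser_zero[of "c l"] by (simp only: u_def of_real_0) (simp add: c_def a_def)
  qed
  ultimately show ?thesis unfolding solves_A_iff by blast
qed

lemma solves_A_ex1: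
  assumes "\<psi> \<in> V K"
  shows "\<exists>!u. solves_A h K u \<and> u 0 = \<psi>"
  using solves_A_exists[OF assms] solves_A_unique by metis

end

theory Submission
  imports Defs "HOL-Complex_Analysis.Complex_Analysis"
begin

text \<open>After removing a phase, one step of the splitting is the time-one flow of a small cubic kick of
  size \<open>\<tau>\<close> followed by that of a bounded linear field of size \<open>2 \<tau> / h\<^sup>2\<close>. Under the CFL condition the
  Baker-Campbell-Hausdorff series, expanded in the kick only, converges in its first \<open>M + 2\<close> orders through
  the Bernoulli generating function, whose radius of convergence is \<open>2 \<pi>\<close>. It yields a modified energy
  conserved up to \<open>\<tau>\<^sup>M\<^sup>+\<^sup>3\<close> per step and equal, up to \<open>\<tau>\<^sup>2\<close>, to \<open>\<tau> / 2\<close> times the discrete Hamiltonian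
  plus a multiple of the exactly conserved mass. On piecewise linear interpolants the discrete Hamiltonian is
  within \<open>O(h\<^sup>2)\<close> of the continuous one, for which the orbit of the ground state is coercively stable among
  even functions; Riccati substitutions give the coercivity explicitly. A continuity argument along the two
  flows of each step closes the estimate. The CFL condition bounds \<open>\<tau>\<close> by \<open>h\<^sup>2\<close>, so all errors are
  \<open>O(\<delta> + h)\<close>.\<close>

text \<open>The obstacle is the size 2 \<tau> / h^2 of the linear field, which the CFL condition
  bounds but does not make small: brackets with it gain nothing in norm. They gain only when tested
  by the symplectic form. There the bracket of the linear field with the kick is of order \<tau>^2
  (\<open>P_pair\<close>), by summation by parts, and a field that is small in this weak sense stays
  so under brackets with bounded Hamiltonian fields. Energies ask for no more. Bracketing the linear
  field with an l-linear field costs l + 1 times its size. Fields are kept up to degree 2 M + 3, so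
  the series needs (2 M + 4) (2 \<tau> / h^2) < 2 \<pi>, which the CFL condition implies because (2
  M + 4) / (2 M + 3) <= 4 / 3. The differential equation of the series in the strength s of the kick
  becomes algebraic: each kick raises the degree by two, so the part of degree l scales like s^((l -
  1) / 2) and is fixed by the lower degrees. Polynomials are unsymmetrised multilinear maps on
  lists; to be Hamiltonian then means invariance under cyclic rotation.\<close>

section \<open>Bernoulli numbers and summation along antidiagonals\<close>

text \<open>\<open>b n\<close> is the Taylor coefficient of z / (exp z - 1), the n-th Bernoulli
  number divided by n!. The recursion is the Cauchy product with (exp z - 1) / z, and absolute
  convergence below 2 \<pi> holds because the nonzero zeros of exp z - 1 nearest to the origin are 2
  \<pi> i and -2 \<pi> i.\<close>

lemma bernoulli_coeffs:
 obtains b :: "nat => real" where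
 "!!n. (\<Sum>m\<le>n. b m / fact (Suc (n - m))) = (if n = 0 then 1 else 0)"
 "!!\<rho>. 0 <= \<rho> ==> \<rho> < 2 * pi ==> summable (%n. \<bar>b n\<bar> * \<rho> ^ n)"
proof -
 define \<Phi> :: "complex fps" where "\<Phi> = fps_shift 1 (fps_exp 1 - 1)"
 have nth: "fps_nth \<Phi> n = 1 / fact (Suc n)" for n
 by (simp add: \<Phi>_def algebra_simps)
 have rad: "fps_conv_radius \<Phi> = \<infinity>"
 proof -
 have "fps_conv_radius (fps_exp 1 - 1 :: complex fps) >= min (fps_conv_radius (fps_exp 1 :: complex fps)) (fps_conv_radius (1 :: complex fps))"
 by (rule fps_conv_radius_diff)
 then show ?thesis by (simp add: \<Phi>_def)
 qed
 have exp: "eval_fps \<Phi> has_fps_expansion \<Phi>"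
 using rad by (simp add: has_fps_expansion_def)
 have ev: "z * eval_fps \<Phi> z = exp z - 1" for z
 proof -
 have eq: "fps_X * \<Phi> = fps_exp 1 - 1"
 by (rule fps_ext) (auto simp: nth fps_mult_fps_X_commute[symmetric] split: nat.splits)
 have "eval_fps (fps_X * \<Phi>) z = z * eval_fps \<Phi> z"
 by (subst eval_fps_mult) (auto simp: rad)
 moreover have "eval_fps (fps_exp 1 - 1) z = exp z - 1"
 by (subst eval_fps_diff) auto
 ultimately show ?thesis by (simp add: eq)
 qed
 have nz: "eval_fps \<Phi> z ~= 0" if "norm z < 2 * pi" for z
 proof (cases "z = 0")
 case True then show ?thesis by (simp add: eval_fps_at_0 nth)
 next
 case False
 show ?thesis
 proof
 assume "eval_fps \<Phi> z = 0"
 then have "exp z = 1" using ev[of z] by simp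
 then obtain n :: int where n: "Re z = 0" "Im z = real_of_int (2 * n) * pi"
 by (auto simp: exp_eq_1)
 have "n ~= 0" using n False by (auto simp: complex_eq_iff)
 have nn: "norm z = \<bar>Im z\<bar>" using n by (simp add: cmod_def)
 have "norm z = 2 * pi * \<bar>real_of_int n\<bar>" using nn n by (simp add: abs_mult)
 moreover have "\<bar>real_of_int n\<bar> >= 1" using \<open>n ~= 0\<close> by linarith
 ultimately have "norm z >= 2 * pi" using mult_left_mono[of 1 "\<bar>real_of_int n\<bar>" "2 * pi"] by simp
 with that show False by simp
 qed
 qed
 define G where "G = inverse \<Phi>"
 have Gexp: "(%z. inverse (eval_fps \<Phi> z)) has_fps_expansion G"
 unfolding G_def by (rule has_fps_expansion_inverse[OF exp]) (simp add: nth)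
 have "(%z. inverse (eval_fps \<Phi> z)) holomorphic_on eball 0 (ereal (2 * pi))"
 by (intro holomorphic_intros holomorphic_on_subset[OF holomorphic_on_eval_fps[of _ \<Phi>]])
 (auto simp: rad nz)
 from holomorphic_on_imp_fps_conv_radius_ge[OF Gexp this]
 have Grad: "fps_conv_radius G >= ereal (2 * pi)" .
 define b where "b n = Re (fps_nth G n)" for n
 have "(\<Sum>m\<le>n. b m / fact (Suc (n - m))) = (if n = 0 then 1 else 0)" for n
 proof -
 have "G * \<Phi> = 1" unfolding G_def by (rule inverse_mult_eq_1) (simp add: nth)
 then have "fps_nth (G * \<Phi>) n = (if n = 0 then 1 else 0)" by simp
 then have "Re (\<Sum>m=0..n. fps_nth G m * (1 / fact (Suc (n - m)))) = (if n = 0 then 1 else 0)"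
 by (simp add: fps_mult_nth nth)
 moreover have "Re (fps_nth G m * (1 / fact (Suc (n - m)))) = b m / fact (Suc (n - m))" for m
 proof -
 have "fps_nth G m * (1 / fact (Suc (n - m))) = fps_nth G m / of_real (fact (Suc (n - m)))"
 by (metis (no_types, lifting) mult.right_neutral of_real_fact times_divide_eq_right)
 then show ?thesis unfolding b_def by (simp only: Re_divide_of_real)
 qed
 ultimately show ?thesis by (simp only: Re_sum atMost_atLeast0)
 qed
 moreover have "summable (%n. \<bar>b n\<bar> * \<rho> ^ n)" if "0 <= \<rho>" "\<rho> < 2 * pi" for \<rho>
 proof (rule summable_comparison_test')
 have "summable (%n. norm (fps_nth G n * of_real \<rho> ^ n))"
 by (rule abs_summable_in_conv_radius)
 (use that Grad in \<open>auto simp: fps_conv_radius_def intro: less_le_trans[of _ "ereal (2*pi)"]\<close>)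
 then show "summable (%n. norm (fps_nth G n) * \<rho> ^ n)"
 using that by (simp add: norm_mult norm_power)
 show "norm (\<bar>b n\<bar> * \<rho> ^ n) <= norm (fps_nth G n) * \<rho> ^ n" for n
 using that by (auto simp: b_def abs_mult abs_Re_le_cmod intro!: mult_right_mono)
 qed
 ultimately show thesis using that by blast
qed

text \<open>The product bound makes the family absolutely summable over all pairs, so rows, columns
  and antidiagonals have the same total. The antidiagonals are where the Bernoulli recursion can
  act.\<close>

lemma sums_diagonal:
 fixes a :: "nat => nat => real"
 assumes x: "summable x" and y: "summable y" and le: "!!m k. \<bar>a m k\<bar> <= x m * y k"
 and x0: "!!m. x m >= 0" and y0: "!!k. y k >= 0"
 shows "(%n. \<Sum>m\<le>n. a m (n - m)) sums (\<Sum>k. \<Sum>m. a m k)"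
 "(\<Sum>k. \<Sum>m. a m k) = (\<Sum>m. \<Sum>k. a m k)"
proof -
 have X: "x summable_on UNIV" and Y: "y summable_on UNIV"
 using x y x0 y0 by (auto intro!: summable_nonneg_imp_summable_on)
 have "(%(m, k). x m * y k) summable_on UNIV \<times> UNIV"
 proof (rule summable_on_SigmaI[where g = "%m. x m * (\<Sum>\<^sub>\<infinity>k. y k)"])
 show "((%k. case (m, k) of (m, k) => x m * y k) has_sum x m * (\<Sum>\<^sub>\<infinity>k. y k)) UNIV" for m
 using has_sum_cmult_right[OF has_sum_infsum[OF Y], of "x m"] by simp
 show "(%m. x m * (\<Sum>\<^sub>\<infinity>k. y k)) summable_on UNIV"
 by (rule summable_on_cmult_left[OF X])
 qed (use x0 y0 in auto)
 then have "(%p. norm (x (fst p) * y (snd p))) summable_on UNIV"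
 using x0 y0 by (simp add: case_prod_unfold abs_mult)
 then have "(%p. norm (a (fst p) (snd p))) summable_on UNIV"
 by (rule Infinite_Sum.abs_summable_on_comparison_test) (use le x0 y0 in \<open>auto simp: abs_mult\<close>)
 then have S: "(%(m, k). a m k) summable_on UNIV"
 using Infinite_Sum.abs_summable_summable[of "%p. a (fst p) (snd p)"] by (simp add: case_prod_unfold)
 define T where "T = (\<Sum>\<^sub>\<infinity>(m, k)\<in>UNIV. a m k)"
 have T: "((%(m, k). a m k) has_sum T) UNIV" unfolding T_def using S by (rule has_sum_infsum)
 have row: "(%k. a m k) summable_on UNIV" for m
 by (rule norm_summable_imp_summable_on)
 (rule summable_comparison_test'[OF summable_mult[OF y, of "x m"]], use le in auto)
 have col: "(%m. a m k) summable_on UNIV" for k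
 by (rule norm_summable_imp_summable_on)
 (rule summable_comparison_test'[OF summable_mult2[OF x, of "y k"]], use le in auto)
 have "((%m. \<Sum>k. a m k) has_sum T) UNIV"
 proof -
 have r: "((%k. a m k) has_sum (\<Sum>k. a m k)) UNIV" for m
 using has_sum_infsum[OF row[of m]] has_sum_imp_sums sums_unique by metis
 show ?thesis
 by (rule has_sum_SigmaD[where f = "%(m,k). a m k" and B = "%_. UNIV"]) (use T r in auto)
 qed
 then have 1: "(\<Sum>m. \<Sum>k. a m k) = T" using has_sum_imp_sums sums_unique by metis
 have "((%k. \<Sum>m. a m k) has_sum T) UNIV"
 proof -
 have r: "((%m. a m k) has_sum (\<Sum>m. a m k)) UNIV" for k
 using has_sum_infsum[OF col[of k]] has_sum_imp_sums sums_unique by metis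
 have T': "((%(k, m). a m k) has_sum T) UNIV"
 using T by (subst (asm) has_sum_reindex_bij_witness[of UNIV prod.swap prod.swap UNIV "%(k,m). a m k"]) auto
 show ?thesis
 by (rule has_sum_SigmaD[where f = "%(k,m). a m k" and B = "%_. UNIV"]) (use T' r in auto)
 qed
 then have 2: "(\<Sum>k. \<Sum>m. a m k) = T" using has_sum_imp_sums sums_unique by metis
 have "((%n. \<Sum>m\<le>n. a m (n - m)) has_sum T) UNIV"
 proof -
 have T': "((%(n, m). a m (n - m)) has_sum T) (SIGMA n:UNIV. {..n})"
 using T by (subst has_sum_reindex_bij_witness[of _ "%(m,k). (m+k,m)" "%(n,m). (m,n-m)" UNIV "%(m,k). a m k"]) auto
 show ?thesis
 by (rule has_sum_SigmaD[where f = "%(n,m). a m (n-m)" and B = "%n. {..n}"]) (use T' in auto)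
 qed
 then show "(%n. \<Sum>m\<le>n. a m (n - m)) sums (\<Sum>k. \<Sum>m. a m k)" unfolding 2 by (rule has_sum_imp_sums)
 show "(\<Sum>k. \<Sum>m. a m k) = (\<Sum>m. \<Sum>k. a m k)" using 1 2 by simp
qed

section \<open>Calculus of unsymmetrised multilinear maps on lists\<close>

text \<open>The middle block is what a field is fed. It is nonempty because fields have no constant
  term; hence replacing it by a single vector never lengthens the list.\<close>

definition S3 :: "'a list => ('a list \<times> 'a list \<times> 'a list) set" where
 "S3 us = {(xs, ys, zs). us = xs @ ys @ zs \<and> ys ~= []}"

definition S2 :: "'a list => ('a list \<times> 'a list) set" where
 "S2 us = {(xs, ys). us = xs @ ys}"

text \<open>A polynomial is represented by one multilinear map for each list length and evaluated on
  constant lists. There \<open>ins F f\<close> is the derivative of the polynomial \<open>F\<close>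
  along the vector field \<open>f\<close>.\<close>

definition ins :: "('v list => 'w::comm_monoid_add) => ('v list => 'v) => 'v list => 'w" where
 "ins F f us = (\<Sum>(xs, ys, zs)\<in>S3 us. F (xs @ f ys # zs))"

lemma S3_image: "S3 us = (%(j, i). (take i us, take j (drop i us), drop (i + j) us)) `
 (SIGMA j:{1..length us}. {..length us - j})" (is "_ = ?f ` ?D")
proof
 show "S3 us \<subseteq> ?f ` ?D"
 proof
 fix t assume "t \<in> S3 us"
 then obtain xs ys zs where t: "t = (xs, ys, zs)" "us = xs @ ys @ zs" "ys ~= []" by (auto simp: S3_def)
 show "t \<in> ?f ` ?D"
 by (rule image_eqI[of _ _ "(length ys, length xs)"]) (use t in \<open>auto simp: Suc_le_eq\<close>)
 qed
next
 show "?f ` ?D \<subseteq> S3 us"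
 by (auto simp: S3_def add.commute[of _ "_::nat"] simp flip: drop_drop)
qed

lemma S3_inj: "inj_on (%(j, i). (take i us, take j (drop i us), drop (i + j) us))
 (SIGMA j:{1..length us}. {..length us - j})"
proof (rule inj_onI, clarsimp)
 fix j i j' i'
 assume a: "take i us = take i' us" "take j (drop i us) = take j' (drop i' us)"
 "i <= length us - j" "i' <= length us - j'" "j <= length us" "j' <= length us"
 from a(1) have "length (take i us) = length (take i' us)" by simp
 moreover have "i <= length us" "i' <= length us" using a by linarith+
 ultimately have i: "i = i'" by simp
 from a(2) have "length (take j (drop i us)) = length (take j' (drop i' us))" by simp
 then have "min j (length us - i) = min j' (length us - i')" by (simp add: min.commute)
 moreover have "j <= length us - i" "j' <= length us - i'" using a i by linarith+
 ultimately show "j = j' \<and> i = i'" using i by simp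
qed

lemma finite_S3 [simp]: "finite (S3 us)"
 by (subst S3_image) auto

lemma finite_S2 [simp]: "finite (S2 us)"
proof -
 have "S2 us \<subseteq> (%i. (take i us, drop i us)) ` {..length us}"
 proof
 fix t assume "t \<in> S2 us"
 then obtain xs ys where t: "t = (xs, ys)" "us = xs @ ys" by (auto simp: S2_def)
 show "t \<in> (%i. (take i us, drop i us)) ` {..length us}"
 by (rule image_eqI[of _ _ "length xs"]) (use t in auto)
 qed
 then show ?thesis by (rule finite_subset) auto
qed

lemma sum_S3:
 "(\<Sum>(xs, ys, zs)\<in>S3 us. H xs ys zs) =
 (\<Sum>j=1..length us. \<Sum>i\<le>length us - j. H (take i us) (take j (drop i us)) (drop (i + j) us))"
 unfolding S3_image sum.reindex[OF S3_inj]
 by (subst sum.Sigma) (auto simp: case_prod_unfold)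

text \<open>A block lies to the right of the marked letter \<open>v\<close>, contains it, or lies to
  its left. This trichotomy is what multilinearity, the exchange symmetry and the bracket identity
  of insertions rest on.\<close>

lemma sum_S3_Cons:
 "(\<Sum>(x, y, z)\<in>S3 (xs @ v # zs). H x y z) =
 (\<Sum>(a, b, c)\<in>S3 zs. H (xs @ v # a) b c) +
 (\<Sum>(a, b1)\<in>S2 xs. \<Sum>(b2, c)\<in>S2 zs. H a (b1 @ v # b2) c) +
 (\<Sum>(a, b, c)\<in>S3 xs. H a b (c @ v # zs))"
proof -
 let ?f1 = "%(a, b, c). (xs @ v # a, b, c)" and ?f3 = "%(a, b, c). (a, b, c @ v # zs)"
 let ?f2 = "%((a, b1), (b2, c)). (a, b1 @ v # b2, c)"
 let ?A = "?f1 ` S3 zs" and ?B = "?f2 ` (S2 xs \<times> S2 zs)" and ?C = "?f3 ` S3 xs"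
 have eq: "S3 (xs @ v # zs) = ?A \<union> ?B \<union> ?C"
 proof
 show "S3 (xs @ v # zs) \<subseteq> ?A \<union> ?B \<union> ?C"
 proof
 fix t assume "t \<in> S3 (xs @ v # zs)"
 then obtain a b c where t: "t = (a, b, c)" and e: "xs @ v # zs = a @ b @ c" and b: "b ~= []"
 by (auto simp: S3_def)
 from iffD1[OF append_eq_append_conv2 e] show "t \<in> ?A \<union> ?B \<union> ?C"
 proof (elim exE disjE conjE)
 fix d assume "xs @ d = a" "v # zs = d @ b @ c"
 note 1 = this[symmetric]
 show ?thesis
 proof (cases d)
 case Nil
 with 1 b obtain b2 where b2: "b = v # b2" "zs = b2 @ c" by (cases b) auto
 have "t = ?f2 ((xs, []), (b2, c))" using t 1 Nil b2 by simp
 moreover have "((xs, []), (b2, c)) \<in> S2 xs \<times> S2 zs" using b2 by (simp add: S2_def)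
 ultimately show ?thesis by blast
 next
 case (Cons v' d')
 with 1 have "v' = v" "d' @ b @ c = zs" by auto
 then have "t = ?f1 (d', b, c)" "(d', b, c) \<in> S3 zs" using t 1 Cons b by (auto simp: S3_def)
 then show ?thesis by blast
 qed
 next
 fix d assume "xs = a @ d" "d @ v # zs = b @ c"
 note 2 = this[symmetric]
 from iffD1[OF append_eq_append_conv2 2(2)] show ?thesis
 proof (elim disjE exE conjE)
 fix e assume 3: "b = d @ e" "e @ c = v # zs"
 show ?thesis
 proof (cases e)
 case Nil
 then have "t = ?f3 (a, b, [])" "(a, b, []) \<in> S3 xs" using t 2 3 b by (auto simp: S3_def)
 then show ?thesis by blast
 next
 case (Cons v' b2)
 then have "t = ?f2 ((a, d), (b2, c))" "((a, d), (b2, c)) \<in> S2 xs \<times> S2 zs"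
 using t 2 3 by (auto simp: S2_def)
 then show ?thesis by blast
 qed
 next
 fix e assume 4: "b @ e = d" "c = e @ v # zs"
 then have "t = ?f3 (a, b, e)" "(a, b, e) \<in> S3 xs" using t 2 b by (auto simp: S3_def)
 then show ?thesis by blast
 qed
 qed
 qed
 show "?A \<union> ?B \<union> ?C \<subseteq> S3 (xs @ v # zs)" by (auto simp: S3_def S2_def)
 qed
 have d1: "(?A \<union> ?B) \<inter> ?C = {}" by (auto simp: S3_def S2_def)
 have d2: "?A \<inter> ?B = {}" 
 proof -
 have A: "length (fst t) > length xs" if "t \<in> ?A" for t using that by auto
 have B: "length (fst t) <= length xs" if "t \<in> ?B" for t using that by (auto simp: S2_def)
 show ?thesis
 proof (rule equals0I)
 fix t assume "t \<in> ?A \<inter> ?B"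
 then show False using A[of t] B[of t] by simp
 qed
 qed
 have i1: "inj_on ?f1 (S3 zs)" and i3: "inj_on ?f3 (S3 xs)" by (auto simp: inj_on_def)
 have i2: "inj_on ?f2 (S2 xs \<times> S2 zs)"
 by (auto simp: inj_on_def S2_def)
 have "(\<Sum>(x, y, z)\<in>S3 (xs @ v # zs). H x y z) = (\<Sum>(x, y, z)\<in>?A. H x y z) + (\<Sum>(x, y, z)\<in>?B. H x y z) + (\<Sum>(x, y, z)\<in>?C. H x y z)"
 unfolding eq by (subst sum.union_disjoint[OF _ _ d1], simp, simp, subst sum.union_disjoint[OF _ _ d2]) auto
 then show ?thesis
 unfolding sum.reindex[OF i1] sum.reindex[OF i2] sum.reindex[OF i3]
 by (simp add: case_prod_unfold sum.cartesian_product o_def)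
qed

definition ml :: "('v::real_vector list => 'w::real_vector) => bool" where
 "ml F \<longleftrightarrow> (\<forall>xs zs. linear (%v. F (xs @ v # zs)))"

text \<open>The Lie bracket of polynomial vector fields, with the sign for which differentiation
  along a field is a homomorphism (\<open>pre_lie\<close>).\<close>

definition lie :: "('v::real_vector list => 'v) => ('v list => 'v) => 'v list => 'v" where
 "lie f g us = ins g f us - ins f g us"

lemma mlD: "ml F ==> linear (%v. F (xs @ v # zs))" by (simp add: ml_def)

lemma linear_sum_fun:
 "(!!a. a \<in> S ==> linear (%v. h a v)) ==> linear (%v. \<Sum>a\<in>S. h a v)"
 by (rule linear_compose_sum) auto

lemma ml_ins:
 assumes F: "ml F" and f: "ml f" shows "ml (ins F f)"
 unfolding ml_def
proof (intro allI)
 fix xs zs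
 have 1: "linear (%v. F (xs @ v # a @ f b # c))" for a b c using mlD[OF F, of xs "a @ f b # c"] .
 have 2: "linear (%v. F (a @ f (b1 @ v # b2) # c))" for a b1 b2 c
 using linear_compose[OF mlD[OF f, of b1 b2] mlD[OF F, of a c]] by (simp add: o_def)
 have 3: "linear (%v. F (a @ f b # c @ v # zs))" for a b c
 using mlD[OF F, of "a @ f b # c" zs] by simp
 show "linear (%v. ins F f (xs @ v # zs))"
 unfolding ins_def sum_S3_Cons
 by (intro linear_compose_add linear_sum_fun) (auto simp: case_prod_unfold intro!: linear_sum_fun 1 2 3)
qed

lemma ins_diff_left: "ins (%us. F us - G us) f us = ins F f us - ins G f (us :: 'v list)" for F :: "'v list => 'w::ab_group_add"
 by (simp add: ins_def case_prod_unfold sum_subtractf)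

lemma ml_diff: "ml F ==> ml G ==> ml (%us. F us - G us)"
 by (auto simp: ml_def intro!: linear_compose_sub)

lemma ml_lie: "ml f ==> ml g ==> ml (lie f g)"
 unfolding lie_def[abs_def] by (intro ml_diff ml_ins)

text \<open>Two successive insertions are nested or disjoint. The disjoint ones are counted by
  \<open>U\<close> (the block of \<open>g\<close> to the left of that of \<open>f\<close>) and
  \<open>W\<close> (to the right); they occur in both orders and cancel, and the nested ones form
  the bracket.\<close>

lemma pre_lie:
 assumes F: "ml F"
 shows "ins (ins F g) f us - ins (ins F f) g us = ins F (lie f g) us"
proof -
 define U where "U f g = (\<Sum>(xs, ys, zs)\<in>S3 us. \<Sum>(a, b, c)\<in>S3 zs. F (xs @ g ys # a @ f b # c))" for f g
 define W where "W f g = (\<Sum>(xs, ys, zs)\<in>S3 us. \<Sum>(a, b, c)\<in>S3 xs. F (a @ f b # c @ g ys # zs))" for f g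
 have dec: "ins (ins F f) g us = U f g + ins F (ins f g) us + W f g" for f g
 proof -
 have mid: "(\<Sum>(xs, ys, zs)\<in>S3 us. \<Sum>(a, b1)\<in>S2 xs. \<Sum>(b2, c)\<in>S2 zs. F (a @ f (b1 @ g ys # b2) # c))
 = ins F (ins f g) us"
 proof -
 have "ins F (ins f g) us = (\<Sum>(a, b, c)\<in>S3 us. \<Sum>(b1, ys, b2)\<in>S3 b. F (a @ f (b1 @ g ys # b2) # c))"
 unfolding ins_def by (simp add: case_prod_unfold linear_sum[OF mlD[OF F]])
 also have "... = (\<Sum>(xs, ys, zs)\<in>S3 us. \<Sum>((a, b1), (b2, c))\<in>S2 xs \<times> S2 zs. F (a @ f (b1 @ g ys # b2) # c))"
 unfolding case_prod_unfold
 by (subst (1 2) sum.Sigma, simp, simp, simp, simp)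
 (rule sum.reindex_bij_witness[of _
 "%((xs, ys, zs), ((a, b1), (b2, c))). ((a, b1 @ ys @ b2, c), (b1, ys, b2))"
 "%((a, b, c), (b1, ys, b2)). ((a @ b1, ys, b2 @ c), ((a, b1), (b2, c)))"],
 auto simp: S3_def S2_def)
 finally show ?thesis by (simp add: sum.cartesian_product case_prod_unfold)
 qed
 have "ins (ins F f) g us = (\<Sum>(xs, ys, zs)\<in>S3 us. \<Sum>(a, b, c)\<in>S3 zs. F (xs @ g ys # a @ f b # c))
 + (\<Sum>(xs, ys, zs)\<in>S3 us. \<Sum>(a, b1)\<in>S2 xs. \<Sum>(b2, c)\<in>S2 zs. F (a @ f (b1 @ g ys # b2) # c))
 + (\<Sum>(xs, ys, zs)\<in>S3 us. \<Sum>(a, b, c)\<in>S3 xs. F (a @ f b # c @ g ys # zs))"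
 unfolding ins_def[of "ins F f" g us] ins_def[of F f] sum_S3_Cons
 by (simp add: case_prod_unfold sum.distrib)
 then show ?thesis unfolding mid U_def W_def .
 qed
 have UW: "U f g = W g f" for f g
 unfolding U_def W_def case_prod_unfold
 by (subst (1 2) sum.Sigma, simp, simp, simp, simp)
 (rule sum.reindex_bij_witness[of _
 "%((xs, ys, zs), (a, b, c)). ((a, b, c @ ys @ zs), (c, ys, zs))"
 "%((xs, ys, zs), (a, b, c)). ((xs @ ys @ a, b, c), (xs, ys, a))"],
 auto simp: S3_def)
 have "ins F (lie f g) us = ins F (ins g f) us - ins F (ins f g) us"
 unfolding ins_def[of F] lie_def
 by (simp add: case_prod_unfold linear_diff[OF mlD[OF F]] sum_subtractf)
 then show ?thesis unfolding dec UW by simp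
qed

section \<open>Majorant recursions\<close>

text \<open>Coefficients of the formal solution y = p x^3 + c y^2 / x. The index
  \<open>l + 1 - j\<close> reflects that a bracket of fields of degrees j and k has degree j + k -
  1; the sum omits j = 1, the linear field, which is accounted for separately.\<close>

function majorant :: "real => real => nat => real" where
 "majorant p c l = (if l = 3 then p else 0) + c * (\<Sum>j\<in>{2..<l}. majorant p c j * majorant p c (l + 1 - j))"
 by auto
termination by (relation "Wellfounded.measure (%(p, c, l). l)") auto

declare majorant.simps [simp del]

lemma majorant_nonneg: "p >= 0 ==> c >= 0 ==> majorant p c l >= 0"
proof (induction l rule: less_induct)
 case (less l)
 then show ?case
 by (subst majorant.simps) (auto intro!: add_nonneg_nonneg mult_nonneg_nonneg sum_nonneg)
qed

lemma majorant_low [simp]: "l <= 2 ==> majorant p c l = 0"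
 by (subst majorant.simps) auto

lemma majorant_even: "even l ==> majorant p c l = 0"
proof (induction l rule: less_induct)
 case (less l)
 have "majorant p c j * majorant p c (l + 1 - j) = 0" if "j \<in> {2..<l}" for j
 proof (cases "even j")
 case True then show ?thesis using less that by simp
 next
 case False
 then have "even (l + 1 - j)" using less.prems that by auto
 moreover have "l + 1 - j < l" using that by auto
 ultimately show ?thesis using less.IH[of "l + 1 - j"] by simp
 qed
 then have "(\<Sum>j\<in>{2..<l}. majorant p c j * majorant p c (l + 1 - j)) = 0" by (intro sum.neutral) blast
 then show ?case using less.prems by (subst majorant.simps) auto
qed

text \<open>The linear counterpart for weak bounds: \<open>k\<close> stands for the bracket of the
  linear field with the kick, \<open>e\<close> for the bracket of the kick with the remainder two
  degrees below, and \<open>c\<close> for brackets with the nonlinear part of the modified field, of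
  size \<open>D\<close>.\<close>

function energy_majorant :: "(nat => real) => real => real => real => nat => real" where
 "energy_majorant D k c e l = (if l = 3 then k else 0) + e * (if l <= 3 then 0 else energy_majorant D k c e (l - 2))
 + c * (\<Sum>j\<in>{2..<l}. D j * energy_majorant D k c e (l + 1 - j))"
 by auto
termination by (relation "Wellfounded.measure (%(D, k, c, e, l). l)") auto

declare energy_majorant.simps [simp del]

lemma energy_majorant_nonneg:
 "(!!j. D j >= 0) ==> k >= 0 ==> c >= 0 ==> e >= 0 ==> energy_majorant D k c e l >= 0"
proof (induction l rule: less_induct)
 case (less l)
 then show ?case
 by (subst energy_majorant.simps) (auto intro!: add_nonneg_nonneg mult_nonneg_nonneg sum_nonneg)
qed

lemma energy_majorant_low [simp]: "l <= 2 ==> energy_majorant D k c e l = 0"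
 by (subst energy_majorant.simps) auto

lemma energy_majorant_even:
 assumes D: "!!j. even j ==> D j = 0"
 shows "even l ==> energy_majorant D k c e l = 0"
proof (induction l rule: less_induct)
 case (less l)
 have "D j * energy_majorant D k c e (l + 1 - j) = 0" if "j \<in> {2..<l}" for j
 proof (cases "even j")
 case True then show ?thesis using D by simp
 next
 case False
 then have "even (l + 1 - j)" using less.prems that by auto
 moreover have "l + 1 - j < l" using that by auto
 ultimately show ?thesis using less.IH[of "l + 1 - j"] by simp
 qed
 then have "(\<Sum>j\<in>{2..<l}. D j * energy_majorant D k c e (l + 1 - j)) = 0" by (intro sum.neutral) blast
 moreover have "energy_majorant D k c e (l - 2) = 0" if "l > 3"
 using less.IH[of "l - 2"] less.prems that by auto
 ultimately show ?case using less.prems by (subst energy_majorant.simps) auto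
qed

lemma sum_S3_le:
 fixes H :: "'a list => 'a list => 'a list => real"
 assumes "!!xs ys zs. us = xs @ ys @ zs ==> ys ~= [] ==> H xs ys zs <= w (length ys)"
 shows "(\<Sum>(xs, ys, zs)\<in>S3 us. H xs ys zs) <= (\<Sum>j=1..length us. real (length us + 1 - j) * w j)"
proof -
 have "(\<Sum>(xs, ys, zs)\<in>S3 us. H xs ys zs) <= (\<Sum>(xs, ys, zs)\<in>S3 us. w (length ys))"
 by (rule sum_mono) (auto simp: S3_def assms)
 also have "... = (\<Sum>j=1..length us. \<Sum>i\<le>length us - j. w (length (take j (drop i us))))"
 by (rule sum_S3)
 also have "... = (\<Sum>j=1..length us. \<Sum>i\<le>length us - j. w j)"
 by (intro sum.cong refl arg_cong[where f = w]) auto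
 also have "... = (\<Sum>j=1..length us. real (length us + 1 - j) * w j)"
 by (intro sum.cong refl) (auto simp: Suc_diff_le)
 finally show ?thesis .
qed

text \<open>A block of length j has l + 1 - j positions in one order of insertion and, after
  reversing the summation, j in the other. The total l + 1 does not depend on j; it is the factor
  that enters the CFL condition.\<close>

lemma conv_sum:
 fixes z g :: "nat => real"
 shows "(\<Sum>j=1..l. real (l + 1 - j) * (g (l + 1 - j) * z j)) + (\<Sum>j=1..l. real (l + 1 - j) * (z (l + 1 - j) * g j))
 = real (l + 1) * (\<Sum>j=1..l. z j * g (l + 1 - j))"
proof -
 have "(\<Sum>j=1..l. real (l + 1 - j) * (z (l + 1 - j) * g j)) = (\<Sum>j=1..l. real j * (z j * g (l + 1 - j)))"
 by (subst sum.atLeastAtMost_rev) (auto intro!: sum.cong)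
 then show ?thesis
 by (auto simp: sum_distrib_left simp flip: sum.distrib intro!: sum.cong simp: of_nat_diff algebra_simps)
qed

section \<open>Kicked Hamiltonian systems: norm bounds and weak bounds\<close>

text \<open>The kick has size \<sigma>^2 and the linear field size \<open>\<alpha>\<close>, of order
  one. \<open>A_sym\<close> and \<open>P_cyc\<close> make both Hamiltonian for \<open>om\<close>.
  \<open>P_pair\<close> is the only gain: an order \<sigma>^4 where the separate bounds would give
  \<sigma>^2 times \<open>\<alpha>\<close>. \<open>C0\<close> and \<open>C1\<close> compare
  \<open>hn\<close> with the Banach norm; they serve convergence and enter no final constant.
  \<open>cfl\<close> bounds the cost of one bracket with the linear field in every degree up to
  \<open>L\<close>.\<close>

locale kicked =
 fixes hn :: "'v::banach => real" and om :: "'v => 'v => real"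
 and A :: "'v => 'v" and P :: "'v => 'v => 'v => 'v"
 and C0 C1 \<alpha> p \<kappa> co \<sigma> \<Omega> \<rho> B :: real and b :: "nat => real" and L :: nat
 assumes hn_add: "hn (u + v) <= hn u + hn v"
 and hn_scale: "hn (c *\<^sub>R u) = \<bar>c\<bar> * hn u"
 and hn_le: "hn u <= C0 * norm u" and norm_le: "norm u <= C1 * hn u"
 and C0: "C0 >= 0" and C1: "C1 >= 0"
 and om_linear: "linear (%u. om u v)"
 and om_anti: "om u v = - om v u"
 and om_le: "\<bar>om u v\<bar> <= co * hn u * hn v"
 and A_linear: "linear A" and A_le: "hn (A u) <= \<alpha> * hn u"
 and A_sym: "om (A u) v = om (A v) u"
 and P_linear: "linear (%u. P u v w)" "linear (%v. P u v w)" "linear (%w. P u v w)"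
 and P_le: "hn (P u v w) <= p * \<sigma>\<^sup>2 * (hn u * hn v * hn w)"
 and P_cyc: "om (P u v w) x = om (P x u v) w"
 and P_pair: "\<bar>om (P u v w) (A x) + om (P u v (A w)) x\<bar> <= \<kappa> * \<sigma>^4 * (hn u * hn v * hn w * hn x)"
 and nonneg: "\<alpha> >= 0" "p >= 0" "\<kappa> >= 0" "co >= 0" "\<sigma> > 0" "\<sigma> <= 1" "1 <= \<rho>" "\<Omega> < \<rho>"
 and cfl: "real (L + 1) * \<alpha> <= \<Omega>" and L3: "L >= 3"
 and b_summable: "summable (%n. \<bar>b n\<bar> * \<rho> ^ n)" and b_le: "(\<Sum>n. \<bar>b n\<bar> * \<rho> ^ n) <= B"
 and b_conv: "(\<Sum>m\<le>n. b m / fact (Suc (n - m))) = (if n = 0 then 1 else 0)"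
begin

lemma B_nonneg: "B >= 0"
 using suminf_nonneg[OF b_summable] nonneg b_le by fastforce

lemma hn_zero [simp]: "hn 0 = 0" using hn_scale[of 0 0] by simp

lemma hn_minus [simp]: "hn (- u) = hn u" using hn_scale[of "-1" u] by simp

lemma hn_nonneg [simp]: "hn u >= 0" using hn_add[of u "-u"] by simp

lemma hn_diff: "hn (u - v) <= hn u + hn v" using hn_add[of u "-v"] by simp

lemma hn_sum: "hn (sum f S) <= (\<Sum>a\<in>S. hn (f a))"
proof (induction S rule: infinite_finite_induct)
 case (insert x F)
 then show ?case using hn_add[of "f x" "sum f F"] by simp
qed auto

lemma hn_eq_0: "hn u = 0 ==> u = 0" using norm_le[of u] by simp

lemma tendsto_hn: assumes "(f \<longlongrightarrow> l) F" shows "((%x. hn (f x)) \<longlongrightarrow> hn l) F"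
proof (rule Lim_transform_bound[where g = "%x. C0 * norm (f x - l)", THEN LIM_zero_cancel])
 have "\<bar>hn x - hn l\<bar> <= C0 * norm (x - l)" for x
 using hn_add[of "x - l" l] hn_add[of "l - x" x] hn_le[of "x - l"] hn_le[of "l - x"] norm_minus_commute[of l x]
 by simp
 then show "\<forall>\<^sub>F x in F. norm (hn (f x) - hn l) <= norm (C0 * norm (f x - l))"
 using C0 by (simp add: abs_mult)
 show "((%x. C0 * norm (f x - l)) \<longlongrightarrow> 0) F"
 using tendsto_mult_left[OF tendsto_norm_zero[OF LIM_zero[OF assms]], of C0] by simp
qed

lemma om_linear2: "linear (%v. om u v)"
 using linear_compose_neg[OF om_linear[of u]] om_anti[of _ u] om_anti[of u] by (metis (no_types, lifting) ext)

lemma om_self [simp]: "om u u = 0" using om_anti[of u u] by simp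

lemma bounded_linear_om: "bounded_linear (%u. om u v)"
proof (rule bounded_linear_intro[where K = "co * C0 * hn v"])
 fix x show "norm (om x v) <= norm x * (co * C0 * hn v)"
 proof -
 have "\<bar>om x v\<bar> <= co * hn x * hn v" by (rule om_le)
 also have "... <= co * (C0 * norm x) * hn v" using nonneg by (intro mult_right_mono mult_left_mono hn_le) auto
 finally show ?thesis by (simp add: ac_simps)
 qed
qed (auto simp: linear_add[OF om_linear] linear_scale[OF om_linear])

definition hp :: "'v list => real" where "hp us = prod_list (map hn us)"

lemma hp_simps [simp]: "hp [] = 1" "hp (u # us) = hn u * hp us" "hp (xs @ ys) = hp xs * hp ys"
 by (auto simp: hp_def)

lemma hp_nonneg [simp]: "hp us >= 0" by (induction us) auto

definition fb :: "('v list => 'v) => (nat => real) => bool" where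
 "fb f g \<longleftrightarrow> (\<forall>us. hn (f us) <= g (length us) * hp us)"

text \<open>A weak bound: the field is tested by the symplectic form. Energies see fields only in
  this way, and it is only here that the bracket of \<open>A\<close> and \<open>P\<close> is
  small.\<close>

definition eb :: "('v list => 'v) => (nat => real) => bool" where
 "eb f g \<longleftrightarrow> (\<forall>us u. \<bar>om (f us) u\<bar> <= g (length us) * hp us * hn u)"

definition sb :: "('v list => real) => (nat => real) => bool" where
 "sb F g \<longleftrightarrow> (\<forall>us. \<bar>F us\<bar> <= g (length us) * hp us)"

text \<open>Invariance of the form om (f us) u under cyclic rotations of the word
  \<open>u # us\<close>. It expresses that \<open>f\<close> is a Hamiltonian field without any
  symmetrisation of \<open>f\<close>.\<close>

definition xch :: "('v list => 'v) => bool" where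
 "xch f \<longleftrightarrow> (\<forall>xs v zs u. om (f (xs @ v # zs)) u = om (f (zs @ u # xs)) v)"

lemma xchD: "xch f ==> om (f (xs @ v # zs)) u = om (f (zs @ u # xs)) v"
 by (simp add: xch_def)

lemma om_sum_left: "om (sum f S) u = (\<Sum>a\<in>S. om (f a) u)"
 using linear_sum[OF om_linear] .

lemma om_diff_left: "om (x - y) u = om x u - om y u"
 using linear_diff[OF om_linear] .

lemma om_ins:
 assumes "xch g"
 shows "om (ins g f us) u = (\<Sum>(xs, ys, zs)\<in>S3 us. om (g (zs @ u # xs)) (f ys))"
 unfolding ins_def om_sum_left case_prod_unfold
 by (intro sum.cong refl) (rule xchD[OF assms])

lemma om_ins0: "om (ins g f us) u = (\<Sum>(xs, ys, zs)\<in>S3 us. om (g (xs @ f ys # zs)) u)"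
 unfolding ins_def om_sum_left case_prod_unfold ..

text \<open>Terms in which \<open>v\<close> stays outside the inner block are exchanged with one
  another. If \<open>v\<close> lies inside it, two exchanges and the antisymmetry of
  \<open>om\<close> produce minus the matching term of the opposite insertion, and the bracket
  contains both insertions with opposite signs.\<close>

lemma xch_lie:
 assumes f: "xch f" and g: "xch g"
 shows "xch (lie f g)"
 unfolding xch_def
proof (intro allI)
 fix xs zs :: "'v list" and u v :: 'v
 define L1 where "L1 g f = (\<Sum>(a, b, c)\<in>S3 zs. om (g (xs @ v # a @ f b # c)) u)" for g f
 define L2 where "L2 g f = (\<Sum>(a, b1)\<in>S2 xs. \<Sum>(b2, c)\<in>S2 zs. om (g (a @ f (b1 @ v # b2) # c)) u)" for g f
 define L3 where "L3 g f = (\<Sum>(a, b, c)\<in>S3 xs. om (g (a @ f b # c @ v # zs)) u)" for g f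
 define R2 where "R2 g f = (\<Sum>(a, b1)\<in>S2 zs. \<Sum>(b2, c)\<in>S2 xs. om (g (a @ f (b1 @ u # b2) # c)) v)" for g f
 have l: "om (ins g f (xs @ v # zs)) u = L1 g f + L2 g f + L3 g f" for g f
 using om_ins0[of g f "xs @ v # zs" u] sum_S3_Cons[of "%a b c. om (g (a @ f b # c)) u" xs v zs]
 by (simp add: L1_def L2_def L3_def case_prod_unfold)
 have r: "om (ins g f (zs @ u # xs)) v = L3 g f + R2 g f + L1 g f" if g: "xch g" for g f
 proof -
 have "om (g (zs @ u # a @ f b # c)) v = om (g (a @ f b # c @ v # zs)) u" for a b c
 using xchD[OF g, of zs u "a @ f b # c" v] by simp
 moreover have "om (g (a @ f b # c @ u # xs)) v = om (g (xs @ v # a @ f b # c)) u" for a b c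
 using xchD[OF g, of "a @ f b # c" u xs v] by simp
 ultimately show ?thesis
 using om_ins0[of g f "zs @ u # xs" v] sum_S3_Cons[of "%a b c. om (g (a @ f b # c)) v" zs u xs]
 by (simp add: L1_def L3_def R2_def case_prod_unfold)
 qed
 have m: "L2 g f = - R2 f g" if f: "xch f" and g: "xch g" for f g
 proof -
 have e: "om (g (a @ f (b1 @ v # b2) # c)) u = - om (f (b2 @ g (c @ u # a) # b1)) v" for a b1 b2 c
 using xchD[OF g, of a "f (b1 @ v # b2)" c u] xchD[OF f, of b1 v b2 "g (c @ u # a)"]
 om_anti[of "g (c @ u # a)" "f (b1 @ v # b2)"] by simp
 have "L2 g f = - (\<Sum>(a, b1)\<in>S2 xs. \<Sum>(b2, c)\<in>S2 zs. om (f (b2 @ g (c @ u # a) # b1)) v)"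
 unfolding L2_def e by (simp add: case_prod_unfold sum_negf)
 also have "(\<Sum>(a, b1)\<in>S2 xs. \<Sum>(b2, c)\<in>S2 zs. om (f (b2 @ g (c @ u # a) # b1)) v) = R2 f g"
 unfolding R2_def case_prod_unfold by (rule sum.swap)
 finally show ?thesis .
 qed
 show "om (lie f g (xs @ v # zs)) u = om (lie f g (zs @ u # xs)) v"
 unfolding lie_def om_diff_left l r[OF f] r[OF g] using m[OF f g] m[OF g f] by simp
qed

lemma ins_le:
 assumes "!!us. N (G us) <= g (length us) * hp us" and f: "fb f z"
 and N: "!!(S :: ('v list \<times> 'v list \<times> 'v list) set) h. N (sum h S) <= (\<Sum>a\<in>S. N (h a))" and g0: "!!j. g j >= 0"
 shows "N (ins G f us) <= (\<Sum>j=1..length us. real (length us + 1 - j) * (g (length us + 1 - j) * z j)) * hp us"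
proof -
 have "N (ins G f us) <= (\<Sum>(xs, ys, zs)\<in>S3 us. N (G (xs @ f ys # zs)))"
 unfolding ins_def case_prod_unfold by (rule N)
 also have "... <= (\<Sum>j=1..length us. real (length us + 1 - j) * (g (length us + 1 - j) * z j * hp us))"
 proof (rule sum_S3_le)
 fix xs ys zs assume us: "us = xs @ ys @ zs" "ys ~= []"
 have len: "length (xs @ f ys # zs) = length us + 1 - length ys" using us by simp
 have "N (G (xs @ f ys # zs)) <= g (length us + 1 - length ys) * hp (xs @ f ys # zs)"
 using assms(1)[of "xs @ f ys # zs"] unfolding len .
 also have "hp (xs @ f ys # zs) <= z (length ys) * hp us"
 proof -
 have "hn (f ys) <= z (length ys) * hp ys" using f by (simp add: fb_def)
 then have "hp xs * (hn (f ys) * hp zs) <= hp xs * ((z (length ys) * hp ys) * hp zs)"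
 by (intro mult_left_mono mult_right_mono) auto
 then show ?thesis using us by (simp add: ac_simps)
 qed
 finally show "N (G (xs @ f ys # zs)) <= g (length us + 1 - length ys) * z (length ys) * hp us"
 using g0 by (simp add: mult_left_mono mult.assoc)
 qed
 finally show ?thesis by (simp add: sum_distrib_right mult.assoc)
qed

lemma lie_le:
 assumes f: "fb f z" and g: "fb g y" and z0: "!!j. z j >= 0" and y0: "!!j. y j >= 0"
 shows "hn (lie f g us) <= real (length us + 1) * (\<Sum>j=1..length us. z j * y (length us + 1 - j)) * hp us"
proof -
 have "hn (lie f g us) <= hn (ins g f us) + hn (ins f g us)" unfolding lie_def by (rule hn_diff)
 also have "... <= (\<Sum>j=1..length us. real (length us + 1 - j) * (y (length us + 1 - j) * z j)) * hp us
 + (\<Sum>j=1..length us. real (length us + 1 - j) * (z (length us + 1 - j) * y j)) * hp us"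
 using f g z0 y0 by (intro add_mono ins_le[where N = hn]) (auto simp: fb_def intro!: hn_sum)
 finally show ?thesis unfolding distrib_right[symmetric] conv_sum .
qed

lemma om_ins_le:
 assumes "xch g" and g: "eb g e" and f: "fb f z" and e0: "!!j. e j >= 0"
 shows "\<bar>om (ins g f us) u\<bar> <= (\<Sum>j=1..length us. real (length us + 1 - j) * (e (length us + 1 - j) * z j)) * hp us * hn u"
proof -
 have "\<bar>om (ins g f us) u\<bar> <= (\<Sum>(xs, ys, zs)\<in>S3 us. \<bar>om (g (zs @ u # xs)) (f ys)\<bar>)"
 unfolding om_ins[OF assms(1)] using sum_abs[of _ "S3 us"] by (simp add: case_prod_unfold)
 also have "... <= (\<Sum>j=1..length us. real (length us + 1 - j) * (e (length us + 1 - j) * z j * hp us * hn u))"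
 proof (rule sum_S3_le)
 fix xs ys zs assume us: "us = xs @ ys @ zs" "ys ~= []"
 have len: "length (zs @ u # xs) = length us + 1 - length ys" using us by simp
 have "\<bar>om (g (zs @ u # xs)) (f ys)\<bar> <= e (length us + 1 - length ys) * hp (zs @ u # xs) * hn (f ys)"
 using g unfolding eb_def len[symmetric] by blast
 also have "... <= e (length us + 1 - length ys) * hp (zs @ u # xs) * (z (length ys) * hp ys)"
 using f e0 by (intro mult_left_mono) (auto simp: fb_def)
 finally show "\<bar>om (g (zs @ u # xs)) (f ys)\<bar> <= e (length us + 1 - length ys) * z (length ys) * hp us * hn u"
 using us by (simp add: ac_simps)
 qed
 finally show ?thesis by (simp add: sum_distrib_right mult.assoc)
qed

text \<open>Exchange moves the test vector into the outer field and turns the value of the inner one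
  into the new test vector. So a weak bound on one field and a norm bound on the other suffice: weak
  smallness survives brackets with fields that are merely bounded.\<close>

lemma om_lie_le:
 assumes xf: "xch f" and xg: "xch g" and f: "fb f z" and g: "eb g y"
 and z0: "!!j. z j >= 0" and y0: "!!j. y j >= 0"
 shows "\<bar>om (lie f g us) u\<bar> <= real (length us + 1) * (\<Sum>j=1..length us. z j * y (length us + 1 - j)) * hp us * hn u"
proof -
 have "\<bar>om (ins f g us) u\<bar> <= (\<Sum>(xs, ys, zs)\<in>S3 us. \<bar>om (f (zs @ u # xs)) (g ys)\<bar>)"
 unfolding om_ins[OF xf] using sum_abs[of _ "S3 us"] by (simp add: case_prod_unfold)
 also have "... <= (\<Sum>j=1..length us. real (length us + 1 - j) * (z (length us + 1 - j) * y j * hp us * hn u))"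
 proof (rule sum_S3_le)
 fix xs ys zs assume us: "us = xs @ ys @ zs" "ys ~= []"
 have len: "length (zs @ u # xs) = length us + 1 - length ys" using us by simp
 have "\<bar>om (f (zs @ u # xs)) (g ys)\<bar> = \<bar>om (g ys) (f (zs @ u # xs))\<bar>"
 using om_anti[of "g ys"] by simp
 also have "... <= y (length ys) * hp ys * hn (f (zs @ u # xs))" using g by (simp add: eb_def)
 also have "hn (f (zs @ u # xs)) <= z (length us + 1 - length ys) * hp (zs @ u # xs)"
 using f unfolding fb_def len[symmetric] by blast
 then have "y (length ys) * hp ys * hn (f (zs @ u # xs)) <= y (length ys) * hp ys * (z (length us + 1 - length ys) * hp (zs @ u # xs))"
 using y0 by (intro mult_left_mono) auto
 finally show "\<bar>om (f (zs @ u # xs)) (g ys)\<bar> <= z (length us + 1 - length ys) * y (length ys) * hp us * hn u"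
 using us by (simp add: ac_simps)
 qed
 finally have 1: "\<bar>om (ins f g us) u\<bar> <= (\<Sum>j=1..length us. real (length us + 1 - j) * (z (length us + 1 - j) * y j)) * hp us * hn u"
 by (simp add: sum_distrib_right mult.assoc)
 have "\<bar>om (lie f g us) u\<bar> <= \<bar>om (ins g f us) u\<bar> + \<bar>om (ins f g us) u\<bar>"
 unfolding lie_def om_diff_left by (rule abs_triangle_ineq4)
 also note add_mono[OF om_ins_le[OF xg g f y0] 1]
 finally show ?thesis unfolding distrib_right[symmetric] conv_sum .
qed

end

lemma ml_zero: "ml F ==> F (xs @ 0 # zs) = 0"
 using linear_0[OF mlD] .

lemma ml_add: "ml F ==> F (xs @ (u + v) # zs) = F (xs @ u # zs) + F (xs @ v # zs)"
 using linear_add[OF mlD] .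

lemma ml_scale: "ml F ==> F (xs @ (c *\<^sub>R u) # zs) = c *\<^sub>R F (xs @ u # zs)"
 using linear_scale[OF mlD] .

lemma ins_cong_S3:
 assumes "!!xs ys zs. us = xs @ ys @ zs ==> ys ~= [] ==> F (xs @ f ys # zs) = F' (xs @ f' ys # zs)"
 shows "ins F f us = ins F' f' us"
 unfolding ins_def by (rule sum.cong) (auto simp: S3_def assms)

lemma ins_cong:
 assumes "!!vs. length vs <= length us ==> F vs = F' vs" "!!vs. length vs <= length us ==> f vs = f' vs"
 shows "ins F f us = ins F' f' us"
proof (rule ins_cong_S3)
 fix xs ys zs assume us: "us = xs @ ys @ zs" "ys ~= []"
 then have "length (xs @ f ys # zs) <= length us" by (cases ys) auto
 then show "F (xs @ f ys # zs) = F' (xs @ f' ys # zs)" using assms us by simp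
qed

lemma lie_cong:
 assumes "!!vs. length vs <= length us ==> f vs = f' vs" "!!vs. length vs <= length us ==> g vs = g' vs"
 shows "lie f g us = lie f' g' us"
 unfolding lie_def by (intro arg_cong2[where f = minus] ins_cong assms)

context kicked
begin

definition Af :: "'v list => 'v" where "Af us = (case us of [u] => A u | _ => 0)"

definition Pf :: "'v list => 'v" where "Pf us = (case us of [u, v, w] => P u v w | _ => 0)"

lemma Af_simps [simp]: "Af [u] = A u" "length us ~= 1 ==> Af us = 0"
 by (auto simp: Af_def split: list.splits)

lemma Pf_simps [simp]: "Pf [u, v, w] = P u v w" "length us ~= 3 ==> Pf us = 0"
 by (auto simp: Pf_def split: list.splits)

lemma list3_split:
 assumes "length (xs @ v # zs) = 3"
 shows "(\<exists>a c. xs = [] \<and> zs = [a, c]) \<or> (\<exists>a c. xs = [a] \<and> zs = [c]) \<or> (\<exists>a c. xs = [a, c] \<and> zs = [])"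
proof -
 have "length xs + length zs = 2" using assms by simp
 then show ?thesis
 by (cases xs; cases zs) (auto simp: length_Suc_conv numeral_2_eq_2 neq_Nil_conv)
qed

lemma ml_Af: "ml Af"
 unfolding ml_def
proof (intro allI)
 fix xs zs :: "'v list"
 show "linear (%v. Af (xs @ v # zs))"
 by (cases "xs = [] \<and> zs = []") (auto simp: A_linear linear_zero)
qed

lemma ml_Pf: "ml Pf"
 unfolding ml_def
proof (intro allI)
 fix xs zs :: "'v list"
 show "linear (%v. Pf (xs @ v # zs))"
 proof (cases "length xs + length zs = 2")
 case True
 then have "length (xs @ undefined # zs) = 3" by simp
 from list3_split[OF this] show ?thesis using P_linear by auto
 next
 case False
 then have "Pf (xs @ v # zs) = 0" for v by (intro Pf_simps(2)) auto
 then show ?thesis by (simp add: linear_zero)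
 qed
qed

lemma xch_Af: "xch Af"
 unfolding xch_def
proof (intro allI)
 fix xs zs :: "'v list" and u v
 show "om (Af (xs @ v # zs)) u = om (Af (zs @ u # xs)) v"
 proof (cases "xs = [] \<and> zs = []")
 case True then show ?thesis using A_sym by simp
 next
 case False
 then have "Af (xs @ v # zs) = 0" "Af (zs @ u # xs) = 0" by (auto intro!: Af_simps(2))
 then show ?thesis by (simp add: linear_0[OF om_linear])
 qed
qed

lemma xch_Pf: "xch Pf"
 unfolding xch_def
proof (intro allI)
 fix xs zs :: "'v list" and u v
 show "om (Pf (xs @ v # zs)) u = om (Pf (zs @ u # xs)) v"
 proof (cases "length xs + length zs = 2")
 case True
 then have "length (xs @ v # zs) = 3" by simp
 from list3_split[OF this] show ?thesis
 proof (elim disjE exE conjE)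
 fix a c assume "xs = []" "zs = [a, c]"
 then show ?thesis using P_cyc[of a c u v] by simp
 next
 fix a c assume "xs = [a]" "zs = [c]"
 then show ?thesis using P_cyc[of a v c u] P_cyc[of u a v c] by simp
 next
 fix a c assume "xs = [a, c]" "zs = []"
 then show ?thesis using P_cyc[of a c v u] by simp
 qed
 next
 case False
 then have "length xs + length zs ~= 2" "length zs + length xs ~= 2" by auto
 then show ?thesis by (simp add: linear_0[OF om_linear])
 qed
qed

lemma fb_Pf: "hn (Pf us) <= (if length us = 3 then p * \<sigma>\<^sup>2 else 0) * hp us"
proof (cases "length us = 3")
 case True
 then obtain u v w where "us = [u, v, w]" by (auto simp: numeral_3_eq_3 length_Suc_conv)
 then show ?thesis using P_le[of u v w] by (simp add: mult.assoc)
qed auto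

lemma fb_Af: "hn (Af us) <= (if length us = 1 then \<alpha> else 0) * hp us"
proof (cases "length us = 1")
 case True
 then obtain u where "us = [u]" by (auto simp: length_Suc_conv)
 then show ?thesis using A_le[of u] by simp
qed auto

section \<open>Iterated brackets and the modified field\<close>

text \<open>The iterated adjoint action of a field on the kick, from which the terms linear in the
  kick of the Baker-Campbell-Hausdorff series are built.\<close>

definition G :: "('v list => 'v) => nat => 'v list => 'v" where
 "G Z k = (lie Z ^^ k) Pf"

lemma G_simps [simp]: "G Z 0 = Pf" "G Z (Suc k) = lie Z (G Z k)" by (auto simp: G_def)

lemma ml_G: "ml Z ==> ml (G Z k)" by (induction k) (auto simp: ml_Pf ml_lie)

lemma xch_G: "xch Z ==> xch (G Z k)" by (induction k) (auto simp: xch_Pf xch_lie)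

lemma G_low: assumes "ml Z" shows "length us < 3 ==> G Z k us = 0"
proof (induction k arbitrary: us)
 case (Suc k)
 have "ins (G Z k) Z us = ins (%_. 0) Z us"
 by (rule ins_cong) (use Suc in auto)
 moreover have "ins Z (G Z k) us = ins (%_. 0) Z us"
 by (rule ins_cong_S3) (use Suc ml_zero[OF assms] in auto)
 ultimately show ?case by (simp add: lie_def)
qed auto

text \<open>The kick starts in degree three, so brackets with it see the field only in strictly
  lower degrees. A block longer than \<open>n\<close> would be the whole list and leave a single
  argument, where \<open>G_low\<close> gives zero. This makes the equation for the modified field
  triangular in the degree.\<close>

lemma G_agree:
 assumes m: "ml Z" "ml Z'" and eq: "!!us. length us <= n ==> Z us = Z' us"
 shows "length us <= Suc n ==> G Z k us = G Z' k us"
proof (induction k arbitrary: us)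
 case (Suc k)
 have "ins (G Z k) Z us = ins (G Z' k) Z' us"
 proof (rule ins_cong_S3)
 fix xs ys zs assume us: "us = xs @ ys @ zs" "ys ~= []"
 show "G Z k (xs @ Z ys # zs) = G Z' k (xs @ Z' ys # zs)"
 proof (cases "length ys <= n")
 case True
 have "length (xs @ Z ys # zs) <= Suc n" using us Suc.prems by (cases ys) auto
 then show ?thesis using Suc.IH eq[OF True] by simp
 next
 case False
 moreover have "length xs + (length ys + length zs) <= Suc n" using us Suc.prems by simp
 ultimately have "length xs = 0" "length zs = 0" by linarith+
 then have "xs = []" "zs = []" by auto
 then show ?thesis using G_low[OF m(1)] G_low[OF m(2)] by simp
 qed
 qed
 moreover have "ins Z (G Z k) us = ins Z' (G Z' k) us"
 proof (rule ins_cong_S3)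
 fix xs ys zs assume us: "us = xs @ ys @ zs" "ys ~= []"
 show "Z (xs @ G Z k ys # zs) = Z' (xs @ G Z' k ys # zs)"
 proof (cases "length ys < 3")
 case True
 then show ?thesis using G_low[OF m(1)] G_low[OF m(2)] ml_zero[OF m(1)] ml_zero[OF m(2)] by simp
 next
 case False
 then have "length (xs @ G Z k ys # zs) <= n" "length ys <= Suc n" using us Suc.prems by auto
 then show ?thesis using eq Suc.IH by simp
 qed
 qed
 ultimately show ?case by (simp add: lie_def)
qed auto

text \<open>Chosen so that in \<open>conv_step\<close> the nonlinear part of the field uses up
  exactly the gap between \<open>\<Omega>\<close> and \<open>\<rho>\<close>.\<close>

definition cm :: real where "cm = real (L + 1) * (2 * B) / (\<rho> - \<Omega>)"

definition D :: "nat => real" where "D = majorant p cm"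

text \<open>Intended size of the modified field. Two more degrees cost one more kick, hence the
  power of \<open>\<sigma>\<close>; the linear part carries none. The factor 2 B comes from dividing
  a Bernoulli series by (l - 1) / 2 >= 1 / 2.\<close>

definition zb :: "nat => real" where "zb l = (if l = 1 then \<alpha> else 2 * B * D l * \<sigma> ^ (l - 1))"

lemma cm_nonneg: "cm >= 0" using nonneg B_nonneg by (simp add: cm_def)

lemma D_nonneg [simp]: "D l >= 0" unfolding D_def using majorant_nonneg nonneg cm_nonneg by blast

lemma D_low [simp]: "l <= 2 ==> D l = 0" by (simp add: D_def)

lemma zb_nonneg [simp]: "zb l >= 0" using nonneg B_nonneg by (simp add: zb_def)

text \<open>On the scale X l \<sigma>^(l - 1) a bracket with the modified field costs at most
  \<open>\<rho>\<close>. Its linear part contributes (l + 1) \<open>\<alpha>\<close> <=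
  \<open>\<Omega>\<close> by the CFL condition, and the rest at most
  \<open>\<rho> - \<Omega>\<close> by the recursion of the majorant.\<close>

lemma conv_step:
 assumes X: "X 0 = 0" "X 1 = 0" and X0: "!!j. X j >= 0"
 and rec: "X l >= cm * (\<Sum>j\<in>{2..<l}. D j * X (l + 1 - j))" and l: "l <= L"
 shows "real (l + 1) * (\<Sum>j=1..l. zb j * (X (l + 1 - j) * \<sigma> ^ (l + 1 - j - 1))) <= \<rho> * (X l * \<sigma> ^ (l - 1))"
proof (cases "l = 0")
 case False
 define S where "S = (\<Sum>j\<in>{2..<l}. D j * X (l + 1 - j))"
 have S0: "S >= 0" unfolding S_def using X0 by (intro sum_nonneg mult_nonneg_nonneg) auto
 have "(\<Sum>j=1..l. zb j * (X (l + 1 - j) * \<sigma> ^ (l + 1 - j - 1))) =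
 zb 1 * (X l * \<sigma> ^ (l - 1)) + (\<Sum>j\<in>{2..l}. zb j * (X (l + 1 - j) * \<sigma> ^ (l + 1 - j - 1)))"
 using False by (subst sum.atLeast_Suc_atMost) (auto simp: numeral_2_eq_2)
 also have "(\<Sum>j\<in>{2..l}. zb j * (X (l + 1 - j) * \<sigma> ^ (l + 1 - j - 1))) =
 (\<Sum>j\<in>{2..<l}. zb j * (X (l + 1 - j) * \<sigma> ^ (l + 1 - j - 1)))"
 proof (rule sum.mono_neutral_right)
 show "\<forall>j\<in>{2..l} - {2..<l}. zb j * (X (l + 1 - j) * \<sigma> ^ (l + 1 - j - 1)) = 0"
 proof
 fix j assume "j \<in> {2..l} - {2..<l}"
 then have "l + 1 - j = 1" by auto
 then show "zb j * (X (l + 1 - j) * \<sigma> ^ (l + 1 - j - 1)) = 0" using X by simp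
 qed
 qed auto
 also have "... = (\<Sum>j\<in>{2..<l}. 2 * B * \<sigma> ^ (l - 1) * (D j * X (l + 1 - j)))"
 proof (rule sum.cong)
 fix j assume j: "j \<in> {2..<l}"
 then have "\<sigma> ^ (j - 1) * \<sigma> ^ (l + 1 - j - 1) = \<sigma> ^ (l - 1)"
 unfolding power_add[symmetric] by (intro arg_cong[where f = "%n. \<sigma> ^ n"]) auto
 then show "zb j * (X (l + 1 - j) * \<sigma> ^ (l + 1 - j - 1)) = 2 * B * \<sigma> ^ (l - 1) * (D j * X (l + 1 - j))"
 using j by (simp add: zb_def)
 qed simp
 also have "... = 2 * B * \<sigma> ^ (l - 1) * S" by (simp add: S_def sum_distrib_left)
 finally have "real (l + 1) * (\<Sum>j=1..l. zb j * (X (l + 1 - j) * \<sigma> ^ (l + 1 - j - 1))) =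
 (real (l + 1) * \<alpha> * X l + real (l + 1) * (2 * B) * S) * \<sigma> ^ (l - 1)"
 by (simp add: zb_def algebra_simps)
 also have "... <= (\<Omega> * X l + (\<rho> - \<Omega>) * X l) * \<sigma> ^ (l - 1)"
 proof (intro mult_right_mono add_mono)
 have "real (l + 1) * \<alpha> <= real (L + 1) * \<alpha>" using l nonneg by (intro mult_right_mono) auto
 then show "real (l + 1) * \<alpha> <= \<Omega>" using cfl by linarith
 have "real (l + 1) * (2 * B) * S <= real (L + 1) * (2 * B) * S"
 using l B_nonneg S0 by (intro mult_right_mono) auto
 also have "... = (\<rho> - \<Omega>) * (cm * S)" using nonneg by (simp add: cm_def)
 also have "... <= (\<rho> - \<Omega>) * X l" using rec nonneg unfolding S_def by (intro mult_left_mono) auto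
 finally show "real (l + 1) * (2 * B) * S <= (\<rho> - \<Omega>) * X l" .
 qed (use X0 nonneg in simp_all)
 also have "... = \<rho> * (X l * \<sigma> ^ (l - 1))" by (simp add: algebra_simps)
 finally show ?thesis .
qed (use X in simp)

lemma D_rec: "D l >= cm * (\<Sum>j\<in>{2..<l}. D j * D (l + 1 - j))"
 unfolding D_def by (subst (2) majorant.simps) (use nonneg in simp)

lemma G_le:
 assumes "fb Z zb"
 shows "length us <= L ==> hn (G Z k us) <= D (length us) * \<sigma> ^ (length us - 1) * \<rho> ^ k * hp us"
proof (induction k arbitrary: us)
 case 0
 have "(if length us = 3 then p * \<sigma>\<^sup>2 else 0) <= D (length us) * \<sigma> ^ (length us - 1)"
 proof (cases "length us = 3")
 case True
 have "D 3 = p + cm * (\<Sum>j\<in>{2..<3}. D j * D (3 + 1 - j))"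
 unfolding D_def by (subst majorant.simps) simp
 moreover have "{2..<3::nat} = {2}" by auto
 ultimately have "D 3 = p" by simp
 then show ?thesis using True by simp
 qed (use nonneg in simp)
 then have "hn (Pf us) <= (D (length us) * \<sigma> ^ (length us - 1)) * hp us"
 by (rule order_trans[OF fb_Pf mult_right_mono]) simp
 then show ?case by simp
next
 case (Suc k)
 \<comment> \<open>The estimate is available only up to degree \<open>L\<close>; truncation turns it
   into a bound on all lists, and brackets evaluated on lists of length at most \<open>L\<close> do
   not notice it.\<close>
 define g where "g us = (if length us <= L then G Z k us else 0)" for us
 define y where "y l = D l * \<sigma> ^ (l - 1) * \<rho> ^ k" for l
 have g: "fb g y"
 using Suc.IH nonneg by (auto simp: fb_def g_def y_def)
 have "G Z (Suc k) us = lie Z g us"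
 using Suc.prems by (auto simp: g_def intro!: lie_cong)
 also have "hn ... <= real (length us + 1) * (\<Sum>j=1..length us. zb j * y (length us + 1 - j)) * hp us"
 using nonneg by (intro lie_le assms g) (auto simp: y_def)
 also have "real (length us + 1) * (\<Sum>j=1..length us. zb j * y (length us + 1 - j)) =
 \<rho> ^ k * (real (length us + 1) * (\<Sum>j=1..length us. zb j * (D (length us + 1 - j) * \<sigma> ^ (length us + 1 - j - 1))))"
 unfolding y_def by (simp add: sum_distrib_left sum_distrib_right ac_simps)
 also have "... <= \<rho> ^ k * (\<rho> * (D (length us) * \<sigma> ^ (length us - 1)))"
 using nonneg Suc.prems by (intro mult_left_mono conv_step D_rec) auto
 finally show ?case by (simp add: ac_simps mult_right_mono)
qed

lemma hn_sums_le:
 assumes f: "f sums s" and le: "!!k. hn (f k) <= c * (\<bar>b k\<bar> * \<rho> ^ k)" and c: "c >= 0"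
 shows "hn s <= c * B"
proof -
 have "hn (\<Sum>k<n. f k) <= c * B" for n
 proof -
 have "hn (\<Sum>k<n. f k) <= (\<Sum>k<n. c * (\<bar>b k\<bar> * \<rho> ^ k))"
 by (rule order_trans[OF hn_sum sum_mono[OF le]])
 also have "... <= c * B"
 unfolding sum_distrib_left[symmetric] using nonneg
 by (intro mult_left_mono order_trans[OF sum_le_suminf[OF b_summable] b_le] c) auto
 finally show ?thesis .
 qed
 moreover have "(%n. hn (\<Sum>k<n. f k)) \<longlonglongrightarrow> hn s"
 using f unfolding sums_def by (rule tendsto_hn)
 ultimately show ?thesis using LIMSEQ_le_const2 by blast
qed

lemma summable_hn:
 assumes le: "!!k. hn (f k) <= c * (\<bar>b k\<bar> * \<rho> ^ k)"
 shows "summable f"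
proof (rule summable_comparison_test')
 show "summable (%k. C1 * (c * (\<bar>b k\<bar> * \<rho> ^ k)))" by (intro summable_mult b_summable)
 show "norm (f k) <= C1 * (c * (\<bar>b k\<bar> * \<rho> ^ k))" for k
 using norm_le[of "f k"] mult_left_mono[OF le C1] by (rule order_trans)
qed

text \<open>If the kick is multiplied by s, the series solves dZ/ds = sum of \<open>b k\<close>
  ad_Z^k P. The part of degree l is proportional to s^((l - 1) / 2), so at s = 1 the left-hand side
  is (l - 1) / 2 times that part. The equation is imposed up to degree \<open>n\<close> and
  everything above is cut off.\<close>

definition modified :: "nat => ('v list => 'v) => bool" where
 "modified n Z \<longleftrightarrow> ml Z \<and> xch Z \<and> fb Z zb \<and> (\<forall>u. Z [u] = A u) \<and> (\<forall>us. n < length us --> Z us = 0) \<and>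
 (\<forall>us. 2 <= length us \<and> length us <= n --> (%k. b k *\<^sub>R G Z k us) sums (((real (length us) - 1) / 2) *\<^sub>R Z us))"

lemma hn_bG: assumes "fb Z zb" "length us <= L"
 shows "hn (b k *\<^sub>R G Z k us) <= (D (length us) * \<sigma> ^ (length us - 1) * hp us) * (\<bar>b k\<bar> * \<rho> ^ k)"
proof -
 have "hn (b k *\<^sub>R G Z k us) <= \<bar>b k\<bar> * (D (length us) * \<sigma> ^ (length us - 1) * \<rho> ^ k * hp us)"
 unfolding hn_scale using assms by (intro mult_left_mono G_le) auto
 then show ?thesis by (simp add: ac_simps)
qed

text \<open>By \<open>G_agree\<close> the right-hand side in degree n + 1 involves only the parts
  already constructed, so it can serve as the definition of the next part. Linearity and exchange
  symmetry pass to the limit of the series.\<close>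

lemma modified_ex: "1 <= n ==> n <= L ==> \<exists>Z. modified n Z"
proof (induction n rule: nat_induct_at_least)
 case base
 have "fb Af zb"
 unfolding fb_def
 proof
 fix us show "hn (Af us) <= zb (length us) * hp us"
 by (rule order_trans[OF fb_Af mult_right_mono]) (auto simp: zb_def B_nonneg nonneg less_imp_le)
 qed
 then have "modified 1 Af" unfolding modified_def using ml_Af xch_Af by auto
 then show ?case by blast
next
 case (Suc n)
 then obtain Z where "modified n Z" by auto
 then have mlZ: "ml Z" and xZ: "xch Z" and fZ: "fb Z zb" and Z1: "!!u. Z [u] = A u"
 and Z0: "!!us. n < length us ==> Z us = 0"
 and Zs: "!!us. 2 <= length us ==> length us <= n ==> (%k. b k *\<^sub>R G Z k us) sums (((real (length us) - 1) / 2) *\<^sub>R Z us)"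
 unfolding modified_def by auto
 define N where "N us = (\<Sum>k. b k *\<^sub>R G Z k us)" for us
 have Ns: "(%k. b k *\<^sub>R G Z k us) sums N us" if "length us <= L" for us
 unfolding N_def using hn_bG[OF fZ that] by (intro summable_sums summable_hn)
 \<comment> \<open>The factor 2 / n inverts (l - 1) / 2 at l = n + 1.\<close>
 define Z' where "Z' us = (if length us = Suc n then (2 / real n) *\<^sub>R N us else Z us)" for us
 have n: "n >= 1" "Suc n <= L" using Suc by auto
 have ml': "ml Z'"
 unfolding ml_def
 proof (intro allI)
 fix xs zs :: "'v list"
 show "linear (%v. Z' (xs @ v # zs))"
 proof (cases "length xs + length zs = n")
 case True
 have eq: "Z' (xs @ v # zs) = (2 / real n) *\<^sub>R N (xs @ v # zs)" for v using True by (simp add: Z'_def)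
 have s: "(%k. b k *\<^sub>R G Z k (xs @ v # zs)) sums N (xs @ v # zs)" for v
 using True n by (intro Ns) auto
 have "N (xs @ (u + v) # zs) = N (xs @ u # zs) + N (xs @ v # zs)" for u v
 by (rule sums_unique2[OF s]) (use sums_add[OF s[of u] s[of v]] in \<open>simp add: ml_add[OF ml_G[OF mlZ]] scaleR_right_distrib\<close>)
 moreover have "N (xs @ (c *\<^sub>R v) # zs) = c *\<^sub>R N (xs @ v # zs)" for c v
 by (rule sums_unique2[OF s]) (use sums_scaleR_right[OF s[of v], of c] in \<open>simp add: ml_scale[OF ml_G[OF mlZ]] mult.commute\<close>)
 ultimately show ?thesis unfolding eq by (intro linearI) (auto simp: scaleR_right_distrib)
 next
 case False
 then have "Z' (xs @ v # zs) = Z (xs @ v # zs)" for v by (simp add: Z'_def)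
 then show ?thesis using mlD[OF mlZ] by simp
 qed
 qed
 have xch': "xch Z'"
 unfolding xch_def
 proof (intro allI)
 fix xs zs :: "'v list" and u v
 show "om (Z' (xs @ v # zs)) u = om (Z' (zs @ u # xs)) v"
 proof (cases "length xs + length zs = n")
 case True
 have "(%k. om (b k *\<^sub>R G Z k (xs @ v # zs)) u) sums om (N (xs @ v # zs)) u"
 using True n by (intro bounded_linear.sums[OF bounded_linear_om] Ns) auto
 moreover have "(%k. om (b k *\<^sub>R G Z k (zs @ u # xs)) v) sums om (N (zs @ u # xs)) v"
 using True n by (intro bounded_linear.sums[OF bounded_linear_om] Ns) auto
 ultimately have "om (N (xs @ v # zs)) u = om (N (zs @ u # xs)) v"
 using xchD[OF xch_G[OF xZ], of _ xs v zs u] by (simp add: linear_scale[OF om_linear] sums_unique2)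
 then show ?thesis using True by (simp add: Z'_def linear_scale[OF om_linear])
 next
 case False
 then show ?thesis using xchD[OF xZ, of xs v zs u] by (simp add: Z'_def)
 qed
 qed
 have fb': "fb Z' zb"
 unfolding fb_def
 proof
 fix us :: "'v list"
 show "hn (Z' us) <= zb (length us) * hp us"
 proof (cases "length us = Suc n")
 case True
 have "hn (N us) <= (D (length us) * \<sigma> ^ (length us - 1) * hp us) * B"
 using True n nonneg by (intro hn_sums_le[OF Ns] hn_bG fZ) auto
 then have "(2 / real n) * hn (N us) <= 2 * ((D (length us) * \<sigma> ^ (length us - 1) * hp us) * B)"
 using n nonneg by (intro mult_mono) (auto simp: field_simps)
 then show ?thesis using True n by (simp add: Z'_def hn_scale zb_def ac_simps)
 next
 case False then show ?thesis using fZ by (simp add: Z'_def fb_def)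
 qed
 qed
 have agree: "Z us = Z' us" if "length us <= n" for us using that by (simp add: Z'_def)
 have GG: "G Z k us = G Z' k us" if "length us <= Suc n" for k us
 using G_agree[OF mlZ ml' agree that] .
 have "(%k. b k *\<^sub>R G Z' k us) sums (((real (length us) - 1) / 2) *\<^sub>R Z' us)"
 if "2 <= length us" "length us <= Suc n" for us
 proof (cases "length us = Suc n")
 case True
 then have "((real (length us) - 1) / 2) *\<^sub>R Z' us = N us" using n by (simp add: Z'_def)
 then show ?thesis using Ns[of us] GG[OF that(2)] True n by simp
 next
 case False
 then show ?thesis using Zs[of us] GG[OF that(2)] agree[of us] that by simp
 qed
 then have "modified (Suc n) Z'"
 unfolding modified_def using ml' xch' fb' Z0 Z1 n by (auto simp: Z'_def)
 then show ?case by blast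
qed

end

section \<open>Weak smallness of the remainder\<close>

lemma ml_plus: "ml F ==> ml G ==> ml (%us. F us + G us)"
 by (auto simp: ml_def intro!: linear_compose_add)

lemma ins_add_right:
 assumes "ml F" shows "ins F (%us. f us + g us) us = ins F f us + ins F g us"
 by (simp add: ins_def case_prod_unfold ml_add[OF assms] sum.distrib)

lemma ins_add_left: "ins (%us. F us + G us) f us = ins F f us + ins G f (us :: 'v list)"
 for F :: "'v list => 'w::ab_group_add"
 by (simp add: ins_def case_prod_unfold sum.distrib)

context kicked
begin

definition Z :: "'v list => 'v" where "Z = (SOME Z. modified L Z)"

lemma modified_Z: "modified L Z"
proof -
 have "\<exists>Z. modified L Z" by (rule modified_ex) (use L3 in auto)
 then show ?thesis unfolding Z_def by (rule someI_ex)
qed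

lemma ml_Z: "ml Z" and xch_Z: "xch Z" and fb_Z: "fb Z zb" and Z1: "Z [u] = A u"
 and Z_high: "L < length us ==> Z us = 0"
 and Z_sums: "2 <= length us ==> length us <= L ==>
 (%k. b k *\<^sub>R G Z k us) sums (((real (length us) - 1) / 2) *\<^sub>R Z us)"
 using modified_Z unfolding modified_def by blast+

lemma Z_le: "hn (Z us) <= zb (length us) * hp us" using fb_Z by (simp add: fb_def)

lemma Z_Nil [simp]: "Z [] = 0"
 using Z_le[of "[]"] hn_nonneg[of "Z []"] by (intro hn_eq_0) (simp add: zb_def)

definition R :: "'v list => 'v" where "R us = Z us - Af us - Pf us"

definition ec :: "nat => real" where
 "ec = energy_majorant D (2 * \<kappa>) cm (real (L + 1) * p * (2 * B))"

lemma ec_nonneg [simp]: "ec l >= 0"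
 unfolding ec_def using nonneg B_nonneg cm_nonneg by (intro energy_majorant_nonneg) auto

lemma ec_low [simp]: "l <= 2 ==> ec l = 0" by (simp add: ec_def)

lemma ec_rec:
 "ec l = (if l = 3 then 2 * \<kappa> else 0) + real (L + 1) * p * (2 * B) * (if l <= 3 then 0 else ec (l - 2))
 + cm * (\<Sum>j\<in>{2..<l}. D j * ec (l + 1 - j))"
 unfolding ec_def by (rule energy_majorant.simps)

lemma xch_R: "xch R"
 using xch_Z xch_Af xch_Pf unfolding xch_def R_def om_diff_left by simp

lemma ml_R: "ml R"
 unfolding R_def[abs_def] by (intro ml_diff ml_Z ml_Af ml_Pf)

lemma b0: "b 0 = 1" using b_conv[of 0] by simp

text \<open>Of the four terms of the bracket, cyclicity regroups two and two into instances of
  \<open>P_pair\<close>, which accounts for the factor 2.\<close>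

lemma lie_Af_Pf: "\<bar>om (lie Af Pf us) u\<bar> <= (if length us = 3 then 2 * \<kappa> * \<sigma>^4 else 0) * hp us * hn u"
proof (cases "length us = 3")
 case True
 then obtain x y w where us: "us = [x, y, w]" by (auto simp: numeral_3_eq_3 length_Suc_conv)
 have 1: "ins Pf Af us = P (A x) y w + P x (A y) w + P x y (A w)"
 proof -
 have "ins Pf Af us = Pf ([] @ Af [x] # [y, w]) + Pf ([x] @ Af [y] # [w]) + Pf ([x, y] @ Af [w] # [])"
 unfolding ins_def us sum_S3
 by (simp add: numeral_3_eq_3 atLeastAtMostSuc_conv atMost_Suc numeral_2_eq_2)
 then show ?thesis by simp
 qed
 have 2: "ins Af Pf us = A (P x y w)"
 unfolding ins_def us sum_S3
 by (simp add: numeral_3_eq_3 atLeastAtMostSuc_conv atMost_Suc numeral_2_eq_2)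
 have "om (lie Af Pf us) u = (om (P x y w) (A u) + om (P x y (A w)) u) + (om (P w u x) (A y) + om (P w u (A x)) y)"
 unfolding lie_def 1 2 om_diff_left linear_add[OF om_linear]
 using A_sym[of "P x y w" u] om_anti[of "A u"] P_cyc[of w u "A x" y] P_cyc[of y w u "A x"]
 P_cyc[of w u x "A y"] P_cyc[of "A y" w u x] by simp
 moreover have "\<bar>om (P x y w) (A u) + om (P x y (A w)) u\<bar> <= \<kappa> * \<sigma>^4 * (hp us * hn u)"
 using P_pair[of x y w u] by (simp add: us ac_simps)
 moreover have "\<bar>om (P w u x) (A y) + om (P w u (A x)) y\<bar> <= \<kappa> * \<sigma>^4 * (hp us * hn u)"
 using P_pair[of w u x y] by (simp add: us ac_simps)
 ultimately have "\<bar>om (lie Af Pf us) u\<bar> <= \<kappa> * \<sigma>^4 * (hp us * hn u) + \<kappa> * \<sigma>^4 * (hp us * hn u)" by linarith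
 then show ?thesis using True by (simp add: ac_simps)
next
 case False
 have "hn (lie Af Pf us) <= real (length us + 1) *
 (\<Sum>j=1..length us. (if j = 1 then \<alpha> else 0) * (if length us + 1 - j = 3 then p * \<sigma>\<^sup>2 else 0)) * hp us"
 by (rule lie_le) (use fb_Af fb_Pf nonneg in \<open>auto simp: fb_def\<close>)
 also have "(\<Sum>j=1..length us. (if j = 1 then \<alpha> else 0) * (if length us + 1 - j = 3 then p * \<sigma>\<^sup>2 else 0)) = 0"
 using False by (intro sum.neutral) auto
 finally have "hn (lie Af Pf us) = 0" using hn_nonneg[of "lie Af Pf us"] by simp
 then show ?thesis using om_le[of "lie Af Pf us" u] False by simp
qed

text \<open>The bracket of the kick with itself cancels. What is left is weakly small: the bracket
  with \<open>Af\<close>, and one with the remainder.\<close>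

lemma lie_Z_Pf: "lie Z Pf us = lie Af Pf us - lie Pf R us"
proof -
 have Z: "Z = (%us. (Af us + Pf us) + R us)" by (rule ext) (simp add: R_def)
 have "ins Pf Z us = ins Pf Af us + ins Pf Pf us + ins Pf R us"
 by (subst Z) (simp add: ins_add_right[OF ml_Pf])
 moreover have "ins Z Pf us = ins Af Pf us + ins Pf Pf us + ins R Pf us"
 by (subst Z) (simp add: ins_add_left)
 ultimately show ?thesis by (simp add: lie_def)
qed

text \<open>The first bracket is weakly small by \<open>lie_Z_Pf\<close>, given the bound on the
  remainder in lower degrees; each further bracket costs a factor \<open>\<rho>\<close> by
  \<open>om_lie_le\<close> and \<open>conv_step\<close>. The additional \<sigma>^2 is the gain over
  the norm bound \<open>G_le\<close>.\<close>

lemma G_energy: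
 assumes IH: "!!us u. length us < l ==>
 \<bar>om (R us) u\<bar> <= 2 * B * ec (length us) * \<sigma> ^ (length us - 1) * \<sigma>\<^sup>2 * hp us * hn u"
 and l: "l <= L"
 shows "length us <= l ==> \<bar>om (G Z (Suc k) us) u\<bar> <= ec (length us) * \<sigma> ^ (length us - 1) * \<sigma>\<^sup>2 * \<rho> ^ k * hp us * hn u"
proof (induction k arbitrary: us u)
 case 0
 \<comment> \<open>In a bracket with the cubic kick the remainder is evaluated only on lists shorter
   by two, so cutting it off at length \<open>l\<close> changes nothing.\<close>
 define R' where "R' us = (if length us < l then R us else 0)" for us
 define y where "y j = 2 * B * ec j * \<sigma> ^ (j - 1) * \<sigma>\<^sup>2" for j
 define n where "n = length us"
 have yR: "eb R' y" and xR: "xch R'"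
 using IH xch_R B_nonneg nonneg by (auto simp: eb_def xch_def R'_def y_def linear_0[OF om_linear] add.commute)
 have "lie Pf R us = lie Pf R' us"
 proof -
 have "ins R Pf us = ins R' Pf us"
 proof (rule ins_cong_S3)
 fix xs ys zs assume us: "us = xs @ ys @ zs" "ys ~= []"
 show "R (xs @ Pf ys # zs) = R' (xs @ Pf ys # zs)"
 proof (cases "length ys = 3")
 case True then show ?thesis using us 0 by (simp add: R'_def)
 next
 case False then show ?thesis using ml_zero[OF ml_R] by (simp add: R'_def)
 qed
 qed
 moreover have "ins Pf R us = ins Pf R' us"
 proof (rule ins_cong_S3)
 fix xs ys zs assume us: "us = xs @ ys @ zs" "ys ~= []"
 show "Pf (xs @ R ys # zs) = Pf (xs @ R' ys # zs)"
 proof (cases "length ys < l")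
 case False then have "length (xs @ R ys # zs) ~= 3"
 using us 0 by auto
 then show ?thesis by simp
 qed (simp add: R'_def)
 qed
 ultimately show ?thesis by (simp add: lie_def)
 qed
 then have "\<bar>om (lie Pf R us) u\<bar> <= real (length us + 1) *
 (\<Sum>j=1..length us. (if j = 3 then p * \<sigma>\<^sup>2 else 0) * y (length us + 1 - j)) * hp us * hn u"
 using om_lie_le[OF xch_Pf xR _ yR, of "%j. if j = 3 then p * \<sigma>\<^sup>2 else 0"] fb_Pf nonneg B_nonneg
 by (simp add: fb_def y_def)
 also have "(\<Sum>j=1..length us. (if j = 3 then p * \<sigma>\<^sup>2 else 0) * y (length us + 1 - j))
 = (if n >= 3 then p * \<sigma>\<^sup>2 * y (n - 2) else 0)"
 proof -
 have "(\<Sum>j=1..n. (if j = 3 then p * \<sigma>\<^sup>2 else 0) * y (n + 1 - j)) =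
 (\<Sum>j=1..n. if j = 3 then p * \<sigma>\<^sup>2 * y (n + 1 - j) else 0)" by (intro sum.cong) auto
 then show ?thesis by (simp add: n_def sum.delta numeral_3_eq_3 numeral_2_eq_2)
 qed
 also have "real (length us + 1) * (if n >= 3 then p * \<sigma>\<^sup>2 * y (n - 2) else 0)
 <= (real (L + 1) * p * (2 * B) * (if n <= 3 then 0 else ec (n - 2))) * \<sigma> ^ (n - 1) * \<sigma>\<^sup>2"
 proof (cases "n > 3")
 case True
 then have s: "\<sigma>\<^sup>2 * \<sigma> ^ (n - 2 - 1) = \<sigma> ^ (n - 1)" unfolding power_add[symmetric]
 by (intro arg_cong[where f = "%m. \<sigma> ^ m"]) auto
 have "real (length us + 1) * (p * \<sigma>\<^sup>2 * y (n - 2)) = real (length us + 1) * (p * (2 * B) * ec (n - 2) * (\<sigma>\<^sup>2 * \<sigma> ^ (n - 2 - 1)) * \<sigma>\<^sup>2)"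
 by (simp add: y_def ac_simps)
 also have "... <= real (L + 1) * (p * (2 * B) * ec (n - 2) * (\<sigma>\<^sup>2 * \<sigma> ^ (n - 2 - 1)) * \<sigma>\<^sup>2)"
 using 0 l nonneg B_nonneg by (intro mult_right_mono) auto
 finally show ?thesis using True unfolding s by (simp add: algebra_simps)
 qed (auto simp: y_def)
 finally have 1: "\<bar>om (lie Pf R us) u\<bar> <= (real (L + 1) * p * (2 * B) * (if n <= 3 then 0 else ec (n - 2))) * \<sigma> ^ (n - 1) * \<sigma>\<^sup>2 * hp us * hn u"
 by (simp add: mult_right_mono)
 have 2: "\<bar>om (lie Af Pf us) u\<bar> <= (if n = 3 then 2 * \<kappa> else 0) * \<sigma> ^ (n - 1) * \<sigma>\<^sup>2 * hp us * hn u"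
 using lie_Af_Pf[of us u] by (auto simp: n_def power2_eq_square power4_eq_xxxx split: if_splits)
 have ecl: "(if n = 3 then 2 * \<kappa> else 0) + real (L + 1) * p * (2 * B) * (if n <= 3 then 0 else ec (n - 2)) <= ec n"
 by (subst ec_rec[of n]) (use cm_nonneg in \<open>auto intro!: mult_nonneg_nonneg sum_nonneg\<close>)
 have "\<bar>om (G Z (Suc 0) us) u\<bar> <= \<bar>om (lie Af Pf us) u\<bar> + \<bar>om (lie Pf R us) u\<bar>"
 unfolding G_simps lie_Z_Pf om_diff_left by (rule abs_triangle_ineq4)
 also have "... <= ((if n = 3 then 2 * \<kappa> else 0) + real (L + 1) * p * (2 * B) * (if n <= 3 then 0 else ec (n - 2))) * \<sigma> ^ (n - 1) * \<sigma>\<^sup>2 * hp us * hn u"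
 using 1 2 by (simp only: distrib_right)
 also have "... <= ec n * \<sigma> ^ (n - 1) * \<sigma>\<^sup>2 * hp us * hn u"
 using nonneg by (intro mult_right_mono ecl) auto
 finally show ?case by (simp add: n_def)
next
 case (Suc k)
 define g where "g us = (if length us <= l then G Z (Suc k) us else 0)" for us
 define y where "y j = ec j * \<sigma> ^ (j - 1) * \<sigma>\<^sup>2 * \<rho> ^ k" for j
 have g: "eb g y" and xg: "xch g"
 using Suc.IH nonneg xch_G[OF xch_Z, of "Suc k"]
 by (auto simp: eb_def g_def y_def xch_def linear_0[OF om_linear] add.commute)
 have "G Z (Suc (Suc k)) us = lie Z g us"
 unfolding G_simps(2)[of Z "Suc k"] using Suc.prems by (intro lie_cong) (auto simp: g_def)
 then have "\<bar>om (G Z (Suc (Suc k)) us) u\<bar> <= real (length us + 1) * (\<Sum>j=1..length us. zb j * y (length us + 1 - j)) * hp us * hn u"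
 using om_lie_le[OF xch_Z xg fb_Z g] nonneg by (simp add: y_def)
 also have "real (length us + 1) * (\<Sum>j=1..length us. zb j * y (length us + 1 - j)) =
 \<sigma>\<^sup>2 * \<rho> ^ k * (real (length us + 1) * (\<Sum>j=1..length us. zb j * (ec (length us + 1 - j) * \<sigma> ^ (length us + 1 - j - 1))))"
 unfolding y_def by (simp add: sum_distrib_left sum_distrib_right ac_simps)
 also have "... <= \<sigma>\<^sup>2 * \<rho> ^ k * (\<rho> * (ec (length us) * \<sigma> ^ (length us - 1)))"
 proof (intro mult_left_mono conv_step)
 show "cm * (\<Sum>j = 2..<length us. D j * ec (length us + 1 - j)) <= ec (length us)"
 by (subst (2) ec_rec) (use nonneg B_nonneg in auto)
 qed (use nonneg Suc.prems l in auto)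
 finally show ?case by (simp add: ac_simps mult_right_mono)
qed

text \<open>The term k = 0 of the series for \<open>Z\<close> is the kick itself, which
  \<open>R\<close> subtracts (in degree three the prefactor is one). Every other term contains a
  bracket and is covered by \<open>G_energy\<close>, which needs the remainder only below the
  current degree.\<close>

lemma R_energy:
 "length us <= L ==> \<bar>om (R us) u\<bar> <= 2 * B * ec (length us) * \<sigma> ^ (length us - 1) * \<sigma>\<^sup>2 * hp us * hn u"
proof (induction "length us" arbitrary: us u rule: less_induct)
 case less
 define n where "n = length us"
 consider "us = []" | v where "us = [v]" | "n >= 2"
 by (cases us; cases "tl us") (auto simp: n_def)
 then show ?case
 proof cases
 case 3
 have Ge: "\<bar>om (G Z (Suc k) us) u\<bar> <= ec n * \<sigma> ^ (n - 1) * \<sigma>\<^sup>2 * \<rho> ^ k * hp us * hn u" for k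
 using G_energy[of n us k u] less by (simp add: n_def)
 have s: "(%k. b k *\<^sub>R G Z k us) sums (((real n - 1) / 2) *\<^sub>R Z us)"
 using Z_sums[of us] 3 less.prems by (simp add: n_def)
 then have "(%k. b (Suc k) *\<^sub>R G Z (Suc k) us) sums (((real n - 1) / 2) *\<^sub>R Z us - b 0 *\<^sub>R G Z 0 us)"
 using sums_split_initial_segment[OF s, of 1] by simp
 moreover have "((real n - 1) / 2) *\<^sub>R Z us - b 0 *\<^sub>R G Z 0 us = ((real n - 1) / 2) *\<^sub>R R us"
 using 3 by (cases "n = 3") (auto simp: R_def b0 n_def)
 ultimately have "(%k. om (b (Suc k) *\<^sub>R G Z (Suc k) us) u) sums om (((real n - 1) / 2) *\<^sub>R R us) u"
 using bounded_linear.sums[OF bounded_linear_om] by metis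
 then have s2: "(%k. b (Suc k) * om (G Z (Suc k) us) u) sums (((real n - 1) / 2) * om (R us) u)"
 by (simp only: linear_scale[OF om_linear] real_scaleR_def)
 define c where "c = ec n * \<sigma> ^ (n - 1) * \<sigma>\<^sup>2 * hp us * hn u"
 have c0: "c >= 0" unfolding c_def using nonneg by (intro mult_nonneg_nonneg) auto
 have le: "\<bar>b (Suc k) * om (G Z (Suc k) us) u\<bar> <= c * (\<bar>b (Suc k)\<bar> * \<rho> ^ Suc k)" for k
 proof -
 have "\<bar>b (Suc k) * om (G Z (Suc k) us) u\<bar> <= \<bar>b (Suc k)\<bar> * (c * \<rho> ^ k)"
 unfolding abs_mult using Ge[of k] by (intro mult_left_mono) (auto simp: c_def ac_simps)
 also have "... <= \<bar>b (Suc k)\<bar> * (c * \<rho> ^ Suc k)"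
 using nonneg c0 by (intro mult_left_mono) (auto intro!: mult_right_mono simp: mult_le_cancel_right1)
 finally show ?thesis by (simp add: ac_simps)
 qed
 have sm: "summable (%k. \<bar>b (Suc k)\<bar> * \<rho> ^ Suc k)"
 using b_summable by (subst summable_Suc_iff[of "%k. \<bar>b k\<bar> * \<rho> ^ k"])
 have "(\<Sum>k. \<bar>b (Suc k)\<bar> * \<rho> ^ Suc k) <= B"
 using suminf_split_head[OF b_summable] b_le b0 by simp
 then have cB: "(\<Sum>k. c * (\<bar>b (Suc k)\<bar> * \<rho> ^ Suc k)) <= c * B"
 using c0 by (subst suminf_mult[OF sm]) (intro mult_left_mono)
 have "\<bar>\<Sum>k. b (Suc k) * om (G Z (Suc k) us) u\<bar> <= (\<Sum>k. c * (\<bar>b (Suc k)\<bar> * \<rho> ^ Suc k))"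
 using norm_suminf_le[of "%k. b (Suc k) * om (G Z (Suc k) us) u", OF _ summable_mult[OF sm, of c]] le by simp
 then have "\<bar>((real n - 1) / 2) * om (R us) u\<bar> <= c * B" using sums_unique[OF s2] cB by linarith
 moreover have "\<bar>((real n - 1) / 2) * om (R us) u\<bar> >= (1 / 2) * \<bar>om (R us) u\<bar>"
 unfolding abs_mult using 3 by (intro mult_right_mono) auto
 ultimately have "\<bar>om (R us) u\<bar> <= 2 * (c * B)" by linarith
 then show ?thesis by (simp add: c_def n_def ac_simps)
 qed (auto simp: R_def Z1 linear_0[OF om_linear])
qed

end

section \<open>Lie series and the truncated Baker-Campbell-Hausdorff identity\<close>

lemma binomial_diag: "real (n choose Suc m) / fact n = 1 / fact (Suc m) / fact (n - Suc m)" if "m < n"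
 using that by (subst binomial_fact) auto

lemma ins_scale: "ins (%us. c * F us) f us = c * ins F f (us :: 'v list)" for F :: "'v list => real"
 by (simp add: ins_def case_prod_unfold sum_distrib_left)

lemma ins_sum: "ins (%us. \<Sum>k\<in>S. H k us) f us = (\<Sum>k\<in>S. ins (H k) f (us :: 'v list))" for H :: "_ => 'v list => real"
 unfolding ins_def case_prod_unfold by (rule sum.swap)

lemma ins_zero [simp]: "ins (%us. 0) f us = 0" by (simp add: ins_def case_prod_unfold)

lemma sums_ins:
 fixes H :: "nat => 'v list => real"
 assumes "!!us. (%k. H k us) sums Z us"
 shows "(%k. ins (H k) f us) sums ins Z f us"
 unfolding ins_def case_prod_unfold by (intro sums_sum assms)

context kicked
begin

definition bdd :: "('v list => real) => bool" where
 "bdd F \<longleftrightarrow> (\<forall>n. \<exists>c\<ge>0. \<forall>us. length us <= n --> \<bar>F us\<bar> <= c * hp us)"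

text \<open>Vanishing on lists shorter than two keeps blocks short: in an insertion on a list of
  length at most L + 1, a contributing block has length at most \<open>L\<close>, where the defining
  equation of \<open>Z\<close> is available.\<close>

definition adm :: "('v list => real) => bool" where
 "adm F \<longleftrightarrow> ml F \<and> bdd F \<and> (\<forall>us. length us < 2 --> F us = 0)"

abbreviation opr :: "('v list => 'v) => nat => ('v list => real) => 'v list => real" where
 "opr f k F \<equiv> ((%F. ins F f) ^^ k) F"

text \<open>The Lie series of differentiation along \<open>f\<close>, formally the composition of
  \<open>F\<close> with the time-one flow of \<open>f\<close>.\<close>

definition expo :: "('v list => 'v) => ('v list => real) => 'v list => real" where
 "expo f F us = (\<Sum>k. opr f k F us / fact k)"

lemma length_S3: "us = xs @ ys @ zs ==> ys ~= [] ==> length (xs @ v # zs) <= length us"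
 by (cases ys) auto

text \<open>The square is a crude count of blocks. The bound on \<open>f\<close> is asked for only
  on blocks that contribute, since the iterated brackets are controlled only up to degree
  \<open>L\<close>.\<close>

lemma ins_bound:
 assumes F: "!!us. length us <= n ==> \<bar>F us\<bar> <= c * hp us"
 and f: "!!xs ys zs. us = xs @ ys @ zs ==> ys ~= [] ==> F (xs @ f ys # zs) ~= 0 ==> hn (f ys) <= z * hp ys"
 and c: "c >= 0" and z: "z >= 0" and n: "length us <= n"
 shows "\<bar>ins F f us\<bar> <= real (Suc n)^2 * (c * z) * hp us"
proof -
 have "\<bar>ins F f us\<bar> <= (\<Sum>(xs, ys, zs)\<in>S3 us. \<bar>F (xs @ f ys # zs)\<bar>)"
 unfolding ins_def case_prod_unfold by (rule sum_abs)
 also have "... <= (\<Sum>j=1..length us. real (length us + 1 - j) * (c * z * hp us))"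
 proof (rule sum_S3_le)
 fix xs ys zs assume us: "us = xs @ ys @ zs" "ys ~= []"
 show "\<bar>F (xs @ f ys # zs)\<bar> <= c * z * hp us"
 proof (cases "F (xs @ f ys # zs) = 0")
 case True
 then show ?thesis using c z by (simp only: abs_zero) (intro mult_nonneg_nonneg, auto)
 next
 case False
 have "\<bar>F (xs @ f ys # zs)\<bar> <= c * hp (xs @ f ys # zs)"
 by (rule F) (use length_S3[OF us] n in \<open>rule order_trans\<close>)
 also have "... = c * (hp xs * (hn (f ys) * hp zs))" by simp
 also have "... <= c * (hp xs * ((z * hp ys) * hp zs))"
 using f[OF us False] c by (intro mult_left_mono mult_right_mono) auto
 finally show ?thesis using us by (simp add: ac_simps)
 qed
 qed
 also have "... <= (\<Sum>j=1..length us. real (Suc n) * (c * z * hp us))"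
 using n c z by (intro sum_mono mult_right_mono) auto
 also have "... = real (length us) * (real (Suc n) * (c * z * hp us))" by simp
 also have "... <= real (Suc n) * (real (Suc n) * (c * z * hp us))"
 using n c z by (intro mult_right_mono) auto
 finally show ?thesis by (simp add: power2_eq_square ac_simps)
qed

lemma fb_const:
 assumes "fb f z"
 obtains K where "K >= 0" "!!us. length us <= n ==> hn (f us) <= K * hp us"
proof
 define K where "K = (\<Sum>j\<le>n. \<bar>z j\<bar>)"
 show "K >= 0" by (simp add: K_def sum_nonneg)
 fix us :: "'v list" assume "length us <= n"
 then have "\<bar>z (length us)\<bar> <= K" unfolding K_def by (intro member_le_sum) auto
 then have "z (length us) <= K" by linarith
 moreover have "hn (f us) <= z (length us) * hp us" using assms by (simp add: fb_def)
 ultimately show "hn (f us) <= K * hp us" using mult_right_mono[of _ K "hp us"] by fastforce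
qed

lemma opr_bound:
 assumes F: "bdd F" and f: "fb f z"
 obtains c K where "c >= 0" "K >= 1" "!!k us. length us <= n ==> \<bar>opr f k F us\<bar> <= c * K ^ k * hp us"
proof -
 obtain c where c: "c >= 0" "!!us. length us <= n ==> \<bar>F us\<bar> <= c * hp us"
 using F unfolding bdd_def by blast
 obtain z' where z': "z' >= 0" "!!us. length us <= n ==> hn (f us) <= z' * hp us"
 using fb_const[OF f] by metis
 define K where "K = real (Suc n)^2 * z' + 1"
 have K: "K >= 1" using z' by (simp add: K_def)
 have "\<bar>opr f k F us\<bar> <= c * K ^ k * hp us" if "length us <= n" for k us
 using that
 proof (induction k arbitrary: us)
 case (Suc k)
 have "\<bar>ins (opr f k F) f us\<bar> <= real (Suc n)^2 * (c * K ^ k * z') * hp us"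
 by (rule ins_bound) (use Suc c z' K in auto)
 also have "... <= c * K ^ Suc k * hp us"
 using c K by (intro mult_right_mono) (auto simp: K_def algebra_simps)
 finally show ?case by simp
 qed (use c in simp)
 then show thesis using that c K by blast
qed

lemma bdd_ins: assumes "bdd F" "fb f z" shows "bdd (ins F f)"
 unfolding bdd_def
proof
 fix n
 obtain c K where "c >= 0" "K >= 1" "!!k us. length us <= n ==> \<bar>opr f k F us\<bar> <= c * K ^ k * hp us"
 using opr_bound[OF assms] by metis
 from this(1,2) this(3)[of _ 1] show "\<exists>c\<ge>0. \<forall>us. length us <= n --> \<bar>ins F f us\<bar> <= c * hp us"
 by (intro exI[of _ "c * K"]) auto
qed

lemma ins_low: "(!!us. length us < d ==> F us = (0::real)) ==> length us < d ==> ins F f us = 0"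
 using ins_cong[of us F "%_. 0" f f] by simp

lemma adm_ins: "adm F ==> fb f z ==> ml f ==> adm (ins F f)"
 unfolding adm_def using ml_ins bdd_ins ins_low[of 2 F] by blast

lemma adm_opr: "adm F ==> fb f z ==> ml f ==> adm (opr f k F)"
 by (induction k) (auto intro: adm_ins)

lemma opr_low: "(!!us. length us < d ==> F us = 0) ==> length us < d ==> opr f k F us = 0"
proof (induction k arbitrary: us)
 case (Suc k) then show ?case using ins_low[of d "opr f k F" us f] by simp
qed auto

lemma expo_summable:
 assumes "bdd F" "fb f z"
 shows "summable (%k. opr f k F us / fact k)"
proof -
 obtain c K where cK: "c >= 0" "K >= 1" "!!k vs. length vs <= length us ==> \<bar>opr f k F vs\<bar> <= c * K ^ k * hp vs"
 using opr_bound[OF assms] by metis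
 show ?thesis
 proof (rule summable_comparison_test')
 show "summable (%k. c * hp us * (K ^ k /\<^sub>R fact k))"
 by (intro summable_mult summable_exp_generic)
 show "norm (opr f k F us / fact k) <= c * hp us * (K ^ k /\<^sub>R fact k)" for k
 proof -
 have "\<bar>opr f k F us\<bar> / fact k <= (c * K ^ k * hp us) / fact k"
 using cK(3)[of us k] by (intro divide_right_mono) auto
 then show ?thesis by (simp add: divide_inverse abs_mult ac_simps)
 qed
 qed
qed

lemma opr_le:
 assumes F: "!!us. length us <= n ==> \<bar>F us\<bar> <= c * hp us" and f: "!!us. length us <= n ==> hn (f us) <= z * hp us"
 and c: "c >= 0" and z: "z >= 0"
 shows "length us <= n ==> \<bar>opr f k F us\<bar> <= c * (real (Suc n)^2 * z) ^ k * hp us"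
proof (induction k arbitrary: us)
 case (Suc k)
 have "\<bar>ins (opr f k F) f us\<bar> <= real (Suc n)^2 * (c * (real (Suc n)^2 * z) ^ k * z) * hp us"
 by (rule ins_bound) (use Suc c z f in auto)
 then show ?case by (simp add: ac_simps)
qed (use F in simp)

lemma expo_bound:
 assumes F: "!!us. length us <= n ==> \<bar>F us\<bar> <= c * hp us" and f: "!!us. length us <= n ==> hn (f us) <= z * hp us"
 and c: "c >= 0" and z: "z >= 0" and us: "length us <= n"
 shows "\<bar>expo f F us\<bar> <= c * exp (real (Suc n)^2 * z) * hp us"
proof -
 define K where "K = real (Suc n)^2 * z"
 have K: "K >= 0" using z by (simp add: K_def)
 have le: "\<bar>opr f k F us\<bar> <= c * K ^ k * hp us" if "length us <= n" for k us
 unfolding K_def by (rule opr_le) (use assms that in auto)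
 have s: "(%k. c * hp us * (K ^ k /\<^sub>R fact k)) sums (c * hp us * exp K)"
 by (intro sums_mult exp_converges)
 have "\<bar>expo f F us\<bar> <= (\<Sum>k. c * hp us * (K ^ k /\<^sub>R fact k))"
 unfolding expo_def real_norm_def[symmetric]
 proof (rule norm_suminf_le[OF _ sums_summable[OF s]])
 fix k
 have "\<bar>opr f k F us\<bar> / fact k <= (c * K ^ k * hp us) / fact k"
 using le[OF us, of k] by (intro divide_right_mono) auto
 then show "norm (opr f k F us / fact k) <= c * hp us * (K ^ k /\<^sub>R fact k)"
 by (simp add: divide_inverse abs_mult ac_simps)
 qed
 then show ?thesis using sums_unique[OF s] by (simp add: K_def ac_simps)
qed

lemma adm_expo:
 assumes F: "adm F" and f: "fb f z" "ml f" shows "adm (expo f F)"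
proof -
 have bF: "bdd F" and mF: "ml F" and lF: "!!us. length us < 2 ==> F us = 0" using F by (auto simp: adm_def)
 have m: "ml (opr f k F)" for k using adm_opr[OF F f] by (simp add: adm_def)
 have s: "(%k. opr f k F us / fact k) sums expo f F us" for us
 unfolding expo_def using expo_summable[OF bF f(1)] by (rule summable_sums)
 have "ml (expo f F)"
 unfolding ml_def
 proof (intro allI linearI)
 fix xs zs :: "'v list" and u v c
 show "expo f F (xs @ (u + v) # zs) = expo f F (xs @ u # zs) + expo f F (xs @ v # zs)"
 by (rule sums_unique2[OF s]) (use sums_add[OF s[of "xs @ u # zs"] s[of "xs @ v # zs"]] in \<open>simp add: ml_add[OF m] add_divide_distrib\<close>)
 show "expo f F (xs @ (c *\<^sub>R u) # zs) = c *\<^sub>R expo f F (xs @ u # zs)"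
 by (rule sums_unique2[OF s]) (use sums_mult[OF s[of "xs @ u # zs"], of c] in \<open>simp add: ml_scale[OF m]\<close>)
 qed
 moreover have "bdd (expo f F)"
 unfolding bdd_def
 proof
 fix n
 obtain c where c: "c >= 0" "!!us. length us <= n ==> \<bar>F us\<bar> <= c * hp us"
 using bF unfolding bdd_def by blast
 obtain z' where z': "z' >= 0" "!!us. length us <= n ==> hn (f us) <= z' * hp us"
 using fb_const[OF f(1)] by metis
 show "\<exists>c\<ge>0. \<forall>us. length us <= n --> \<bar>expo f F us\<bar> <= c * hp us"
 using expo_bound[where n = n and F = F and c = c and f = f and z = z', OF c(2) z'(2) c(1) z'(1)] c(1)
 by (intro exI[of _ "c * exp (real (Suc n)^2 * z')"]) auto
 qed
 moreover have "expo f F us = 0" if "length us < 2" for us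
 unfolding expo_def using opr_low[of 2 F us _ f] lF that by simp
 ultimately show ?thesis by (simp add: adm_def)
qed

text \<open>\<open>Y m\<close> is the \<open>m\<close>-fold commutator of insertion of \<open>Z\<close> with the derivation that
 multiplies a scalar by the length of its argument.\<close>

fun Y :: "nat => ('v list => real) => 'v list => real" where
 "Y 0 F us = (\<Sum>(xs, ys, zs)\<in>S3 us. (real (length ys) - 1) * F (xs @ Z ys # zs))"
| "Y (Suc m) F us = ins (Y m F) Z us - Y m (ins F Z) us"

text \<open>The commutator of the degree derivation with the n-th power of an operator, expanded in
  nested commutators with all powers collected on the inside. The two sums of the induction step
  merge by Pascal's rule.\<close>

lemma length_opr:
 "real (length us) * opr Z n F us - opr Z n (%vs. real (length vs) * F vs) us =
 (\<Sum>m<n. real (n choose Suc m) * Y m (opr Z (n - Suc m) F) us)"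
proof (induction n arbitrary: us)
 case (Suc n)
 define X where "X k = opr Z k F" for k
 have XS: "ins (X k) Z = X (Suc k)" for k by (simp add: X_def)
 define H where "H = opr Z n (%vs. real (length vs) * F vs)"
 have IH: "H us = real (length us) * X n us - (\<Sum>m<n. real (n choose Suc m) * Y m (X (n - Suc m)) us)" for us
 using Suc.IH[of us] by (simp add: H_def X_def)
 have Y0: "real (length us) * ins (X n) Z us - ins (%vs. real (length vs) * X n vs) Z us = Y 0 (X n) us"
 unfolding ins_def Y.simps case_prod_unfold sum_distrib_left sum_subtractf[symmetric]
 by (rule sum.cong) (auto simp: S3_def algebra_simps)
 have "ins H Z us = ins (%vs. real (length vs) * X n vs) Z us - (\<Sum>m<n. real (n choose Suc m) * ins (Y m (X (n - Suc m))) Z us)"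
 unfolding IH[abs_def] ins_diff_left ins_sum ins_scale ..
 then have "real (length us) * X (Suc n) us - ins H Z us =
 Y 0 (X n) us + (\<Sum>m<n. real (n choose Suc m) * ins (Y m (X (n - Suc m))) Z us)"
 using Y0 XS[of n] by simp
 also have "(\<Sum>m<n. real (n choose Suc m) * ins (Y m (X (n - Suc m))) Z us) =
 (\<Sum>m<n. real (n choose Suc m) * Y (Suc m) (X (n - Suc m)) us) + (\<Sum>m<n. real (n choose Suc m) * Y m (X (n - m)) us)"
 unfolding sum.distrib[symmetric]
 proof (rule sum.cong)
 fix m assume "m \<in> {..<n}"
 then have "ins (X (n - Suc m)) Z = X (n - m)" using XS[of "n - Suc m"] by (simp add: Suc_diff_Suc)
 then show "real (n choose Suc m) * ins (Y m (X (n - Suc m))) Z us =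
 real (n choose Suc m) * Y (Suc m) (X (n - Suc m)) us + real (n choose Suc m) * Y m (X (n - m)) us"
 by (simp add: algebra_simps)
 qed simp
 also have "Y 0 (X n) us + ((\<Sum>m<n. real (n choose Suc m) * Y (Suc m) (X (n - Suc m)) us) + (\<Sum>m<n. real (n choose Suc m) * Y m (X (n - m)) us))
 = (\<Sum>m<Suc n. real (n choose m) * Y m (X (n - m)) us) + (\<Sum>m<Suc n. real (n choose Suc m) * Y m (X (n - m)) us)"
 proof -
 have "(\<Sum>m<Suc n. real (n choose m) * Y m (X (n - m)) us) =
 Y 0 (X n) us + (\<Sum>m<n. real (n choose Suc m) * Y (Suc m) (X (n - Suc m)) us)"
 by (subst sum.lessThan_Suc_shift) simp
 moreover have "(\<Sum>m<Suc n. real (n choose Suc m) * Y m (X (n - m)) us) = (\<Sum>m<n. real (n choose Suc m) * Y m (X (n - m)) us)"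
 by simp
 ultimately show ?thesis by (simp only: add.assoc)
 qed
 also have "... = (\<Sum>m<Suc n. real (Suc n choose Suc m) * Y m (X (Suc n - Suc m)) us)"
 unfolding sum.distrib[symmetric] by (rule sum.cong) (auto simp: algebra_simps)
 finally show ?case by (simp add: X_def H_def)
qed simp

lemma bounded_linear_slot:
 assumes "ml F" "bdd F" shows "bounded_linear (%v. F (xs @ v # zs))"
proof -
 obtain c where c: "c >= 0" "!!us. length us <= length xs + Suc (length zs) ==> \<bar>F us\<bar> <= c * hp us"
 using assms unfolding bdd_def by blast
 show ?thesis
 proof (rule bounded_linear_intro[where K = "c * (hp xs * hp zs) * C0"])
 fix v
 have "\<bar>F (xs @ v # zs)\<bar> <= c * (hp xs * hp zs) * hn v" using c(2)[of "xs @ v # zs"] by (simp add: ac_simps)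
 also have "... <= c * (hp xs * hp zs) * (C0 * norm v)" using c(1) by (intro mult_left_mono hn_le) auto
 finally show "norm (F (xs @ v # zs)) <= norm v * (c * (hp xs * hp zs) * C0)" by (simp add: ac_simps)
 qed (auto simp: ml_add[OF assms(1)] ml_scale[OF assms(1)])
qed

text \<open>Commuting the degree with insertion of \<open>Z\<close> inserts the field (degree - 1)
  Z, which by the equation for \<open>Z\<close> is twice the Bernoulli series of brackets. Each
  further commutator adds one bracket with \<open>Z\<close> by \<open>pre_lie\<close>.\<close>

lemma Y_sums:
 assumes "adm F" "length us <= L + 1"
 shows "(%N. 2 * b N * ins F (G Z (N + m)) us) sums Y m F us"
 using assms
proof (induction m arbitrary: F us)
 case 0
 then have mF: "ml F" and bF: "bdd F" and lF: "!!us. length us < 2 ==> F us = 0" by (auto simp: adm_def)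
 have "(%N. 2 * b N * F (xs @ G Z N ys # zs)) sums ((real (length ys) - 1) * F (xs @ Z ys # zs))"
 if us: "us = xs @ ys @ zs" "ys ~= []" for xs ys zs
 proof (cases "length ys = 1 \<or> length (xs @ Z ys # zs) < 2")
 case True
 then have 1: "F (xs @ G Z N ys # zs) = 0" for N using G_low[OF ml_Z] ml_zero[OF mF] lF by auto
 have 2: "(real (length ys) - 1) * F (xs @ Z ys # zs) = 0" using True lF by auto
 show ?thesis unfolding 1 2 by simp
 next
 case False
 then have l: "2 <= length ys" "length ys <= L"
 proof -
 have "length ys ~= 0" using us by simp
 then show "2 <= length ys" using False by linarith
 have "length xs + (length ys + length zs) <= L + 1" using us 0 by simp
 moreover have "\<not> length (xs @ Z ys # zs) < 2" using False by blast
 then have "length xs + length zs >= 1" unfolding length_append length_Cons by linarith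
 ultimately show "length ys <= L" by linarith
 qed
 have "(%N. F (xs @ (b N *\<^sub>R G Z N ys) # zs)) sums F (xs @ (((real (length ys) - 1) / 2) *\<^sub>R Z ys) # zs)"
 by (rule bounded_linear.sums[OF bounded_linear_slot[OF mF bF] Z_sums[OF l]])
 from sums_mult[OF this, of 2] show ?thesis by (simp add: ml_scale[OF mF] mult.assoc)
 qed
 then show ?case
 unfolding ins_def Y.simps case_prod_unfold sum_distrib_left
 by (intro sums_sum) (auto simp: S3_def)
next
 case (Suc m)
 have mF: "ml F" using Suc.prems by (simp add: adm_def)
 have 1: "(%N. 2 * b N * ins (ins F Z) (G Z (N + m)) us) sums Y m (ins F Z) us"
 by (rule Suc.IH[OF adm_ins[OF Suc.prems(1) fb_Z ml_Z] Suc.prems(2)])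
 have 2: "(%N. ins (%us. 2 * b N * ins F (G Z (N + m)) us) Z us) sums ins (Y m F) Z us"
 unfolding ins_def[of _ Z] case_prod_unfold
 by (intro sums_sum Suc.IH[OF Suc.prems(1)]) (use Suc.prems(2) length_S3 in \<open>fastforce simp: S3_def\<close>)
 have "ins (%us. 2 * b N * ins F (G Z (N + m)) us) Z us - 2 * b N * ins (ins F Z) (G Z (N + m)) us
 = 2 * b N * ins F (G Z (N + Suc m)) us" for N
 using pre_lie[OF mF, of "G Z (N + m)" Z us] by (simp add: ins_scale right_diff_distrib[symmetric])
 with sums_diff[OF 2 1] show ?case by simp
qed

lemma G_ins_bound:
 obtains K where "K >= 0" "!!F c N us. (!!us. length us < 2 ==> F us = 0) ==> c >= 0 ==>
 (!!us. length us <= L + 1 ==> \<bar>F us\<bar> <= c * hp us) ==> length us <= L + 1 ==>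
 \<bar>ins F (G Z N) us\<bar> <= K * c * \<rho> ^ N * hp us"
proof -
 define Dm where "Dm = (\<Sum>j\<le>L. D j * \<sigma> ^ (j - 1))"
 have Dm0: "Dm >= 0" unfolding Dm_def using nonneg by (intro sum_nonneg) auto
 have Dm: "D j * \<sigma> ^ (j - 1) <= Dm" if "j <= L" for j
 unfolding Dm_def using that nonneg by (intro member_le_sum) auto
 show thesis
 proof (rule that)
 show "real (Suc (L + 1))^2 * Dm >= 0" using Dm0 by simp
 fix F :: "'v list => real" and c :: real and N :: nat and us :: "'v list"
 assume l: "!!us. length us < 2 ==> F us = 0" and c: "(c::real) >= 0"
 and F: "!!us. length us <= L + 1 ==> \<bar>F us\<bar> <= c * hp us" and us: "length us <= L + 1"
 have "\<bar>ins F (G Z N) us\<bar> <= real (Suc (L + 1))^2 * (c * (Dm * \<rho> ^ N)) * hp us"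
 proof (rule ins_bound)
 fix xs ys zs assume s: "us = xs @ ys @ zs" "ys ~= []" "F (xs @ G Z N ys # zs) ~= 0"
 have "\<not> length (xs @ G Z N ys # zs) < 2" using l s(3) by blast
 then have "length xs + length zs >= 1" unfolding length_append length_Cons by linarith
 moreover have "length xs + (length ys + length zs) <= L + 1" using s us by simp
 ultimately have ys: "length ys <= L" by linarith
 have "hn (G Z N ys) <= D (length ys) * \<sigma> ^ (length ys - 1) * \<rho> ^ N * hp ys"
 by (rule G_le[OF fb_Z ys])
 also have "... <= Dm * \<rho> ^ N * hp ys" using nonneg Dm[OF ys] by (intro mult_right_mono) auto
 finally show "hn (G Z N ys) <= Dm * \<rho> ^ N * hp ys" .
 qed (use F c us Dm0 nonneg in auto)
 then show "\<bar>ins F (G Z N) us\<bar> <= real (Suc (L + 1))^2 * Dm * c * \<rho> ^ N * hp us"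
 by (simp add: ac_simps)
 qed
qed

lemma Y_bound:
 obtains K where "K >= 0" "!!F c m us. adm F ==> c >= 0 ==>
 (!!us. length us <= L + 1 ==> \<bar>F us\<bar> <= c * hp us) ==> length us <= L + 1 ==>
 \<bar>Y m F us\<bar> <= K * c * \<rho> ^ m * hp us"
proof -
 obtain K where K: "K >= 0" "!!F c N us. (!!us. length us < 2 ==> F us = 0) ==> c >= 0 ==>
 (!!us. length us <= L + 1 ==> \<bar>F us\<bar> <= c * hp us) ==> length us <= L + 1 ==>
 \<bar>ins F (G Z N) us\<bar> <= K * c * \<rho> ^ N * hp us" using G_ins_bound by metis
 have Y: "\<bar>Y m F us\<bar> <= 2 * B * K * c * \<rho> ^ m * hp us"
 if F: "adm F" and c: "c >= 0" and Fc: "!!us. length us <= L + 1 ==> \<bar>F us\<bar> <= c * hp us" and us: "length us <= L + 1"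
 for F c m us
 proof -
 define c' where "c' = 2 * K * c * \<rho> ^ m * hp us"
 have c'0: "c' >= 0" unfolding c'_def using K c nonneg by (intro mult_nonneg_nonneg) auto
 have le: "norm (2 * b N * ins F (G Z (N + m)) us) <= c' * (\<bar>b N\<bar> * \<rho> ^ N)" for N
 proof -
 have "\<bar>ins F (G Z (N + m)) us\<bar> <= K * c * \<rho> ^ (N + m) * hp us"
 using K(2)[of F c us "N + m"] F c Fc us by (simp add: adm_def)
 then have "2 * \<bar>b N\<bar> * \<bar>ins F (G Z (N + m)) us\<bar> <= 2 * \<bar>b N\<bar> * (K * c * \<rho> ^ (N + m) * hp us)"
 by (intro mult_left_mono) auto
 then show ?thesis by (simp add: abs_mult c'_def power_add ac_simps)
 qed
 have "\<bar>Y m F us\<bar> <= (\<Sum>N. c' * (\<bar>b N\<bar> * \<rho> ^ N))"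
 using norm_suminf_le[OF le summable_mult[OF b_summable]] sums_unique[OF Y_sums[OF F us, of m]] by simp
 also have "... = c' * (\<Sum>N. \<bar>b N\<bar> * \<rho> ^ N)" by (rule suminf_mult[OF b_summable])
 also have "... <= c' * B" by (intro mult_left_mono b_le c'0)
 finally show ?thesis by (simp add: c'_def ac_simps)
 qed
 show thesis by (rule that[of "2 * B * K", OF _ Y]) (use K B_nonneg in simp)
qed

text \<open>Both series run over brackets with \<open>Z\<close>. Collected along N + m = n, the
  coefficient of the n-fold bracket is the Bernoulli convolution, which vanishes except at n = 0,
  where the kick itself remains.\<close>

lemma Y_exp_sums:
 assumes F: "adm F" and us: "length us <= L + 1"
 shows "(%m. Y m F us / fact (Suc m)) sums (2 * ins F Pf us)"
proof -
 obtain K where K: "K >= 0" "!!F c N us. (!!us. length us < 2 ==> F us = 0) ==> c >= 0 ==>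
 (!!us. length us <= L + 1 ==> \<bar>F us\<bar> <= c * hp us) ==> length us <= L + 1 ==>
 \<bar>ins F (G Z N) us\<bar> <= K * c * \<rho> ^ N * hp us" using G_ins_bound by metis
 obtain K' where K': "K' >= 0" "!!F c m us. adm F ==> c >= 0 ==>
 (!!us. length us <= L + 1 ==> \<bar>F us\<bar> <= c * hp us) ==> length us <= L + 1 ==>
 \<bar>Y m F us\<bar> <= K' * c * \<rho> ^ m * hp us" using Y_bound by metis
 obtain c where c: "c >= 0" "!!us. length us <= L + 1 ==> \<bar>F us\<bar> <= c * hp us"
 using F unfolding adm_def bdd_def by blast
 define q where "q n = 2 * ins F (G Z n) us" for n
 define a where "a N m = b N * q (N + m) / fact (Suc m)" for N m
 define k where "k = 2 * K * c * hp us"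
 have k0: "k >= 0" unfolding k_def using K c by (intro mult_nonneg_nonneg) auto
 have q: "\<bar>q n\<bar> <= k * \<rho> ^ n" for n
 using K(2)[of F c us n] F c us by (simp add: adm_def q_def k_def ac_simps)
 have sx: "summable (%N. \<bar>b N\<bar> * \<rho> ^ N)" by (rule b_summable)
 have sy: "summable (%m. k * (\<rho> ^ m / fact (Suc m)))"
 proof (rule summable_comparison_test'[OF summable_mult[OF summable_exp_generic[of \<rho>], of k]])
 fix m
 have "\<rho> ^ m / fact (Suc m) <= \<rho> ^ m / fact m" using nonneg by (intro divide_left_mono fact_mono) auto
 then show "norm (k * (\<rho> ^ m / fact (Suc m))) <= k * (\<rho> ^ m /\<^sub>R fact m)"
 using k0 nonneg by (simp add: abs_mult divide_inverse mult.commute mult_left_mono)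
 qed
 have aB: "\<bar>a N m\<bar> <= (\<bar>b N\<bar> * \<rho> ^ N) * (k * (\<rho> ^ m / fact (Suc m)))" for N m
 proof -
 have "\<bar>a N m\<bar> = \<bar>b N\<bar> * \<bar>q (N + m)\<bar> / fact (Suc m)" by (simp add: a_def abs_mult)
 also have "... <= \<bar>b N\<bar> * (k * \<rho> ^ (N + m)) / fact (Suc m)" by (intro divide_right_mono mult_left_mono q) auto
 finally show ?thesis by (simp add: power_add ac_simps)
 qed
 note D = sums_diagonal[OF sx sy aB]
 have "(%n. \<Sum>N\<le>n. a N (n - N)) sums (\<Sum>m. \<Sum>N. a N m)"
 by (rule D(1)) (use nonneg k0 in auto)
 moreover have "(\<Sum>N\<le>n. a N (n - N)) = (if n = 0 then q 0 else 0)" for n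
 proof -
 have "(\<Sum>N\<le>n. a N (n - N)) = (\<Sum>N\<le>n. b N / fact (Suc (n - N)) * q n)"
 by (rule sum.cong) (auto simp: a_def)
 also have "... = (if n = 0 then q 0 else 0)" unfolding sum_distrib_right[symmetric] b_conv by simp
 finally show ?thesis .
 qed
 ultimately have "(\<Sum>m. \<Sum>N. a N m) = q 0"
 using sums_unique2[OF _ sums_single[of 0 "%_. q 0"]] by (simp add: eq_commute[of 0])
 moreover have "(\<Sum>N. a N m) = Y m F us / fact (Suc m)" for m
 proof -
 have "(%N. a N m) sums (Y m F us / fact (Suc m))"
 using sums_divide[OF Y_sums[OF F us, of m], of "fact (Suc m)"] by (simp add: a_def q_def ac_simps)
 then show ?thesis by (rule sums_unique[symmetric])
 qed
 moreover have "summable (%m. Y m F us / fact (Suc m))"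
 proof (rule summable_comparison_test'[OF summable_mult[OF summable_exp_generic[of \<rho>], of "K' * c * hp us"]])
 fix m
 have Ym: "\<bar>Y m F us\<bar> <= K' * c * \<rho> ^ m * hp us" by (rule K'(2)[OF F c us])
 have "\<bar>Y m F us\<bar> / fact (Suc m) <= \<bar>Y m F us\<bar> / fact m"
 by (intro divide_left_mono fact_mono) auto
 also have "... <= (K' * c * \<rho> ^ m * hp us) / fact m"
 using Ym by (intro divide_right_mono) auto
 finally show "norm (Y m F us / fact (Suc m)) <= K' * c * hp us * (\<rho> ^ m /\<^sub>R fact m)"
 by (simp add: divide_inverse abs_mult ac_simps)
 qed
 ultimately show ?thesis by (simp add: sums_iff q_def)
qed

text \<open>The degree-by-degree form of the derivative in s of the Lie series of \<open>Z\<close>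
  for the kick scaled by s. The commutators of \<open>length_opr\<close>, divided by n!, rearrange
  into a double series whose inner sum is evaluated by \<open>Y_exp_sums\<close>.\<close>

lemma expo_Z_rec:
 assumes F: "adm F" and d: "!!us. length us ~= d ==> F us = 0" and us: "length us <= L + 1"
 shows "(real (length us) - real d) * expo Z F us = 2 * ins (expo Z F) Pf us"
proof -
 have bF: "bdd F" using F by (simp add: adm_def)
 obtain K where K: "K >= 0" "!!F c m us. adm F ==> c >= 0 ==>
 (!!us. length us <= L + 1 ==> \<bar>F us\<bar> <= c * hp us) ==> length us <= L + 1 ==>
 \<bar>Y m F us\<bar> <= K * c * \<rho> ^ m * hp us" using Y_bound by metis
 obtain c C where c: "c >= 0" "C >= 1" "!!k us. length us <= L + 1 ==> \<bar>opr Z k F us\<bar> <= c * C ^ k * hp us"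
 using opr_bound[OF bF fb_Z] by metis
 have aX: "adm (opr Z k F)" for k by (rule adm_opr[OF F fb_Z ml_Z])
 have sX: "(%k. opr Z k F us / fact k) sums expo Z F us" for us
 unfolding expo_def using expo_summable[OF bF fb_Z] by (rule summable_sums)
 have dF: "(%vs. real (length vs) * F vs) = (%vs. real d * F vs)"
 by (rule ext) (metis d mult_eq_0_iff)
 have opr_d: "opr Z n (%vs. real d * F vs) = (%us. real d * opr Z n F us)" for n
 by (induction n) (auto simp: ins_scale)
 define a where "a m k = Y m (opr Z k F) us / fact (Suc m) / fact k" for m k
 have step: "(real (length us) - real d) * opr Z n F us / fact n = (\<Sum>m<n. a m (n - Suc m))" for n
 proof -
 have "(real (length us) - real d) * opr Z n F us = (\<Sum>m<n. real (n choose Suc m) * Y m (opr Z (n - Suc m) F) us)"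
 using length_opr[of us n F] unfolding dF opr_d by (simp add: left_diff_distrib)
 then show ?thesis
 proof (simp only: sum_divide_distrib, intro sum.cong refl)
 fix m assume "m \<in> {..<n}"
 then have "real (n choose Suc m) / fact n * Y m (opr Z (n - Suc m) F) us = a m (n - Suc m)"
 by (subst binomial_diag) (auto simp: a_def)
 then show "real (n choose Suc m) * Y m (opr Z (n - Suc m) F) us / fact n = a m (n - Suc m)" by simp
 qed
 qed
 have "(%n. (real (length us) - real d) * opr Z n F us / fact n) sums ((real (length us) - real d) * expo Z F us)"
 using sums_mult[OF sX[of us], of "real (length us) - real d"] by simp
 then have "(%n. \<Sum>m<n. a m (n - Suc m)) sums ((real (length us) - real d) * expo Z F us)"
 unfolding step .
 then have 1: "(%n. \<Sum>m\<le>n. a m (n - m)) sums ((real (length us) - real d) * expo Z F us)"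
 using sums_Suc_iff[of "%n. \<Sum>m<n. a m (n - Suc m)" "(real (length us) - real d) * expo Z F us"]
 by (simp add: lessThan_Suc_atMost)
 have aB: "\<bar>a m k\<bar> <= (\<rho> ^ m /\<^sub>R fact m) * (K * c * hp us * (C ^ k /\<^sub>R fact k))" for m k
 proof -
 have f: "\<rho> ^ m / fact (Suc m) <= \<rho> ^ m / fact m" using nonneg by (intro divide_left_mono fact_mono) auto
 have "\<bar>Y m (opr Z k F) us\<bar> <= K * (c * C ^ k) * \<rho> ^ m * hp us"
 by (rule K(2)[OF aX _ _ us]) (use c in auto)
 then have "\<bar>Y m (opr Z k F) us\<bar> / fact (Suc m) / fact k <= (K * (c * C ^ k) * \<rho> ^ m * hp us) / fact (Suc m) / fact k"
 by (intro divide_right_mono) auto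
 also have "... = (K * c * C ^ k * hp us / fact k) * (\<rho> ^ m / fact (Suc m))" by (simp add: ac_simps)
 also have "... <= (K * c * C ^ k * hp us / fact k) * (\<rho> ^ m / fact m)"
 using K c by (intro mult_left_mono f divide_nonneg_nonneg mult_nonneg_nonneg) auto
 finally show ?thesis by (simp add: a_def divide_inverse abs_mult ac_simps)
 qed
 have 2: "(%n. \<Sum>m\<le>n. a m (n - m)) sums (\<Sum>k. \<Sum>m. a m k)"
 by (rule sums_diagonal(1)[OF summable_exp_generic summable_mult[OF summable_exp_generic] aB])
 (use nonneg K c in auto)
 have m: "(\<Sum>m. a m k) = 2 * ins (opr Z k F) Pf us / fact k" for k
 using sums_unique[OF sums_divide[OF Y_exp_sums[OF aX us, of k], of "fact k"]] by (simp add: a_def)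
 have "(%k. ins (%us. opr Z k F us / fact k) Pf us) sums ins (expo Z F) Pf us"
 by (rule sums_ins[OF sX])
 have insd: "ins (%us. opr Z k F us / fact k) Pf us = ins (opr Z k F) Pf us / fact k" for k
 by (simp add: ins_def case_prod_unfold sum_divide_distrib)
 from sums_mult[OF \<open>(%k. ins (%us. opr Z k F us / fact k) Pf us) sums ins (expo Z F) Pf us\<close>, of 2]
 have "(%k. 2 * ins (opr Z k F) Pf us / fact k) sums (2 * ins (expo Z F) Pf us)"
 unfolding insd by simp
 then have 3: "(\<Sum>k. \<Sum>m. a m k) = 2 * ins (expo Z F) Pf us" unfolding m by (rule sums_unique[symmetric])
 show ?thesis using sums_unique2[OF 1 2] 3 by simp
qed

text \<open>Inserting a nonlinear part of \<open>Z\<close> passes to a shorter list, where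
  \<open>F\<close> vanishes; in the lowest degree only the linear part acts.\<close>

lemma opr_at:
 assumes low: "!!us. length us < d ==> F us = 0" and mF: "ml F"
 shows "length us <= d ==> opr Z k F us = opr Af k F us"
proof (induction k arbitrary: us)
 case (Suc k)
 have "ins (opr Z k F) Z us = ins (opr Af k F) Af us"
 proof (rule ins_cong_S3)
 fix xs ys zs assume us: "us = xs @ ys @ zs" "ys ~= []"
 show "opr Z k F (xs @ Z ys # zs) = opr Af k F (xs @ Af ys # zs)"
 proof (cases "length ys = 1")
 case True
 then obtain y where "ys = [y]" by (auto simp: length_Suc_conv)
 then show ?thesis using Suc us by (simp add: Z1)
 next
 case False
 then have "length ys >= 2" using us(2) by (cases ys) (auto simp: Suc_le_eq)
 then have "length (xs @ v # zs) < d" for v using us Suc.prems by simp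
 then have "opr Z k F (xs @ Z ys # zs) = 0" "opr Af k F (xs @ Af ys # zs) = 0"
 by (auto intro!: opr_low[of d] low)
 then show ?thesis by simp
 qed
 qed
 then show ?case by simp
qed simp

text \<open>The recursion of \<open>expo_Z_rec\<close>, solved upwards from degree \<open>d\<close>
  in steps of two. It says exp(Z) = exp(P) exp(A) as operators on polynomials, up to degree L + 1:
  the derivatives along \<open>Pf\<close> act on \<open>expo Af F\<close>, as they must for the kick
  to be applied first to the state.\<close>

lemma expo_Z:
 assumes F: "adm F" and d: "!!us. length us ~= d ==> F us = 0"
 shows "length us <= L + 1 ==> expo Z F us =
 (if d <= length us \<and> even (length us - d) then opr Pf ((length us - d) div 2) (expo Af F) us / fact ((length us - d) div 2) else 0)"
proof (induction "length us" arbitrary: us rule: less_induct)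
 case less
 have mF: "ml F" and bF: "bdd F" using F by (auto simp: adm_def)
 have low: "length us < d ==> F us = 0" for us by (rule d) simp
 consider "length us < d" | "length us = d" | "length us > d" by linarith
 then show ?case
 proof cases
 case 1
 then show ?thesis unfolding expo_def using opr_low[OF low] by simp
 next
 case 2
 then show ?thesis unfolding expo_def using opr_at[OF low mF] by simp
 next
 case 3
 have mV: "ml (expo Z F)" using adm_expo[OF F fb_Z ml_Z] by (simp add: adm_def)
 have fA: "fb Af (%j. if j = 1 then \<alpha> else 0)" using fb_Af by (simp add: fb_def)
 have fP: "fb Pf (%j. if j = 3 then p * \<sigma>\<^sup>2 else 0)" using fb_Pf by (simp add: fb_def)
 define E where "E = expo Af F"
 have aE: "adm E" unfolding E_def by (rule adm_expo[OF F fA ml_Af])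
 have mE: "ml (opr Pf i E)" for i using adm_opr[OF aE fP ml_Pf] by (simp add: adm_def)
 have IH: "length vs + 2 = length us ==> expo Z F vs =
 (if d <= length vs \<and> even (length vs - d) then opr Pf ((length vs - d) div 2) E vs / fact ((length vs - d) div 2) else 0)" for vs
 using less.hyps[of vs] less.prems unfolding E_def by simp
 have rec: "(real (length us) - real d) * expo Z F us = 2 * ins (expo Z F) Pf us"
 by (rule expo_Z_rec[OF F d less.prems])
 show ?thesis
 proof (cases "even (length us - d)")
 case True
 then obtain i where i: "length us = d + 2 * i" "i >= 1" using 3
 proof -
 from True obtain i where "length us - d = 2 * i" by (elim evenE)
 with 3 have "length us = d + 2 * i" "i >= 1" by linarith+
 then show thesis by (rule that)
 qed
 have "ins (expo Z F) Pf us = ins (%vs. 1 / fact (i - 1) * opr Pf (i - 1) E vs) Pf us"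
 proof (rule ins_cong_S3)
 fix xs ys zs assume us: "us = xs @ ys @ zs" "ys ~= []"
 show "expo Z F (xs @ Pf ys # zs) = 1 / fact (i - 1) * opr Pf (i - 1) E (xs @ Pf ys # zs)"
 proof (cases "length ys = 3")
 case True
 have "length xs + (length ys + length zs) = d + 2 * i" using us i by simp
 then have "length (xs @ Pf ys # zs) = d + 2 * (i - 1)" "length (xs @ Pf ys # zs) + 2 = length us"
 using True i us by simp_all
 then have e: "(length (xs @ Pf ys # zs) - d) div 2 = i - 1" "even (length (xs @ Pf ys # zs) - d)" "d <= length (xs @ Pf ys # zs)"
 "length (xs @ Pf ys # zs) + 2 = length us"
 by simp_all
 show ?thesis unfolding IH[OF e(4)] e(1) using e(2,3) by simp
 next
 case False
 then show ?thesis using ml_zero[OF mV] ml_zero[OF mE] by simp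
 qed
 qed
 also have "... = opr Pf i E us / fact (i - 1)"
 unfolding ins_scale using i by (cases i) auto
 finally have "real i * expo Z F us = opr Pf i E us / fact (i - 1)" using rec i by simp
 then have "expo Z F us = opr Pf i E us / (real i * fact (i - 1))" using i by (simp add: field_simps)
 also have "real i * fact (i - 1) = fact i" using i by (simp add: fact_reduce)
 finally show ?thesis using i by (simp add: E_def)
 next
 case False
 have "ins (expo Z F) Pf us = ins (%vs. 0) Pf us"
 proof (rule ins_cong_S3)
 fix xs ys zs assume us: "us = xs @ ys @ zs" "ys ~= []"
 show "expo Z F (xs @ Pf ys # zs) = 0"
 proof (cases "length ys = 3")
 case True
 have e: "length (xs @ Pf ys # zs) + 2 = length us" using us True by auto
 have "\<not> (d <= length (xs @ Pf ys # zs) \<and> even (length (xs @ Pf ys # zs) - d))"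
 proof
 assume a: "d <= length (xs @ Pf ys # zs) \<and> even (length (xs @ Pf ys # zs) - d)"
 then have "length us - d = (length (xs @ Pf ys # zs) - d) + 2" using e by linarith
 then show False using a False by simp
 qed
 then show ?thesis unfolding IH[OF e] by (simp only: if_False)
 next
 case False
 then show ?thesis using ml_zero[OF mV] by simp
 qed
 qed
 then have "(real (length us) - real d) * expo Z F us = 0" using rec by simp
 then show ?thesis using 3 False by simp
 qed
 qed
qed

end

section \<open>Evaluation on the diagonal and Hamiltonians of fields\<close>

lemma has_vector_derivative_quotient:
 "(f has_vector_derivative D) (at t) \<longleftrightarrow> ((%s. (f s - f t) /\<^sub>R (s - t)) \<longlongrightarrow> D) (at t)"
proof -
 have eq: "norm ((f s - f t) /\<^sub>R (s - t) - D) = norm (f s - (f t + (s - t) *\<^sub>R D)) / norm (s - t)" if "s ~= t" for s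
 proof -
 have "(f s - f t) /\<^sub>R (s - t) - D = (f s - (f t + (s - t) *\<^sub>R D)) /\<^sub>R (s - t)"
 using that by (simp add: scaleR_diff_right scaleR_add_right)
 then show ?thesis by (simp add: divide_inverse mult.commute)
 qed
 have "((%s. (f s - f t) /\<^sub>R (s - t)) \<longlongrightarrow> D) (at t) \<longleftrightarrow> ((%s. norm ((f s - f t) /\<^sub>R (s - t) - D)) \<longlongrightarrow> 0) (at t)"
 by (simp add: tendsto_norm_zero_iff LIM_zero_iff)
 also have "... \<longleftrightarrow> ((%s. norm (f s - (f t + (s - t) *\<^sub>R D)) / norm (s - t)) \<longlongrightarrow> 0) (at t)"
 by (rule filterlim_cong) (auto simp: eventually_at_filter eq)
 also have "... \<longleftrightarrow> (f has_vector_derivative D) (at t)"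
 unfolding has_vector_derivative_def has_derivative_iff_norm
 by (simp add: bounded_linear_scaleR_left algebra_simps)
 finally show ?thesis ..
qed

lemma sum_opr_add:
 fixes F H :: "'v list => real"
 shows "((%F. ins F f) ^^ k) (%us. F us + H us) = (%us. ((%F. ins F f) ^^ k) F us + ((%F. ins F f) ^^ k) H us)"
 by (induction k) (auto simp: ins_add_left)

lemma sum_opr_sum:
 fixes H :: "'a => 'v list => real"
 shows "((%F. ins F f) ^^ k) (%us. \<Sum>d\<in>S. H d us) = (%us. \<Sum>d\<in>S. ((%F. ins F f) ^^ k) (H d) us)"
 by (induction k) (auto simp: ins_sum)

context kicked
begin

text \<open>The product rule by peeling off one moving slot at a time. In that slot linearity gives
  the difference quotient of the curve, and the bound on \<open>F\<close> allows its limit to be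
  taken while the other slots still move.\<close>

lemma diag_deriv_aux:
 assumes F: "adm F" and g: "(\<gamma> has_vector_derivative g') (at t)"
 shows "((%s. F (replicate n (\<gamma> s) @ zs)) has_real_derivative
 (\<Sum>i<n. F (replicate i (\<gamma> t) @ g' # replicate (n - Suc i) (\<gamma> t) @ zs))) (at t)"
proof (induction n arbitrary: zs)
 case (Suc n)
 have mF: "ml F" and bF: "bdd F" using F by (auto simp: adm_def)
 define Q where "Q s v = F (replicate n (\<gamma> s) @ v # zs)" for s v
 have Qlin: "linear (Q s)" for s unfolding Q_def by (rule mlD[OF mF])
 define dq where "dq s = (\<gamma> s - \<gamma> t) /\<^sub>R (s - t)" for s
 have dq: "(dq \<longlongrightarrow> g') (at t)" using g unfolding dq_def has_vector_derivative_quotient .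
 have IH: "((%s. Q s v) has_real_derivative
 (\<Sum>i<n. F (replicate i (\<gamma> t) @ g' # replicate (n - Suc i) (\<gamma> t) @ v # zs))) (at t)" for v
 unfolding Q_def by (rule Suc.IH)
 have gcont: "(\<gamma> \<longlongrightarrow> \<gamma> t) (at t)"
 using has_vector_derivative_continuous[OF g] by (simp add: continuous_at isCont_def)
 obtain c where c: "c >= 0" "!!us. length us <= n + Suc (length zs) ==> \<bar>F us\<bar> <= c * hp us"
 using bF unfolding bdd_def by blast
 have hp_rep: "hp (replicate n v) = hn v ^ n" for v n by (induction n) auto
 have 1: "((%s. Q s (dq s)) \<longlongrightarrow> Q t g') (at t)"
 proof -
 have "((%s. Q s (dq s - g')) \<longlongrightarrow> 0) (at t)"
 proof (rule Lim_null_comparison)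
 show "\<forall>\<^sub>F s in at t. norm (Q s (dq s - g')) <= c * (hn (\<gamma> s) ^ n * (hn (dq s - g') * hp zs))"
 using c(2)[of "replicate n _ @ _ # zs"] by (auto simp: Q_def hp_rep)
 have "((%s. c * (hn (\<gamma> s) ^ n * (hn (dq s - g') * hp zs))) \<longlongrightarrow> c * (hn (\<gamma> t) ^ n * (hn 0 * hp zs))) (at t)"
 using LIM_zero[OF dq] by (intro tendsto_intros tendsto_hn gcont)
 then show "((%s. c * (hn (\<gamma> s) ^ n * (hn (dq s - g') * hp zs))) \<longlongrightarrow> 0) (at t)" by simp
 qed
 moreover have "((%s. Q s g') \<longlongrightarrow> Q t g') (at t)"
 using DERIV_isCont[OF IH] by (simp add: isCont_def)
 ultimately have "((%s. Q s (dq s - g') + Q s g') \<longlongrightarrow> 0 + Q t g') (at t)" by (rule tendsto_add)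
 then show ?thesis by (simp add: linear_diff[OF Qlin])
 qed
 have 2: "((%s. (Q s (\<gamma> t) - Q t (\<gamma> t)) / (s - t)) \<longlongrightarrow>
 (\<Sum>i<n. F (replicate i (\<gamma> t) @ g' # replicate (n - Suc i) (\<gamma> t) @ \<gamma> t # zs))) (at t)"
 using IH[of "\<gamma> t"] by (simp add: has_field_derivative_iff)
 have "((%s. (Q s (\<gamma> s) - Q t (\<gamma> t)) / (s - t)) \<longlongrightarrow>
 Q t g' + (\<Sum>i<n. F (replicate i (\<gamma> t) @ g' # replicate (n - Suc i) (\<gamma> t) @ \<gamma> t # zs))) (at t)"
 proof (rule Lim_transform_eventually[OF tendsto_add[OF 1 2]])
 show "\<forall>\<^sub>F s in at t. Q s (dq s) + (Q s (\<gamma> t) - Q t (\<gamma> t)) / (s - t) = (Q s (\<gamma> s) - Q t (\<gamma> t)) / (s - t)"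
 unfolding eventually_at_filter
 proof (intro always_eventually allI impI)
 fix s assume "s ~= t"
 have "Q s (dq s) = (Q s (\<gamma> s) - Q s (\<gamma> t)) / (s - t)"
 unfolding dq_def by (simp add: linear_scale[OF Qlin] linear_diff[OF Qlin] divide_inverse mult.commute)
 then show "Q s (dq s) + (Q s (\<gamma> t) - Q t (\<gamma> t)) / (s - t) = (Q s (\<gamma> s) - Q t (\<gamma> t)) / (s - t)"
 by (simp add: diff_divide_distrib)
 qed
 qed
 moreover have "F (replicate (Suc n) (\<gamma> s) @ zs) = Q s (\<gamma> s)" for s
 by (simp add: Q_def replicate_append_same[symmetric] del: replicate_Suc) (simp add: replicate_app_Cons_same)
 moreover have "Q t g' + (\<Sum>i<n. F (replicate i (\<gamma> t) @ g' # replicate (n - Suc i) (\<gamma> t) @ \<gamma> t # zs)) =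
 (\<Sum>i<Suc n. F (replicate i (\<gamma> t) @ g' # replicate (Suc n - Suc i) (\<gamma> t) @ zs))"
 proof -
 have "replicate (n - Suc i) (\<gamma> t) @ \<gamma> t # zs = replicate (Suc n - Suc i) (\<gamma> t) @ zs" if "i < n" for i
 proof -
 have "Suc n - Suc i = Suc (n - Suc i)" using that by simp
 then show ?thesis by (simp only: replicate_Suc replicate_app_Cons_same append_Cons)
 qed
 then have "(\<Sum>i<n. F (replicate i (\<gamma> t) @ g' # replicate (n - Suc i) (\<gamma> t) @ \<gamma> t # zs)) =
 (\<Sum>i<n. F (replicate i (\<gamma> t) @ g' # replicate (Suc n - Suc i) (\<gamma> t) @ zs))"
 by (intro sum.cong refl arg_cong[where f = F]) simp
 then show ?thesis by (simp add: Q_def)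
 qed
 ultimately show ?case unfolding has_field_derivative_iff by simp
qed simp

lemma diag_deriv:
 assumes F: "adm F" and g: "(\<gamma> has_vector_derivative g') (at t)"
 shows "((%s. F (replicate n (\<gamma> s))) has_real_derivative
 (\<Sum>i<n. F (replicate i (\<gamma> t) @ g' # replicate (n - Suc i) (\<gamma> t)))) (at t)"
 using diag_deriv_aux[OF assms, of n "[]"] by simp

lemma ins_replicate:
 "ins F f (replicate N \<psi>) = (\<Sum>j=1..N. \<Sum>i<Suc (N - j). F (replicate i \<psi> @ f (replicate j \<psi>) # replicate (Suc (N - j) - Suc i) \<psi>))"
 unfolding ins_def sum_S3 lessThan_Suc_atMost
proof (simp only: length_replicate, intro sum.cong refl)
 fix j i assume "j \<in> {1..N}" "i \<in> {..N - j}"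
 then have "take i (replicate N \<psi>) = replicate i \<psi>" "take j (drop i (replicate N \<psi>)) = replicate j \<psi>"
 "drop (i + j) (replicate N \<psi>) = replicate (Suc (N - j) - Suc i) \<psi>"
 by (auto simp: min_def add.commute)
 then show "F (take i (replicate N \<psi>) @ f (take j (drop i (replicate N \<psi>))) # drop (i + j) (replicate N \<psi>)) =
 F (replicate i \<psi> @ f (replicate j \<psi>) # replicate (Suc (N - j) - Suc i) \<psi>)" by simp
qed

lemma diag_ins_homogeneous:
 assumes F: "adm F" and f: "!!us. length us ~= m ==> f us = 0" and m: "m >= 1" and n: "n >= 1"
 and g: "(\<gamma> has_vector_derivative f (replicate m (\<gamma> t))) (at t)"
 shows "((%s. F (replicate n (\<gamma> s))) has_real_derivative ins F f (replicate (n + m - 1) (\<gamma> t))) (at t)"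
proof -
 have mF: "ml F" using F by (simp add: adm_def)
 have "ins F f (replicate (n + m - 1) (\<gamma> t)) = (\<Sum>j=1..n + m - 1. if j = m then
 (\<Sum>i<n. F (replicate i (\<gamma> t) @ f (replicate m (\<gamma> t)) # replicate (n - Suc i) (\<gamma> t))) else 0)"
 unfolding ins_replicate
 proof (rule sum.cong)
 fix j assume "j \<in> {1..n + m - 1}"
 show "(\<Sum>i<Suc (n + m - 1 - j). F (replicate i (\<gamma> t) @ f (replicate j (\<gamma> t)) # replicate (Suc (n + m - 1 - j) - Suc i) (\<gamma> t))) =
 (if j = m then (\<Sum>i<n. F (replicate i (\<gamma> t) @ f (replicate m (\<gamma> t)) # replicate (n - Suc i) (\<gamma> t))) else 0)"
 proof (cases "j = m")
 case True
 then have "Suc (n + m - 1 - j) = n" using n by simp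
 then show ?thesis using True by simp
 next
 case False then show ?thesis by (simp add: f ml_zero[OF mF])
 qed
 qed simp
 also have "... = (\<Sum>i<n. F (replicate i (\<gamma> t) @ f (replicate m (\<gamma> t)) # replicate (n - Suc i) (\<gamma> t)))"
 using m n by simp
 finally show ?thesis using diag_deriv[OF F g, of n] by simp
qed

text \<open>Without symmetry, vanishing on constant lists does not make \<open>F\<close> zero.
  Still, for each block length the sum over positions is the derivative of the diagonal values along
  the line through \<open>\<psi>\<close> with velocity f(\<psi>, ..., \<psi>), hence zero.\<close>

lemma diag_zero_ins:
 assumes F: "adm F" and 0: "!!\<psi> n. F (replicate n \<psi>) = 0"
 shows "ins F f (replicate N \<psi>) = 0"
 unfolding ins_replicate
proof (rule sum.neutral, rule ballI)
 fix j assume "j \<in> {1..N}"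
 define \<gamma> where "\<gamma> s = \<psi> + s *\<^sub>R f (replicate j \<psi>)" for s :: real
 have "(\<gamma> has_vector_derivative f (replicate j \<psi>)) (at 0)"
 unfolding \<gamma>_def by (auto intro!: derivative_eq_intros)
 from diag_deriv[OF F this, of "Suc (N - j)"]
 have "((%s. 0) has_real_derivative (\<Sum>i<Suc (N - j). F (replicate i \<psi> @ f (replicate j \<psi>) # replicate (Suc (N - j) - Suc i) \<psi>))) (at 0)"
 by (simp only: 0) (simp add: \<gamma>_def)
 then show "(\<Sum>i<Suc (N - j). F (replicate i \<psi> @ f (replicate j \<psi>) # replicate (Suc (N - j) - Suc i) \<psi>)) = 0"
 using DERIV_unique DERIV_const by blast
qed

text \<open>The Hamiltonian of \<open>f\<close>, up to the sign convention, recovered by Euler's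
  formula for homogeneous functions; this is the origin of the division by the degree.\<close>

definition form :: "('v list => 'v) => 'v list => real" where
 "form f us = (if us = [] then 0 else om (f (tl us)) (hd us) / real (length us))"

lemma form_slot:
 assumes "xch f"
 shows "form f (replicate i \<psi> @ w # replicate k \<psi>) = om (f (replicate (i + k) \<psi>)) w / real (Suc (i + k))"
proof (cases i)
 case (Suc i')
 have "om (f (replicate i' \<psi> @ w # replicate k \<psi>)) \<psi> = om (f (replicate k \<psi> @ \<psi> # replicate i' \<psi>)) w"
 by (rule xchD[OF assms])
 also have "replicate k \<psi> @ \<psi> # replicate i' \<psi> = replicate (i + k) \<psi>"
 using replicate_add[of k "Suc i'" \<psi>] Suc by (simp add: add.commute)
 finally show ?thesis using Suc by (simp add: form_def)
qed (simp add: form_def)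

lemma ml_form: "ml f ==> ml (form f)"
 unfolding ml_def[of "form f"]
proof (intro allI)
 fix xs zs assume f: "ml f"
 show "linear (%v. form f (xs @ v # zs))"
 proof (cases xs)
 case Nil
 have "linear (%v. (1 / real (Suc (length zs))) *\<^sub>R om (f zs) v)"
 using om_linear2 by (rule linear_compose_scale_right)
 then show ?thesis using Nil by (simp add: form_def)
 next
 case (Cons x xs')
 define c where "c = 1 / real (length (xs @ undefined # zs))"
 have "linear (%v. c *\<^sub>R om (f (xs' @ v # zs)) x)"
 using linear_compose_scale_right[OF linear_compose[OF mlD[OF f, of xs' zs] om_linear[of x]]] by (simp add: o_def)
 moreover have "form f (xs @ v # zs) = c *\<^sub>R om (f (xs' @ v # zs)) x" for v
 by (simp add: form_def c_def Cons)
 ultimately show ?thesis by simp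
 qed
qed

lemma form_le:
 assumes "\<bar>om (f (tl us)) (hd us)\<bar> <= c * hp (tl us) * hn (hd us)" "us ~= []" "c >= 0"
 shows "\<bar>form f us\<bar> <= c * hp us"
proof -
 have "\<bar>form f us\<bar> = \<bar>om (f (tl us)) (hd us)\<bar> / real (length us)" using assms by (simp add: form_def)
 also have "... <= \<bar>om (f (tl us)) (hd us)\<bar> / 1"
 using assms(2) by (intro divide_left_mono) (auto simp: Suc_le_eq)
 also have "... <= c * hp us" using assms(1,2) by (cases us) (auto simp: ac_simps)
 finally show ?thesis .
qed

lemma bdd_form:
 assumes "fb f z" shows "bdd (form f)"
 unfolding bdd_def
proof
 fix n
 obtain K where K: "K >= 0" "!!us. length us <= n ==> hn (f us) <= K * hp us" using fb_const[OF assms] by metis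
 show "\<exists>c\<ge>0. \<forall>us. length us <= n --> \<bar>form f us\<bar> <= c * hp us"
 proof (intro exI[of _ "co * K"] conjI allI impI)
 fix us :: "'v list" assume us: "length us <= n"
 show "\<bar>form f us\<bar> <= co * K * hp us"
 proof (cases "us = []")
 case True then show ?thesis using K nonneg by (simp add: form_def)
 next
 case False
 show ?thesis
 proof (rule form_le[OF _ False])
 have "hn (f (tl us)) <= K * hp (tl us)" using us by (intro K) auto
 then have "co * hn (f (tl us)) * hn (hd us) <= co * (K * hp (tl us)) * hn (hd us)"
 using nonneg by (intro mult_right_mono mult_left_mono) auto
 then show "\<bar>om (f (tl us)) (hd us)\<bar> <= co * K * hp (tl us) * hn (hd us)"
 using om_le[of "f (tl us)" "hd us"] by (simp add: mult.assoc)
 qed (use K nonneg in auto)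
 qed
 qed (use K nonneg in auto)
qed

lemma adm_form:
 assumes "ml f" "fb f z" "f [] = 0"
 shows "adm (form f)"
 unfolding adm_def
proof (intro conjI allI impI ml_form[OF assms(1)] bdd_form[OF assms(2)])
 fix us :: "'v list" assume "length us < 2"
 then consider "us = []" | u where "us = [u]" by (cases us; cases "tl us") auto
 then show "form f us = 0" by cases (auto simp: form_def assms linear_0[OF om_linear])
qed

text \<open>Conservation of a Hamiltonian along its own field: the terms for block lengths j and N -
  j cancel by antisymmetry of \<open>om\<close>.\<close>

lemma diag_form:
 assumes f: "xch f" "f [] = 0"
 shows "ins (form f) f (replicate N \<psi>) = 0"
proof -
 define q where "q j = om (f (replicate (N - j) \<psi>)) (f (replicate j \<psi>))" for j
 have "ins (form f) f (replicate N \<psi>) = (\<Sum>j=1..N. q j)"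
 unfolding ins_replicate
 proof (rule sum.cong)
 fix j assume j: "j \<in> {1..N}"
 have "(\<Sum>i<Suc (N - j). form f (replicate i \<psi> @ f (replicate j \<psi>) # replicate (Suc (N - j) - Suc i) \<psi>)) =
 (\<Sum>i<Suc (N - j). q j / real (Suc (N - j)))"
 proof (rule sum.cong[OF refl])
 fix i assume "i \<in> {..<Suc (N - j)}"
 then have "i + (Suc (N - j) - Suc i) = N - j" by auto
 then show "form f (replicate i \<psi> @ f (replicate j \<psi>) # replicate (Suc (N - j) - Suc i) \<psi>) = q j / real (Suc (N - j))"
 unfolding form_slot[OF f(1)] q_def by simp
 qed
 then show "(\<Sum>i<Suc (N - j). form f (replicate i \<psi> @ f (replicate j \<psi>) # replicate (Suc (N - j) - Suc i) \<psi>)) = q j"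
 by (simp del: of_nat_Suc)
 qed simp
 also have "... = (\<Sum>j\<le>N. q j)"
 proof -
 have "q 0 = 0" using om_anti[of "f (replicate N \<psi>)" 0] by (simp add: q_def f linear_0[OF om_linear])
 then show ?thesis by (simp add: atMost_atLeast0 sum.atLeast_Suc_atMost)
 qed
 also have "... = 0"
 proof -
 have "(\<Sum>j\<le>N. q j) = (\<Sum>j\<le>N. q (N - j))"
 by (rule sum.reindex_bij_witness[of _ "%j. N - j" "%j. N - j"]) auto
 also have "... = - (\<Sum>j\<le>N. q j)"
 unfolding sum_negf[symmetric]
 proof (rule sum.cong[OF refl])
 fix j assume "j \<in> {..N}"
 then have "N - (N - j) = j" by simp
 then show "q (N - j) = - q j" unfolding q_def by (simp only:) (rule om_anti)
 qed
 finally show ?thesis by simp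
 qed
 finally show ?thesis .
qed

text \<open>The derivative of a Hamiltonian along the linear field is the Hamiltonian of the
  bracket. The linear field preserves the degree, so the division by the length does not
  interfere.\<close>

lemma ins_form_Af:
 assumes "xch f" and f0: "f [] = 0"
 shows "ins (form f) Af us = (if us = [] then 0 else om (lie Af f (tl us)) (hd us) / real (length us))"
proof (cases us)
 case (Cons u vs)
 have l: "length (xs @ Af ys # zs) = length us" if "us = xs @ ys @ zs" "length ys = 1" for xs ys zs
 using that by simp
 have "ins (form f) Af us * real (length us) = (\<Sum>(xs, ys, zs)\<in>S3 ([] @ u # vs). om (f (tl (xs @ Af ys # zs))) (hd (xs @ Af ys # zs)))"
 unfolding ins_def case_prod_unfold sum_distrib_right append_Nil Cons[symmetric]
 proof (rule sum.cong)
 fix p assume p: "p \<in> S3 us"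
 obtain xs ys zs where p': "p = (xs, ys, zs)" "us = xs @ ys @ zs" "ys ~= []" using p by (auto simp: S3_def)
 show "form f (fst p @ Af (fst (snd p)) # snd (snd p)) * real (length us) =
 om (f (tl (fst p @ Af (fst (snd p)) # snd (snd p)))) (hd (fst p @ Af (fst (snd p)) # snd (snd p)))"
 proof (cases "length ys = 1")
 case True
 then show ?thesis using p' l[of xs ys zs] by (simp add: form_def)
 next
 case False
 then have "Af ys = 0" by simp
 moreover have "om (f (tl (xs @ 0 # zs))) (hd (xs @ 0 # zs)) = 0"
 proof (cases xs)
 case Nil then show ?thesis using om_anti[of "f zs" 0] by (simp add: linear_0[OF om_linear])
 next
 case (Cons x xs')
 then show ?thesis using xchD[OF assms(1), of xs' 0 zs x] om_anti[of "f (zs @ x # xs')" 0]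
 by (simp add: linear_0[OF om_linear])
 qed
 ultimately show ?thesis using p' by (simp add: form_def)
 qed
 qed simp
 also have "... = om (ins f Af vs) u + (\<Sum>(b2, c)\<in>S2 vs. om (f c) (Af (u # b2)))"
 proof -
 have "S3 ([] :: 'v list) = {}" "S2 ([] :: 'v list) = {([], [])}" by (auto simp: S3_def S2_def)
 then show ?thesis unfolding sum_S3_Cons om_ins0 by (simp add: case_prod_unfold)
 qed
 also have "(\<Sum>(b2, c)\<in>S2 vs. om (f c) (Af (u # b2))) = om (f vs) (A u)"
 proof -
 have "(\<Sum>(b2, c)\<in>S2 vs. om (f c) (Af (u # b2))) = (\<Sum>(b2, c)\<in>{([], vs)}. om (f c) (Af (u # b2)))"
 proof (rule sum.mono_neutral_right)
 show "\<forall>i\<in>S2 vs - {([], vs)}. (case i of (b2, c) => om (f c) (Af (u # b2))) = 0"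
 proof
 fix i assume "i \<in> S2 vs - {([], vs)}"
 then obtain b2 c where i: "i = (b2, c)" "b2 ~= []" by (auto simp: S2_def)
 then have "Af (u # b2) = 0" by (intro Af_simps(2)) auto
 then show "(case i of (b2, c) => om (f c) (Af (u # b2))) = 0"
 using i om_anti[of "f c" 0] by (simp add: linear_0[OF om_linear])
 qed
 qed (simp, simp add: S2_def)
 then show ?thesis by simp
 qed
 also have "om (ins f Af vs) u + om (f vs) (A u) = om (lie Af f vs) u"
 proof -
 have "ins Af f vs = A (f vs) \<or> (vs = [] \<and> ins Af f vs = 0)"
 proof (cases "vs = []")
 case True
 have "S3 ([] :: 'v list) = {}" by (auto simp: S3_def)
 then show ?thesis using True by (simp add: ins_def)
 next
 case False
 have "ins Af f vs = (\<Sum>(xs, ys, zs)\<in>{([], vs, [])}. Af (xs @ f ys # zs))"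
 unfolding ins_def
 proof (rule sum.mono_neutral_right)
 show "\<forall>i\<in>S3 vs - {([], vs, [])}. (case i of (xs, ys, zs) => Af (xs @ f ys # zs)) = 0"
 proof
 fix i assume "i \<in> S3 vs - {([], vs, [])}"
 then obtain xs ys zs where i: "i = (xs, ys, zs)" and v: "vs = xs @ ys @ zs" and n: "i ~= ([], vs, [])"
 by (cases i) (auto simp: S3_def)
 have "xs ~= [] \<or> zs ~= []" using i v n by auto
 then have "length xs + length zs ~= 0" by auto
 then have "Af (xs @ f ys # zs) = 0" by (intro Af_simps(2)) auto
 then show "(case i of (xs, ys, zs) => Af (xs @ f ys # zs)) = 0" using i by simp
 qed
 qed (simp, use False in \<open>simp add: S3_def\<close>)
 then show ?thesis by simp
 qed
 then show ?thesis
 proof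
 assume "ins Af f vs = A (f vs)"
 then show ?thesis using A_sym[of "f vs" u] om_anti[of "A u" "f vs"] by (simp add: lie_def om_diff_left)
 next
 assume v: "vs = [] \<and> ins Af f vs = 0"
 then show ?thesis using f0 by (auto simp: lie_def linear_0[OF om_linear])
 qed
 qed
 finally show ?thesis using Cons by (simp add: field_simps)
next
 case Nil
 have "S3 ([] :: 'v list) = {}" by (auto simp: S3_def)
 then show ?thesis using Nil by (simp add: ins_def)
qed

end

section \<open>The modified energy and its drift over one step\<close>

context kicked
begin

lemma opr_zero [simp]: "opr f k (%us. 0) = (%us. 0)"
 by (induction k) auto

lemma fb_Af': "fb Af (%j. if j = 1 then \<alpha> else 0)" using fb_Af by (simp add: fb_def)

lemma fb_Pf': "fb Pf (%j. if j = 3 then p * \<sigma>\<^sup>2 else 0)" using fb_Pf by (simp add: fb_def)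

lemma Af_le: "hn (Af us) <= \<alpha> * hp us"
 using fb_Af[of us] nonneg by (auto split: if_splits intro: order_trans)

lemma Pf_le: "hn (Pf us) <= p * \<sigma>\<^sup>2 * hp us"
 using fb_Pf[of us] nonneg by (auto split: if_splits intro: order_trans)

lemma hp_replicate [simp]: "hp (replicate n v) = hn v ^ n" by (induction n) auto

lemma expo_sums: "adm F ==> fb f z ==> (%k. opr f k F us / fact k) sums expo f F us"
 unfolding expo_def adm_def using expo_summable by (intro summable_sums) auto

lemma adm_add: "adm F ==> adm H ==> adm (%us. F us + H us)"
 unfolding adm_def
proof (intro conjI; (elim conjE)?)
 assume F: "bdd F" and H: "bdd H"
 show "bdd (%us. F us + H us)"
 unfolding bdd_def
 proof
 fix n
 obtain c where c: "c >= 0" "!!us. length us <= n ==> \<bar>F us\<bar> <= c * hp us" using F unfolding bdd_def by blast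
 obtain d where d: "d >= 0" "!!us. length us <= n ==> \<bar>H us\<bar> <= d * hp us" using H unfolding bdd_def by blast
 show "\<exists>c\<ge>0. \<forall>us. length us <= n --> \<bar>F us + H us\<bar> <= c * hp us"
 proof (intro exI[of _ "c + d"] conjI allI impI)
 fix us :: "'v list" assume "length us <= n"
 then have "\<bar>F us + H us\<bar> <= c * hp us + d * hp us" using c(2)[of us] d(2)[of us] by linarith
 then show "\<bar>F us + H us\<bar> <= (c + d) * hp us" by (simp add: distrib_right)
 qed (use c d in auto)
 qed
qed (auto intro: ml_plus)

lemma adm_restrict:
 assumes "adm F" shows "adm (%us. if length us = d then F us else 0)"
 unfolding adm_def
proof (intro conjI allI impI)
 have mF: "ml F" and bF: "bdd F" and lF: "!!us. length us < 2 ==> F us = 0" using assms by (auto simp: adm_def)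
 show "ml (%us. if length us = d then F us else 0)"
 unfolding ml_def
 proof (intro allI)
 fix xs zs :: "'v list"
 show "linear (%v. if length (xs @ v # zs) = d then F (xs @ v # zs) else 0)"
 using mlD[OF mF, of xs zs] linear_zero by (cases "Suc (length xs + length zs) = d") simp_all
 qed
 show "bdd (%us. if length us = d then F us else 0)"
 unfolding bdd_def
 proof
 fix n
 obtain c where "c >= 0" "!!us. length us <= n ==> \<bar>F us\<bar> <= c * hp us" using bF unfolding bdd_def by blast
 then show "\<exists>c\<ge>0. \<forall>us. length us <= n --> \<bar>if length us = d then F us else 0\<bar> <= c * hp us"
 by (intro exI[of _ c]) auto
 qed
 fix us :: "'v list" assume "length us < 2"
 then show "(if length us = d then F us else 0) = 0" using lF by simp
qed

lemma adm_form_Z: "adm (form Z)" by (rule adm_form[OF ml_Z fb_Z Z_Nil])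
lemma adm_form_Af: "adm (form Af)" by (rule adm_form[OF ml_Af fb_Af']) simp
lemma adm_form_Pf: "adm (form Pf)" by (rule adm_form[OF ml_Pf fb_Pf']) simp

lemma expo_add:
 assumes "adm F" "adm H" "fb f z"
 shows "expo f (%us. F us + H us) us = expo f F us + expo f H us"
proof (rule sums_unique2[OF expo_sums[OF adm_add[OF assms(1,2)] assms(3)]])
 show "(%k. opr f k (%us. F us + H us) us / fact k) sums (expo f F us + expo f H us)"
 using sums_add[OF expo_sums[OF assms(1,3)] expo_sums[OF assms(2,3)]]
 by (simp add: sum_opr_add add_divide_distrib)
qed

text \<open>One insertion is split off from every term, so the smallness of \<open>ins F f\<close>
  alone passes to the whole difference, although \<open>f\<close> may be of size one.\<close>

lemma expo_diff_bound:
 assumes F: "adm F" and f: "fb f z" and fz: "!!us. length us <= n ==> hn (f us) <= y * hp us"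
 and le: "!!us. length us <= n ==> \<bar>ins F f us\<bar> <= c * hp us"
 and c: "c >= 0" and y: "y >= 0" and us: "length us <= n"
 shows "\<bar>expo f F us - F us\<bar> <= c * exp (real (Suc n)^2 * y) * hp us"
proof -
 define K where "K = real (Suc n)^2 * y"
 have K: "K >= 0" using y by (simp add: K_def)
 have s: "(%k. opr f (Suc k) F us / fact (Suc k)) sums (expo f F us - F us)"
 using sums_split_initial_segment[OF expo_sums[OF F f, of us], of 1] by simp
 have e: "(%k. c * hp us * (K ^ k /\<^sub>R fact k)) sums (c * hp us * exp K)"
 by (intro sums_mult exp_converges)
 have "\<bar>expo f F us - F us\<bar> <= (\<Sum>k. c * hp us * (K ^ k /\<^sub>R fact k))"
 unfolding sums_unique[OF s] real_norm_def[symmetric]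
 proof (rule norm_suminf_le[OF _ sums_summable[OF e]])
 fix k
 have "opr f (Suc k) F = opr f k (ins F f)" using funpow_swap1[of "%F. ins F f" k F] by simp
 then have o: "\<bar>opr f (Suc k) F us\<bar> <= c * K ^ k * hp us"
 unfolding K_def using opr_le[OF le fz c y us] by metis
 have "\<bar>opr f (Suc k) F us\<bar> / fact (Suc k) <= \<bar>opr f (Suc k) F us\<bar> / fact k"
 by (intro divide_left_mono fact_mono) auto
 also have "... <= (c * K ^ k * hp us) / fact k" using o by (intro divide_right_mono) auto
 finally show "norm (opr f (Suc k) F us / fact (Suc k)) <= c * hp us * (K ^ k /\<^sub>R fact k)"
 by (simp add: divide_inverse abs_mult ac_simps)
 qed
 then show ?thesis using sums_unique[OF e] by (simp add: K_def ac_simps)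
qed

lemma form_Af_zero: "length us ~= 2 ==> form Af us = 0"
 by (cases us) (auto simp: form_def linear_0[OF om_linear])

lemma form_Pf_zero: "length us ~= 4 ==> form Pf us = 0"
 by (cases us) (auto simp: form_def linear_0[OF om_linear])

lemma ins_form_Af_Af: "ins (form Af) Af us = 0"
 by (subst ins_form_Af[OF xch_Af]) (auto simp: lie_def linear_0[OF om_linear])

lemma ins_form_Pf_Af: "\<bar>ins (form Pf) Af us\<bar> <= \<kappa> * \<sigma>^4 * hp us"
proof (cases us)
 case Nil then show ?thesis using nonneg by (simp add: ins_form_Af[OF xch_Pf])
next
 case (Cons u vs)
 have eq: "\<bar>ins (form Pf) Af us\<bar> = \<bar>om (lie Af Pf vs) u\<bar> / real (Suc (length vs))"
 using Cons by (simp add: ins_form_Af[OF xch_Pf])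
 have c: "0 <= \<kappa> * \<sigma>^4 * (hn u * hp vs)" using nonneg by (intro mult_nonneg_nonneg) auto
 show ?thesis
 proof (cases "length vs = 3")
 case True
 then have "\<bar>om (lie Af Pf vs) u\<bar> <= 2 * (\<kappa> * \<sigma>^4 * (hn u * hp vs))"
 using lie_Af_Pf[of vs u] by (simp add: ac_simps)
 then show ?thesis unfolding eq using True Cons c by simp
 next
 case False
 then have "\<bar>om (lie Af Pf vs) u\<bar> <= 0" using lie_Af_Pf[of vs u] by simp
 then show ?thesis unfolding eq using Cons c by simp
 qed
qed

text \<open>The kick can enter either slot of the quadratic form; the two contributions are the two
  terms of \<open>P_pair\<close>.\<close>

lemma ins_form_Af_Pf: "\<bar>ins (form Af) Pf us\<bar> <= \<kappa> * \<sigma>^4 * hp us"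
proof (cases "length us = 4")
 case True
 then obtain x u v w where us: "us = [x, u, v, w]" by (auto simp: numeral_eq_Suc length_Suc_conv)
 have "ins (form Af) Pf us = form Af [P x u v, w] + form Af [x, P u v w]"
 unfolding ins_def us sum_S3
 by (simp add: eval_nat_numeral atLeastAtMostSuc_conv atMost_Suc form_Af_zero)
 also have "... = - (om (P u v w) (A x) + om (P u v (A w)) x) / 2"
 using A_sym[of "P u v w" x] om_anti[of "A x" "P u v w"] om_anti[of "A w" "P x u v"] P_cyc[of u v "A w" x]
 by (simp add: form_def field_simps)
 finally have "\<bar>ins (form Af) Pf us\<bar> = \<bar>om (P u v w) (A x) + om (P u v (A w)) x\<bar> / 2" by simp
 also have "... <= \<bar>om (P u v w) (A x) + om (P u v (A w)) x\<bar>" by simp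
 also have "... <= \<kappa> * \<sigma>^4 * hp us" using P_pair[of u v w x] by (simp add: us ac_simps)
 finally show ?thesis .
next
 case False
 have "ins (form Af) Pf us = ins (%_. 0) Pf us"
 proof (rule ins_cong_S3)
 fix xs ys zs assume us: "us = xs @ ys @ zs" "ys ~= []"
 show "form Af (xs @ Pf ys # zs) = 0"
 proof (cases "length ys = 3")
 case True
 then show ?thesis using us False by (intro form_Af_zero) auto
 next
 case False
 then show ?thesis using ml_zero[OF ml_form[OF ml_Af]] by simp
 qed
 qed
 then show ?thesis using nonneg by simp
qed

lemma form_R_le:
 assumes "length us <= L + 1"
 shows "\<bar>form R us\<bar> <= 2 * B * ec (length us - 1) * \<sigma> ^ (length us - 2) * \<sigma>\<^sup>2 * hp us"
proof (cases "us = []")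
 case False
 have "length (tl us) <= L" using assms by simp
 from R_energy[OF this, of "hd us"] show ?thesis
 using B_nonneg nonneg by (intro form_le) (auto simp: False numeral_2_eq_2)
qed (auto simp: form_def)

lemma form_Z: "form Z us = form Af us + form Pf us + form R us"
 by (auto simp: form_def R_def om_diff_left add_divide_distrib[symmetric])

text \<open>The value of the Hamiltonian of \<open>Z\<close>. A field of degree at most
  \<open>L\<close> has a Hamiltonian of degree at most L + 1.\<close>

definition Ehat :: "'v => real" where "Ehat \<psi> = (\<Sum>m\<le>L + 1. form Z (replicate m \<psi>))"

lemma Ehat_approx:
 assumes "hn \<psi> <= Rb" "1 <= Rb"
 shows "\<bar>Ehat \<psi> - om (A \<psi>) \<psi> / 2 - om (P \<psi> \<psi> \<psi>) \<psi> / 4\<bar> <= (\<Sum>d\<le>L + 1. 2 * B * ec (d - 1)) * \<sigma>^4 * Rb ^ (L + 1)"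
proof -
 have a: "form Af (replicate m \<psi>) = (if m = 2 then om (A \<psi>) \<psi> / 2 else 0)" for m
 proof (cases "m = 2")
 case True then show ?thesis by (simp add: form_def numeral_2_eq_2)
 next
 case False then show ?thesis by (simp add: form_Af_zero)
 qed
 have p: "form Pf (replicate m \<psi>) = (if m = 4 then om (P \<psi> \<psi> \<psi>) \<psi> / 4 else 0)" for m
 proof (cases "m = 4")
 case True then show ?thesis by (simp add: form_def numeral_eq_Suc)
 next
 case False then show ?thesis by (simp add: form_Pf_zero)
 qed
 have "Ehat \<psi> = om (A \<psi>) \<psi> / 2 + om (P \<psi> \<psi> \<psi>) \<psi> / 4 + (\<Sum>m\<le>L + 1. form R (replicate m \<psi>))"
 unfolding Ehat_def form_Z sum.distrib a p using L3 by simp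
 then have "\<bar>Ehat \<psi> - om (A \<psi>) \<psi> / 2 - om (P \<psi> \<psi> \<psi>) \<psi> / 4\<bar> = \<bar>\<Sum>m\<le>L + 1. form R (replicate m \<psi>)\<bar>" by simp
 also have "... <= (\<Sum>m\<le>L + 1. \<bar>form R (replicate m \<psi>)\<bar>)" by (rule sum_abs)
 also have "... <= (\<Sum>m\<le>L + 1. 2 * B * ec (m - 1) * (\<sigma>^4 * Rb ^ (L + 1)))"
 proof (rule sum_mono)
 fix m assume m: "m \<in> {..L + 1}"
 show "\<bar>form R (replicate m \<psi>)\<bar> <= 2 * B * ec (m - 1) * (\<sigma>^4 * Rb ^ (L + 1))"
 proof (cases "m >= 4")
 case True
 have 1: "\<sigma> ^ (m - 2) * \<sigma>\<^sup>2 <= \<sigma>^4"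
 unfolding power_add[symmetric] using nonneg True by (intro power_decreasing) auto
 have 2: "hn \<psi> ^ m <= Rb ^ (L + 1)"
 using power_mono[OF assms(1), of m] power_increasing[of m "L + 1" Rb] m assms by fastforce
 have "\<bar>form R (replicate m \<psi>)\<bar> <= 2 * B * ec (m - 1) * \<sigma> ^ (m - 2) * \<sigma>\<^sup>2 * hn \<psi> ^ m"
 using form_R_le[of "replicate m \<psi>"] m by simp
 also have "... = 2 * B * ec (m - 1) * ((\<sigma> ^ (m - 2) * \<sigma>\<^sup>2) * hn \<psi> ^ m)" by (simp add: ac_simps)
 also have "... <= 2 * B * ec (m - 1) * (\<sigma>^4 * Rb ^ (L + 1))"
 using 1 2 B_nonneg nonneg by (intro mult_left_mono mult_mono) auto
 finally show ?thesis .
 next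
 case False
 then have "ec (m - 1) = 0" by simp
 then show ?thesis using form_R_le[of "replicate m \<psi>"] m by simp
 qed
 qed
 finally show ?thesis by (simp only: sum_distrib_right mult.assoc)
qed

definition Ed :: "nat => 'v list => real" where "Ed d us = (if length us = d then form Z us else 0)"

definition Gd :: "nat => 'v list => real" where "Gd d = expo Af (Ed d)"

lemma adm_Ed: "adm (Ed d)" unfolding Ed_def[abs_def] by (rule adm_restrict[OF adm_form_Z])

lemma adm_Gd: "adm (Gd d)" unfolding Gd_def by (rule adm_expo[OF adm_Ed fb_Af' ml_Af])

text \<open>The first insertion of \<open>Z\<close> into its own Hamiltonian vanishes on constant
  lists by \<open>diag_form\<close>, and later insertions preserve this by
  \<open>diag_zero_ins\<close>.\<close>

lemma form_Z_diag: "expo Z (form Z) (replicate m \<psi>) = form Z (replicate m \<psi>)"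
proof -
 have "opr Z (Suc k) (form Z) (replicate m \<psi>) = 0" for k m \<psi>
 proof (induction k arbitrary: m \<psi>)
 case 0 then show ?case using diag_form[OF xch_Z Z_Nil] by simp
 next
 case (Suc k)
 then show ?case using diag_zero_ins[OF adm_opr[OF adm_form_Z fb_Z ml_Z, of "Suc k"]] by simp
 qed
 then have "(%k. opr Z (Suc k) (form Z) (replicate m \<psi>) / fact (Suc k)) sums 0" by simp
 moreover have "(%k. opr Z (Suc k) (form Z) (replicate m \<psi>) / fact (Suc k)) sums
 (expo Z (form Z) (replicate m \<psi>) - form Z (replicate m \<psi>))"
 using sums_split_initial_segment[OF expo_sums[OF adm_form_Z fb_Z, of "replicate m \<psi>"], of 1] by simp
 ultimately show ?thesis using sums_unique2 by fastforce
qed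

lemma form_Z_Ed: "form Z = (%us. \<Sum>d\<le>L + 1. Ed d us)"
proof
 fix us :: "'v list"
 have "form Z us = 0" if "\<not> length us <= L + 1"
 using that Z_high[of "tl us"] by (cases us) (auto simp: form_def linear_0[OF om_linear])
 then show "form Z us = (\<Sum>d\<le>L + 1. Ed d us)" by (auto simp: Ed_def)
qed

text \<open>On constant lists the Lie series of \<open>Z\<close> fixes its Hamiltonian, and by
  \<open>expo_Z\<close> that series is the composition of the two exact ones up to degree L + 1. So
  the modified energy is a Taylor polynomial, along the kick, of its own homogeneous parts pulled
  back by the linear flow.\<close>

lemma Ehat_expansion:
 "Ehat \<psi> = (\<Sum>d\<le>L + 1. \<Sum>i\<le>(L + 1 - d) div 2. opr Pf i (Gd d) (replicate (d + 2 * i) \<psi>) / fact i)"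
proof -
 define t where "t d m = (if d <= m \<and> even (m - d) then opr Pf ((m - d) div 2) (Gd d) (replicate m \<psi>) / fact ((m - d) div 2) else 0)" for d m
 have "form Z (replicate m \<psi>) = (\<Sum>d\<le>L + 1. t d m)" if "m <= L + 1" for m
 proof -
 have "(%k. opr Z k (form Z) (replicate m \<psi>) / fact k) sums (\<Sum>d\<le>L + 1. expo Z (Ed d) (replicate m \<psi>))"
 using sums_sum[of "{..L + 1}" "%d k. opr Z k (Ed d) (replicate m \<psi>) / fact k" "%d. expo Z (Ed d) (replicate m \<psi>)"]
 expo_sums[OF adm_Ed fb_Z]
 by (simp only: form_Z_Ed sum_opr_sum sum_divide_distrib)
 from sums_unique2[OF expo_sums[OF adm_form_Z fb_Z] this]
 have "form Z (replicate m \<psi>) = (\<Sum>d\<le>L + 1. expo Z (Ed d) (replicate m \<psi>))"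
 by (simp only: form_Z_diag)
 also have "... = (\<Sum>d\<le>L + 1. t d m)"
 proof (rule sum.cong[OF refl])
 fix d
 have z: "length us ~= d ==> Ed d us = 0" for us by (simp add: Ed_def)
 have "length (replicate m \<psi>) <= L + 1" using that by simp
 from expo_Z[OF adm_Ed z this]
 show "expo Z (Ed d) (replicate m \<psi>) = t d m" by (simp only: t_def Gd_def length_replicate)
 qed
 finally show ?thesis .
 qed
 then have "Ehat \<psi> = (\<Sum>m\<le>L + 1. \<Sum>d\<le>L + 1. t d m)" unfolding Ehat_def by simp
 also have "... = (\<Sum>d\<le>L + 1. \<Sum>m\<le>L + 1. t d m)" by (rule sum.swap)
 also have "... = (\<Sum>d\<le>L + 1. \<Sum>i\<le>(L + 1 - d) div 2. opr Pf i (Gd d) (replicate (d + 2 * i) \<psi>) / fact i)"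
 proof (rule sum.cong[OF refl])
 fix d assume d: "d \<in> {..L + 1}"
 have "(\<Sum>m\<le>L + 1. t d m) = (\<Sum>m\<in>{m. m <= L + 1 \<and> d <= m \<and> even (m - d)}. t d m)"
 by (rule sum.mono_neutral_right) (auto simp: t_def)
 also have "... = (\<Sum>i\<le>(L + 1 - d) div 2. opr Pf i (Gd d) (replicate (d + 2 * i) \<psi>) / fact i)"
 proof (rule sum.reindex_bij_witness[of _ "%i. d + 2 * i" "%m. (m - d) div 2"])
 fix i assume "i \<in> {..(L + 1 - d) div 2}"
 then have "2 * i <= L + 1 - d" by auto
 then show "d + 2 * i \<in> {m. m <= L + 1 \<and> d <= m \<and> even (m - d)}" using d by auto
 qed (auto simp: t_def intro: div_le_mono elim!: evenE)
 finally show "(\<Sum>m\<le>L + 1. t d m) = (\<Sum>i\<le>(L + 1 - d) div 2. opr Pf i (Gd d) (replicate (d + 2 * i) \<psi>) / fact i)" .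
 qed
 finally show ?thesis .
qed

text \<open>The linear flow over unit time has size one, so its Taylor series cannot be truncated.
  The coefficients grow at most geometrically, and the Lagrange remainder tends to zero.\<close>

lemma flow_A:
 assumes \<gamma>: "!!t. (\<gamma> has_vector_derivative A (\<gamma> t)) (at t)" and d: "d >= 1"
 shows "Ed d (replicate d (\<gamma> 1)) = Gd d (replicate d (\<gamma> 0))"
proof -
 define D where "D k t = opr Af k (Ed d) (replicate d (\<gamma> t))" for k t
 have der: "(D k has_real_derivative D (Suc k) t) (at t)" for k t
 using diag_ins_homogeneous[OF adm_opr[OF adm_Ed fb_Af' ml_Af], of 1 Af d \<gamma> t k d] d \<gamma>
 by (simp add: D_def[abs_def])
 have "bdd (Ed d)" using adm_Ed by (simp add: adm_def)
 then obtain c K where cK: "c >= 0" "K >= 1" "!!k us. length us <= d ==> \<bar>opr Af k (Ed d) us\<bar> <= c * K ^ k * hp us"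
 using opr_bound[OF _ fb_Af'] by metis
 have "continuous_on {0..1} \<gamma>"
 using \<gamma> by (intro continuous_at_imp_continuous_on) (auto intro: has_vector_derivative_continuous)
 then have "bounded (\<gamma> ` {0..1})" by (intro compact_imp_bounded compact_continuous_image) auto
 then have "\<exists>r. \<forall>t\<in>{0..1}. norm (\<gamma> t) <= r" by (simp add: bounded_iff)
 then obtain r where r: "!!t. t \<in> {0..1} ==> norm (\<gamma> t) <= r" by blast
 have r0: "r >= 0" using r[of 0] norm_ge_zero[of "\<gamma> 0"] by (simp del: norm_ge_zero)
 define H where "H = (C0 * r) ^ d"
 have H: "hn (\<gamma> t) ^ d <= H" if "t \<in> {0..1}" for t
 unfolding H_def using hn_le[of "\<gamma> t"] mult_left_mono[OF r[OF that] C0] by (intro power_mono) auto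
 have bnd: "norm (D 0 1 - (\<Sum>k<n. D k 0 / fact k)) <= c * H * (K ^ n / fact n)" for n
 proof -
 have "\<exists>t>0. t <= 1 \<and> D 0 1 = (\<Sum>m<n. D m 0 / fact m * 1 ^ m) + D n t / fact n * 1 ^ n"
 using Maclaurin2[of 1 D "D 0" n] der by auto
 then obtain t where t: "0 < t" "t <= 1" "D 0 1 = (\<Sum>m<n. D m 0 / fact m) + D n t / fact n" by auto
 have "\<bar>D n t\<bar> <= c * K ^ n * hn (\<gamma> t) ^ d" unfolding D_def using cK(3)[of "replicate d (\<gamma> t)" n] by simp
 also have "... <= c * K ^ n * H" using cK H[of t] t by (intro mult_left_mono) auto
 finally have "\<bar>D n t\<bar> / fact n <= (c * K ^ n * H) / fact n" by (intro divide_right_mono) auto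
 then show ?thesis using t by (simp add: ac_simps)
 qed
 have lim: "(%n. c * H * (K ^ n / fact n)) \<longlonglongrightarrow> 0"
 using tendsto_mult_left[OF summable_LIMSEQ_zero[OF summable_exp_generic[of K]], of "c * H"]
 by (simp add: divide_inverse mult.commute)
 have "(%n. D 0 1 - (\<Sum>k<n. D k 0 / fact k)) \<longlonglongrightarrow> 0"
 by (rule Lim_null_comparison[OF always_eventually[OF allI[OF bnd]] lim])
 moreover have "(%n. D 0 1 - (\<Sum>k<n. D k 0 / fact k)) \<longlonglongrightarrow> D 0 1 - Gd d (replicate d (\<gamma> 0))"
 unfolding Gd_def D_def using expo_sums[OF adm_Ed fb_Af', unfolded sums_def] by (intro tendsto_intros)
 ultimately have "0 = D 0 1 - Gd d (replicate d (\<gamma> 0))" by (rule LIMSEQ_unique)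
 then show ?thesis by (simp add: D_def)
qed

text \<open>The kick is small, so a finite expansion is enough. The Lagrange remainder sits at an
  intermediate time, which is why later bounds are required along the whole kick.\<close>

lemma flow_P:
 assumes \<beta>: "!!t. (\<beta> has_vector_derivative P (\<beta> t) (\<beta> t) (\<beta> t)) (at t)" and d: "d >= 1"
 shows "\<exists>t\<in>{0..1}. Gd d (replicate d (\<beta> 1)) = (\<Sum>i<n. opr Pf i (Gd d) (replicate (d + 2 * i) (\<beta> 0)) / fact i)
 + opr Pf n (Gd d) (replicate (d + 2 * n) (\<beta> t)) / fact n"
proof -
 define D where "D k t = opr Pf k (Gd d) (replicate (d + 2 * k) (\<beta> t))" for k t
 have der: "(D k has_real_derivative D (Suc k) t) (at t)" for k t
 using diag_ins_homogeneous[OF adm_opr[OF adm_Gd fb_Pf' ml_Pf], of 3 Pf "d + 2 * k" \<beta> t k d] d \<beta>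
 by (simp add: D_def[abs_def] numeral_3_eq_3)
 have "\<exists>t>0. t <= 1 \<and> D 0 1 = (\<Sum>m<n. D m 0 / fact m * 1 ^ m) + D n t / fact n * 1 ^ n"
 using Maclaurin2[of 1 D "D 0" n] der by auto
 then show ?thesis unfolding D_def by force
qed

end

context kicked
begin

lemma Ed_trivial:
 assumes "d < 2 \<or> odd d" shows "Ed d = (%us. 0)"
proof
 fix us :: "'v list"
 have "form Z us = 0" if "odd (length us)"
 proof (cases us)
 case (Cons u vs)
 then have e: "even (length vs)" using that by simp
 then have "zb (length vs) = 0" using majorant_even[of "length vs" p cm] by (auto simp: zb_def D_def)
 then have "hn (Z vs) = 0" using Z_le[of vs] hn_nonneg[of "Z vs"] by simp
 then have "Z vs = 0" by (rule hn_eq_0)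
 then show ?thesis using Cons by (simp add: form_def linear_0[OF om_linear])
 qed (simp add: form_def)
 moreover have "form Z us = 0" if "length us < 2" using adm_form_Z that by (simp add: adm_def)
 ultimately show "Ed d us = 0" using assms by (auto simp: Ed_def)
qed

abbreviation Nn :: real where "Nn \<equiv> real (Suc (L + 3)) ^ 2"

definition cd :: "nat => real" where
 "cd d = (2 * B * ec (d - 1) + \<kappa>) * exp (Nn * \<Omega>) * (Nn * p + 1) ^ (L + 3)"

lemma expN_le: "exp (Nn * \<alpha>) <= exp (Nn * \<Omega>)"
proof -
 have "\<alpha> <= real (L + 1) * \<alpha>" using nonneg mult_right_mono[of 1 "real (L + 1)" \<alpha>] by simp
 then have "\<alpha> <= \<Omega>" using cfl by linarith
 then show ?thesis by (simp add: mult_left_mono)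
qed

lemma Omega_nonneg: "\<Omega> >= 0"
 using cfl nonneg by (smt (verit) mult_nonneg_nonneg of_nat_0_le_iff)

lemma opr_Pf_le:
 assumes F: "!!us. length us <= L + 3 ==> \<bar>F us\<bar> <= c * hp us" and c: "c >= 0"
 and n: "n <= L + 3" and us: "length us <= L + 3"
 shows "\<bar>opr Pf n F us\<bar> <= (Nn * p + 1) ^ (L + 3) * (\<sigma> ^ (2 * n) * c) * hp us"
proof -
 have "\<bar>opr Pf n F us\<bar> <= c * (Nn * (p * \<sigma>\<^sup>2)) ^ n * hp us"
 using nonneg by (intro opr_le F Pf_le c us) auto
 also have "c * (Nn * (p * \<sigma>\<^sup>2)) ^ n = (Nn * p) ^ n * (\<sigma> ^ (2 * n) * c)"
 proof -
 have "(\<sigma>\<^sup>2) ^ n = \<sigma> ^ (2 * n)" by (simp only: power_mult)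
 moreover have "(Nn * (p * \<sigma>\<^sup>2)) ^ n = (Nn * p) ^ n * (\<sigma>\<^sup>2) ^ n"
 by (simp only: power_mult_distrib[symmetric] mult.assoc)
 ultimately show ?thesis by simp
 qed
 also have "... <= (Nn * p + 1) ^ (L + 3) * (\<sigma> ^ (2 * n) * c)"
 proof (rule mult_right_mono)
 have "(Nn * p) ^ n <= (Nn * p + 1) ^ n" using nonneg by (intro power_mono) auto
 also have "... <= (Nn * p + 1) ^ (L + 3)" using nonneg n by (intro power_increasing) auto
 finally show "(Nn * p) ^ n <= (Nn * p + 1) ^ (L + 3)" .
 qed (use nonneg c in auto)
 finally show ?thesis by (simp add: mult_right_mono)
qed

text \<open>The n kicks of the remainder give \<sigma>^(2 n), so the part of degree d still owes
  \<sigma>^d. For d >= 6 this is the weak bound on \<open>R\<close>. For d = 2 the energy of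
  \<open>A\<close> is invariant under \<open>A\<close>, and its first derivative along the kick is
  of order \<sigma>^4 instead of \<sigma>^2. For d = 4 the kick conserves its own energy on the
  diagonal, the linear flow changes that energy only by \<sigma>^4, and the rest comes from
  \<open>R\<close>.\<close>

lemma remainder_le:
 assumes d: "2 <= d" "even d" and n: "d + 2 * n = L + 3" and d': "d <= L + 1"
 shows "\<bar>opr Pf n (Gd d) (replicate (L + 3) \<psi>)\<bar> <= cd d * \<sigma> ^ (L + 3) * hn \<psi> ^ (L + 3)"
proof -
 have nL: "n <= L + 3" and n1: "n >= 1" using n d' by auto
 have K1: "1 <= exp (Nn * \<Omega>)" using Omega_nonneg by simp
 have e0: "2 * B * ec (d - 1) >= 0" using B_nonneg by simp
 have pw: "(Nn * p + 1) ^ (L + 3) >= 0" using nonneg by simp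
 obtain k where "d = 2 * k" using d by (elim evenE)
 moreover from this have "k = 1 \<or> k = 2 \<or> k >= 3" using d by linarith
 ultimately consider "d = 2" | "d = 4" | "d >= 6" by fastforce
 then show ?thesis
 proof cases
 case 1
 have E: "Ed 2 = form Af"
 proof
 fix us :: "'v list"
 show "Ed 2 us = form Af us"
 proof (cases "length us = 2")
 case True
 then obtain x y where "us = [x, y]" by (auto simp: numeral_2_eq_2 length_Suc_conv)
 then show ?thesis by (simp add: Ed_def form_def Z1)
 qed (simp add: Ed_def form_Af_zero)
 qed
 have "Gd 2 us = form Af us" for us
 proof -
 have "opr Af (Suc k) (form Af) = (%us. 0)" for k
 proof -
 have "ins (form Af) Af = (%us. 0)" by (rule ext) (rule ins_form_Af_Af)
 then show ?thesis using funpow_swap1[of "%F. ins F Af" k "form Af"] by simp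
 qed
 then have "(%k. opr Af (Suc k) (form Af) us / fact (Suc k)) sums 0" by (simp del: funpow.simps)
 then have "expo Af (form Af) us - form Af us = 0"
 using sums_split_initial_segment[OF expo_sums[OF adm_form_Af fb_Af', of us], of 1] sums_unique2 by fastforce
 then show ?thesis by (simp add: Gd_def E)
 qed
 then have G: "Gd 2 = form Af" by blast
 obtain m where m: "n = Suc m" using n1 by (cases n) auto
 have "opr Pf n (form Af) = opr Pf m (ins (form Af) Pf)"
 unfolding m using funpow_swap1[of "%F. ins F Pf" m "form Af"] by simp
 then have "\<bar>opr Pf n (Gd d) (replicate (L + 3) \<psi>)\<bar> <= (Nn * p + 1) ^ (L + 3) * (\<sigma> ^ (2 * m) * (\<kappa> * \<sigma>^4)) * hp (replicate (L + 3) \<psi>)"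
 unfolding 1 G using nonneg nL m ins_form_Af_Pf by (simp only:) (rule opr_Pf_le, auto)
 also have "\<sigma> ^ (2 * m) * (\<kappa> * \<sigma>^4) = \<kappa> * \<sigma> ^ (L + 3)"
 proof -
 have "2 * m + 4 = L + 3" using n 1 m by simp
 then have "\<sigma> ^ (2 * m) * \<sigma>^4 = \<sigma> ^ (L + 3)" unfolding power_add[symmetric] by (simp only:)
 then show ?thesis by (simp add: ac_simps)
 qed
 also have "(Nn * p + 1) ^ (L + 3) * (\<kappa> * \<sigma> ^ (L + 3)) * hp (replicate (L + 3) \<psi>)
 = \<kappa> * 1 * (Nn * p + 1) ^ (L + 3) * \<sigma> ^ (L + 3) * hn \<psi> ^ (L + 3)" by (simp add: ac_simps)
 also have "... <= cd d * \<sigma> ^ (L + 3) * hn \<psi> ^ (L + 3)"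
 unfolding cd_def using K1 e0 pw nonneg by (intro mult_right_mono mult_mono) auto
 finally show ?thesis .
 next
 case 2
 define Er where "Er us = (if length us = 4 then form R us else 0)" for us
 have R0: "R [] = 0" by (simp add: R_def)
 have fR: "adm (form R)"
 proof -
 have "form R = (%us. form Z us + (- 1) * (form Af us + form Pf us))" by (rule ext) (simp add: form_Z)
 moreover have "adm (%us. (- 1) * (form Af us + form Pf us))"
 proof -
 have a: "adm (%us. form Af us + form Pf us)" by (rule adm_add[OF adm_form_Af adm_form_Pf])
 then have "ml (%us. (- 1) *\<^sub>R (form Af us + form Pf us))"
 unfolding adm_def ml_def using linear_compose_scale_right by blast
 then show ?thesis using a by (auto simp: adm_def bdd_def abs_minus_commute[of 0] simp del: minus_add_distrib)
 qed
 ultimately show ?thesis using adm_add[OF adm_form_Z] by simp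
 qed
 have aEr: "adm Er" unfolding Er_def[abs_def] by (rule adm_restrict[OF fR])
 have E: "Ed 4 = (%us. form Pf us + Er us)"
 by (rule ext) (auto simp: Ed_def Er_def form_Z form_Af_zero form_Pf_zero)
 define F where "F us = (expo Af (form Pf) us - form Pf us) + expo Af Er us" for us
 have G: "Gd 4 = (%us. form Pf us + F us)"
 unfolding Gd_def E by (rule ext) (simp add: expo_add[OF adm_form_Pf aEr fb_Af'] F_def)
 have "opr Pf (Suc k) (form Pf) (replicate m \<psi>) = 0" for k m \<psi>
 proof (induction k arbitrary: m \<psi>)
 case 0 then show ?case using diag_form[OF xch_Pf] by simp
 next
 case (Suc k)
 then show ?case using diag_zero_ins[OF adm_opr[OF adm_form_Pf fb_Pf' ml_Pf, of "Suc k"]] by simp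
 qed
 then have "opr Pf n (form Pf) (replicate (L + 3) \<psi>) = 0" using n1 by (cases n) auto
 then have eq: "opr Pf n (Gd d) (replicate (L + 3) \<psi>) = opr Pf n F (replicate (L + 3) \<psi>)"
 unfolding 2 G sum_opr_add by simp
 define c where "c = (2 * B * ec 3 + \<kappa>) * \<sigma>^4 * exp (Nn * \<Omega>)"
 have c0: "c >= 0" unfolding c_def using B_nonneg nonneg by (intro mult_nonneg_nonneg add_nonneg_nonneg) auto
 have "\<bar>F us\<bar> <= c * hp us" if us: "length us <= L + 3" for us
 proof -
 have 1: "\<bar>expo Af (form Pf) us - form Pf us\<bar> <= \<kappa> * \<sigma>^4 * exp (Nn * \<alpha>) * hp us"
 by (rule expo_diff_bound[OF adm_form_Pf fb_Af' Af_le ins_form_Pf_Af]) (use nonneg us in auto)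
 have "\<bar>Er us\<bar> <= 2 * B * ec 3 * \<sigma>^4 * hp us" for us
 proof (cases "length us = 4")
 case True
 then show ?thesis using form_R_le[of us] L3 by (simp add: Er_def power2_eq_square power4_eq_xxxx ac_simps)
 next
 case False then show ?thesis using B_nonneg by (simp add: Er_def)
 qed
 then have 2: "\<bar>expo Af Er us\<bar> <= 2 * B * ec 3 * \<sigma>^4 * exp (Nn * \<alpha>) * hp us"
 by (rule expo_bound[OF _ Af_le]) (use nonneg B_nonneg us in auto)
 have "\<bar>F us\<bar> <= (2 * B * ec 3 + \<kappa>) * \<sigma>^4 * exp (Nn * \<alpha>) * hp us"
 unfolding F_def using 1 2 abs_triangle_ineq[of "expo Af (form Pf) us - form Pf us" "expo Af Er us"]
 by (simp add: algebra_simps)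
 also have "... <= c * hp us"
 unfolding c_def using expN_le B_nonneg nonneg
 by (intro mult_right_mono mult_left_mono mult_nonneg_nonneg add_nonneg_nonneg) auto
 finally show ?thesis .
 qed
 then have "\<bar>opr Pf n (Gd d) (replicate (L + 3) \<psi>)\<bar> <= (Nn * p + 1) ^ (L + 3) * (\<sigma> ^ (2 * n) * c) * hp (replicate (L + 3) \<psi>)"
 unfolding eq using c0 nL by (intro opr_Pf_le) auto
 also have "\<sigma> ^ (2 * n) * c = (2 * B * ec 3 + \<kappa>) * exp (Nn * \<Omega>) * \<sigma> ^ (L + 3)"
 proof -
 have "2 * n + 4 = L + 3" using n 2 by simp
 then have "\<sigma> ^ (2 * n) * \<sigma>^4 = \<sigma> ^ (L + 3)" unfolding power_add[symmetric] by (simp only:)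
 then show ?thesis by (simp add: c_def ac_simps)
 qed
 finally show ?thesis by (simp add: cd_def 2 ac_simps)
 next
 case 3
 define c where "c = 2 * B * ec (d - 1) * \<sigma> ^ d * exp (Nn * \<Omega>)"
 have c0: "c >= 0" unfolding c_def using B_nonneg nonneg by (intro mult_nonneg_nonneg) auto
 have sd: "\<sigma> ^ (d - 2) * \<sigma>\<^sup>2 = \<sigma> ^ d"
 unfolding power_add[symmetric] by (rule arg_cong[where f = "%m. \<sigma> ^ m"]) (use d in simp)
 have Edb: "\<bar>Ed d us\<bar> <= 2 * B * ec (d - 1) * \<sigma> ^ d * hp us" for us
 proof (cases "length us = d")
 case True
 then have "Ed d us = form R us" using 3 by (simp add: Ed_def form_Z form_Af_zero form_Pf_zero)
 moreover have "\<bar>form R us\<bar> <= 2 * B * ec (d - 1) * (\<sigma> ^ (d - 2) * \<sigma>\<^sup>2) * hp us"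
 using form_R_le[of us] True d' by (simp add: ac_simps)
 ultimately show ?thesis unfolding sd by simp
 next
 case False
 then show ?thesis using B_nonneg nonneg by (simp add: Ed_def)
 qed
 have "\<bar>Gd d us\<bar> <= c * hp us" if us: "length us <= L + 3" for us
 proof -
 have "\<bar>Gd d us\<bar> <= 2 * B * ec (d - 1) * \<sigma> ^ d * exp (Nn * \<alpha>) * hp us"
 unfolding Gd_def by (rule expo_bound[OF Edb Af_le]) (use nonneg B_nonneg us in auto)
 also have "... <= c * hp us"
 unfolding c_def using expN_le B_nonneg nonneg
 by (intro mult_right_mono mult_left_mono mult_nonneg_nonneg) auto
 finally show ?thesis .
 qed
 then have "\<bar>opr Pf n (Gd d) (replicate (L + 3) \<psi>)\<bar> <= (Nn * p + 1) ^ (L + 3) * (\<sigma> ^ (2 * n) * c) * hp (replicate (L + 3) \<psi>)"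
 using c0 nL by (intro opr_Pf_le) auto
 also have "\<sigma> ^ (2 * n) * c = 2 * B * ec (d - 1) * exp (Nn * \<Omega>) * \<sigma> ^ (L + 3)"
 proof -
 have "2 * n + d = L + 3" using n by simp
 then have "\<sigma> ^ (2 * n) * \<sigma> ^ d = \<sigma> ^ (L + 3)" unfolding power_add[symmetric] by (simp only:)
 then show ?thesis by (simp add: c_def ac_simps)
 qed
 also have "(Nn * p + 1) ^ (L + 3) * (2 * B * ec (d - 1) * exp (Nn * \<Omega>) * \<sigma> ^ (L + 3)) * hp (replicate (L + 3) \<psi>)
 = 2 * B * ec (d - 1) * exp (Nn * \<Omega>) * (Nn * p + 1) ^ (L + 3) * \<sigma> ^ (L + 3) * hn \<psi> ^ (L + 3)"
 by (simp add: ac_simps)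
 also have "... <= cd d * \<sigma> ^ (L + 3) * hn \<psi> ^ (L + 3)"
 unfolding cd_def using pw nonneg by (intro mult_right_mono) auto
 finally show ?thesis .
 qed
qed

lemma cd_nonneg: "cd d >= 0"
 unfolding cd_def using B_nonneg nonneg by (intro mult_nonneg_nonneg add_nonneg_nonneg) auto

text \<open>\<open>flow_A\<close> carries the energy back exactly to the end of the kick; expanding
  along the kick reproduces the polynomial of \<open>Ehat_expansion\<close> at its start, so only
  the remainders differ. Oddness of \<open>L\<close> lets every even d reach L + 3 by a whole number
  of kicks.\<close>

lemma Ehat_drift:
 assumes \<gamma>: "!!t. (\<gamma> has_vector_derivative A (\<gamma> t)) (at t)"
 and \<beta>: "!!t. (\<beta> has_vector_derivative P (\<beta> t) (\<beta> t) (\<beta> t)) (at t)"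
 and joint: "\<gamma> 0 = \<beta> 1" and Rb: "!!t. t \<in> {0..1} ==> hn (\<beta> t) <= Rb" and L: "odd L"
 shows "\<bar>Ehat (\<gamma> 1) - Ehat (\<beta> 0)\<bar> <= (\<Sum>d\<le>L + 1. cd d) * \<sigma> ^ (L + 3) * Rb ^ (L + 3)"
proof -
 define S where "S d = (\<Sum>i\<le>(L + 1 - d) div 2. opr Pf i (Gd d) (replicate (d + 2 * i) (\<beta> 0)) / fact i)" for d
 have Rb0: "Rb >= 0" using Rb[of 0] hn_nonneg[of "\<beta> 0"] by (simp del: hn_nonneg)
 have "\<bar>Ed d (replicate d (\<gamma> 1)) - S d\<bar> <= cd d * \<sigma> ^ (L + 3) * Rb ^ (L + 3)" if d: "d <= L + 1" for d
 proof (cases "d < 2 \<or> odd d")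
 case True
 have z: "Ed d = (%us. 0)" by (rule Ed_trivial[OF True])
 have "Gd d = (%us. 0)" unfolding Gd_def z expo_def by simp
 then have "S d = 0" by (simp add: S_def)
 then show ?thesis using z cd_nonneg[of d] nonneg Rb0 by simp
 next
 case False
 define n where "n = Suc ((L + 1 - d) div 2)"
 have n: "d + 2 * n = L + 3" using False d L by (auto simp: n_def elim!: evenE oddE)
 obtain t where t: "t \<in> {0..1}" "Gd d (replicate d (\<beta> 1)) =
 (\<Sum>i<n. opr Pf i (Gd d) (replicate (d + 2 * i) (\<beta> 0)) / fact i) + opr Pf n (Gd d) (replicate (d + 2 * n) (\<beta> t)) / fact n"
 using flow_P[where n = n and d = d, OF \<beta>] False by auto
 have "(\<Sum>i<n. opr Pf i (Gd d) (replicate (d + 2 * i) (\<beta> 0)) / fact i) = S d"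
 by (simp add: S_def n_def lessThan_Suc_atMost)
 then have "Ed d (replicate d (\<gamma> 1)) - S d = opr Pf n (Gd d) (replicate (L + 3) (\<beta> t)) / fact n"
 using flow_A[OF \<gamma>, of d] False t(2) joint n by simp
 then have "\<bar>Ed d (replicate d (\<gamma> 1)) - S d\<bar> = \<bar>opr Pf n (Gd d) (replicate (L + 3) (\<beta> t))\<bar> / fact n" by simp
 also have "... <= \<bar>opr Pf n (Gd d) (replicate (L + 3) (\<beta> t))\<bar> / 1"
 by (intro divide_left_mono) (auto simp: fact_ge_1)
 also have "... <= cd d * \<sigma> ^ (L + 3) * hn (\<beta> t) ^ (L + 3)"
 using remainder_le[OF _ _ n d, of "\<beta> t"] False by simp
 also have "... <= cd d * \<sigma> ^ (L + 3) * Rb ^ (L + 3)"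
 using cd_nonneg nonneg Rb[OF t(1)] by (intro mult_left_mono power_mono) auto
 finally show ?thesis .
 qed
 moreover have "Ehat (\<gamma> 1) = (\<Sum>d\<le>L + 1. Ed d (replicate d (\<gamma> 1)))"
 by (simp add: Ehat_def Ed_def)
 moreover have "Ehat (\<beta> 0) = (\<Sum>d\<le>L + 1. S d)" unfolding S_def by (rule Ehat_expansion)
 ultimately have "\<bar>Ehat (\<gamma> 1) - Ehat (\<beta> 0)\<bar> <= (\<Sum>d\<le>L + 1. cd d * \<sigma> ^ (L + 3) * Rb ^ (L + 3))"
 by (simp only: sum_subtractf[symmetric]) (rule order_trans[OF sum_abs], rule sum_mono, simp)
 then show ?thesis by (simp only: sum_distrib_right mult.assoc)
qed

end

text \<open>The order of quantifiers is the point: \<open>C\<close>, \<open>\<rho>\<close>,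
  \<open>B\<close> and \<open>b\<close> precede the system, so that one constant serves all mesh
  sizes, time steps and numbers of nodes.\<close>

theorem modified_energy:
 fixes \<Omega> p \<kappa> Rb :: real and M :: nat
 assumes "0 <= \<Omega>" "\<Omega> < 2 * pi" "1 <= Rb"
 obtains C \<rho> B b where "C >= 0"
 "!!hn om A P C0 C1 \<alpha> co \<sigma>. kicked (hn :: 'v::banach => real) om A P C0 C1 \<alpha> p \<kappa> co \<sigma> \<Omega> \<rho> B b (2 * M + 3) ==>
 \<exists>E. (\<forall>\<psi>. hn \<psi> <= Rb --> \<bar>E \<psi> - om (A \<psi>) \<psi> / 2 - om (P \<psi> \<psi> \<psi>) \<psi> / 4\<bar> <= C * \<sigma>^4) \<and>
 (\<forall>\<gamma> \<beta>. (\<forall>t. (\<gamma> has_vector_derivative A (\<gamma> t)) (at t)) -->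
 (\<forall>t. (\<beta> has_vector_derivative P (\<beta> t) (\<beta> t) (\<beta> t)) (at t)) -->
 \<gamma> 0 = \<beta> 1 --> (\<forall>t\<in>{0..1}. hn (\<beta> t) <= Rb) -->
 \<bar>E (\<gamma> 1) - E (\<beta> 0)\<bar> <= C * \<sigma> ^ (2 * M + 6))"
 "\<rho> >= 1" "\<Omega> < \<rho>" "summable (%n. \<bar>b n\<bar> * \<rho> ^ n)" "(\<Sum>n. \<bar>b n\<bar> * \<rho> ^ n) <= B"
 "!!n. (\<Sum>m\<le>n. b m / fact (Suc (n - m))) = (if n = 0 then 1 else (0::real))"
proof -
 obtain b :: "nat => real" where b:
 "!!n. (\<Sum>m\<le>n. b m / fact (Suc (n - m))) = (if n = 0 then 1 else 0)"
 "!!\<rho>. 0 <= \<rho> ==> \<rho> < 2 * pi ==> summable (%n. \<bar>b n\<bar> * \<rho> ^ n)"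
 using bernoulli_coeffs by metis
 \<comment> \<open>The midpoint between \<open>\<Omega>\<close> and the radius of convergence,
   raised to one because powers of \<open>\<rho>\<close> are used as increasing.\<close>
 define \<rho> where "\<rho> = max 1 ((\<Omega> + 2 * pi) / 2)"
 have \<rho>: "1 <= \<rho>" "\<Omega> < \<rho>" "\<rho> < 2 * pi" using assms pi_gt3 by (auto simp: \<rho>_def)
 have s: "summable (%n. \<bar>b n\<bar> * \<rho> ^ n)" using \<rho> by (intro b(2)) auto
 define B where "B = (\<Sum>n. \<bar>b n\<bar> * \<rho> ^ n)"
 define L where "L = 2 * M + 3"
 \<comment> \<open>Outside the locale \<open>ec\<close> and \<open>cd\<close> depend only on
   \<open>p\<close>, \<open>\<kappa>\<close>, \<open>\<Omega>\<close>, \<open>\<rho>\<close>,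
   \<open>B\<close> and \<open>L\<close>, so these constants exist before any system is
   chosen.\<close>
 define c1 where "c1 = (\<Sum>d\<le>L + 1. 2 * B * kicked.ec p \<kappa> \<Omega> \<rho> B L (d - 1)) * Rb ^ (L + 1)"
 define c2 where "c2 = (\<Sum>d\<le>L + 1. kicked.cd p \<kappa> \<Omega> \<rho> B L d) * Rb ^ (L + 3)"
 define C where "C = max 0 (max c1 c2)"
 have "\<exists>E. (\<forall>\<psi>. hn \<psi> <= Rb --> \<bar>E \<psi> - om (A \<psi>) \<psi> / 2 - om (P \<psi> \<psi> \<psi>) \<psi> / 4\<bar> <= C * \<sigma>^4) \<and>
 (\<forall>\<gamma> \<beta>. (\<forall>t. (\<gamma> has_vector_derivative A (\<gamma> t)) (at t)) -->
 (\<forall>t. (\<beta> has_vector_derivative P (\<beta> t) (\<beta> t) (\<beta> t)) (at t)) -->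
 \<gamma> 0 = \<beta> 1 --> (\<forall>t\<in>{0..1}. hn (\<beta> t) <= Rb) -->
 \<bar>E (\<gamma> 1) - E (\<beta> 0)\<bar> <= C * \<sigma> ^ (2 * M + 6))"
 if "kicked (hn :: 'v => real) om A P C0 C1 \<alpha> p \<kappa> co \<sigma> \<Omega> \<rho> B b (2 * M + 3)"
 for hn om A P C0 C1 \<alpha> co \<sigma>
 proof -
 interpret kicked hn om A P C0 C1 \<alpha> p \<kappa> co \<sigma> \<Omega> \<rho> B b L using that by (simp add: L_def)
 have L: "odd L" "L + 3 = 2 * M + 6" by (simp_all add: L_def)
 show ?thesis
 proof (intro exI[of _ Ehat] conjI allI impI)
 fix \<psi> assume "hn \<psi> <= Rb"
 then have "\<bar>Ehat \<psi> - om (A \<psi>) \<psi> / 2 - om (P \<psi> \<psi> \<psi>) \<psi> / 4\<bar> <= c1 * \<sigma>^4"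
 using Ehat_approx assms unfolding c1_def by (simp only: mult.assoc mult.commute[of "\<sigma>^4"])
 also have "... <= C * \<sigma>^4" using nonneg by (intro mult_right_mono) (auto simp: C_def)
 finally show "\<bar>Ehat \<psi> - om (A \<psi>) \<psi> / 2 - om (P \<psi> \<psi> \<psi>) \<psi> / 4\<bar> <= C * \<sigma>^4" .
 next
 fix \<gamma> \<beta>
 assume "\<forall>t. (\<gamma> has_vector_derivative A (\<gamma> t)) (at t)"
 "\<forall>t. (\<beta> has_vector_derivative P (\<beta> t) (\<beta> t) (\<beta> t)) (at t)" "\<gamma> 0 = \<beta> 1" "\<forall>t\<in>{0..1}. hn (\<beta> t) <= Rb"
 then have "\<bar>Ehat (\<gamma> 1) - Ehat (\<beta> 0)\<bar> <= (\<Sum>d\<le>L + 1. cd d) * \<sigma> ^ (L + 3) * Rb ^ (L + 3)"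
 by (intro Ehat_drift L(1)) auto
 then have "\<bar>Ehat (\<gamma> 1) - Ehat (\<beta> 0)\<bar> <= c2 * \<sigma> ^ (L + 3)"
 unfolding c2_def by (simp only: mult.assoc mult.commute[of "Rb ^ (L + 3)"])
 also have "... <= C * \<sigma> ^ (L + 3)" using nonneg by (intro mult_right_mono) (auto simp: C_def)
 finally show "\<bar>Ehat (\<gamma> 1) - Ehat (\<beta> 0)\<bar> <= C * \<sigma> ^ (2 * M + 6)" unfolding L(2) .
 qed
 qed
 then show thesis
 using \<rho> s b(1) by (intro that[of C \<rho> B b]) (auto simp: C_def B_def)
qed

section \<open>Functions on the line with explicit square integrable derivatives\<close>

lemma exp_abs_integrable:
 assumes "c > 0" shows "integrable lborel (%x::real. exp (- c * \<bar>x\<bar>))"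
proof -
 have half: "set_integrable lborel {0..} (%x::real. exp (- c * x))"
 proof -
 have "(\<integral>\<^sup>+x. ennreal (exp (- c * x)) * indicator {0..} x \<partial>lborel) = ennreal (0 - (- exp (- c * 0) / c))"
 proof (rule nn_integral_FTC_atLeast)
 fix x :: real assume "0 <= x"
 show "((%x. - exp (- c * x) / c) has_real_derivative exp (- c * x)) (at x)"
 using assms by (auto intro!: derivative_eq_intros)
 next
 have "filterlim (%x. - c * x) at_bot at_top"
 using assms by (intro filterlim_tendsto_neg_mult_at_bot[OF tendsto_const _ filterlim_ident]) auto
 then have "((%x. exp (- c * x)) \<longlongrightarrow> 0) at_top" by (rule filterlim_compose[OF exp_at_bot])
 then show "((%x. - exp (- c * x) / c) \<longlongrightarrow> 0) at_top"
 using tendsto_mult_left[of _ 0 at_top "- 1 / c"] by simp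
 qed auto
 then have "(\<integral>\<^sup>+x. ennreal (indicator {0..} x * exp (- c * x)) \<partial>lborel) < \<infinity>"
 by (subst nn_integral_cong[where v = "%x. ennreal (exp (- c * x)) * indicator {0..} x"]) (auto split: split_indicator)
 then show ?thesis
 unfolding set_integrable_def by (intro integrableI_nonneg) (auto split: split_indicator)
 qed
 have r: "integrable lborel (%x. indicator {0..} x * exp (- c * x))"
 using half by (simp add: set_integrable_def)
 have l: "integrable lborel (%x. indicator {0..} (- x) * exp (- c * (- x)))"
 using lborel_integrable_real_affine[OF r, of "-1" 0] by simp
 show ?thesis
 by (rule Bochner_Integration.integrable_bound[OF Bochner_Integration.integrable_add[OF r l]])
 (auto split: split_indicator)
qed

lemma integral_FTC_line:
 fixes F G :: "real => real"
 assumes cont: "continuous_on UNIV F" and S: "finite S"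
 and der: "!!x. x \<notin> S ==> (F has_real_derivative G x) (at x)"
 and int: "integrable lborel G" and top: "(F \<longlongrightarrow> b) at_top" and bot: "(F \<longlongrightarrow> a) at_bot"
 shows "integral\<^sup>L lborel G = b - a"
proof -
 have eq: "(LINT x|lborel. indicator {- real n..real n} x * G x) = F (real n) - F (- real n)" for n
 proof -
 have si: "set_integrable lborel {- real n..real n} G"
 unfolding set_integrable_def using int by (intro integrable_mult_indicator) auto
 have "(G has_integral F (real n) - F (- real n)) {- real n..real n}"
 by (rule fundamental_theorem_of_calculus_interior_strong[OF S])
 (use der cont in \<open>auto intro: continuous_on_subset simp flip: has_real_derivative_iff_has_vector_derivative\<close>)
 then have "integral {- real n..real n} G = F (real n) - F (- real n)" by (rule integral_unique)
 then show ?thesis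
 using set_borel_integral_eq_integral(2)[OF si] by (simp add: set_lebesgue_integral_def)
 qed
 have "(%n. LINT x|lborel. indicator {- real n..real n} x * G x) \<longlonglongrightarrow> (LINT x|lborel. G x)"
 proof (rule integral_dominated_convergence[where w = "%x. norm (G x)"])
 show "AE x in lborel. (%n. indicator {- real n..real n} x * G x) \<longlonglongrightarrow> G x"
 proof (rule AE_I2)
 fix x
 have "\<forall>\<^sub>F n in sequentially. indicator {- real n..real n} x * G x = G x"
 using eventually_ge_at_top[of "nat \<lceil>\<bar>x\<bar>\<rceil>"]
 by eventually_elim (auto simp: indicator_def nat_le_iff ceiling_le_iff abs_le_iff)
 then show "(%n. indicator {- real n..real n} x * G x) \<longlonglongrightarrow> G x" by (rule tendsto_eventually)
 qed
 qed (use int in \<open>auto split: split_indicator\<close>)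
 then have 1: "(%n. F (real n) - F (- real n)) \<longlonglongrightarrow> integral\<^sup>L lborel G" by (simp add: eq)
 have "(%n. F (real n) - F (- real n)) \<longlonglongrightarrow> b - a"
 using filterlim_compose[OF top filterlim_real_sequentially]
 filterlim_compose[OF bot filterlim_compose[OF filterlim_uminus_at_bot_at_top filterlim_real_sequentially]]
 by (intro tendsto_diff) auto
 with 1 show ?thesis by (rule LIMSEQ_unique)
qed

text \<open>A function together with its derivative off a finite set. The class contains both the
  smooth ground state and piecewise linear interpolants, and the limits at infinity remove all
  boundary terms in integrations by parts.\<close>

definition W :: "(real => real) => (real => real) => bool" where
 "W u u' \<longleftrightarrow> continuous_on UNIV u \<and> (\<exists>S. finite S \<and> (\<forall>x. x \<notin> S --> (u has_real_derivative u' x) (at x))) \<and>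
 u' \<in> borel_measurable borel \<and> integrable lborel (%x. (u x)\<^sup>2) \<and> integrable lborel (%x. (u' x)\<^sup>2) \<and>
 (u \<longlongrightarrow> 0) at_top \<and> (u \<longlongrightarrow> 0) at_bot"

definition nrm :: "(real => real) => (real => real) => real" where
 "nrm u u' = (LINT x|lborel. (u x)\<^sup>2 + (u' x)\<^sup>2)"

lemma integrable_mult_L2:
 fixes u v :: "real => real"
 assumes "u \<in> borel_measurable borel" "v \<in> borel_measurable borel"
 and "integrable lborel (%x. (u x)\<^sup>2)" "integrable lborel (%x. (v x)\<^sup>2)"
 shows "integrable lborel (%x. u x * v x)"
proof (rule Bochner_Integration.integrable_bound[OF Bochner_Integration.integrable_add[OF assms(3,4)]])
 show "AE x in lborel. norm (u x * v x) <= norm ((u x)\<^sup>2 + (v x)\<^sup>2)"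
 proof (rule AE_I2)
 fix x
 have "2 * \<bar>u x * v x\<bar> <= (u x)\<^sup>2 + (v x)\<^sup>2"
 using sum_squares_bound[of "\<bar>u x\<bar>" "\<bar>v x\<bar>"] by (simp add: abs_mult)
 then show "norm (u x * v x) <= norm ((u x)\<^sup>2 + (v x)\<^sup>2)" by simp
 qed
qed (use assms in auto)

lemma W_measurable: "W u u' ==> u \<in> borel_measurable borel" "W u u' ==> u' \<in> borel_measurable borel"
 by (auto simp: W_def intro: borel_measurable_continuous_onI)

lemma W_int: "W u u' ==> W v v' ==> integrable lborel (%x. u x * v x)"
 "W u u' ==> W v v' ==> integrable lborel (%x. u' x * v' x)"
 "W u u' ==> W v v' ==> integrable lborel (%x. u x * v' x)"
 by (auto simp: W_def intro!: integrable_mult_L2 borel_measurable_continuous_onI)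

lemma W_sq: "W u u' ==> integrable lborel (%x. (u x)\<^sup>2)" "W u u' ==> integrable lborel (%x. (u' x)\<^sup>2)"
 by (auto simp: W_def)

lemma integrable_bounded_mult:
 fixes f g :: "real => real"
 assumes "integrable lborel f" "g \<in> borel_measurable borel" "!!x. \<bar>g x\<bar> <= C"
 shows "integrable lborel (%x. g x * f x)"
proof (rule Bochner_Integration.integrable_bound[OF integrable_mult_right[OF integrable_norm[OF assms(1)], of C]])
 have "\<bar>g x\<bar> * \<bar>f x\<bar> <= \<bar>C * \<bar>f x\<bar>\<bar>" for x
 by (rule order_trans[OF mult_right_mono[OF assms(3)] abs_ge_self]) simp
 then show "AE x in lborel. norm (g x * f x) <= norm (C * norm (f x))" by (simp add: abs_mult)
qed (use assms in auto)

lemma W_add: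
 assumes "W u u'" "W v v'" shows "W (%x. u x + c * v x) (%x. u' x + c * v' x)"
proof -
 note i = W_int[OF assms] W_sq[OF assms(1)] W_sq[OF assms(2)]
 obtain S where S: "finite S" "!!x. x \<notin> S ==> (u has_real_derivative u' x) (at x)" using assms(1) by (auto simp: W_def)
 obtain T where T: "finite T" "!!x. x \<notin> T ==> (v has_real_derivative v' x) (at x)" using assms(2) by (auto simp: W_def)
 have e: "(a + c * b)\<^sup>2 = a\<^sup>2 + (2 * c) * (a * b) + c\<^sup>2 * b\<^sup>2" for a b :: real by (simp add: power2_eq_square algebra_simps)
 have "\<exists>S. finite S \<and> (\<forall>x. x \<notin> S --> ((%x. u x + c * v x) has_real_derivative u' x + c * v' x) (at x))"
 using S T by (intro exI[of _ "S \<union> T"]) (auto intro!: derivative_eq_intros)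
 moreover have "integrable lborel (%x. (u x + c * v x)\<^sup>2)" "integrable lborel (%x. (u' x + c * v' x)\<^sup>2)"
 unfolding e using i by auto
 moreover have "((%x. u x + c * v x) \<longlongrightarrow> 0) at_top" "((%x. u x + c * v x) \<longlongrightarrow> 0) at_bot"
 using assms tendsto_add[OF _ tendsto_mult_left[of v 0 _ c], of u 0] by (auto simp: W_def)
 ultimately show ?thesis
 using assms by (auto simp: W_def intro!: continuous_intros)
qed

lemma nrm_nonneg: "nrm u u' >= 0" unfolding nrm_def by (intro integral_nonneg_AE) auto

lemma nrm_split: "W u u' ==> nrm u u' = (LINT x|lborel. (u x)\<^sup>2) + (LINT x|lborel. (u' x)\<^sup>2)"
 unfolding nrm_def using W_sq by (intro Bochner_Integration.integral_add) auto

lemma int_sq_nonneg: "(LINT x|lborel. (f x)\<^sup>2) >= (0::real)"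
 by (intro integral_nonneg_AE) auto

text \<open>Integrate the derivative of the square from \<open>x\<close> to infinity and use 2 |u
  u'| <= u^2 + u'^2.\<close>

lemma W_sup:
 assumes "W u u'" shows "(u x)\<^sup>2 <= nrm u u'"
proof -
 obtain S where S: "finite S" "!!x. x \<notin> S ==> (u has_real_derivative u' x) (at x)" using assms by (auto simp: W_def)
 have cont: "continuous_on UNIV u" and top: "(u \<longlongrightarrow> 0) at_top" using assms by (auto simp: W_def)
 have int: "integrable lborel (%x. 2 * (u x * u' x))" using W_int(3)[OF assms assms] by simp
 have int2: "integrable lborel (%x. (u x)\<^sup>2 + (u' x)\<^sup>2)" using W_sq[OF assms] by simp
 have le: "(u x)\<^sup>2 <= (u y)\<^sup>2 + nrm u u'" if "x <= y" for y
 proof -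
 have si: "set_integrable lborel {x..y} (%x. 2 * (u x * u' x))"
 unfolding set_integrable_def using int by (intro integrable_mult_indicator) auto
 have "((%x. 2 * (u x * u' x)) has_integral (u y)\<^sup>2 - (u x)\<^sup>2) {x..y}"
 proof (rule fundamental_theorem_of_calculus_interior_strong[OF S(1) that])
 show "continuous_on {x..y} (%x. (u x)\<^sup>2)" by (intro continuous_intros continuous_on_subset[OF cont]) auto
 show "((%x. (u x)\<^sup>2) has_vector_derivative 2 * (u z * u' z)) (at z)" if "z \<in> {x<..<y} - S" for z
 unfolding has_real_derivative_iff_has_vector_derivative[symmetric] using S(2)[of z] that
 by (auto intro!: derivative_eq_intros)
 qed
 then have "(LINT z|lborel. indicator {x..y} z * (2 * (u z * u' z))) = (u y)\<^sup>2 - (u x)\<^sup>2"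
 using set_borel_integral_eq_integral(2)[OF si, unfolded set_lebesgue_integral_def real_scaleR_def] integral_unique by metis
 moreover have "- (LINT z|lborel. indicator {x..y} z * (2 * (u z * u' z))) <= nrm u u'"
 unfolding nrm_def integral_minus[symmetric]
 proof (rule integral_mono)
 show "integrable lborel (%z. - (indicator {x..y} z * (2 * (u z * u' z))))"
 using si by (simp add: set_integrable_def)
 show "- (indicator {x..y} z * (2 * (u z * u' z))) <= (u z)\<^sup>2 + (u' z)\<^sup>2" for z
 using zero_le_power2[of "u z + u' z"] by (auto simp: power2_eq_square algebra_simps split: split_indicator)
 qed (use int2 in auto)
 ultimately show ?thesis by linarith
 qed
 have ev: "\<forall>\<^sub>F y in at_top. (u x)\<^sup>2 <= (u y)\<^sup>2 + nrm u u'"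
 by (rule eventually_mono[OF eventually_ge_at_top[of x]]) (rule le)
 have "((%y. (u y)\<^sup>2 + nrm u u') \<longlongrightarrow> 0\<^sup>2 + nrm u u') at_top"
 by (intro tendsto_intros top)
 from tendsto_lowerbound[OF this ev trivial_limit_at_top_linorder] show ?thesis by simp
qed

text \<open>Completing the square with the Riccati function \<open>p\<close>, which may jump where \<open>w\<close> vanishes.\<close>

lemma riccati_coercive:
 assumes w: "W w w'" and S: "finite S"
 and p: "!!x. x \<notin> S ==> (p has_real_derivative p' x) (at x)"
 and zero: "!!x. x \<in> S ==> \<not> isCont p x ==> w x = 0"
 and pm: "p \<in> borel_measurable borel" "p' \<in> borel_measurable borel" "pot \<in> borel_measurable borel"
 and bd: "!!x. \<bar>p x\<bar> <= C" "!!x. \<bar>p' x\<bar> <= C" "!!x. \<bar>pot x\<bar> <= C"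
 and le: "!!x. x \<notin> S ==> c <= pot x - p' x - (p x)\<^sup>2"
 shows "c * (LINT x|lborel. (w x)\<^sup>2) <= (LINT x|lborel. (w' x)\<^sup>2 + pot x * (w x)\<^sup>2)"
proof -
 have C0: "C >= 0" using bd(1)[of 0] by linarith
 obtain T where T: "finite T" "!!x. x \<notin> T ==> (w has_real_derivative w' x) (at x)" using w by (auto simp: W_def)
 have cont: "continuous_on UNIV w" and top: "(w \<longlongrightarrow> 0) at_top" and bot: "(w \<longlongrightarrow> 0) at_bot" using w by (auto simp: W_def)
 note m = W_measurable[OF w]
 note sq = W_sq[OF w]
 have i1: "integrable lborel (%x. p' x * (w x)\<^sup>2)" and i2: "integrable lborel (%x. p x * (w x * w' x))"
 and i3: "integrable lborel (%x. pot x * (w x)\<^sup>2)"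
 using integrable_bounded_mult[OF sq(1) pm(2) bd(2)] integrable_bounded_mult[OF W_int(3)[OF w w] pm(1) bd(1)]
 integrable_bounded_mult[OF sq(1) pm(3) bd(3)] by auto
 have lim0: "((%x. p x * (w x)\<^sup>2) \<longlongrightarrow> 0) F" if "(w \<longlongrightarrow> 0) F" for F
 proof (rule Lim_null_comparison)
 show "\<forall>\<^sub>F x in F. norm (p x * (w x)\<^sup>2) <= C * (w x)\<^sup>2"
 using bd(1) by (auto simp: abs_mult intro!: always_eventually mult_right_mono)
 show "((%x. C * (w x)\<^sup>2) \<longlongrightarrow> 0) F" using tendsto_mult_left[OF tendsto_power[OF that, of 2], of C] by simp
 qed
 have "(LINT x|lborel. p' x * (w x)\<^sup>2 + 2 * (p x * (w x * w' x))) = 0 - 0"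
 proof (rule integral_FTC_line[where F = "%x. p x * (w x)\<^sup>2" and S = "S \<union> T"])
 have "isCont (%x. p x * (w x)\<^sup>2) x" for x
 proof (cases "isCont p x")
 case True
 then show ?thesis using cont by (auto intro!: continuous_intros simp: continuous_on_eq_continuous_at)
 next
 case False
 then have "x \<in> S" using p DERIV_isCont by blast
 then have wx: "w x = 0" using zero False by blast
 have "isCont w x" using cont by (simp add: continuous_on_eq_continuous_at)
 then have "(w \<longlongrightarrow> 0) (at x)" using wx by (simp add: isCont_def)
 from lim0[OF this] show ?thesis using wx by (simp add: isCont_def)
 qed
 then show "continuous_on UNIV (%x. p x * (w x)\<^sup>2)" by (simp add: continuous_on_eq_continuous_at)
 show "((%x. p x * (w x)\<^sup>2) has_real_derivative p' x * (w x)\<^sup>2 + 2 * (p x * (w x * w' x))) (at x)" if "x \<notin> S \<union> T" for x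
 using p[of x] T(2)[of x] that by (auto intro!: derivative_eq_intros simp: power2_eq_square algebra_simps)
 qed (use S T i1 i2 lim0 top bot in auto)
 then have 0: "(LINT x|lborel. p' x * (w x)\<^sup>2 + 2 * (p x * (w x * w' x))) = 0" by simp
 have "c * (LINT x|lborel. (w x)\<^sup>2) = (LINT x|lborel. c * (w x)\<^sup>2) + (LINT x|lborel. p' x * (w x)\<^sup>2 + 2 * (p x * (w x * w' x)))"
 unfolding 0 by simp
 also have "... = (LINT x|lborel. c * (w x)\<^sup>2 + (p' x * (w x)\<^sup>2 + 2 * (p x * (w x * w' x))))"
 using sq i1 i2 by (intro Bochner_Integration.integral_add[symmetric]) auto
 also have "... <= (LINT x|lborel. (w' x)\<^sup>2 + pot x * (w x)\<^sup>2)"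
 proof (rule integral_mono_AE)
 have "AE x in lborel. x \<notin> S"
 using S by (intro AE_not_in) (simp add: null_setsI emeasure_lborel_countable countable_finite finite_imp_closed borel_closed)
 then show "AE x in lborel. c * (w x)\<^sup>2 + (p' x * (w x)\<^sup>2 + 2 * (p x * (w x * w' x))) <= (w' x)\<^sup>2 + pot x * (w x)\<^sup>2"
 proof eventually_elim
 fix x assume "x \<notin> S"
 then have "c * (w x)\<^sup>2 <= (pot x - p' x - (p x)\<^sup>2) * (w x)\<^sup>2" by (intro mult_right_mono le) auto
 moreover have "0 <= (w' x - p x * w x)\<^sup>2" by simp
 ultimately show "c * (w x)\<^sup>2 + (p' x * (w x)\<^sup>2 + 2 * (p x * (w x * w' x))) <= (w' x)\<^sup>2 + pot x * (w x)\<^sup>2"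
 by (simp add: power2_eq_square algebra_simps)
 qed
 qed (use sq i1 i2 i3 in auto)
 finally show ?thesis .
qed

section \<open>The ground state and its linearised operators\<close>

abbreviation th :: "real => real" where "th x \<equiv> tanh (x / 4)"

abbreviation eta :: "real => real" where "eta \<equiv> ground_state"

definition eta1 :: "real => real" where "eta1 x = - eta x * th x / 4"

text \<open>\<open>Vm\<close> is 1/16 - \<eta>^2 and \<open>Vp\<close> is 1/16 - 3 \<eta>^2: the
  potentials of the second variation of the action in the imaginary and the real direction, with
  1/16 the Lagrange multiplier. In terms of tanh the Riccati inequalities become rational.\<close>

definition Vm :: "real => real" where "Vm x = (2 * (th x)\<^sup>2 - 1) / 16"

definition Vp :: "real => real" where "Vp x = (6 * (th x)\<^sup>2 - 5) / 16"

text \<open>The derivative of the rescaled ground states \<open>\<mu> \<eta>(\<mu> x)\<close> at \<open>\<mu> = 1\<close>.\<close>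

definition gen :: "real => real" where "gen x = eta x + x * eta1 x"

definition gen1 :: "real => real" where "gen1 x = - eta x * th x / 2 + x * eta x * (2 * (th x)\<^sup>2 - 1) / 16"

lemma th_deriv: "((%x. th x) has_real_derivative (1 - (th x)\<^sup>2) / 4) (at x)"
 by (auto intro!: derivative_eq_intros simp: field_simps)

lemma th_bound: "\<bar>th x\<bar> < 1" by (simp add: abs_less_iff tanh_real_gt_neg1 tanh_real_lt_1 minus_less_iff)

lemma th_sq: "(th x)\<^sup>2 < 1" using th_bound[of x] by (simp add: abs_square_less_1)

lemma eta_pos: "eta x > 0" by (simp add: ground_state_def cosh_real_pos)

lemma eta_sq: "(eta x)\<^sup>2 = (1 - (th x)\<^sup>2) / 8"
proof -
 have c: "cosh (x / 4) ~= 0" by simp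
 have "1 - (th x)\<^sup>2 = ((cosh (x / 4))\<^sup>2 - (sinh (x / 4))\<^sup>2) / (cosh (x / 4))\<^sup>2"
 using c by (simp add: tanh_def power_divide diff_divide_distrib)
 then have "(1 / cosh (x / 4))\<^sup>2 = 1 - (th x)\<^sup>2"
 by (simp add: hyperbolic_pythagoras power_divide)
 then show ?thesis by (simp add: ground_state_def power_mult_distrib power_divide)
qed

lemma eta_deriv: "(eta has_real_derivative eta1 x) (at x)"
 unfolding ground_state_def[abs_def] eta1_def
 by (auto intro!: derivative_eq_intros simp: ground_state_def tanh_def power2_eq_square field_simps)

lemma eta1_deriv: "(eta1 has_real_derivative Vm x * eta x) (at x)"
proof -
 have "((%x. - eta x * th x / 4) has_real_derivative
 - (eta1 x) * th x / 4 - eta x * ((1 - (th x)\<^sup>2) / 4) / 4) (at x)"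
 by (rule derivative_eq_intros eta_deriv th_deriv refl | simp add: field_simps)+
 moreover have "- (eta1 x) * th x / 4 - eta x * ((1 - (th x)\<^sup>2) / 4) / 4 = Vm x * eta x"
 by (simp add: eta1_def Vm_def field_simps power2_eq_square)
 ultimately show ?thesis by (simp add: eta1_def[abs_def])
qed

lemma gen_deriv: "(gen has_real_derivative gen1 x) (at x)"
proof -
 have "((%x. eta x + x * eta1 x) has_real_derivative eta1 x + (eta1 x + x * (Vm x * eta x))) (at x)"
 by (rule derivative_eq_intros eta_deriv eta1_deriv refl | simp)+
 moreover have "eta1 x + (eta1 x + x * (Vm x * eta x)) = gen1 x"
 by (simp add: eta1_def Vm_def gen1_def field_simps)
 ultimately show ?thesis by (simp add: gen_def[abs_def])
qed

text \<open>The rescaled state \<mu> \<eta>(\<mu> x) solves the ground state equation with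
  multiplier \<mu>^2 / 16. Differentiating at \<mu> = 1 leaves the derivative 1/8 of the multiplier
  times \<eta>.\<close>

lemma gen1_deriv: "(gen1 has_real_derivative Vp x * gen x + eta x / 8) (at x)"
proof -
 define t where "t = th x"
 define e where "e = eta x"
 have "((%x. - eta x * th x / 2 + x * eta x * (2 * (th x)\<^sup>2 - 1) / 16) has_real_derivative
 - (eta1 x * t + e * ((1 - t\<^sup>2) / 4)) / 2 + ((e + x * eta1 x) * (2 * t\<^sup>2 - 1) + x * e * (4 * t * ((1 - t\<^sup>2) / 4))) / 16) (at x)"
 unfolding t_def e_def
 by (rule derivative_eq_intros eta_deriv th_deriv refl | simp add: field_simps power2_eq_square)+
 moreover have "- (eta1 x * t + e * ((1 - t\<^sup>2) / 4)) / 2 + ((e + x * eta1 x) * (2 * t\<^sup>2 - 1) + x * e * (4 * t * ((1 - t\<^sup>2) / 4))) / 16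
 = Vp x * gen x + eta x / 8"
 unfolding gen_def eta1_def Vp_def t_def[symmetric] e_def[symmetric]
 by (simp add: field_simps power2_eq_square)
 ultimately show ?thesis by (simp add: gen1_def[abs_def])
qed

lemma eta_decay: "eta x <= exp (- (1 / 4) * \<bar>x\<bar>)"
proof -
 have s2: "sqrt 2 >= 1" by simp
 have "exp \<bar>x / 4\<bar> <= 2 * cosh (x / 4)"
 by (cases "x >= 0") (auto simp: cosh_def)
 also have "... <= sqrt 2 * (2 * cosh (x / 4))"
 using mult_right_mono[OF s2, of "2 * cosh (x / 4)"] by simp
 finally have "exp (\<bar>x\<bar> / 4) <= 2 * sqrt 2 * cosh (x / 4)" by (simp add: ac_simps)
 then have "1 / (2 * sqrt 2 * cosh (x / 4)) <= 1 / exp (\<bar>x\<bar> / 4)"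
 by (intro divide_left_mono mult_pos_pos) (auto simp: cosh_real_pos)
 then show ?thesis by (simp add: ground_state_def exp_minus field_simps)
qed

text \<open>Half the decay rate of \<open>eta\<close>; the other half absorbs the factor x that
  occurs in \<open>gen\<close>.\<close>

abbreviation ex :: "real => real" where "ex x \<equiv> exp (- (1 / 8) * \<bar>x\<bar>)"

lemma eta_le: "eta x <= ex x"
 by (rule order_trans[OF eta_decay]) simp

lemma x_eta_le: "\<bar>x * eta x\<bar> <= 8 * ex x"
proof -
 have "\<bar>x * eta x\<bar> = \<bar>x\<bar> * eta x" using eta_pos[of x] by (simp add: abs_mult)
 also have "... <= (8 * exp (\<bar>x\<bar> / 8)) * exp (- (1 / 4) * \<bar>x\<bar>)"
 proof (rule mult_mono[OF _ eta_decay])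
 show "\<bar>x\<bar> <= 8 * exp (\<bar>x\<bar> / 8)" using exp_ge_add_one_self[of "\<bar>x\<bar> / 8"] by linarith
 qed (use eta_pos[of x] in auto)
 also have "... = 8 * ex x" by (simp add: mult.assoc flip: exp_add)
 finally show ?thesis .
qed

lemma W_decay:
 assumes u: "!!x. (u has_real_derivative u' x) (at x)" and m: "continuous_on UNIV u'"
 and b: "!!x. \<bar>u x\<bar> <= C * ex x" "!!x. \<bar>u' x\<bar> <= C * ex x"
 shows "W u u'"
proof -
 have sq: "integrable lborel (%x. (f x)\<^sup>2)"
 if c: "continuous_on UNIV f" and f: "!!x. \<bar>f x\<bar> <= C * ex x" for f :: "real => real"
 proof (rule Bochner_Integration.integrable_bound[OF integrable_mult_right[OF exp_abs_integrable[of "1/4"], of "C\<^sup>2"]])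
 show "AE x in lborel. norm ((f x)\<^sup>2) <= norm (C\<^sup>2 * exp (- (1 / 4) * \<bar>x\<bar>))"
 proof (rule AE_I2)
 fix x
 have "(f x)\<^sup>2 <= (C * ex x)\<^sup>2" using power_mono[OF f[of x], of 2] by simp
 also have "... = C\<^sup>2 * exp (- (1 / 4) * \<bar>x\<bar>)" by (simp add: power_mult_distrib power2_eq_square flip: exp_add)
 finally show "norm ((f x)\<^sup>2) <= norm (C\<^sup>2 * exp (- (1 / 4) * \<bar>x\<bar>))" by simp
 qed
 show "(%x. (f x)\<^sup>2) \<in> borel_measurable lborel"
 using borel_measurable_continuous_onI[OF c] by simp
 qed simp
 have cu: "continuous_on UNIV u" by (rule DERIV_continuous_on[OF has_field_derivative_at_within[OF u]])
 have lim: "(u \<longlongrightarrow> 0) F" if "filterlim (%x::real. \<bar>x\<bar>) at_top F" for F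
 proof (rule Lim_null_comparison)
 show "\<forall>\<^sub>F x in F. norm (u x) <= C * ex x" using b by (intro always_eventually) auto
 have "filterlim (%x::real. - (1 / 8) * \<bar>x\<bar>) at_bot F"
 by (rule filterlim_tendsto_neg_mult_at_bot[OF tendsto_const _ that]) simp
 then have "((%x. ex x) \<longlongrightarrow> 0) F" by (rule filterlim_compose[OF exp_at_bot])
 then show "((%x. C * ex x) \<longlongrightarrow> 0) F" using tendsto_mult_left[of _ 0 F C] by simp
 qed
 have "filterlim (%x::real. \<bar>x\<bar>) at_top at_top"
 by (rule filterlim_at_top_mono[OF filterlim_ident]) (intro always_eventually allI abs_ge_self)
 moreover have "filterlim (%x::real. \<bar>x\<bar>) at_top at_bot"
 by (rule filterlim_at_top_mono[OF filterlim_uminus_at_top_at_bot]) (intro always_eventually allI abs_ge_minus_self)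
 ultimately show ?thesis
 unfolding W_def
 proof (intro conjI cu borel_measurable_continuous_onI[OF m] sq[OF cu b(1)] sq[OF m b(2)] lim)
 show "\<exists>S. finite S \<and> (\<forall>x. x \<notin> S --> (u has_real_derivative u' x) (at x))"
 using u by (intro exI[of _ "{}"]) simp
 qed
qed

lemma cont_th: "continuous_on UNIV (%x. th x)"
 by (intro continuous_intros) auto

lemma cont_eta: "continuous_on UNIV eta"
 by (rule DERIV_continuous_on[OF has_field_derivative_at_within[OF eta_deriv]])

lemma cont_Vm: "continuous_on UNIV Vm" "continuous_on UNIV Vp"
 unfolding Vm_def[abs_def] Vp_def[abs_def] by (intro continuous_intros cont_th; simp)+

lemma cont_gen: "continuous_on UNIV gen" "continuous_on UNIV gen1" "continuous_on UNIV eta1"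
 by (rule DERIV_continuous_on[OF has_field_derivative_at_within[OF gen_deriv]]
 DERIV_continuous_on[OF has_field_derivative_at_within[OF gen1_deriv]]
 DERIV_continuous_on[OF has_field_derivative_at_within[OF eta1_deriv]])+

lemma V_bound: "\<bar>Vm x\<bar> <= 1" "\<bar>Vp x\<bar> <= 1"
proof -
 obtain s where s: "s = (th x)\<^sup>2" "0 <= s" "s < 1" using th_sq[of x] by auto
 show "\<bar>Vm x\<bar> <= 1" "\<bar>Vp x\<bar> <= 1"
 unfolding Vm_def Vp_def s(1)[symmetric] abs_le_iff using s(2,3) by simp_all
qed

lemma abs_mult_le1: "\<bar>a\<bar> <= 1 ==> \<bar>b\<bar> <= c ==> \<bar>a * b\<bar> <= (c::real)"
 using mult_mono[of "\<bar>a\<bar>" 1 "\<bar>b\<bar>" c] by (simp add: abs_mult)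

lemma eta_abs: "\<bar>eta x\<bar> <= ex x" using eta_le[of x] eta_pos[of x] by simp

lemma eta1_le: "\<bar>eta1 x\<bar> <= ex x"
 using abs_mult_le1[of "th x / 4" "eta x" "ex x"] th_bound[of x] eta_abs[of x] by (simp add: eta1_def ac_simps abs_mult)

lemma gen_le: "\<bar>gen x\<bar> <= 10 * ex x"
proof -
 have "x * eta1 x = (- th x / 4) * (x * eta x)" by (simp add: eta1_def)
 then have "\<bar>x * eta1 x\<bar> <= 8 * ex x"
 using abs_mult_le1[of "- th x / 4" "x * eta x", OF _ x_eta_le] th_bound[of x] by simp
 moreover have "ex x >= 0" by simp
 ultimately show ?thesis using eta_abs[of x] unfolding gen_def by linarith
qed

lemma gen1_le: "\<bar>gen1 x\<bar> <= 10 * ex x"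
proof -
 have "\<bar>Vm x * (x * eta x)\<bar> <= 8 * ex x" by (rule abs_mult_le1[OF V_bound(1) x_eta_le])
 moreover have "gen1 x = 2 * eta1 x + Vm x * (x * eta x)" by (simp add: gen1_def eta1_def Vm_def)
 ultimately show ?thesis using eta1_le[of x] by linarith
qed

lemma W_eta: "W eta eta1"
 by (rule W_decay[where C = 1]) (use eta_deriv cont_gen eta_abs eta1_le in auto)

lemma W_eta1: "W eta1 (%x. Vm x * eta x)"
proof (rule W_decay[where C = 1])
 show "continuous_on UNIV (%x. Vm x * eta x)" by (intro continuous_intros cont_Vm cont_eta)
 show "\<bar>Vm x * eta x\<bar> <= 1 * ex x" for x using abs_mult_le1[OF V_bound(1) eta_abs] by simp
qed (use eta1_deriv eta1_le in auto)

lemma W_gen: "W gen gen1"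
 by (rule W_decay[where C = 10]) (use gen_deriv cont_gen gen_le gen1_le in auto)

lemma W_gen1: "W gen1 (%x. Vp x * gen x + eta x / 8)"
proof (rule W_decay[where C = 20])
 show "continuous_on UNIV (%x. Vp x * gen x + eta x / 8)" by (intro continuous_intros cont_Vm cont_eta cont_gen) auto
 show "\<bar>Vp x * gen x + eta x / 8\<bar> <= 20 * ex x" for x
 using abs_mult_le1[OF V_bound(2)[of x] gen_le[of x]] eta_abs[of x] by linarith
 show "\<bar>gen1 x\<bar> <= 20 * ex x" for x using gen1_le[of x] exp_ge_zero[of "- (1 / 8) * \<bar>x\<bar>"] by linarith
qed (use gen1_deriv in auto)

lemma W_parts:
 assumes "W u u'" "W v v'"
 shows "(LINT x|lborel. u' x * v x + u x * v' x) = 0"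
proof -
 obtain S where S: "finite S" "!!x. x \<notin> S ==> (u has_real_derivative u' x) (at x)" using assms(1) by (auto simp: W_def)
 obtain T where T: "finite T" "!!x. x \<notin> T ==> (v has_real_derivative v' x) (at x)" using assms(2) by (auto simp: W_def)
 have l: "((%x. u x * v x) \<longlongrightarrow> 0) at_top" "((%x. u x * v x) \<longlongrightarrow> 0) at_bot"
 using assms tendsto_mult[of u 0 _ v 0] by (auto simp: W_def)
 have "(LINT x|lborel. u' x * v x + u x * v' x) = 0 - 0"
 proof (rule integral_FTC_line[OF _ _ _ _ l, of "S \<union> T"])
 show "continuous_on UNIV (%x. u x * v x)" using assms by (auto simp: W_def intro!: continuous_intros)
 show "((%x. u x * v x) has_real_derivative u' x * v x + u x * v' x) (at x)" if "x \<notin> S \<union> T" for x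
 using S(2)[of x] T(2)[of x] that by (auto intro!: derivative_eq_intros)
 show "integrable lborel (%x. u' x * v x + u x * v' x)"
 using W_int(3)[OF assms] W_int(3)[OF assms(2,1)] by (simp add: mult.commute)
 qed (use S T in auto)
 then show ?thesis by simp
qed

lemma th_lim: "((%x. th x) \<longlongrightarrow> 1) at_top" "((%x. th x) \<longlongrightarrow> -1) at_bot"
proof -
 have 1: "filterlim (%x::real. x / 4) at_top at_top" "filterlim (%x::real. x / 4) at_bot at_bot"
 using filterlim_tendsto_pos_mult_at_top[OF tendsto_const[of "1/4::real"] _ filterlim_ident]
 filterlim_tendsto_pos_mult_at_bot[OF tendsto_const[of "1/4::real"] _ filterlim_ident] by simp_all
 show "((%x. th x) \<longlongrightarrow> 1) at_top" by (rule filterlim_compose[OF tanh_real_at_top 1(1)])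
 show "((%x. th x) \<longlongrightarrow> -1) at_bot" by (rule filterlim_compose[OF tanh_real_at_bot 1(2)])
qed

lemma int_eta_sq: "(LINT x|lborel. (eta x)\<^sup>2) = 1"
proof -
 have "(LINT x|lborel. (eta x)\<^sup>2) = (1 / 2) * 1 - (1 / 2) * (- 1)"
 proof (rule integral_FTC_line[where S = "{}" and F = "%x. (1 / 2) * th x"])
 show "((%x. (1 / 2) * th x) has_real_derivative (eta x)\<^sup>2) (at x)" for x
 using DERIV_cmult[OF th_deriv[of x], of "1 / 2"] by (simp add: eta_sq)
 show "continuous_on UNIV (%x. (1 / 2) * th x)" by (intro continuous_on_mult continuous_on_const cont_th)
 show "((%x. (1 / 2) * th x) \<longlongrightarrow> (1 / 2) * 1) at_top" by (intro tendsto_mult tendsto_const th_lim)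
 show "((%x. (1 / 2) * th x) \<longlongrightarrow> (1 / 2) * (- 1)) at_bot" by (intro tendsto_mult tendsto_const th_lim)
 qed (simp_all add: W_sq[OF W_eta])
 then show ?thesis by simp
qed

text \<open>The rescaled state has mass \<mu>, and the derivative of the mass at \<mu> = 1 is twice
  this integral. Its positivity is the slope condition for stability; the proof integrates the
  derivative of x \<eta>^2.\<close>

lemma int_eta_gen: "(LINT x|lborel. eta x * gen x) = 1 / 2"
proof -
 have "(LINT x|lborel. (eta x)\<^sup>2 + 2 * (x * eta1 x * eta x)) = 0 - 0"
 proof (rule integral_FTC_line[where S = "{}" and F = "%x. x * (eta x)\<^sup>2"])
 show "((%x. x * (eta x)\<^sup>2) has_real_derivative (eta x)\<^sup>2 + 2 * (x * eta1 x * eta x)) (at x)" for x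
 using eta_deriv[of x] by (auto intro!: derivative_eq_intros simp: power2_eq_square)
 have e: "(eta x)\<^sup>2 + 2 * (x * eta1 x * eta x) = 2 * (eta x * gen x) - (eta x)\<^sup>2" for x
 by (simp add: gen_def power2_eq_square algebra_simps)
 show "integrable lborel (%x. (eta x)\<^sup>2 + 2 * (x * eta1 x * eta x))"
 unfolding e using W_int(1)[OF W_eta W_gen] W_sq[OF W_eta] by simp
 have "((%x. x * (eta x)\<^sup>2) \<longlongrightarrow> 0) F" if "(eta \<longlongrightarrow> 0) F" for F
 proof (rule Lim_null_comparison)
 show "\<forall>\<^sub>F x in F. norm (x * (eta x)\<^sup>2) <= 8 * eta x"
 proof (intro always_eventually allI)
 fix x
 have "ex x <= 1" by simp
 then have "\<bar>x * eta x\<bar> <= 8" using x_eta_le[of x] by linarith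
 then have "\<bar>x * eta x\<bar> * eta x <= 8 * eta x" using eta_pos[of x] by (intro mult_right_mono) auto
 then show "norm (x * (eta x)\<^sup>2) <= 8 * eta x"
 using eta_pos[of x] by (simp add: power2_eq_square abs_mult mult.assoc)
 qed
 show "((%x. 8 * eta x) \<longlongrightarrow> 0) F" using tendsto_mult_left[OF that, of 8] by simp
 qed
 then show "((%x. x * (eta x)\<^sup>2) \<longlongrightarrow> 0) at_top" "((%x. x * (eta x)\<^sup>2) \<longlongrightarrow> 0) at_bot"
 using W_eta by (auto simp: W_def)
 show "continuous_on UNIV (%x. x * (eta x)\<^sup>2)" by (intro continuous_intros cont_eta)
 qed simp
 then have 0: "(LINT x|lborel. (eta x)\<^sup>2 + 2 * (x * eta1 x * eta x)) = 0" by simp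
 have "(LINT x|lborel. 2 * (eta x * gen x)) = (LINT x|lborel. ((eta x)\<^sup>2 + 2 * (x * eta1 x * eta x)) + (eta x)\<^sup>2)"
 by (rule Bochner_Integration.integral_cong) (auto simp: gen_def power2_eq_square algebra_simps)
 also have "... = (LINT x|lborel. (eta x)\<^sup>2 + 2 * (x * eta1 x * eta x)) + (LINT x|lborel. (eta x)\<^sup>2)"
 proof (rule Bochner_Integration.integral_add)
 have e: "(eta x)\<^sup>2 + 2 * (x * eta1 x * eta x) = 2 * (eta x * gen x) - (eta x)\<^sup>2" for x
 by (simp add: gen_def power2_eq_square algebra_simps)
 show "integrable lborel (%x. (eta x)\<^sup>2 + 2 * (x * eta1 x * eta x))"
 unfolding e using W_int(1)[OF W_eta W_gen] W_sq[OF W_eta] by simp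
 qed (rule W_sq[OF W_eta])
 finally show ?thesis unfolding 0 int_eta_sq by simp
qed

section \<open>Coercivity through explicit Riccati functions\<close>

text \<open>The logarithmic derivative -th / 4 of \<open>eta\<close> solves the Riccati equation for
  \<open>Vm\<close> exactly and leaves no gain. Adding 1 / (8 (1 + |th|)) with the sign of x creates
  one, at the price of a jump at the origin, where the test function is made to vanish.\<close>

definition ricm :: "real => real" where
 "ricm x = (if x > 0 then (- th x + 1 / (2 * (1 + th x))) / 4 else (- th x - 1 / (2 * (1 - th x))) / 4)"

definition ricm1 :: "real => real" where
 "ricm1 x = (if x > 0 then (- (1 - (th x)\<^sup>2) - (1 - th x) / (2 * (1 + th x))) / 16
 else (- (1 - (th x)\<^sup>2) - (1 + th x) / (2 * (1 - th x))) / 16)"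

lemma th_range: "-1 < th x" "th x < 1" using th_bound[of x] by auto

lemma th_sgn: "x > 0 ==> th x > 0" "x <= 0 ==> th x <= 0"
 by auto

lemma ricm_deriv:
 assumes "x ~= 0" shows "(ricm has_real_derivative ricm1 x) (at x)"
proof (cases "x > 0")
 case True
 have n: "1 + th x ~= 0" using th_range[of x] by linarith
 have "((%x. (- th x + 1 / (2 * (1 + th x))) / 4) has_real_derivative
 (- ((1 - (th x)\<^sup>2) / 4) - 2 * ((1 - (th x)\<^sup>2) / 4) / (2 * (1 + th x))\<^sup>2) / 4) (at x)"
 using n by (auto intro!: derivative_eq_intros th_deriv simp: power2_eq_square field_simps)
 moreover have "(- ((1 - (th x)\<^sup>2) / 4) - 2 * ((1 - (th x)\<^sup>2) / 4) / (2 * (1 + th x))\<^sup>2) / 4 = ricm1 x"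
 using n True by (simp add: ricm1_def divide_simps) (simp add: power2_eq_square algebra_simps)
 ultimately have "((%x. (- th x + 1 / (2 * (1 + th x))) / 4) has_real_derivative ricm1 x) (at x)" by simp
 then show ?thesis
 by (rule has_field_derivative_transform_within_open[where S = "{0<..}"]) (use True in \<open>auto simp: ricm_def\<close>)
next
 case False
 have n: "1 - th x ~= 0" using th_range[of x] by linarith
 have "((%x. (- th x - 1 / (2 * (1 - th x))) / 4) has_real_derivative
 (- ((1 - (th x)\<^sup>2) / 4) - 2 * ((1 - (th x)\<^sup>2) / 4) / (2 * (1 - th x))\<^sup>2) / 4) (at x)"
 using n by (auto intro!: derivative_eq_intros th_deriv simp: power2_eq_square field_simps)
 moreover have "(- ((1 - (th x)\<^sup>2) / 4) - 2 * ((1 - (th x)\<^sup>2) / 4) / (2 * (1 - th x))\<^sup>2) / 4 = ricm1 x"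
 using n False by (simp add: ricm1_def divide_simps) (simp add: power2_eq_square algebra_simps)
 ultimately have "((%x. (- th x - 1 / (2 * (1 - th x))) / 4) has_real_derivative ricm1 x) (at x)" by simp
 then show ?thesis
 by (rule has_field_derivative_transform_within_open[where S = "{..<0}"]) (use False assms in \<open>auto simp: ricm_def\<close>)
qed

lemma ricm_le: "1 / 64 <= Vm x - ricm1 x - (ricm x)\<^sup>2"
proof -
 have key: "(2 * t\<^sup>2 - 1) / 16 - (- (1 - t\<^sup>2) - (1 - t) / (2 * (1 + t))) / 16 - ((- t + 1 / (2 * (1 + t))) / 4)\<^sup>2 >= 1 / 64"
 if "0 <= t" for t :: real
 proof -
 have n: "1 + t > 0" using that by simp
 \<comment> \<open>Multiplied out, the contributions of -th / 4 cancel, and the perturbation leaves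
   a gain that is smallest at t = 0, where it equals 1/64.\<close>
 have "(2 * t\<^sup>2 - 1) / 16 - (- (1 - t\<^sup>2) - (1 - t) / (2 * (1 + t))) / 16 - ((- t + 1 / (2 * (1 + t))) / 4)\<^sup>2
 = (1 / 2 - (1 / (2 * (1 + t)))\<^sup>2) / 16"
 using n by (simp add: divide_simps) (simp add: power2_eq_square algebra_simps)
 moreover have "(1 / (2 * (1 + t)))\<^sup>2 <= (1 / 2)\<^sup>2" using that by (intro power_mono) (auto simp: field_simps)
 moreover have "(1 / 2)\<^sup>2 = (1 / 4 :: real)" by (simp add: power2_eq_square)
 moreover have "(1 / 2 - X) / 16 >= 1 / 64" if "X <= 1 / 4" for X :: real using that by simp
 ultimately show ?thesis by (simp only:)
 qed
 show ?thesis
 proof (cases "x > 0")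
 case True
 then show ?thesis using key[of "th x"] th_sgn[of x] by (simp add: Vm_def ricm_def ricm1_def)
 next
 case False
 have "(- th x - 1 / (2 * (1 - th x))) / 4 = - ((- (- th x) + 1 / (2 * (1 + - th x))) / 4)"
 by (simp add: field_simps)
 then have "((- th x - 1 / (2 * (1 - th x))) / 4)\<^sup>2 = ((- (- th x) + 1 / (2 * (1 + - th x))) / 4)\<^sup>2"
 by (simp only: power2_minus)
 then show ?thesis using False key[of "- th x"] th_sgn(2)[of x] by (simp add: Vm_def ricm_def ricm1_def)
 qed
qed

lemma inv_le1: "1 <= s ==> \<bar>1 / (2 * s)\<bar> <= (1::real)" by (auto simp: field_simps)

lemma ricm_bound: "\<bar>ricm x\<bar> <= 10" "\<bar>ricm1 x\<bar> <= 10"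
proof -
 have k: "\<bar>(- t + 1 / (2 * (1 + t))) / 4\<bar> <= 10 \<and> \<bar>(- (1 - t\<^sup>2) - (1 - t) / (2 * (1 + t))) / 16\<bar> <= 10"
 if t: "0 <= t" "t < 1" for t :: real
 proof
 have 1: "\<bar>1 / (2 * (1 + t))\<bar> <= 1" using t by (intro inv_le1) auto
 have lin: "\<bar>(- t + y) / 4\<bar> <= 10" if "\<bar>y\<bar> <= 1" for y using that t by (auto simp: abs_le_iff)
 show "\<bar>(- t + 1 / (2 * (1 + t))) / 4\<bar> <= 10" by (rule lin[OF 1])
 have lin2: "\<bar>(- (1 - r) - y) / 16\<bar> <= 10" if "0 <= r" "r <= 1" "\<bar>y\<bar> <= 1" for r y :: real
 using that by (auto simp: abs_le_iff)
 have "t\<^sup>2 <= 1" "0 <= t\<^sup>2" using t by (auto simp: power_le_one)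
 moreover have "\<bar>(1 - t) / (2 * (1 + t))\<bar> <= 1" using t by (auto simp: field_simps)
 ultimately show "\<bar>(- (1 - t\<^sup>2) - (1 - t) / (2 * (1 + t))) / 16\<bar> <= 10" by (intro lin2)
 qed
 have "\<bar>ricm x\<bar> <= 10 \<and> \<bar>ricm1 x\<bar> <= 10"
 proof (cases "x > 0")
 case True
 then show ?thesis using k[of "th x"] th_range[of x] th_sgn[of x] by (simp add: ricm_def ricm1_def)
 next
 case False
 have "(- th x - 1 / (2 * (1 - th x))) / 4 = - ((- (- th x) + 1 / (2 * (1 + - th x))) / 4)"
 by (simp add: field_simps)
 then have "\<bar>(- th x - 1 / (2 * (1 - th x))) / 4\<bar> = \<bar>(- (- th x) + 1 / (2 * (1 + - th x))) / 4\<bar>"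
 by (simp only: abs_minus_cancel)
 then show ?thesis using False k[of "- th x"] th_range[of x] th_sgn(2)[of x] by (simp add: ricm_def ricm1_def)
 qed
 then show "\<bar>ricm x\<bar> <= 10" "\<bar>ricm1 x\<bar> <= 10" by auto
qed

lemma meas_th: "(%x. th x) \<in> borel_measurable borel"
 by (rule borel_measurable_continuous_onI[OF cont_th])

lemma meas_V: "Vm \<in> borel_measurable borel" "Vp \<in> borel_measurable borel"
 by (rule borel_measurable_continuous_onI[OF cont_Vm(1)] borel_measurable_continuous_onI[OF cont_Vm(2)])+

lemma coercive_minus0:
 assumes w: "W w w'" and w0: "w 0 = 0"
 shows "(1 / 64) * (LINT x|lborel. (w x)\<^sup>2) <= (LINT x|lborel. (w' x)\<^sup>2 + Vm x * (w x)\<^sup>2)"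
proof (rule riccati_coercive[OF w, where S = "{0}" and p = ricm and p' = ricm1 and C = 10])
 note [measurable] = meas_th
 show "ricm \<in> borel_measurable borel" "ricm1 \<in> borel_measurable borel"
 unfolding ricm_def[abs_def] ricm1_def[abs_def] by measurable
 show "\<bar>Vm x\<bar> <= 10" for x using V_bound(1)[of x] by simp
qed (use w0 ricm_deriv ricm_le ricm_bound meas_V in auto)

text \<open>With s = th, the first summand is the logarithmic derivative of \<eta>', which spans the
  kernel of the operator with potential \<open>Vp\<close>. The second is a small multiple of a
  solution of the linearised Riccati equation with constant right-hand side, so to first order it
  yields a uniform gain.\<close>

definition ricq :: "real => real" where
 "ricq s = ((1 - 2 * s\<^sup>2) / s + (1 / 648) * ((1 + s + s\<^sup>2) / (3 * s\<^sup>2 * (1 + s)))) / 4"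

text \<open>The derivative of \<open>ricq (th x)\<close> with respect to x, written in s = th; hence
  the factor (1 - s^2) / 4 relative to the derivative in s.\<close>

definition ricq1 :: "real => real" where
 "ricq1 s = ((1 - s\<^sup>2) * (- 1 / s\<^sup>2 - 2) - (1 / 648) * ((1 - s) * (s^3 + 2 * s\<^sup>2 + 4 * s + 2) / (3 * s^3 * (1 + s)))) / 16"

lemma ricq_deriv:
 assumes "0 < s" "s < 1" shows "(ricq has_real_derivative 4 * ricq1 s / (1 - s\<^sup>2)) (at s)"
proof -
 have n: "s ~= 0" "1 + s ~= 0" "1 - s\<^sup>2 ~= 0" "1 - s ~= 0" using assms by (auto simp: power2_eq_1_iff)
 define N where "N = 1 + s + s\<^sup>2"
 define Dn where "Dn = 3 * s\<^sup>2 * (1 + s)"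
 have Dn: "Dn ~= 0" using n by (simp add: Dn_def)
 have "(ricq has_real_derivative ((- 4 * s * s - (1 - 2 * s\<^sup>2)) / s\<^sup>2 +
 (1 / 648) * (((1 + 2 * s) * Dn - N * (6 * s * (1 + s) + 3 * s\<^sup>2)) / Dn\<^sup>2)) / 4) (at s)"
 proof -
 have dN: "((%s. 1 + s + s\<^sup>2) has_real_derivative 1 + 2 * s) (at s)"
 by (auto intro!: derivative_eq_intros)
 have dD: "((%s. 3 * s\<^sup>2 * (1 + s)) has_real_derivative 6 * s * (1 + s) + 3 * s\<^sup>2) (at s)"
 by (auto intro!: derivative_eq_intros)
 have dP: "((%s. 1 - 2 * s\<^sup>2) has_real_derivative - 4 * s) (at s)"
 by (auto intro!: derivative_eq_intros)
 have "((%s. (1 + s + s\<^sup>2) / (3 * s\<^sup>2 * (1 + s))) has_real_derivative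
 ((1 + 2 * s) * Dn - N * (6 * s * (1 + s) + 3 * s\<^sup>2)) / Dn\<^sup>2) (at s)"
 using DERIV_quotient[OF dN dD] Dn by (simp add: N_def Dn_def numeral_2_eq_2 mult.commute)
 moreover have "((%s. (1 - 2 * s\<^sup>2) / s) has_real_derivative (- 4 * s * s - (1 - 2 * s\<^sup>2)) / s\<^sup>2) (at s)"
 using DERIV_quotient[OF dP DERIV_ident] n by (simp add: numeral_2_eq_2)
 ultimately show ?thesis
 unfolding ricq_def[abs_def] by (intro DERIV_cdivide DERIV_add DERIV_cmult)
 qed
 moreover have "(- 4 * s * s - (1 - 2 * s\<^sup>2)) / s\<^sup>2 = (- 1 / s\<^sup>2 - 2)"
 using n by (simp add: divide_simps) (simp add: power2_eq_square algebra_simps)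
 moreover have "((1 + 2 * s) * Dn - N * (6 * s * (1 + s) + 3 * s\<^sup>2)) / Dn\<^sup>2 =
 - ((s^3 + 2 * s\<^sup>2 + 4 * s + 2) / (3 * s^3 * (1 + s)\<^sup>2))"
 unfolding N_def Dn_def using n
 by (simp add: divide_simps) (simp add: power2_eq_square power3_eq_cube power4_eq_xxxx algebra_simps)
 moreover have "((- 1 / s\<^sup>2 - 2) + (1 / 648) * (- ((s^3 + 2 * s\<^sup>2 + 4 * s + 2) / (3 * s^3 * (1 + s)\<^sup>2)))) / 4 = 4 * ricq1 s / (1 - s\<^sup>2)"
 proof -
 have f: "1 - s\<^sup>2 = (1 - s) * (1 + s)" by (simp add: power2_eq_square algebra_simps)
 define b where "b = s^3 + 2 * s\<^sup>2 + 4 * s + 2"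
 have "(1 - s) * b / (3 * s^3 * (1 + s)) = (1 - s\<^sup>2) * (b / (3 * s^3 * (1 + s)\<^sup>2))"
 unfolding f using n by (simp add: divide_simps) (simp add: power2_eq_square algebra_simps)
 then have "4 * ricq1 s = (1 - s\<^sup>2) * (((- 1 / s\<^sup>2 - 2) + (1 / 648) * (- (b / (3 * s^3 * (1 + s)\<^sup>2)))) / 4)"
 proof -
 have "4 * ((a * d - (1 / 648) * X) / 16) = a * ((d + (1 / 648) * (- c)) / 4)" if "X = a * c" for a c d X :: real
 unfolding that by (simp add: field_simps)
 then show ?thesis unfolding ricq1_def b_def[symmetric] using \<open>(1 - s) * b / (3 * s^3 * (1 + s)) = (1 - s\<^sup>2) * (b / (3 * s^3 * (1 + s)\<^sup>2))\<close> by blast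
 qed
 then show ?thesis using n by (simp add: b_def)
 qed
 ultimately show ?thesis by (simp only:)
qed

text \<open>\<open>i1\<close> is the exact Riccati equation of \<open>p0\<close> and
  \<open>i2\<close> the linearised one of \<open>q\<close>, so a multiple \<epsilon> of
  \<open>q\<close> gains (\<epsilon> - \<epsilon>^2 q^2) / 16. Since q <= 18 for s >= 1/6, the
  choice \<epsilon> = 1 / (2 * 18^2) = 1/648 keeps half of the linear gain: \<epsilon> / 32 =
  1/20736.\<close>

lemma ricq_props:
 assumes "1 / 6 <= s" "s < 1"
 shows "1 / 20736 <= (6 * s\<^sup>2 - 5) / 16 - ricq1 s - (ricq s)\<^sup>2" "\<bar>ricq s\<bar> <= 10" "\<bar>ricq1 s\<bar> <= 10"
proof -
 have s0: "s > 0" using assms by simp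
 define q where "q = (1 + s + s\<^sup>2) / (3 * s\<^sup>2 * (1 + s))"
 define q1 where "q1 = (1 - s) * (s^3 + 2 * s\<^sup>2 + 4 * s + 2) / (3 * s^3 * (1 + s))"
 define p0 where "p0 = (1 - 2 * s\<^sup>2) / s"
 have s2: "s\<^sup>2 >= 1 / 36" using power_mono[OF assms(1), of 2] by (simp add: power2_eq_square)
 have s3: "s^3 >= 1 / 216" using power_mono[OF assms(1), of 3] by (simp add: power3_eq_cube)
 have le1: "s\<^sup>2 <= 1" "s^3 <= 1" using assms s0 by (auto intro: power_le_one)
 have q0: "q >= 0" unfolding q_def using s0 by auto
 have q: "q <= 18"
 proof -
 have "s\<^sup>2 <= s" using assms s0 by (simp add: power2_eq_square)
 moreover have "1 + s + r <= (3 / 2) * (1 + s)" if "r <= s" for r using that assms by simp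
 ultimately have "1 + s + s\<^sup>2 <= (3 / 2) * (1 + s)" by blast
 then have "q <= ((3 / 2) * (1 + s)) / (3 * s\<^sup>2 * (1 + s))" unfolding q_def using s0 by (intro divide_right_mono) auto
 also have "... = 1 / (2 * s\<^sup>2)"
 proof -
 have "1 + s ~= 0" "s ~= 0" using s0 by auto
 then show ?thesis by (simp add: divide_simps)
 qed
 also have "... <= 1 / (2 * (1 / 36))" using s2 by (intro divide_left_mono mult_left_mono) auto
 finally show ?thesis by simp
 qed
 have q1: "0 <= q1" "q1 <= 648"
 proof -
 show "0 <= q1" unfolding q1_def using s0 assms by (intro divide_nonneg_nonneg mult_nonneg_nonneg) auto
 have "(1 - s) * (s^3 + 2 * s\<^sup>2 + 4 * s + 2) <= 1 * 9" using assms s0 le1 by (intro mult_mono) auto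
 moreover have "3 * s^3 * (1 + s) >= (3 * (1 / 216)) * 1" using s3 s0 by (intro mult_mono) auto
 ultimately have "q1 <= (1 * 9) / ((3 * (1 / 216)) * 1)" unfolding q1_def
 using s0 assms by (intro frac_le) auto
 then show "q1 <= 648" by simp
 qed
 have p: "ricq s = (p0 + (1 / 648) * q) / 4" by (simp add: ricq_def p0_def q_def)
 have p1: "ricq1 s = ((1 - s\<^sup>2) * (- 1 / s\<^sup>2 - 2) - (1 / 648) * q1) / 16" by (simp add: ricq1_def q1_def)
 have i1: "(1 - s\<^sup>2) * (- 1 / s\<^sup>2 - 2) + p0\<^sup>2 = 6 * s\<^sup>2 - 5"
 unfolding p0_def using s0 by (simp add: divide_simps) (simp add: power2_eq_square algebra_simps)
 have i2: "q1 - 2 * p0 * q = 1"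
 unfolding p0_def q_def q1_def using s0
 by (simp add: divide_simps) (simp add: power2_eq_square power3_eq_cube algebra_simps)
 have "(6 * s\<^sup>2 - 5) / 16 - ricq1 s - (ricq s)\<^sup>2 =
 ((6 * s\<^sup>2 - 5) - ((1 - s\<^sup>2) * (- 1 / s\<^sup>2 - 2) + p0\<^sup>2) + (1 / 648) * (q1 - 2 * p0 * q) - (1 / 648)\<^sup>2 * q\<^sup>2) / 16"
 unfolding p p1 by (simp add: power2_eq_square algebra_simps add_divide_distrib diff_divide_distrib)
 also have "... = (1 / 648 - (1 / 648)\<^sup>2 * q\<^sup>2) / 16" unfolding i1 i2 by simp
 finally have e: "(6 * s\<^sup>2 - 5) / 16 - ricq1 s - (ricq s)\<^sup>2 = (1 / 648 - (1 / 648)\<^sup>2 * q\<^sup>2) / 16" .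
 have "q\<^sup>2 <= 18\<^sup>2" using q q0 by (intro power_mono) auto
 then show "1 / 20736 <= (6 * s\<^sup>2 - 5) / 16 - ricq1 s - (ricq s)\<^sup>2"
 unfolding e by (simp add: power2_eq_square)
 have inv: "1 / s <= 6" "0 <= 1 / s" "1 / s\<^sup>2 <= 36" "0 <= 1 / s\<^sup>2" using assms s0 s2 by (auto simp: field_simps)
 have "p0 = 1 / s - 2 * s" unfolding p0_def using s0 by (simp add: field_simps power2_eq_square)
 moreover have "\<bar>(i - 2 * s + (1 / 648) * q) / 4\<bar> <= 10" if "i <= 6" "0 <= i" for i
 proof -
 have "0 <= (1 / 648) * q" "(1 / 648) * q <= 1" using q q0 by simp_all
 then have "\<bar>i - 2 * s + (1 / 648) * q\<bar> <= 40" using that assms by (intro abs_leI) simp_all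
 then show ?thesis by simp
 qed
 ultimately show "\<bar>ricq s\<bar> <= 10" unfolding p using inv by simp
 have "\<bar>- j - 2\<bar> <= 38" if "j <= 36" "0 <= j" for j :: real using that by simp
 from this[OF inv(3,4)] have "\<bar>(1 - s\<^sup>2) * (- 1 / s\<^sup>2 - 2)\<bar> <= 1 * 38"
 unfolding abs_mult using le1 by (intro mult_mono) auto
 then show "\<bar>ricq1 s\<bar> <= 10" unfolding p1 using q1 by auto
qed

text \<open>The logarithmic derivative of \<eta>' has a pole at the origin. Inside |x| < 4/5 a
  linear function replaces it: -p' = 5/8 outweighs the depth 5/16 of the potential plus p^2 <= 1/4.
  The jumps at 4/5 and -4/5 require test functions that vanish there.\<close>

definition ricp :: "real => real" where
 "ricp x = (if \<bar>x\<bar> < 4 / 5 then - (5 / 8) * x else if x > 0 then ricq (th x) else - ricq (- th x))"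

definition ricp1 :: "real => real" where
 "ricp1 x = (if \<bar>x\<bar> < 4 / 5 then - (5 / 8) else if x > 0 then ricq1 (th x) else ricq1 (- th x))"

text \<open>From exp(2/5) >= 7/5 one gets tanh(1/5) >= (1 - 5/7) / (1 + 5/7) = 1/6, the threshold
  used for \<open>ricq\<close>.\<close>

lemma th_far: assumes "4 / 5 <= x" shows "1 / 6 <= th x"
proof -
 have "th x >= tanh (1 / 5)" using assms by simp
 moreover have "tanh (1 / 5 :: real) >= 1 / 6"
 proof -
 have e: "exp (2 * (1 / 5)) >= (1 + 2 * (1 / 5) :: real)" by (rule exp_ge_add_one_self)
 have "tanh (1 / 5 :: real) = (1 - exp (- 2 * (1 / 5))) / (1 + exp (- 2 * (1 / 5)))" by (rule tanh_real_altdef)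
 moreover have "exp (- 2 * (1 / 5) :: real) <= 5 / 7"
 using e by (simp add: exp_minus field_simps)
 moreover have "exp (- 2 * (1 / 5) :: real) > 0" by simp
 moreover have "1 / 6 <= (1 - e) / (1 + e)" if "e <= 5 / 7" "e > 0" for e :: real
 using that by (simp add: pos_le_divide_eq)
 ultimately show ?thesis by metis
 qed
 ultimately show ?thesis by linarith
qed

lemma ricp_deriv:
 assumes "x \<notin> {- (4 / 5), 4 / 5}" shows "(ricp has_real_derivative ricp1 x) (at x)"
proof -
 consider "\<bar>x\<bar> < 4 / 5" | "x > 4 / 5" | "x < - (4 / 5)" using assms by fastforce
 then show ?thesis
 proof cases
 case 1
 have "((%x. - (5 / 8) * x) has_real_derivative ricp1 x) (at x)"
 using 1 by (auto intro!: derivative_eq_intros simp: ricp1_def)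
 then show ?thesis
 by (rule has_field_derivative_transform_within_open[where S = "{- (4 / 5)<..<4 / 5}"]) (use 1 in \<open>auto simp: ricp_def\<close>)
 next
 case 2
 then have "0 < th x" "th x < 1" using th_range by auto
 from DERIV_chain2[OF ricq_deriv[OF this] th_deriv]
 have "((%x. ricq (th x)) has_real_derivative ricp1 x) (at x)"
 using 2 th_sq[of x] by (simp add: ricp1_def)
 then show ?thesis
 by (rule has_field_derivative_transform_within_open[where S = "{4 / 5<..}"]) (use 2 in \<open>auto simp: ricp_def\<close>)
 next
 case 3
 then have a: "0 < - th x" "- th x < 1" using th_range[of x] by auto
 have "((%x. - th x) has_real_derivative - ((1 - (th x)\<^sup>2) / 4)) (at x)" by (intro DERIV_minus th_deriv)
 from DERIV_minus[OF DERIV_chain2[OF ricq_deriv[OF a] this]]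
 have "((%x. - ricq (- th x)) has_real_derivative ricp1 x) (at x)"
 using 3 th_sq[of x] by (simp add: ricp1_def)
 then show ?thesis
 by (rule has_field_derivative_transform_within_open[where S = "{..<- (4 / 5)}"]) (use 3 in \<open>auto simp: ricp_def\<close>)
 qed
qed

lemma ricp_props: "1 / 20736 <= Vp x - ricp1 x - (ricp x)\<^sup>2" "\<bar>ricp x\<bar> <= 10" "\<bar>ricp1 x\<bar> <= 10"
proof -
 have "1 / 20736 <= Vp x - ricp1 x - (ricp x)\<^sup>2 \<and> \<bar>ricp x\<bar> <= 10 \<and> \<bar>ricp1 x\<bar> <= 10"
 proof -
 consider "\<bar>x\<bar> < 4 / 5" | "x >= 4 / 5" | "x <= - (4 / 5)" by linarith
 then show ?thesis
 proof cases
 case 1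
 have "x\<^sup>2 <= (4 / 5)\<^sup>2" using power_mono[of "\<bar>x\<bar>" "4 / 5" 2] 1 by simp
 then have "x\<^sup>2 <= 16 / 25" by (simp add: power2_eq_square)
 moreover have "0 <= (th x)\<^sup>2" by simp
 moreover have "Vp x - ricp1 x - (ricp x)\<^sup>2 = (6 * (th x)\<^sup>2 - 5) / 16 + 5 / 8 - 25 / 64 * x\<^sup>2"
 using 1 by (simp add: Vp_def ricp1_def ricp_def power2_eq_square)
 moreover have "1 / 20736 <= (6 * r - 5) / 16 + 5 / 8 - 25 / 64 * y" if "0 <= r" "y <= 16 / 25" for r y :: real
 proof -
 have "25 / 64 * y <= 1 / 4" "(6 * r - 5) / 16 >= - (5 / 16)" using that by simp_all
 moreover have "1 / 20736 <= a + 5 / 8 - c" if "c <= 1 / 4" "a >= - (5 / 16)" for a c :: real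
 using that by simp
 ultimately show ?thesis by blast
 qed
 ultimately have "1 / 20736 <= Vp x - ricp1 x - (ricp x)\<^sup>2" by (simp only:)
 then show ?thesis using 1 by (auto simp: ricp_def ricp1_def)
 next
 case 2
 then show ?thesis using ricq_props[OF th_far[OF 2] th_range(2)] by (simp add: ricp_def ricp1_def Vp_def)
 next
 case 3
 have f: "1 / 6 <= - th x" using th_far[of "- x"] 3 by (simp add: tanh_minus)
 have "- th x < 1" using th_range(1)[of x] by linarith
 then show ?thesis using ricq_props[OF f] 3 by (simp add: ricp_def ricp1_def Vp_def)
 qed
 qed
 then show "1 / 20736 <= Vp x - ricp1 x - (ricp x)\<^sup>2" "\<bar>ricp x\<bar> <= 10" "\<bar>ricp1 x\<bar> <= 10" by auto
qed

lemma coercive_plus0: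
 assumes w: "W w w'" and w0: "w (4 / 5) = 0" "w (- (4 / 5)) = 0"
 shows "(1 / 20736) * (LINT x|lborel. (w x)\<^sup>2) <= (LINT x|lborel. (w' x)\<^sup>2 + Vp x * (w x)\<^sup>2)"
proof (rule riccati_coercive[OF w, where S = "{- (4 / 5), 4 / 5}" and p = ricp and p' = ricp1 and C = 10])
 note [measurable] = meas_th
 have [measurable]: "ricq \<in> borel_measurable borel" "ricq1 \<in> borel_measurable borel"
 unfolding ricq_def[abs_def] ricq1_def[abs_def] by measurable
 show "ricp \<in> borel_measurable borel" "ricp1 \<in> borel_measurable borel"
 unfolding ricp_def[abs_def] ricp1_def[abs_def] by measurable
 show "\<bar>Vp x\<bar> <= 10" for x using V_bound(2)[of x] by simp
 show "w x = 0" if "x \<in> {- (4 / 5), 4 / 5}" for x using that w0 by blast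
 show "(ricp has_real_derivative ricp1 x) (at x)" if "x \<notin> {- (4 / 5), 4 / 5}" for x
 by (rule ricp_deriv[OF that])
qed (simp_all only: ricp_props meas_V finite.intros)

definition quad :: "(real => real) => (real => real) => (real => real) => real" where
 "quad pot u u' = (LINT x|lborel. (u' x)\<^sup>2 + pot x * (u x)\<^sup>2)"

definition bil :: "(real => real) => (real => real) => (real => real) => (real => real) => (real => real) => real" where
 "bil pot u u' v v' = (LINT x|lborel. u' x * v' x + pot x * (u x * v x))"

lemma V_int:
 assumes "pot \<in> borel_measurable borel" "!!x. \<bar>pot x\<bar> <= 1" "W u u'" "W v v'"
 shows "integrable lborel (%x. pot x * (u x * v x))" "integrable lborel (%x. pot x * (u x)\<^sup>2)"
 using integrable_bounded_mult[OF W_int(1)[OF assms(3,4)] assms(1,2)]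
 integrable_bounded_mult[OF W_sq(1)[OF assms(3)] assms(1,2)] by auto

lemma quad_add:
 assumes pot: "pot \<in> borel_measurable borel" "!!x. \<bar>pot x\<bar> <= 1" and u: "W u u'" and v: "W v v'"
 shows "quad pot (%x. u x + c * v x) (%x. u' x + c * v' x) = quad pot u u' + 2 * c * bil pot u u' v v' + c\<^sup>2 * quad pot v v'"
proof -
 note i = V_int[OF pot u v] V_int(2)[OF pot v v] W_sq[OF u] W_sq[OF v] W_int(2)[OF u v]
 have "quad pot (%x. u x + c * v x) (%x. u' x + c * v' x) =
 (LINT x|lborel. ((u' x)\<^sup>2 + pot x * (u x)\<^sup>2) + (2 * c * (u' x * v' x + pot x * (u x * v x)) + c\<^sup>2 * ((v' x)\<^sup>2 + pot x * (v x)\<^sup>2)))"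
 unfolding quad_def by (rule Bochner_Integration.integral_cong) (auto simp: power2_eq_square algebra_simps)
 also have "... = quad pot u u' + (LINT x|lborel. 2 * c * (u' x * v' x + pot x * (u x * v x)) + c\<^sup>2 * ((v' x)\<^sup>2 + pot x * (v x)\<^sup>2))"
 unfolding quad_def using i by (intro Bochner_Integration.integral_add) auto
 also have "(LINT x|lborel. 2 * c * (u' x * v' x + pot x * (u x * v x)) + c\<^sup>2 * ((v' x)\<^sup>2 + pot x * (v x)\<^sup>2))
 = (LINT x|lborel. 2 * c * (u' x * v' x + pot x * (u x * v x))) + (LINT x|lborel. c\<^sup>2 * ((v' x)\<^sup>2 + pot x * (v x)\<^sup>2))"
 using i by (intro Bochner_Integration.integral_add) auto
 finally show ?thesis by (simp add: quad_def bil_def)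
qed

lemma bil_one: "bil (%x. 1) u u' v v' = (LINT x|lborel. u x * v x + u' x * v' x)"
 by (simp add: bil_def add.commute)

lemma quad_one: "quad (%x. 1) u u' = nrm u u'"
 by (simp add: quad_def nrm_def add.commute)

lemma nrm_add:
 assumes "W u u'" "W v v'"
 shows "nrm (%x. u x + c * v x) (%x. u' x + c * v' x) = nrm u u' + 2 * c * bil (%x. 1) u u' v v' + c\<^sup>2 * nrm v v'"
 using quad_add[of "%x. 1", OF _ _ assms] by (simp add: quad_one)

lemma quad_bounds:
 assumes pot: "pot \<in> borel_measurable borel" "!!x. \<bar>pot x\<bar> <= 1" and u: "W u u'"
 shows "quad pot u u' <= nrm u u'" "(LINT x|lborel. (u' x)\<^sup>2) - (LINT x|lborel. (u x)\<^sup>2) <= quad pot u u'"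
proof -
 note i = V_int(2)[OF pot u u] W_sq[OF u]
 have le: "\<bar>pot x * (u x)\<^sup>2\<bar> <= (u x)\<^sup>2" for x using abs_mult_le1[OF pot(2)[of x]] by simp
 have "pot x * (u x)\<^sup>2 <= (u x)\<^sup>2" "- ((u x)\<^sup>2) <= pot x * (u x)\<^sup>2" for x using le[of x] by (simp_all only: abs_le_iff) auto
 note le2 = this
 show "quad pot u u' <= nrm u u'"
 unfolding quad_def nrm_def using i le2 by (intro integral_mono) (auto simp: add.commute)
 have "(LINT x|lborel. (u' x)\<^sup>2) - (LINT x|lborel. (u x)\<^sup>2) = (LINT x|lborel. (u' x)\<^sup>2 - (u x)\<^sup>2)"
 using i by (intro Bochner_Integration.integral_diff[symmetric]) auto
 also have "... <= quad pot u u'" unfolding quad_def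
 proof (rule integral_mono)
 show "(u' x)\<^sup>2 - (u x)\<^sup>2 <= (u' x)\<^sup>2 + pot x * (u x)\<^sup>2" for x using le2(2)[of x] by simp
 qed (use i in auto)
 finally show "(LINT x|lborel. (u' x)\<^sup>2) - (LINT x|lborel. (u x)\<^sup>2) <= quad pot u u'" .
qed

text \<open>The potential is at most one in modulus, so the integral of u'^2 exceeds that of u^2 by
  no more than the quadratic form. Combined with control of u^2 this bounds the full norm at the
  cost of a factor 3.\<close>

lemma upgrade_coercive:
 assumes pot: "pot \<in> borel_measurable borel" "!!x. \<bar>pot x\<bar> <= 1" and u: "W u u'" and c: "0 < c" "c <= 1"
 and le: "c * (LINT x|lborel. (u x)\<^sup>2) <= quad pot u u' + r" and r: "0 <= r"
 shows "c / 3 * nrm u u' <= quad pot u u' + r"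
proof -
 define a where "a = (LINT x|lborel. (u x)\<^sup>2)"
 define a' where "a' = (LINT x|lborel. (u' x)\<^sup>2)"
 define q where "q = quad pot u u' + r"
 have a: "a >= 0" unfolding a_def by (rule int_sq_nonneg)
 have 1: "c * a <= q" using le by (simp add: a_def q_def)
 have 2: "a' - a <= q" using quad_bounds(2)[OF pot u] r by (simp add: a_def a'_def q_def)
 have "q >= 0" using 1 a c by (meson mult_nonneg_nonneg order_trans less_imp_le)
 then have "c * q <= q" using c by (simp add: mult_left_le_one_le)
 moreover have "c * a' <= c * q + c * a" using mult_left_mono[OF 2, of c] c by (simp add: algebra_simps)
 ultimately have "c * (a + a') <= 3 * q" using 1 by (simp add: distrib_left)
 then show ?thesis using nrm_split[OF u] by (simp add: a_def a'_def q_def)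
qed

lemma bil_eta: "W u u' ==> bil Vm eta eta1 u u' = 0"
 using W_parts[OF W_eta1, of u u'] unfolding bil_def by (simp add: ac_simps)

lemma bil_gen: "W u u' ==> bil Vp gen gen1 u u' = - (LINT x|lborel. eta x * u x) / 8"
proof -
 assume u: "W u u'"
 have "0 = (LINT x|lborel. (Vp x * gen x + eta x / 8) * u x + gen1 x * u' x)" using W_parts[OF W_gen1 u] by simp
 also have "... = (LINT x|lborel. (gen1 x * u' x + Vp x * (gen x * u x)) + (eta x * u x) / 8)"
 by (rule Bochner_Integration.integral_cong) (auto simp: algebra_simps)
 also have "... = bil Vp gen gen1 u u' + (LINT x|lborel. (eta x * u x) / 8)"
 unfolding bil_def
 using V_int(1)[OF meas_V(2) V_bound(2) W_gen u] W_int(2)[OF W_gen u] W_int(1)[OF W_eta u]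
 by (intro Bochner_Integration.integral_add) auto
 finally show ?thesis by simp
qed

lemma bil_commute: "bil pot u u' v v' = bil pot v v' u u'"
 by (simp add: bil_def mult.commute)

text \<open>A multiple of \<open>eta\<close> is subtracted to produce a zero at the origin. It lies
  in the kernel, so the form does not change, and by orthogonality in H1 the norm can only
  grow.\<close>

lemma coercive_minus:
 assumes v: "W v v'" and orth: "bil (%x. 1) v v' eta eta1 = 0"
 shows "1 / 192 * nrm v v' <= quad Vm v v'"
proof -
 define a where "a = v 0 / eta 0"
 define w where "w x = v x + (- a) * eta x" for x
 define w' where "w' x = v' x + (- a) * eta1 x" for x
 have W: "W w w'" unfolding w_def[abs_def] w'_def[abs_def] by (rule W_add[OF v W_eta])
 have w0: "w 0 = 0" using eta_pos[of 0] by (simp add: w_def a_def)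
 have q: "quad Vm w w' = quad Vm v v'"
 unfolding w_def[abs_def] w'_def[abs_def] quad_add[OF meas_V(1) V_bound(1) v W_eta]
 using bil_eta[OF v] bil_eta[OF W_eta] by (simp add: bil_commute[of Vm v v' eta eta1]) (simp add: quad_def bil_def power2_eq_square)
 have "1 / 64 * (LINT x|lborel. (w x)\<^sup>2) <= quad Vm w w' + 0"
 using coercive_minus0[OF W w0] by (simp add: quad_def)
 from upgrade_coercive[OF meas_V(1) V_bound(1) W _ _ this]
 have "1 / 192 * nrm w w' <= quad Vm v v'" by (simp add: q)
 moreover have "nrm w w' = nrm v v' + a\<^sup>2 * nrm eta eta1"
 unfolding w_def[abs_def] w'_def[abs_def] nrm_add[OF v W_eta] orth by simp
 moreover have "a\<^sup>2 * nrm eta eta1 >= 0" using nrm_nonneg by simp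
 ultimately show ?thesis by linarith
qed

lemma gen_far_pos: "gen (4 / 5) > 0"
proof -
 have "gen (4 / 5) = eta (4 / 5) * (1 - th (4 / 5) / 5)" by (simp add: gen_def eta1_def algebra_simps)
 moreover have "1 - th (4 / 5) / 5 > 0" using th_range(2)[of "4 / 5"] by simp
 ultimately show ?thesis using eta_pos[of "4 / 5"] by simp
qed

lemma gen_even: "gen (- x) = gen x"
 by (simp add: gen_def eta1_def ground_state_def tanh_minus)

text \<open>Evenness lets one multiple of \<open>gen\<close> produce zeros at both 4/5 and -4/5; no
  translation mode has to be removed. The form is -1/16 on \<open>gen\<close>, so removing a
  multiple \<open>a\<close> gains a^2 / 16, while the cross term involves only the product with
  \<open>eta\<close>, which is added on the right.\<close>

lemma coercive_plus:
 obtains c :: real where "c > 0" "!!u u'. W u u' ==> (!!x. u (- x) = u x) ==>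
 c * nrm u u' <= quad Vp u u' + (LINT x|lborel. eta x * u x)\<^sup>2 / 2"
proof -
 define Fg where "Fg = (LINT x|lborel. (gen x)\<^sup>2)"
 have Fg: "Fg >= 0" unfolding Fg_def by (rule int_sq_nonneg)
 define k where "k = (1 / 20736 :: real)"
 \<comment> \<open>The bound k / 2 matches 2 A, and 1 / (64 (Fg + 1)) matches 2 a^2 Fg against the
   available a^2 / 32.\<close>
 define c where "c = min (k / 2) (1 / (64 * (Fg + 1)))"
 have c: "c > 0" "c <= 1" "c <= k / 2" "c * (64 * (Fg + 1)) <= 1"
 proof -
 show "c > 0" "c <= 1" "c <= k / 2" using Fg by (auto simp: c_def k_def min_def)
 have "c <= 1 / (64 * (Fg + 1))" by (simp add: c_def)
 then show "c * (64 * (Fg + 1)) <= 1" using Fg by (simp add: pos_le_divide_eq)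
 qed
 have "c / 3 * nrm u u' <= quad Vp u u' + (LINT x|lborel. eta x * u x)\<^sup>2 / 2"
 if u: "W u u'" and even: "!!x. u (- x) = u x" for u u'
 proof -
 define m where "m = (LINT x|lborel. eta x * u x)"
 define a where "a = u (4 / 5) / gen (4 / 5)"
 define w where "w x = u x + (- a) * gen x" for x
 define w' where "w' x = u' x + (- a) * gen1 x" for x
 have Ww: "W w w'" unfolding w_def[abs_def] w'_def[abs_def] by (rule W_add[OF u W_gen])
 have w0: "w (4 / 5) = 0" "w (- (4 / 5)) = 0"
 using gen_far_pos even[of "4 / 5"] gen_even[of "4 / 5"] by (simp_all add: w_def a_def)
 define A where "A = (LINT x|lborel. (w x)\<^sup>2)"
 have A0: "A >= 0" unfolding A_def by (rule int_sq_nonneg)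
 have kA: "k * A <= quad Vp w w'" using coercive_plus0[OF Ww w0] by (simp add: quad_def k_def A_def)
 have qg: "quad Vp gen gen1 = - (1 / 16)"
 using bil_gen[OF W_gen] int_eta_gen by (simp add: quad_def bil_def power2_eq_square)
 have qw: "quad Vp w w' = quad Vp u u' + a * m / 4 - a\<^sup>2 / 16"
 unfolding w_def[abs_def] w'_def[abs_def] quad_add[OF meas_V(2) V_bound(2) u W_gen] bil_commute[of Vp u] bil_gen[OF u] qg
 by (simp add: m_def)
 \<comment> \<open>Half of the gain a^2 / 16 pays for the cross term; the other half stays.\<close>
 have am: "- (a * m / 4) >= - (a\<^sup>2 / 32) - m\<^sup>2 / 2"
 proof -
 have "0 <= (a / 4 - m)\<^sup>2" by simp
 then have "a * m / 2 <= a\<^sup>2 / 16 + m\<^sup>2" by (simp add: power2_eq_square algebra_simps)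
 then show ?thesis by simp
 qed
 have low: "a\<^sup>2 / 32 + k * A <= quad Vp u u' + m\<^sup>2 / 2" using qw kA am by linarith
 have "(LINT x|lborel. (u x)\<^sup>2) <= 2 * A + 2 * a\<^sup>2 * Fg"
 proof -
 have "(LINT x|lborel. (u x)\<^sup>2) <= (LINT x|lborel. 2 * (w x)\<^sup>2 + 2 * a\<^sup>2 * (gen x)\<^sup>2)"
 proof (rule integral_mono)
 show "(u x)\<^sup>2 <= 2 * (w x)\<^sup>2 + 2 * a\<^sup>2 * (gen x)\<^sup>2" for x
 using zero_le_power2[of "w x - a * gen x"] by (simp add: w_def power2_eq_square algebra_simps)
 qed (use W_sq[OF u] W_sq[OF Ww] W_sq[OF W_gen] in auto)
 also have "... = (LINT x|lborel. 2 * (w x)\<^sup>2) + (LINT x|lborel. 2 * a\<^sup>2 * (gen x)\<^sup>2)"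
 using W_sq[OF Ww] W_sq[OF W_gen] by (intro Bochner_Integration.integral_add) auto
 finally show ?thesis by (simp add: A_def Fg_def)
 qed
 then have "c * (LINT x|lborel. (u x)\<^sup>2) <= c * (2 * A + 2 * a\<^sup>2 * Fg)" using c by (intro mult_left_mono) auto
 also have "... <= k * A + a\<^sup>2 / 32"
 proof -
 have "(2 * c) * A <= k * A" using c A0 by (intro mult_right_mono) auto
 moreover have "c * 64 * Fg <= 1" using c(1,4) Fg by (simp add: algebra_simps)
 then have "a\<^sup>2 * (c * 64 * Fg) <= a\<^sup>2 * 1" by (intro mult_left_mono) auto
 ultimately show ?thesis by (simp add: algebra_simps)
 qed
 also have "... <= quad Vp u u' + m\<^sup>2 / 2" using low by simp
 finally show ?thesis unfolding m_def
 by (intro upgrade_coercive[OF meas_V(2) V_bound(2) u c(1,2)]) auto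
 qed
 then show thesis using c(1) by (intro that[of "c / 3"]) auto
qed

section \<open>Expansion of the action around the ground state\<close>

text \<open>The Hamiltonian plus 1/16 of the mass, for the complex function with real part
  \<open>a\<close> and imaginary part \<open>b\<close>; the multiplier 1/16 makes the ground state a
  critical point.\<close>

definition action :: "(real => real) => (real => real) => (real => real) => (real => real) => real" where
 "action a a' b b' = (LINT x|lborel. ((a' x)\<^sup>2 + (b' x)\<^sup>2) - ((a x)\<^sup>2 + (b x)\<^sup>2)\<^sup>2 / 2 + ((a x)\<^sup>2 + (b x)\<^sup>2) / 16)"

text \<open>By \<open>W_sup\<close> the squared norm D of the perturbation bounds u^2 + v^2
  pointwise. The cubic term is therefore at most sqrt D, and the quartic term at most D, times the
  integral of u^2 + v^2.\<close>

lemma quartic_int: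
 assumes u: "W u u'" and v: "W v v'"
 shows "integrable lborel (%x. ((u x)\<^sup>2 + (v x)\<^sup>2)\<^sup>2)" "integrable lborel (%x. eta x * u x * ((u x)\<^sup>2 + (v x)\<^sup>2))"
 "\<bar>LINT x|lborel. 2 * (eta x * u x * ((u x)\<^sup>2 + (v x)\<^sup>2)) + ((u x)\<^sup>2 + (v x)\<^sup>2)\<^sup>2 / 2\<bar>
 <= 2 * sqrt (nrm u u' + nrm v v') * (nrm u u' + nrm v v') + (nrm u u' + nrm v v')\<^sup>2"
proof -
 define D where "D = nrm u u' + nrm v v'"
 define \<rho> where "\<rho> x = (u x)\<^sup>2 + (v x)\<^sup>2" for x
 have D0: "D >= 0" using nrm_nonneg by (simp add: D_def)
 have r0: "\<rho> x >= 0" for x by (simp add: \<rho>_def)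
 have rD: "\<rho> x <= D" for x using W_sup[OF u, of x] W_sup[OF v, of x] by (simp add: \<rho>_def D_def)
 have ir: "integrable lborel \<rho>" unfolding \<rho>_def[abs_def] using W_sq[OF u] W_sq[OF v] by auto
 have m [measurable]: "u \<in> borel_measurable borel" "v \<in> borel_measurable borel" using W_measurable u v by auto
 have me [measurable]: "eta \<in> borel_measurable borel" using W_measurable W_eta by blast
 have mr [measurable]: "\<rho> \<in> borel_measurable borel" unfolding \<rho>_def[abs_def] by measurable
 have "\<bar>\<rho> x\<bar> <= D" for x using rD r0 by simp
 from integrable_bounded_mult[OF ir mr this] have i1: "integrable lborel (%x. (\<rho> x)\<^sup>2)" by (simp add: power2_eq_square)
 have eu: "\<bar>eta x * u x\<bar> <= sqrt D" for x
 proof -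
 have "ex x <= 1" by simp
 then have e1: "\<bar>eta x\<bar> <= 1" using eta_abs[of x] by linarith
 have "(u x)\<^sup>2 <= D" using rD[of x] by (simp add: \<rho>_def) (meson add_increasing2 order_trans zero_le_power2 le_add_same_cancel1)
 then have "\<bar>u x\<bar> <= sqrt D" by (simp add: real_le_rsqrt)
 then show ?thesis by (rule abs_mult_le1[OF e1])
 qed
 have i2: "integrable lborel (%x. eta x * u x * \<rho> x)"
 by (rule integrable_bounded_mult[OF ir _ eu]) measurable
 show "integrable lborel (%x. ((u x)\<^sup>2 + (v x)\<^sup>2)\<^sup>2)" "integrable lborel (%x. eta x * u x * ((u x)\<^sup>2 + (v x)\<^sup>2))"
 using i1 i2 by (auto simp: \<rho>_def)
 have irD: "(LINT x|lborel. \<rho> x) <= D"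
 unfolding D_def nrm_def \<rho>_def
 using W_sq[OF u] W_sq[OF v] int_sq_nonneg[of u'] int_sq_nonneg[of v'] by simp
 have "\<bar>LINT x|lborel. 2 * (eta x * u x * \<rho> x) + (\<rho> x)\<^sup>2 / 2\<bar> <= (LINT x|lborel. (2 * sqrt D + D) * \<rho> x)"
 proof (rule integral_abs_bound[THEN order_trans], rule integral_mono)
 fix x
 have *: "\<bar>2 * a + r / 2\<bar> <= 2 * s + t" if "\<bar>a\<bar> <= s" "r <= t" "0 <= r" for a r s t :: real
 using that by linarith
 have "\<bar>eta x * u x * \<rho> x\<bar> <= sqrt D * \<rho> x" using eu[of x] r0[of x] by (simp add: abs_mult mult_right_mono)
 moreover have "(\<rho> x)\<^sup>2 <= D * \<rho> x" using rD[of x] r0[of x] by (simp add: power2_eq_square mult_right_mono)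
 moreover have "0 <= (\<rho> x)\<^sup>2" by simp
 ultimately show "\<bar>2 * (eta x * u x * \<rho> x) + (\<rho> x)\<^sup>2 / 2\<bar> <= (2 * sqrt D + D) * \<rho> x"
 using * by (simp add: distrib_right mult.assoc)
 qed (use i1 i2 ir in auto)
 also have "... <= (2 * sqrt D + D) * D" using irD D0 by (simp add: mult_left_mono)
 finally show "\<bar>LINT x|lborel. 2 * (eta x * u x * ((u x)\<^sup>2 + (v x)\<^sup>2)) + ((u x)\<^sup>2 + (v x)\<^sup>2)\<^sup>2 / 2\<bar>
 <= 2 * sqrt (nrm u u' + nrm v v') * (nrm u u' + nrm v v') + (nrm u u' + nrm v v')\<^sup>2"
 unfolding \<rho>_def D_def by (simp add: distrib_right power2_eq_square)
qed

text \<open>The first variation \<open>Bx\<close> integrates to zero because \<open>eta\<close> is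
  in the kernel of the operator with potential \<open>Vm\<close>. The second variation separates
  into real and imaginary parts since \<open>eta\<close> is real.\<close>

lemma action_expansion:
 assumes u: "W u u'" and v: "W v v'"
 shows "action (%x. eta x + u x) (%x. eta1 x + u' x) v v' = action eta eta1 (%x. 0) (%x. 0) + quad Vp u u' + quad Vm v v'
 - (LINT x|lborel. 2 * (eta x * u x * ((u x)\<^sup>2 + (v x)\<^sup>2)) + ((u x)\<^sup>2 + (v x)\<^sup>2)\<^sup>2 / 2)"
proof -
 note Vi = V_int(2)[OF meas_V(2) V_bound(2) u u] V_int(2)[OF meas_V(1) V_bound(1) v v] V_int(1)[OF meas_V(1) V_bound(1) W_eta u]
 note q = quartic_int(1,2)[OF u v]
 define E where "E x = (eta1 x)\<^sup>2 - (eta x)^4 / 2 + (eta x)\<^sup>2 / 16" for x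
 have W0: "W (%x. 0) (%x. 0)" by (auto simp: W_def intro!: exI[of _ "{}"] derivative_eq_intros)
 have iE: "integrable lborel E"
 using quartic_int(1)[OF W_eta W0] W_sq[OF W_eta] unfolding E_def[abs_def] by (simp add: power2_eq_square power4_eq_xxxx mult.assoc)
 define N where "N x = 2 * (eta x * u x * ((u x)\<^sup>2 + (v x)\<^sup>2)) + ((u x)\<^sup>2 + (v x)\<^sup>2)\<^sup>2 / 2" for x
 have iN: "integrable lborel N" unfolding N_def[abs_def] using q by auto
 define Bx where "Bx x = eta1 x * u' x + Vm x * (eta x * u x)" for x
 have iB: "integrable lborel Bx" unfolding Bx_def[abs_def] using Vi W_int(2)[OF W_eta u] by auto
 have Bz: "(LINT x|lborel. Bx x) = 0" using bil_eta[OF u] by (simp add: bil_def Bx_def)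
 have iP: "integrable lborel (%x. (u' x)\<^sup>2 + Vp x * (u x)\<^sup>2)" "integrable lborel (%x. (v' x)\<^sup>2 + Vm x * (v x)\<^sup>2)"
 using Vi W_sq[OF u] W_sq[OF v] by auto
 have pt: "((eta1 x + u' x)\<^sup>2 + (v' x)\<^sup>2) - ((eta x + u x)\<^sup>2 + (v x)\<^sup>2)\<^sup>2 / 2 + ((eta x + u x)\<^sup>2 + (v x)\<^sup>2) / 16
 = E x + (2 * Bx x + (((u' x)\<^sup>2 + Vp x * (u x)\<^sup>2) + (((v' x)\<^sup>2 + Vm x * (v x)\<^sup>2) - N x)))" for x
 proof -
 have vm: "Vm x = 1 / 16 - (eta x)\<^sup>2" and vp: "Vp x = 1 / 16 - 3 * (eta x)\<^sup>2"
 by (simp_all add: eta_sq Vm_def Vp_def field_simps)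
 show ?thesis unfolding E_def Bx_def N_def vm vp
 by (simp add: power2_eq_square power4_eq_xxxx field_simps)
 qed
 have "action (%x. eta x + u x) (%x. eta1 x + u' x) v v' =
 (LINT x|lborel. E x + (2 * Bx x + (((u' x)\<^sup>2 + Vp x * (u x)\<^sup>2) + (((v' x)\<^sup>2 + Vm x * (v x)\<^sup>2) - N x))))"
 unfolding action_def pt ..
 also have "... = (LINT x|lborel. E x) + (2 * (LINT x|lborel. Bx x) + (quad Vp u u' + (quad Vm v v' - (LINT x|lborel. N x))))"
 unfolding quad_def using iE iB iN iP
 by (subst Bochner_Integration.integral_add, simp, simp, subst Bochner_Integration.integral_add, simp, simp,
 subst Bochner_Integration.integral_add, simp, simp, subst Bochner_Integration.integral_diff) simp_all
 also have "(LINT x|lborel. E x) = action eta eta1 (%x. 0) (%x. 0)"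
 unfolding action_def E_def by (simp add: power2_eq_square power4_eq_xxxx mult.assoc)
 finally show ?thesis unfolding Bz N_def by simp
qed

theorem action_stability:
 obtains c :: real where "c > 0"
 "!!u u' v v'. W u u' ==> W v v' ==> (!!x. u (- x) = u x) ==> bil (%x. 1) v v' eta eta1 = 0 ==>
 c * (nrm u u' + nrm v v') <= action (%x. eta x + u x) (%x. eta1 x + u' x) v v' - action eta eta1 (%x. 0) (%x. 0)
 + (LINT x|lborel. eta x * u x)\<^sup>2 / 2 + 2 * sqrt (nrm u u' + nrm v v') * (nrm u u' + nrm v v') + (nrm u u' + nrm v v')\<^sup>2"
 "!!u u' v v'. W u u' ==> W v v' ==>
 action (%x. eta x + u x) (%x. eta1 x + u' x) v v' - action eta eta1 (%x. 0) (%x. 0)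
 <= (nrm u u' + nrm v v') + 2 * sqrt (nrm u u' + nrm v v') * (nrm u u' + nrm v v') + (nrm u u' + nrm v v')\<^sup>2"
proof -
 obtain c where c: "c > 0" "!!u u'. W u u' ==> (!!x. u (- x) = u x) ==>
 c * nrm u u' <= quad Vp u u' + (LINT x|lborel. eta x * u x)\<^sup>2 / 2" using coercive_plus by metis
 show thesis
 proof (rule that[of "min c (1 / 192)"])
 show "min c (1 / 192) > 0" using c by simp
 next
 fix u u' v v'
 assume u: "W u u'" and v: "W v v'" and e: "!!x. u (- x) = u x" and o: "bil (%x. 1) v v' eta eta1 = 0"
 have "min c (1 / 192) * nrm u u' <= c * nrm u u'" by (rule mult_right_mono) (auto simp: nrm_nonneg)
 moreover have "min c (1 / 192) * nrm v v' <= 1 / 192 * nrm v v'"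
 by (rule mult_right_mono[OF min.cobounded2 nrm_nonneg])
 ultimately
 show "min c (1 / 192) * (nrm u u' + nrm v v') <= action (%x. eta x + u x) (%x. eta1 x + u' x) v v' - action eta eta1 (%x. 0) (%x. 0)
 + (LINT x|lborel. eta x * u x)\<^sup>2 / 2 + 2 * sqrt (nrm u u' + nrm v v') * (nrm u u' + nrm v v') + (nrm u u' + nrm v v')\<^sup>2"
 using c(2)[OF u e] coercive_minus[OF v o] quartic_int(3)[OF u v] action_expansion[OF u v]
 unfolding distrib_left[of "min c (1 / 192)"] by linarith
 next
 fix u u' v v'
 assume u: "W u u'" and v: "W v v'"
 show "action (%x. eta x + u x) (%x. eta1 x + u' x) v v' - action eta eta1 (%x. 0) (%x. 0)
 <= (nrm u u' + nrm v v') + 2 * sqrt (nrm u u' + nrm v v') * (nrm u u' + nrm v v') + (nrm u u' + nrm v v')\<^sup>2"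
 using quad_bounds(1)[OF meas_V(2) V_bound(2) u] quad_bounds(1)[OF meas_V(1) V_bound(1) v] quartic_int(3)[OF u v] action_expansion[OF u v]
 by linarith
 qed
qed

lemma mass_expansion:
 assumes u: "W u u'" and v: "W v v'"
 shows "(LINT x|lborel. (eta x + u x)\<^sup>2 + (v x)\<^sup>2) = 1 + 2 * (LINT x|lborel. eta x * u x) + (LINT x|lborel. (u x)\<^sup>2 + (v x)\<^sup>2)"
proof -
 have "(LINT x|lborel. (eta x + u x)\<^sup>2 + (v x)\<^sup>2) = (LINT x|lborel. (eta x)\<^sup>2 + (2 * (eta x * u x) + ((u x)\<^sup>2 + (v x)\<^sup>2)))"
 by (rule Bochner_Integration.integral_cong) (auto simp: power2_eq_square algebra_simps)
 also have "... = (LINT x|lborel. (eta x)\<^sup>2) + (LINT x|lborel. 2 * (eta x * u x) + ((u x)\<^sup>2 + (v x)\<^sup>2))"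
 using W_sq[OF W_eta] W_int(1)[OF W_eta u] W_sq[OF u] W_sq[OF v] by (intro Bochner_Integration.integral_add) auto
 also have "(LINT x|lborel. 2 * (eta x * u x) + ((u x)\<^sup>2 + (v x)\<^sup>2)) = (LINT x|lborel. 2 * (eta x * u x)) + (LINT x|lborel. (u x)\<^sup>2 + (v x)\<^sup>2)"
 using W_int(1)[OF W_eta u] W_sq[OF u] W_sq[OF v] by (intro Bochner_Integration.integral_add) auto
 finally show ?thesis using int_eta_sq by simp
qed

section \<open>Test functions and the identification of the H1 norm\<close>

text \<open>The flat function exp(-c / x), with polynomials in 1 / x as prefactors so that
  derivatives keep the same form.\<close>

definition bump_part :: "real => real poly => real => real" where
 "bump_part c p x = (if x > 0 then poly p (1 / x) * exp (- c / x) else 0)"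

lemma poly_exp_bounded:
 assumes "c > 0"
 shows "\<exists>B. \<forall>y\<ge>0. \<bar>poly p y\<bar> * exp (- c * y) <= (B::real)"
 using assms
proof (induction p arbitrary: c)
 case 0
 then show ?case by (auto intro: exI[of _ 0])
next
 case (pCons a p)
 then have "c / 2 > 0" by simp
 from pCons.IH[OF this] obtain B where B: "!!y. y >= 0 ==> \<bar>poly p y\<bar> * exp (- (c / 2) * y) <= B" by blast
 have "\<bar>poly (pCons a p) y\<bar> * exp (- c * y) <= \<bar>a\<bar> + 2 / c * B" if y: "y >= 0" for y
 proof -
 have "1 + c / 2 * y <= exp (c / 2 * y)" by (rule exp_ge_add_one_self)
 then have "c / 2 * y <= exp (c / 2 * y)" by linarith
 then have "c / 2 * y * exp (- (c / 2) * y) <= exp (c / 2 * y) * exp (- (c / 2) * y)" by (rule mult_right_mono) simp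
 also have "... = 1" by (simp add: exp_add[symmetric])
 finally have y1: "y * exp (- (c / 2) * y) <= 2 / c" using pCons.prems by (simp add: field_simps)
 have e: "exp (- c * y) = exp (- (c / 2) * y) * exp (- (c / 2) * y)" by (simp add: exp_add[symmetric])
 have "\<bar>poly (pCons a p) y\<bar> * exp (- c * y) <= (\<bar>a\<bar> + \<bar>y * poly p y\<bar>) * exp (- c * y)"
 by (intro mult_right_mono) auto
 also have "... = \<bar>a\<bar> * exp (- c * y) + (y * exp (- (c / 2) * y)) * (\<bar>poly p y\<bar> * exp (- (c / 2) * y))"
 unfolding e using y by (simp add: abs_mult distrib_right mult_ac)
 also have "... <= \<bar>a\<bar> * 1 + 2 / c * B"
 using y y1 B[OF y] pCons.prems by (intro add_mono mult_mono) auto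
 finally show ?thesis by simp
 qed
 then show ?case by blast
qed

lemma bump_part_deriv:
 assumes c: "c > 0"
 shows "(bump_part c p has_real_derivative bump_part c ([:0, 0, 1:] * ([:c:] * p - pderiv p)) x) (at x)"
proof -
 consider "x > 0" | "x < 0" | "x = 0" by linarith
 then show ?thesis
 proof cases
 case 1
 have "((%x. poly p (1 / x) * exp (- c / x)) has_real_derivative
 poly p (1 / x) * (exp (- c / x) * (c / (x * x))) + poly (pderiv p) (1 / x) * (- 1 / (x * x)) * exp (- c / x)) (at x)"
 using 1 by (auto intro!: derivative_eq_intros simp: field_simps)
 moreover have "poly p (1 / x) * (exp (- c / x) * (c / (x * x))) + poly (pderiv p) (1 / x) * (- 1 / (x * x)) * exp (- c / x)
 = bump_part c ([:0, 0, 1:] * ([:c:] * p - pderiv p)) x"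
 using 1 by (simp add: bump_part_def algebra_simps diff_divide_distrib add_divide_distrib)
 ultimately have d: "((%x. poly p (1 / x) * exp (- c / x)) has_real_derivative
 bump_part c ([:0, 0, 1:] * ([:c:] * p - pderiv p)) x) (at x)" by simp
 show ?thesis
 by (rule DERIV_cong_ev[THEN iffD1, OF refl _ refl d])
 (use 1 in \<open>auto simp: bump_part_def intro!: eventually_mono[OF eventually_nhds_in_open[of "{0<..}" x]]\<close>)
 next
 case 2
 have "(bump_part c p has_real_derivative 0) (at x)"
 by (rule DERIV_cong_ev[THEN iffD1, OF refl _ refl DERIV_const[of 0]])
 (use 2 in \<open>auto simp: bump_part_def intro!: eventually_mono[OF eventually_nhds_in_open[of "{..<0}" x]]\<close>)
 then show ?thesis using 2 by (simp add: bump_part_def)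
 next
 case 3
 \<comment> \<open>The factor y^2 provides two powers of h: the difference quotient at the origin is
   at most B |h|, so the derivative there is zero.\<close>
 obtain B where B: "!!y. y >= 0 ==> \<bar>poly (p * [:0, 0, 1:]) y\<bar> * exp (- c * y) <= B"
 using poly_exp_bounded[OF c, of "p * [:0, 0, 1:]"] by blast
 have B0: "B >= 0" using B[of 0] by simp
 have b: "\<bar>bump_part c p h / h\<bar> <= B * \<bar>h\<bar>" if "h ~= 0" for h
 proof (cases "h > 0")
 case True
 have "\<bar>poly p (1 / h)\<bar> / h / h * exp (- c / h) <= B" using B[of "1 / h"] True by (simp add: abs_mult field_simps)
 then show ?thesis using True by (simp add: bump_part_def abs_mult field_simps)
 next
 case False
 then have "bump_part c p h / h = 0" by (simp add: bump_part_def)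
 then show ?thesis unfolding \<open>bump_part c p h / h = 0\<close> using B0 by simp
 qed
 have "((%h. bump_part c p h / h) \<longlongrightarrow> 0) (at 0)"
 proof (rule tendsto_rabs_zero_cancel, rule tendsto_sandwich[of "%h. 0" _ _ "%h. B * \<bar>h\<bar>"])
 have "((%h. B * \<bar>h\<bar>) \<longlongrightarrow> B * \<bar>0::real\<bar>) (at 0)" by (intro tendsto_intros)
 then show "((%h. B * \<bar>h::real\<bar>) \<longlongrightarrow> 0) (at 0)" by simp
 show "\<forall>\<^sub>F h in at 0. \<bar>bump_part c p h / h\<bar> <= B * \<bar>h\<bar>"
 using b by (auto simp: eventually_at intro!: exI[of _ 1])
 qed auto
 then have "(bump_part c p has_real_derivative 0) (at 0)"
 by (simp add: DERIV_def bump_part_def[of c p 0])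
 then show ?thesis using 3 by (simp add: bump_part_def)
 qed
qed

text \<open>A class closed under differentiation and containing the bumps, so that derivatives of
  every order exist without being computed.\<close>

inductive_set bumps :: "real => (real => real) set" for c where
 left: "(%x. bump_part c p (x - a)) \<in> bumps c"
| right: "(%x. bump_part c p (b - x)) \<in> bumps c"
| add: "f \<in> bumps c ==> g \<in> bumps c ==> (%x. f x + g x) \<in> bumps c"
| mult: "f \<in> bumps c ==> g \<in> bumps c ==> (%x. f x * g x) \<in> bumps c"

lemma bumps_deriv:
 assumes c: "c > 0" and "f \<in> bumps c"
 shows "\<exists>f'\<in>bumps c. \<forall>x. (f has_real_derivative f' x) (at x)"
 using assms(2)
proof induction
 case (left p a)
 have "((%x. bump_part c p (x - a)) has_real_derivative
 bump_part c ([:0, 0, 1:] * ([:c:] * p - pderiv p)) (x - a) * 1) (at x)" for x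
 by (rule DERIV_chain2[OF bump_part_deriv[OF c]]) (auto intro!: derivative_eq_intros)
 then show ?case using bumps.left by (intro bexI) (auto simp only: mult_1_right)
next
 case (right p b)
 have n: "bump_part c (- q) y = - bump_part c q y" for q y by (simp add: bump_part_def)
 have "((%x. bump_part c p (b - x)) has_real_derivative
 bump_part c ([:0, 0, 1:] * ([:c:] * p - pderiv p)) (b - x) * - 1) (at x)" for x
 by (rule DERIV_chain2[OF bump_part_deriv[OF c]]) (auto intro!: derivative_eq_intros)
 then have "((%x. bump_part c p (b - x)) has_real_derivative
 bump_part c (- ([:0, 0, 1:] * ([:c:] * p - pderiv p))) (b - x)) (at x)" for x
 by (simp only: n mult_minus1_right)
 then show ?case using bumps.right by (intro bexI allI)
next
 case (add f g)
 then obtain f' g' where "f' \<in> bumps c" "g' \<in> bumps c" "!!x. (f has_real_derivative f' x) (at x)" "!!x. (g has_real_derivative g' x) (at x)" by blast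
 then show ?case by (intro bexI[of _ "%x. f' x + g' x"] allI DERIV_add bumps.add)
next
 case (mult f g)
 then obtain f' g' where "f' \<in> bumps c" "g' \<in> bumps c" "!!x. (f has_real_derivative f' x) (at x)" "!!x. (g has_real_derivative g' x) (at x)" by blast
 then show ?case using mult.hyps
 by (intro bexI[of _ "%x. f' x * g x + g' x * f x"] allI DERIV_mult bumps.add bumps.mult)
qed

lemma bumps_smooth:
 assumes c: "c > 0" and f: "f \<in> bumps c"
 shows "(deriv ^^ k) f field_differentiable at x"
proof -
 have "deriv g \<in> bumps c" if g: "g \<in> bumps c" for g
 proof -
 obtain g' where g': "g' \<in> bumps c" "!!x. (g has_real_derivative g' x) (at x)" using bumps_deriv[OF c g] by blast
 have "deriv g = g'" using g'(2) by (auto intro!: ext DERIV_imp_deriv)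
 then show ?thesis using g'(1) by simp
 qed
 then have "(deriv ^^ k) f \<in> bumps c" by (induction k) (auto simp: f)
 then show ?thesis using bumps_deriv[OF c] unfolding field_differentiable_def by blast
qed

definition bump :: "real => real => real => real => real" where
 "bump a b c x = bump_part c 1 (x - a) * bump_part c 1 (b - x)"

lemma bump_test: "c > 0 ==> test_function (bump a b c)"
 unfolding test_function_def
proof (intro conjI allI)
 show "(deriv ^^ k) (bump a b c) field_differentiable at x" if "c > 0" for k x
 unfolding bump_def[abs_def] by (rule bumps_smooth[OF that bumps.mult[OF bumps.left bumps.right]])
 show "\<exists>R. \<forall>x. \<bar>x\<bar> > R --> bump a b c x = 0"
 by (rule exI[of _ "\<bar>a\<bar> + \<bar>b\<bar>"]) (auto simp: bump_def bump_part_def)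
qed

lemma bump_limit: "(%n. bump a b (1 / real (Suc n)) x) \<longlonglongrightarrow> indicator {a<..<b} x"
proof (cases "a < x \<and> x < b")
 case True
 have e: "(%n. exp (- (1 / real (Suc n)) / y)) \<longlonglongrightarrow> exp (- 0 / y)" if "y > 0" for y
 by (intro tendsto_intros LIMSEQ_Suc lim_1_over_n) (use that in auto)
 have "(%n. exp (- (1 / real (Suc n)) / (x - a)) * exp (- (1 / real (Suc n)) / (b - x))) \<longlonglongrightarrow> exp (- 0 / (x - a)) * exp (- 0 / (b - x))"
 using True by (intro tendsto_mult e) auto
 then show ?thesis using True by (simp add: bump_def bump_part_def)
next
 case False
 then have "bump a b c x = 0" for c by (auto simp: bump_def bump_part_def)
 then show ?thesis using False by (auto simp: indicator_def)
qed

lemma bump_range: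
 assumes "c > 0"
 shows "0 <= bump a b c x" "bump a b c x <= indicator {a<..<b} x"
proof -
 have r: "0 <= bump_part c 1 y" "bump_part c 1 y <= 1" for y using assms by (auto simp: bump_part_def)
 show "0 <= bump a b c x" unfolding bump_def by (intro mult_nonneg_nonneg r)
 have "bump a b c x <= 1 * 1" unfolding bump_def by (intro mult_mono r) auto
 moreover have "bump a b c x = 0" if "\<not> (a < x \<and> x < b)" using that by (auto simp: bump_def bump_part_def)
 ultimately show "bump a b c x <= indicator {a<..<b} x" by (auto simp: indicator_def)
qed

lemma test_function_W:
 assumes "test_function \<phi>"
 shows "W \<phi> (deriv \<phi>)"
proof -
 have d0: "\<phi> field_differentiable at x" "deriv \<phi> field_differentiable at x" for x
 using assms unfolding test_function_def by (metis funpow_0, metis funpow_0 funpow.simps(2) o_apply)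
 have d: "(\<phi> has_real_derivative deriv \<phi> x) (at x)" for x using d0(1) by (simp add: DERIV_deriv_iff_field_differentiable)
 have c: "continuous_on UNIV \<phi>" "continuous_on UNIV (deriv \<phi>)"
 using d0 by (auto intro!: continuous_at_imp_continuous_on field_differentiable_imp_continuous_at)
 obtain R where R: "!!x. \<bar>x\<bar> > R ==> \<phi> x = 0" using assms unfolding test_function_def by blast
 have dR: "deriv \<phi> x = 0" if "\<bar>x\<bar> > R" for x
 proof -
 have o: "open {x. \<bar>x\<bar> > R}" by (intro open_Collect_less continuous_intros)
 have "eventually (%y. \<phi> y = (%_. 0) y) (nhds x)"
 using eventually_nhds_in_open[OF o, of x] that by (auto elim!: eventually_mono simp: R)
 then have "deriv \<phi> x = deriv (%_. 0) x" by (rule deriv_cong_ev) simp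
 then show ?thesis by simp
 qed
 have i: "integrable lborel (%x. (g x)\<^sup>2)" if g: "continuous_on UNIV g" "!!x. \<bar>x\<bar> > R ==> g x = 0" for g :: "real => real"
 proof -
 have "set_integrable lborel {-R..R} (%x. (g x)\<^sup>2)"
 by (rule borel_integrable_atLeastAtMost') (intro continuous_intros continuous_on_subset[OF g(1)], simp)
 moreover have "indicator {-R..R} x *\<^sub>R (g x)\<^sup>2 = (g x)\<^sup>2" for x
 by (cases "\<bar>x\<bar> > R") (auto simp: g(2) indicator_def)
 ultimately show ?thesis by (simp only: set_integrable_def)
 qed
 have "eventually (%x. \<phi> x = 0) at_top" "eventually (%x. \<phi> x = 0) at_bot"
 by (auto intro!: eventually_mono[OF eventually_gt_at_top[of "\<bar>R\<bar>"]] eventually_mono[OF eventually_gt_at_bot[of "- \<bar>R\<bar>"]] R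
 eventually_mono[OF eventually_at_bot_dense[THEN iffD2, of "%x. x < - \<bar>R\<bar>"]])
 then have "(\<phi> \<longlongrightarrow> 0) at_top" "(\<phi> \<longlongrightarrow> 0) at_bot" by (auto intro: tendsto_eventually)
 then show ?thesis unfolding W_def using c d i[OF c(1) R] i[OF c(2) dR] by (auto intro!: borel_measurable_continuous_onI)
qed

lemma sq_bound_integrable:
 fixes f g :: "real => real"
 assumes [measurable]: "f \<in> borel_measurable M" "g \<in> borel_measurable M"
 and "integrable M (%x. (f x)\<^sup>2)" "integrable M (%x. (g x)\<^sup>2)"
 shows "integrable M (%x. f x * g x)"
proof (rule Bochner_Integration.integrable_bound)
 show "integrable M (%x. (f x)\<^sup>2 + (g x)\<^sup>2)" using assms by simp
 have "\<bar>a * b\<bar> <= a\<^sup>2 + b\<^sup>2" for a b :: real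
 proof -
 have "0 <= (\<bar>a\<bar> - \<bar>b\<bar>)\<^sup>2" by simp
 then have "2 * \<bar>a * b\<bar> <= a\<^sup>2 + b\<^sup>2" by (simp add: power2_diff abs_mult)
 then show ?thesis using abs_ge_zero[of "a * b"] by linarith
 qed
 then show "AE x in M. norm (f x * g x) <= norm ((f x)\<^sup>2 + (g x)\<^sup>2)" by (auto simp: abs_of_nonneg)
qed measurable

text \<open>The fundamental lemma of the calculus of variations: integrating against bumps that increase to
 indicators of intervals, \<open>d\<close> has zero integral over every interval.\<close>

lemma AE_zero_if_test_zero:
 fixes d :: "real => real"
 assumes m [measurable]: "d \<in> borel_measurable borel" and i: "integrable lborel (%x. (d x)\<^sup>2)"
 and z: "!!\<phi>. test_function \<phi> ==> (LINT x|lborel. d x * \<phi> x) = 0"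
 shows "AE x in lborel. d x = 0"
proof -
 have li: "integrable lborel (%x. \<bar>d x\<bar> * indicator {a<..<b} x)" for a b :: real
 proof (rule sq_bound_integrable)
 show "integrable lborel (%x. (indicator {a<..<b} x :: real)\<^sup>2)"
 by (simp add: power2_eq_square indicator_inter_arith[symmetric] integrable_indicator_iff)
 (cases "a <= b"; simp)
 qed (use i in auto)
 have Ioo: "(LINT x|lborel. d x * indicator {a<..<b} x) = 0" for a b :: real
 proof -
 have "(%n. LINT x|lborel. d x * bump a b (1 / real (Suc n)) x) \<longlonglongrightarrow> (LINT x|lborel. d x * indicator {a<..<b} x)"
 proof (rule integral_dominated_convergence[OF _ _ li[of a b]])
 show "AE x in lborel. (%n. d x * bump a b (1 / real (Suc n)) x) \<longlonglongrightarrow> d x * indicator {a<..<b} x"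
 by (intro AE_I2 tendsto_mult tendsto_const bump_limit)
 show "AE x in lborel. norm (d x * bump a b (1 / real (Suc n)) x) <= \<bar>d x\<bar> * indicator {a<..<b} x" for n
 using bump_range[of "1 / real (Suc n)" a b] by (intro AE_I2) (auto simp: abs_mult intro!: mult_left_mono)
 have [measurable]: "bump a b (1 / real (Suc n)) \<in> borel_measurable borel" for n
 using W_measurable(1)[OF test_function_W[OF bump_test]] by simp
 show "(%x. d x * bump a b (1 / real (Suc n)) x) \<in> borel_measurable lborel" for n by measurable
 qed measurable
 moreover have "(LINT x|lborel. d x * bump a b (1 / real (Suc n)) x) = 0" for n by (rule z[OF bump_test]) simp
 ultimately show ?thesis by (simp add: LIMSEQ_const_iff)
 qed
 have part: "AE x in lborel. d x * indicator {-real n<..<real n} x = 0" for n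
 proof -
 define f where "f x = d x * indicator {-real n<..<real n} x" for x
 have [measurable]: "f \<in> borel_measurable borel" unfolding f_def[abs_def] by measurable
 have fi: "integrable lborel f"
 by (rule Bochner_Integration.integrable_bound[OF li[of "- real n" "real n"]]) (auto simp: f_def abs_mult)
 have st: "Int_stable (range (%a::real. {..a}))" by (auto simp: Int_stable_def)
 have sb: "sets borel = sigma_sets UNIV (range (%a::real. {..a}))" unfolding borel_eq_atMost by simp
 have sp: "range (%a::real. {..a}) \<subseteq> Pow UNIV" by simp
 have all: "(LINT x|lborel. f x * indicator A x) = 0" if "A \<in> sigma_sets UNIV (range (%a::real. {..a}))" for A
 using st sp that
 proof (induction rule: sigma_sets_induct_disjoint)
 case (basic A)
 then obtain a where A: "A = {..a}" by blast
 have "(LINT x|lborel. f x * indicator A x) = (LINT x|lborel. d x * indicator {- real n<..<min (real n) a} x)"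
 proof (rule integral_cong_AE)
 have "AE x in lborel. x ~= a" by (rule AE_lborel_singleton)
 then show "AE x in lborel. f x * indicator A x = d x * indicator {- real n<..<min (real n) a} x"
 by eventually_elim (auto simp: f_def A indicator_def)
 qed (auto simp: f_def[abs_def] A)
 then show ?case using Ioo by simp
 next
 case (compl A)
 note A = compl(1) and IH = compl(2)
 have Ab: "A \<in> sets lborel" using A sb by simp
 have "f x * indicator (UNIV - A) x = f x - f x * indicator A x" for x by (auto simp: indicator_def)
 then have "(LINT x|lborel. f x * indicator (UNIV - A) x) = (LINT x|lborel. f x) - (LINT x|lborel. f x * indicator A x)"
 using integrable_real_mult_indicator[OF Ab fi] fi by simp
 then show ?case
 using IH Ioo[of "- real n" "real n"] by (simp add: f_def)
 next
 case (union A)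
 note dj = union(1) and A = union(2) and IH = union(3)
 have Ab: "A i \<in> sets lborel" for i using A sb by auto
 have "set_integrable lborel (\<Union>i. A i) f" unfolding set_integrable_def
 by (rule integrable_mult_indicator[OF _ fi]) (use Ab in auto)
 then have "set_lebesgue_integral lborel (\<Union>i. A i) f = (\<Sum>i. set_lebesgue_integral lborel (A i) f)"
 using Ab dj by (intro lebesgue_integral_countable_add) (auto simp: disjoint_family_on_def)
 then show ?case
 using IH by (simp add: set_lebesgue_integral_def mult.commute)
 qed auto
 have "AE x in lborel. f x = 0"
 proof (rule sigma_finite_measure.density_zero[OF sigma_finite_lborel fi])
 fix A :: "real set" assume "A \<in> sets lborel"
 then have "A \<in> sigma_sets UNIV (range (%a::real. {..a}))" using sb by simp
 then show "set_lebesgue_integral lborel A f = 0" using all by (simp add: set_lebesgue_integral_def mult.commute)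
 qed
 then show ?thesis by (simp add: f_def)
 qed
 then have "AE x in lborel. \<forall>n. d x * indicator {-real n<..<real n} x = 0" by (intro AE_all_countable[THEN iffD2] allI)
 then show ?thesis
 proof eventually_elim
 case (elim x)
 obtain n where "\<bar>x\<bar> < real n" using reals_Archimedean2 by blast
 then show "d x = 0" using elim[rule_format, of n] by (auto simp: indicator_def abs_less_iff split: if_splits)
 qed
qed

lemma leb_integral: "f \<in> borel_measurable borel ==> (LINT x|lebesgue. f x) = (LINT x|lborel. f x :: 'a :: {banach, second_countable_topology})"
 by (rule integral_completion) simp

lemma leb_integrable: "f \<in> borel_measurable borel ==> integrable lebesgue f = integrable lborel (f :: real => 'a :: {banach, second_countable_topology})"
 by (rule integrable_completion) simp

lemma borel_leb: "f \<in> borel_measurable borel ==> f \<in> borel_measurable lebesgue"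
 by (rule measurable_completion) simp

text \<open>Integration by parts makes A' a weak derivative too. The difference of the two
  annihilates all test functions and vanishes almost everywhere by
  \<open>AE_zero_if_test_zero\<close>.\<close>

lemma weak_derivative_unique:
 fixes A A' g :: "real => real"
 assumes A: "W A A'" and gm: "g \<in> borel_measurable lebesgue" and gi: "integrable lebesgue (%x. (g x)\<^sup>2)"
 and weak: "!!\<phi>. test_function \<phi> ==> (LINT x|lebesgue. A x * deriv \<phi> x) = - (LINT x|lebesgue. g x * \<phi> x)"
 shows "AE x in lebesgue. g x = A' x"
proof -
 have "g \<in> borel_measurable (completion lborel)" using gm by simp
 \<comment> \<open>A Borel representative moves the argument from Lebesgue measure, where weak
   derivatives live, to \<open>lborel\<close>, where integration by parts is available.\<close>
 from completion_ex_borel_measurable_real[OF this] obtain g1 where g1 [measurable]: "g1 \<in> borel_measurable borel" and eq: "AE x in lborel. g x = g1 x"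
 by auto
 have mA [measurable]: "A \<in> borel_measurable borel" "A' \<in> borel_measurable borel" using W_measurable[OF A] by auto
 have eqL: "AE x in lebesgue. g x = g1 x" using AE_completion[OF eq] .
 have g1i: "integrable lborel (%x. (g1 x)\<^sup>2)"
 proof -
 have "integrable lebesgue (%x. (g1 x)\<^sup>2)"
 by (rule integrable_cong_AE_imp[OF gi]) (use eqL borel_leb[of "%x. (g1 x)\<^sup>2"] in \<open>auto elim: eventually_mono\<close>)
 then show ?thesis by (subst (asm) leb_integrable) auto
 qed
 have "AE x in lborel. g1 x - A' x = 0"
 proof (rule AE_zero_if_test_zero)
 have i: "integrable lborel (%x. g1 x * A' x)" by (rule sq_bound_integrable) (use g1i W_sq[OF A] in auto)
 have "integrable lborel (%x. (g1 x)\<^sup>2 + (A' x)\<^sup>2 - 2 * (g1 x * A' x))" using g1i i W_sq[OF A] by auto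
 then show "integrable lborel (%x. (g1 x - A' x)\<^sup>2)" by (simp add: power2_diff mult.assoc)
 fix \<phi> assume t: "test_function \<phi>"
 note W = test_function_W[OF t]
 have [measurable]: "\<phi> \<in> borel_measurable borel" "deriv \<phi> \<in> borel_measurable borel" using W_measurable[OF W] by auto
 have ig: "integrable lborel (%x. g1 x * \<phi> x)" by (rule sq_bound_integrable) (use g1i W_sq[OF W] in auto)
 have "(LINT x|lborel. g1 x * \<phi> x) = (LINT x|lebesgue. g1 x * \<phi> x)" by (subst leb_integral) auto
 also have "... = (LINT x|lebesgue. g x * \<phi> x)"
 by (rule integral_cong_AE) (use eqL borel_leb[of \<phi>] borel_leb[of g1] gm in \<open>auto elim: eventually_mono\<close>)
 also have "... = - (LINT x|lebesgue. A x * deriv \<phi> x)" using weak[OF t] by simp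
 also have "... = - (LINT x|lborel. A x * deriv \<phi> x)" by (subst leb_integral) auto
 finally have 1: "(LINT x|lborel. g1 x * \<phi> x) = - (LINT x|lborel. A x * deriv \<phi> x)" .
 have iA: "integrable lborel (%x. A' x * \<phi> x)" using W_int(3)[OF W A] by (simp add: mult.commute)
 have "(LINT x|lborel. A' x * \<phi> x) + (LINT x|lborel. A x * deriv \<phi> x) = 0"
 using W_parts[OF A W] iA W_int(3)[OF A W] by simp
 then show "(LINT x|lborel. (g1 x - A' x) * \<phi> x) = 0"
 using 1 ig iA by (simp add: left_diff_distrib)
 qed measurable
 then have "AE x in lebesgue. g1 x - A' x = 0" by (rule AE_completion)
 then show ?thesis using eqL by eventually_elim simp
qed

lemma W_bounded_test:
 assumes "W A A'" "test_function \<phi>"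
 shows "(LINT x|lebesgue. A x * deriv \<phi> x) = - (LINT x|lebesgue. A' x * \<phi> x)"
proof -
 note W = test_function_W[OF assms(2)] and A = assms(1)
 have [measurable]: "\<phi> \<in> borel_measurable borel" "deriv \<phi> \<in> borel_measurable borel" "A \<in> borel_measurable borel" "A' \<in> borel_measurable borel"
 using W_measurable[OF W] W_measurable[OF A] by auto
 have "(LINT x|lborel. A' x * \<phi> x) + (LINT x|lborel. A x * deriv \<phi> x) = 0"
 using W_parts[OF A W] W_int(3)[OF W A] W_int(3)[OF A W] by (simp add: mult.commute)
 then show ?thesis by (simp add: leb_integral)
qed

lemma complex_integral:
 fixes f g :: "real => real"
 assumes "integrable M f" "integrable M g"
 shows "(LINT x|M. Complex (f x) (g x)) = Complex (integral\<^sup>L M f) (integral\<^sup>L M g)"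
proof -
 have "(LINT x|M. Complex (f x) (g x)) = (LINT x|M. complex_of_real (f x) + \<i> * complex_of_real (g x))"
 by (simp add: Complex_eq)
 also have "... = complex_of_real (integral\<^sup>L M f) + \<i> * complex_of_real (integral\<^sup>L M g)"
 using assms by simp
 finally show ?thesis by (simp add: Complex_eq)
qed

text \<open>\<open>H1_norm\<close> uses an arbitrarily chosen weak derivative. Testing against real
  functions separates real and imaginary parts, and uniqueness identifies each with the explicit
  derivative.\<close>

theorem H1_norm_W:
 assumes A: "W A A'" and B: "W B B'"
 shows "H1_norm (%x. Complex (A x) (B x)) = sqrt (nrm A A' + nrm B B')"
proof -
 define f where "f x = Complex (A x) (B x)" for x
 have m [measurable]: "A \<in> borel_measurable borel" "A' \<in> borel_measurable borel" "B \<in> borel_measurable borel" "B' \<in> borel_measurable borel"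
 using W_measurable[OF A] W_measurable[OF B] by auto
 have sq: "square_integrable (%x. Complex (a x) (b x))"
 if [measurable]: "a \<in> borel_measurable borel" "b \<in> borel_measurable borel" and "integrable lborel (%x. (a x)\<^sup>2)" "integrable lborel (%x. (b x)\<^sup>2)" for a b
 unfolding square_integrable_def
 proof
 have [measurable]: "(%x. Complex (a x) (b x)) \<in> borel_measurable borel" unfolding Complex_eq by measurable
 show "(%x. Complex (a x) (b x)) \<in> borel_measurable lebesgue" by (rule borel_leb) measurable
 show "integrable lebesgue (%x. (cmod (Complex (a x) (b x)))\<^sup>2)"
 using that by (subst leb_integrable) (auto simp: cmod_power2)
 qed
 have wd: "has_weak_derivative f (%x. Complex (A' x) (B' x))" unfolding has_weak_derivative_def
 proof (intro allI impI)
 fix \<phi> assume t: "test_function \<phi>"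
 note W = test_function_W[OF t]
 have [measurable]: "\<phi> \<in> borel_measurable borel" "deriv \<phi> \<in> borel_measurable borel" using W_measurable[OF W] by auto
 have i: "integrable lebesgue (%x. a x * deriv \<phi> x)" "integrable lebesgue (%x. a' x * \<phi> x)" if "W a a'" for a a'
 using W_int(3)[OF that W] W_int(3)[OF W that] W_measurable[OF that] by (auto simp: leb_integrable mult.commute)
 have "(LINT x|lebesgue. f x * complex_of_real (deriv \<phi> x)) = (LINT x|lebesgue. Complex (A x * deriv \<phi> x) (B x * deriv \<phi> x))"
 by (rule Bochner_Integration.integral_cong) (auto simp: f_def complex_eq_iff)
 also have "... = - (LINT x|lebesgue. Complex (A' x * \<phi> x) (B' x * \<phi> x))"
 using complex_integral[OF i(1)[OF A] i(1)[OF B]] complex_integral[OF i(2)[OF A] i(2)[OF B]]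
 W_bounded_test[OF A t] W_bounded_test[OF B t] by (simp add: complex_eq_iff)
 also have "(LINT x|lebesgue. Complex (A' x * \<phi> x) (B' x * \<phi> x)) = (LINT x|lebesgue. Complex (A' x) (B' x) * complex_of_real (\<phi> x))"
 by (rule Bochner_Integration.integral_cong) (auto simp: complex_eq_iff)
 finally show "(LINT x|lebesgue. f x * complex_of_real (deriv \<phi> x)) = - (LINT x|lebesgue. Complex (A' x) (B' x) * complex_of_real (\<phi> x))" .
 qed
 define g where "g = weak_derivative f"
 have "\<exists>g. square_integrable g \<and> has_weak_derivative f g"
 using wd sq[of A' B'] W_sq[OF A] W_sq[OF B] m by blast
 then have g: "square_integrable g" "has_weak_derivative f g" unfolding g_def weak_derivative_def by (metis (mono_tags, lifting) someI_ex)+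
 have gm: "g \<in> borel_measurable lebesgue" and gi: "integrable lebesgue (%x. (norm (g x))\<^sup>2)" using g(1) by (auto simp: square_integrable_def)
 have gm': "(%x. Re (g x)) \<in> borel_measurable lebesgue" "(%x. Im (g x)) \<in> borel_measurable lebesgue"
 using gm by (auto intro: borel_measurable_Re borel_measurable_Im)
 have gi': "integrable lebesgue (%x. (Re (g x))\<^sup>2)" "integrable lebesgue (%x. (Im (g x))\<^sup>2)"
 by (rule Bochner_Integration.integrable_bound[OF gi], use gm' in \<open>auto simp: cmod_power2\<close>)+
 have weak: "(LINT x|lebesgue. A x * deriv \<phi> x) = - (LINT x|lebesgue. Re (g x) * \<phi> x)"
 "(LINT x|lebesgue. B x * deriv \<phi> x) = - (LINT x|lebesgue. Im (g x) * \<phi> x)" if t: "test_function \<phi>" for \<phi>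
 proof -
 note W = test_function_W[OF t]
 have [measurable]: "\<phi> \<in> borel_measurable borel" "deriv \<phi> \<in> borel_measurable borel" using W_measurable[OF W] by auto
 have i: "integrable lebesgue (%x. a x * deriv \<phi> x)" if "W a a'" for a a'
 using W_int(3)[OF that W] W_measurable[OF that] by (auto simp: leb_integrable)
 have ps: "integrable lebesgue (%x. (\<phi> x)\<^sup>2)" using W_sq[OF W] by (subst leb_integrable) auto
 have ig: "integrable lebesgue (%x. Re (g x) * \<phi> x)" "integrable lebesgue (%x. Im (g x) * \<phi> x)"
 using sq_bound_integrable[OF gm'(1) borel_leb gi'(1) ps] sq_bound_integrable[OF gm'(2) borel_leb gi'(2) ps] by simp_all
 have "Complex (LINT x|lebesgue. A x * deriv \<phi> x) (LINT x|lebesgue. B x * deriv \<phi> x) = (LINT x|lebesgue. f x * complex_of_real (deriv \<phi> x))"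
 unfolding complex_integral[OF i[OF A] i[OF B], symmetric]
 by (rule Bochner_Integration.integral_cong) (auto simp: f_def complex_eq_iff)
 also have "... = - (LINT x|lebesgue. g x * complex_of_real (\<phi> x))" using g(2) t by (simp add: has_weak_derivative_def)
 also have "(LINT x|lebesgue. g x * complex_of_real (\<phi> x)) = Complex (LINT x|lebesgue. Re (g x) * \<phi> x) (LINT x|lebesgue. Im (g x) * \<phi> x)"
 unfolding complex_integral[OF ig, symmetric]
 by (rule Bochner_Integration.integral_cong) (auto simp: complex_eq_iff)
 finally show "(LINT x|lebesgue. A x * deriv \<phi> x) = - (LINT x|lebesgue. Re (g x) * \<phi> x)"
 "(LINT x|lebesgue. B x * deriv \<phi> x) = - (LINT x|lebesgue. Im (g x) * \<phi> x)" by (auto simp: complex_eq_iff)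
 qed
 have ae: "AE x in lebesgue. Re (g x) = A' x" "AE x in lebesgue. Im (g x) = B' x"
 using weak by (auto intro: weak_derivative_unique[OF A gm'(1) gi'(1)] weak_derivative_unique[OF B gm'(2) gi'(2)])
 have "(LINT x|lebesgue. (norm (f x))\<^sup>2 + (norm (g x))\<^sup>2) = (LINT x|lebesgue. ((A x)\<^sup>2 + (A' x)\<^sup>2) + ((B x)\<^sup>2 + (B' x)\<^sup>2))"
 proof (rule integral_cong_AE)
 have fm: "f \<in> borel_measurable borel" unfolding f_def[abs_def] Complex_eq by measurable
 show "(%x. (norm (f x))\<^sup>2 + (norm (g x))\<^sup>2) \<in> borel_measurable lebesgue" using gm borel_leb[OF fm] by auto
 show "(%x. ((A x)\<^sup>2 + (A' x)\<^sup>2) + ((B x)\<^sup>2 + (B' x)\<^sup>2)) \<in> borel_measurable lebesgue" by (rule borel_leb) measurable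
 show "AE x in lebesgue. (norm (f x))\<^sup>2 + (norm (g x))\<^sup>2 = ((A x)\<^sup>2 + (A' x)\<^sup>2) + ((B x)\<^sup>2 + (B' x)\<^sup>2)"
 using ae by eventually_elim (simp add: cmod_power2 f_def)
 qed
 also have "... = (LINT x|lborel. ((A x)\<^sup>2 + (A' x)\<^sup>2) + ((B x)\<^sup>2 + (B' x)\<^sup>2))" by (rule leb_integral) measurable
 also have "... = nrm A A' + nrm B B'" unfolding nrm_def using W_sq[OF A] W_sq[OF B] by simp
 finally show ?thesis unfolding H1_norm_def f_def[symmetric, abs_def] g_def by (simp add: f_def[abs_def])
qed

section \<open>Distance to the orbit and orbital stability\<close>

lemma bil_add:
 assumes "W u u'" "W v v'" "W w w'"
 shows "bil (%x. 1) (%x. u x + c * v x) (%x. u' x + c * v' x) w w' = bil (%x. 1) u u' w w' + c * bil (%x. 1) v v' w w'"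
proof -
 note i = W_int(1,2)[OF assms(1,3)] W_int(1,2)[OF assms(2,3)]
 have "bil (%x. 1) (%x. u x + c * v x) (%x. u' x + c * v' x) w w' =
 (LINT x|lborel. (u x * w x + u' x * w' x) + c * (v x * w x + v' x * w' x))"
 unfolding bil_one by (rule Bochner_Integration.integral_cong) (auto simp: algebra_simps)
 also have "... = (LINT x|lborel. u x * w x + u' x * w' x) + (LINT x|lborel. c * (v x * w x + v' x * w' x))"
 using i by (intro Bochner_Integration.integral_add) auto
 finally show ?thesis unfolding bil_one by simp
qed

lemma W_scale: "W u u' ==> W (%x. c * u x) (%x. c * u' x)"
proof -
 assume u: "W u u'"
 have "W (%x. u x + (c - 1) * u x) (%x. u' x + (c - 1) * u' x)" by (rule W_add[OF u u])
 then show ?thesis by (simp add: algebra_simps)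
qed

lemma W_cmb: "W u u' ==> W v v' ==> W (%x. a * u x + b * v x) (%x. a * u' x + b * v' x)"
 by (rule W_add[OF W_scale])

lemma bil_cmb:
 assumes "W u u'" "W v v'" "W w w'"
 shows "bil (%x. 1) (%x. a * u x + b * v x) (%x. a * u' x + b * v' x) w w' = a * bil (%x. 1) u u' w w' + b * bil (%x. 1) v v' w w'"
proof -
 have "bil (%x. 1) (%x. a * u x) (%x. a * u' x) w w' = a * bil (%x. 1) u u' w w'"
 using bil_add[OF assms(1,1,3), of "a - 1"] by (simp add: algebra_simps)
 then show ?thesis using bil_add[OF W_scale[OF assms(1)] assms(2,3)] by simp
qed

definition eta_ip :: "(real => real) => (real => real) => real" where
 "eta_ip u u' = bil (%x. 1) u u' eta eta1"

lemma dist_to_orbit_point: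
 assumes A: "W A A'" and B: "W B B'"
 shows "H1_norm (%x. Complex (A x) (B x) - exp (\<i> * of_real \<alpha>) * of_real (eta x))
 = sqrt (nrm A A' + nrm B B' + nrm eta eta1 - 2 * (cos \<alpha> * eta_ip A A' + sin \<alpha> * eta_ip B B'))"
proof -
 have ring: "(a + 2 * (- c) * x + (- c)\<^sup>2 * n) + (b + 2 * (- s) * y + (- s)\<^sup>2 * n) = a + b + (c\<^sup>2 + s\<^sup>2) * n - 2 * (c * x + s * y)"
 for a b c s x y n :: real by (simp add: algebra_simps)
 have "(%x. Complex (A x) (B x) - exp (\<i> * of_real \<alpha>) * of_real (eta x))
 = (%x. Complex (A x + (- cos \<alpha>) * eta x) (B x + (- sin \<alpha>) * eta x))"
 by (auto simp: complex_eq_iff exp_Euler cos_of_real sin_of_real)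
 then have "H1_norm (%x. Complex (A x) (B x) - exp (\<i> * of_real \<alpha>) * of_real (eta x))
 = sqrt (nrm (%x. A x + (- cos \<alpha>) * eta x) (%x. A' x + (- cos \<alpha>) * eta1 x) +
 nrm (%x. B x + (- sin \<alpha>) * eta x) (%x. B' x + (- sin \<alpha>) * eta1 x))"
 using H1_norm_W[OF W_add[OF A W_eta] W_add[OF B W_eta], of "- cos \<alpha>" "- sin \<alpha>"] by simp
 also have "nrm (%x. A x + (- cos \<alpha>) * eta x) (%x. A' x + (- cos \<alpha>) * eta1 x) +
 nrm (%x. B x + (- sin \<alpha>) * eta x) (%x. B' x + (- sin \<alpha>) * eta1 x) =
 nrm A A' + nrm B B' + ((cos \<alpha>)\<^sup>2 + (sin \<alpha>)\<^sup>2) * nrm eta eta1 - 2 * (cos \<alpha> * eta_ip A A' + sin \<alpha> * eta_ip B B')"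
 unfolding nrm_add[OF A W_eta] nrm_add[OF B W_eta] eta_ip_def by (rule ring)
 finally show ?thesis by (simp only: sin_cos_squared_add2 mult_1_left)
qed

text \<open>The optimal phase is the argument of the complex number formed by the two H1 inner
  products with \<open>eta\<close>. After rotating by it, the imaginary part is H1-orthogonal to
  \<open>eta\<close>, exactly the condition of \<open>coercive_minus\<close>.\<close>

lemma orbit_dist_attained:
 assumes A: "W A A'" and B: "W B B'"
 obtains c s where "c\<^sup>2 + s\<^sup>2 = (1::real)" "c * eta_ip B B' - s * eta_ip A A' = 0"
 "H1_dist (%x. Complex (A x) (B x)) ground_orbit =
 sqrt (nrm A A' + nrm B B' + nrm eta eta1 - 2 * (c * eta_ip A A' + s * eta_ip B B'))"
 "c * eta_ip A A' + s * eta_ip B B' = sqrt ((eta_ip A A')\<^sup>2 + (eta_ip B B')\<^sup>2)"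
proof -
 define z where "z = Complex (eta_ip A A') (eta_ip B B')"
 obtain r \<alpha> where r: "r >= 0" "z = of_real r * cis \<alpha>"
 using complex_norm_eq_1_exp by (metis rcis_cmod_Arg rcis_def norm_ge_zero)
 have ip: "eta_ip A A' = r * cos \<alpha>" "eta_ip B B' = r * sin \<alpha>"
 using r(2) by (simp_all add: z_def complex_eq_iff)
 have le: "cos \<beta> * eta_ip A A' + sin \<beta> * eta_ip B B' <= r" for \<beta>
 proof -
 have "cos \<beta> * eta_ip A A' + sin \<beta> * eta_ip B B' = r * cos (\<beta> - \<alpha>)" unfolding ip by (simp add: cos_diff algebra_simps)
 also have "... <= r * 1" using r(1) by (intro mult_left_mono) auto
 finally show ?thesis by simp
 qed
 have eq: "cos \<alpha> * eta_ip A A' + sin \<alpha> * eta_ip B B' = r"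
 proof -
 have "cos \<alpha> * eta_ip A A' + sin \<alpha> * eta_ip B B' = r * ((cos \<alpha>)\<^sup>2 + (sin \<alpha>)\<^sup>2)" unfolding ip by algebra
 then show ?thesis by (simp only: sin_cos_squared_add2 mult_1_right)
 qed
 define N where "N \<beta> = H1_norm (%x. Complex (A x) (B x) - exp (\<i> * of_real \<beta>) * of_real (eta x))" for \<beta>
 have "H1_dist (%x. Complex (A x) (B x)) ground_orbit = Inf (range N)"
 unfolding H1_dist_def ground_orbit_def N_def[abs_def] by (rule arg_cong[of _ _ Inf]) (auto simp: image_def)
 also have "... = N \<alpha>"
 proof (rule cInf_eq_minimum)
 fix y assume "y \<in> range N"
 then obtain \<beta> where "y = N \<beta>" by blast
 then show "N \<alpha> <= y" unfolding N_def dist_to_orbit_point[OF A B] using le[of \<beta>] eq by simp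
 qed auto
 finally have d: "H1_dist (%x. Complex (A x) (B x)) ground_orbit =
 sqrt (nrm A A' + nrm B B' + nrm eta eta1 - 2 * (cos \<alpha> * eta_ip A A' + sin \<alpha> * eta_ip B B'))"
 unfolding N_def dist_to_orbit_point[OF A B] .
 have "(eta_ip A A')\<^sup>2 + (eta_ip B B')\<^sup>2 = r\<^sup>2 * ((cos \<alpha>)\<^sup>2 + (sin \<alpha>)\<^sup>2)" unfolding ip by (simp only: power_mult_distrib distrib_left)
 then have "(eta_ip A A')\<^sup>2 + (eta_ip B B')\<^sup>2 = r\<^sup>2" by simp
 then have "cos \<alpha> * eta_ip A A' + sin \<alpha> * eta_ip B B' = sqrt ((eta_ip A A')\<^sup>2 + (eta_ip B B')\<^sup>2)"
 using eq r(1) by simp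
 then show thesis using that[of "cos \<alpha>" "sin \<alpha>", OF _ _ d] by (simp add: ip)
qed

lemma orbit_dist_formula:
 assumes "W A A'" "W B B'"
 shows "H1_dist (%x. Complex (A x) (B x)) ground_orbit =
 sqrt (nrm A A' + nrm B B' + nrm eta eta1 - 2 * sqrt ((eta_ip A A')\<^sup>2 + (eta_ip B B')\<^sup>2))"
 using orbit_dist_attained[OF assms] by metis

definition mass :: "(real => real) => (real => real) => real" where
 "mass A B = (LINT x|lborel. (A x)\<^sup>2 + (B x)\<^sup>2)"

abbreviation "act_eta \<equiv> action eta eta1 (%x. 0) (%x. 0)"

text \<open>After the optimal rotation the squared distance is the sum of the squared norms of the
  real deviation \<open>u\<close> and the imaginary deviation \<open>v\<close>. Nothing forces
  \<open>u\<close> to be orthogonal to \<open>eta\<close>; that component is recovered from the mass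
  defect instead, so the mass need not equal one.\<close>

theorem orbit_stability:
 obtains c :: real where "c > 0"
 "!!A A' B B' d. W A A' ==> W B B' ==> d = H1_dist (%x. Complex (A x) (B x)) ground_orbit ==>
 (\<forall>x. A (- x) = A x) ==> (\<forall>x. B (- x) = B x) ==>
 c * d\<^sup>2 <= action A A' B B' - act_eta + (mass A B - 1)\<^sup>2 / 4 + 2 * d ^ 3 + 2 * d ^ 4"
 "!!A A' B B' d. W A A' ==> W B B' ==> d = H1_dist (%x. Complex (A x) (B x)) ground_orbit ==>
 0 <= d \<and> action A A' B B' - act_eta <= d\<^sup>2 + 2 * d ^ 3 + d ^ 4 \<and> \<bar>mass A B - 1\<bar> <= 2 * d + d\<^sup>2
 \<and> nrm A A' + nrm B B' <= 2 * nrm eta eta1 + 2 * d\<^sup>2"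
proof (rule action_stability)
 fix c :: real
 assume c: "c > 0"
 and lower: "!!u u' v v'. W u u' ==> W v v' ==> (!!x. u (- x) = u x) ==> bil (%x. 1) v v' eta eta1 = 0 ==>
 c * (nrm u u' + nrm v v') <= action (%x. eta x + u x) (%x. eta1 x + u' x) v v' - act_eta
 + (LINT x|lborel. eta x * u x)\<^sup>2 / 2 + 2 * sqrt (nrm u u' + nrm v v') * (nrm u u' + nrm v v') + (nrm u u' + nrm v v')\<^sup>2"
 and upper: "!!u u' v v'. W u u' ==> W v v' ==>
 action (%x. eta x + u x) (%x. eta1 x + u' x) v v' - act_eta
 <= (nrm u u' + nrm v v') + 2 * sqrt (nrm u u' + nrm v v') * (nrm u u' + nrm v v') + (nrm u u' + nrm v v')\<^sup>2"
 have key: "0 <= d \<and> action A A' B B' - act_eta <= d\<^sup>2 + 2 * d ^ 3 + d ^ 4 \<and> \<bar>mass A B - 1\<bar> <= 2 * d + d\<^sup>2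
 \<and> nrm A A' + nrm B B' <= 2 * nrm eta eta1 + 2 * d\<^sup>2 \<and>
 ((\<forall>x. A (- x) = A x) --> (\<forall>x. B (- x) = B x) -->
 c * d\<^sup>2 <= action A A' B B' - act_eta + (mass A B - 1)\<^sup>2 / 4 + 2 * d ^ 3 + 2 * d ^ 4)"
 if A: "W A A'" and B: "W B B'" and d: "d = H1_dist (%x. Complex (A x) (B x)) ground_orbit" for A A' B B' d
 proof -
 obtain c' s where cs: "c'\<^sup>2 + s\<^sup>2 = (1::real)" "c' * eta_ip B B' - s * eta_ip A A' = 0"
 and ds: "d = sqrt (nrm A A' + nrm B B' + nrm eta eta1 - 2 * (c' * eta_ip A A' + s * eta_ip B B'))"
 unfolding d by (rule orbit_dist_attained[OF A B])
 define U where "U x = c' * A x + s * B x" for x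
 define U' where "U' x = c' * A' x + s * B' x" for x
 define v where "v x = (- s) * A x + c' * B x" for x
 define v' where "v' x = (- s) * A' x + c' * B' x" for x
 define u where "u x = U x + (- 1) * eta x" for x
 define u' where "u' x = U' x + (- 1) * eta1 x" for x
 have WU: "W U U'" and Wv: "W v v'" unfolding U_def[abs_def] U'_def[abs_def] v_def[abs_def] v'_def[abs_def]
 by (rule W_cmb[OF A B])+
 have Wu: "W u u'" unfolding u_def[abs_def] u'_def[abs_def] by (rule W_add[OF WU W_eta])
 have rot: "(c' * a + s * b)\<^sup>2 + ((- s) * a + c' * b)\<^sup>2 = a\<^sup>2 + b\<^sup>2" for a b
 proof -
 have "(c' * a + s * b)\<^sup>2 + ((- s) * a + c' * b)\<^sup>2 = (c'\<^sup>2 + s\<^sup>2) * (a\<^sup>2 + b\<^sup>2)"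
 by (simp add: power2_eq_square algebra_simps)
 then show ?thesis using cs(1) by simp
 qed
 have rotx: "(U x)\<^sup>2 + (v x)\<^sup>2 = (A x)\<^sup>2 + (B x)\<^sup>2" "(U' x)\<^sup>2 + (v' x)\<^sup>2 = (A' x)\<^sup>2 + (B' x)\<^sup>2" for x
 unfolding U_def v_def U'_def v'_def by (rule rot)+
 have nUv: "nrm U U' + nrm v v' = nrm A A' + nrm B B'"
 proof -
 have "nrm U U' + nrm v v' = (LINT x|lborel. ((U x)\<^sup>2 + (v x)\<^sup>2) + ((U' x)\<^sup>2 + (v' x)\<^sup>2))"
 unfolding nrm_split[OF WU] nrm_split[OF Wv] using W_sq[OF WU] W_sq[OF Wv] by simp
 also have "... = nrm A A' + nrm B B'"
 unfolding rotx nrm_split[OF A] nrm_split[OF B] using W_sq[OF A] W_sq[OF B] by simp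
 finally show ?thesis .
 qed
 have bv: "bil (%x. 1) v v' eta eta1 = 0"
 unfolding v_def[abs_def] v'_def[abs_def] bil_cmb[OF A B W_eta] using cs(2) by (simp add: eta_ip_def algebra_simps)
 have bU: "bil (%x. 1) U U' eta eta1 = c' * eta_ip A A' + s * eta_ip B B'"
 unfolding U_def[abs_def] U'_def[abs_def] bil_cmb[OF A B W_eta] by (simp add: eta_ip_def)
 define Dd where "Dd = nrm u u' + nrm v v'"
 have D0: "Dd >= 0" using nrm_nonneg by (simp add: Dd_def)
 have "nrm u u' = nrm U U' - 2 * (c' * eta_ip A A' + s * eta_ip B B') + nrm eta eta1"
 unfolding u_def[abs_def] u'_def[abs_def] nrm_add[OF WU W_eta] bU by simp
 then have "d = sqrt Dd" using nUv ds by (simp add: Dd_def algebra_simps)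
 then have d0: "d >= 0" and dD: "Dd = d\<^sup>2" using D0 by auto
 have eu: "(%x. eta x + u x) = U" "(%x. eta1 x + u' x) = U'" by (auto simp: u_def u'_def)
 have act: "action U U' v v' = action A A' B B'" unfolding action_def rotx ..
 have mas: "mass A B = 1 + 2 * (LINT x|lborel. eta x * u x) + mass u v"
 using mass_expansion[OF Wu Wv] unfolding eu rotx[symmetric] mass_def
 by (metis (mono_tags, lifting) Bochner_Integration.integral_cong eu(1))
 have mD: "0 <= mass u v" "mass u v <= d\<^sup>2"
 proof -
 show "0 <= mass u v" unfolding mass_def by (intro integral_nonneg_AE) auto
 have "mass u v = (LINT x|lborel. (u x)\<^sup>2) + (LINT x|lborel. (v x)\<^sup>2)"
 unfolding mass_def using W_sq[OF Wu] W_sq[OF Wv] by simp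
 then show "mass u v <= d\<^sup>2"
 using nrm_split[OF Wu] nrm_split[OF Wv] int_sq_nonneg[of u'] int_sq_nonneg[of v'] dD unfolding Dd_def by linarith
 qed
 define m where "m = (LINT x|lborel. eta x * u x)"
 have m2: "m\<^sup>2 <= d\<^sup>2"
 proof -
 have "0 <= (LINT x|lborel. (u x + (- m) * eta x)\<^sup>2)" by (rule int_sq_nonneg)
 also have "... = (LINT x|lborel. ((u x)\<^sup>2 - 2 * m * (eta x * u x)) + m\<^sup>2 * (eta x)\<^sup>2)"
 by (rule Bochner_Integration.integral_cong) (auto simp: power2_eq_square algebra_simps)
 also have "... = ((LINT x|lborel. (u x)\<^sup>2) - 2 * m * m) + m\<^sup>2 * 1"
 using W_sq[OF Wu] W_int(1)[OF W_eta Wu] W_sq[OF W_eta] int_eta_sq by (simp add: m_def)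
 finally have "m\<^sup>2 <= (LINT x|lborel. (u x)\<^sup>2)" by (simp add: power2_eq_square)
 then show ?thesis using nrm_split[OF Wu] int_sq_nonneg[of u'] nrm_nonneg[of v v'] dD unfolding Dd_def by linarith
 qed
 have md: "\<bar>m\<bar> <= d" using m2 d0 by (metis abs_le_square_iff abs_of_nonneg)
 have up: "action A A' B B' - act_eta <= d\<^sup>2 + 2 * d ^ 3 + d ^ 4"
 using upper[OF Wu Wv] unfolding eu act Dd_def[symmetric] dD using d0
 by (simp add: power2_eq_square power3_eq_cube power4_eq_xxxx mult.assoc)
 have ma: "\<bar>mass A B - 1\<bar> <= 2 * d + d\<^sup>2"
 using mas mD md unfolding m_def[symmetric] by linarith
 have nn: "nrm A A' + nrm B B' <= 2 * nrm eta eta1 + 2 * d\<^sup>2"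
 proof -
 have "nrm (%x. u x + 1 * eta x) (%x. u' x + 1 * eta1 x) <= 2 * nrm u u' + 2 * nrm eta eta1"
 using nrm_add[OF Wu W_eta, of 1] nrm_add[OF Wu W_eta, of "-1"] nrm_nonneg[of "%x. u x + (-1) * eta x" "%x. u' x + (-1) * eta1 x"]
 by simp
 moreover have "(%x. u x + 1 * eta x) = U" "(%x. u' x + 1 * eta1 x) = U'" by (auto simp: u_def u'_def)
 ultimately have "nrm U U' <= 2 * nrm u u' + 2 * nrm eta eta1" by simp
 then show ?thesis using nUv dD nrm_nonneg[of v v'] unfolding Dd_def by linarith
 qed
 have lo: "c * d\<^sup>2 <= action A A' B B' - act_eta + (mass A B - 1)\<^sup>2 / 4 + 2 * d ^ 3 + 2 * d ^ 4"
 if e: "\<forall>x. A (- x) = A x" "\<forall>x. B (- x) = B x"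
 proof -
 have "eta (- x) = eta x" for x by (simp add: ground_state_def)
 then have ue: "u (- x) = u x" for x using e by (simp add: u_def U_def)
 have 1: "c * d\<^sup>2 <= action A A' B B' - act_eta + m\<^sup>2 / 2 + 2 * d ^ 3 + d ^ 4"
 using lower[OF Wu Wv ue bv] unfolding eu act Dd_def[symmetric] dD m_def[symmetric] using d0
 by (simp add: power2_eq_square power3_eq_cube power4_eq_xxxx mult.assoc)
 \<comment> \<open>The mass depends on \<open>m\<close> linearly, with factor 2, up to the mass of
   the deviation, which is at most d^2.\<close>
 have "\<bar>2 * m\<bar> <= \<bar>mass A B - 1\<bar> + d\<^sup>2" using mas mD unfolding m_def[symmetric] by linarith
 then have "(2 * m)\<^sup>2 <= (\<bar>mass A B - 1\<bar> + d\<^sup>2)\<^sup>2" by (metis abs_ge_zero power2_abs power_mono)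
 also have "... <= 2 * (mass A B - 1)\<^sup>2 + 2 * (d\<^sup>2)\<^sup>2"
 using zero_le_power2[of "\<bar>mass A B - 1\<bar> - d\<^sup>2"] by (simp add: power2_sum power2_diff)
 finally have "m\<^sup>2 / 2 <= (mass A B - 1)\<^sup>2 / 4 + d ^ 4 / 4" by (simp add: power_mult_distrib)
 moreover have "0 <= d ^ 4" by simp
 ultimately show ?thesis using 1 by linarith
 qed
 show ?thesis using d0 up ma nn lo by blast
 qed
 show thesis
 proof (rule that[OF c])
 fix A A' B B' d
 assume a: "W A A'" "W B B'" "d = H1_dist (%x. Complex (A x) (B x)) ground_orbit"
 show "0 <= d \<and> action A A' B B' - act_eta <= d\<^sup>2 + 2 * d ^ 3 + d ^ 4 \<and> \<bar>mass A B - 1\<bar> <= 2 * d + d\<^sup>2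
 \<and> nrm A A' + nrm B B' <= 2 * nrm eta eta1 + 2 * d\<^sup>2"
 using key[OF a] by (elim conjE) (intro conjI)
 assume e: "\<forall>x. A (- x) = A x" "\<forall>x. B (- x) = B x"
 show "c * d\<^sup>2 <= action A A' B B' - act_eta + (mass A B - 1)\<^sup>2 / 4 + 2 * d ^ 3 + 2 * d ^ 4"
 using key[OF a] e by (elim conjE) (rule mp, erule mp, assumption+)
 qed
qed

section \<open>Piecewise linear interpolation and discrete functionals\<close>

definition supp :: "nat => (int => 'a::zero) => bool" where
 "supp K f \<longleftrightarrow> (\<forall>j. \<bar>j\<bar> > int K --> f j = 0)"

definition pl :: "real => nat => (int => real) => real => real" where
 "pl h K a x = (\<Sum>i=-int K..int K. a i * hat (x / h - of_int i))"

definition hat1 :: "real => real => real" where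
 "hat1 h y = (if -1 < y \<and> y < 0 then 1 / h else if 0 < y \<and> y < 1 then - 1 / h else 0)"

definition pl' :: "real => nat => (int => real) => real => real" where
 "pl' h K a x = (\<Sum>i=-int K..int K. a i * hat1 h (x / h - of_int i))"

lemma W_zero: "W (%x. 0) (%x. 0)"
 by (auto simp: W_def intro!: exI[of _ "{}"] derivative_eq_intros)

lemma W_hat:
 assumes h: "h > 0"
 shows "W (%x. hat (x / h - of_int i)) (%x. hat1 h (x / h - of_int i))"
 unfolding W_def
proof (intro conjI exI[of _ "{(of_int i - 1) * h, of_int i * h, (of_int i + 1) * h}"] allI impI)
 let ?y = "%x::real. x / h - of_int i"
 show "continuous_on UNIV (%x. hat (?y x))" unfolding hat_def by (intro continuous_intros) (use h in auto)
 show "finite {(real_of_int i - 1) * h, of_int i * h, (of_int i + 1) * h}" by simp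
 fix x assume "x \<notin> {(of_int i - 1) * h, of_int i * h, (of_int i + 1) * h}"
 then have n: "?y x ~= -1" "?y x ~= 0" "?y x ~= 1" using h by (auto simp: field_simps)
 have c: "isCont ?y x" by (intro continuous_intros) (use h in auto)
 have ev: "eventually (%z. ?y z \<in> T) (nhds x)" if "open T" "?y x \<in> T" for T
 using c that unfolding continuous_at_open
 by (metis (mono_tags, lifting) c eventually_nhds isCont_def tendsto_def topological_tendstoD tendsto_at_iff_tendsto_nhds)
 have d: "((%x. hat (?y x)) has_real_derivative D) (at x)"
 if "open T" "?y x \<in> T" "!!y. y \<in> T ==> hat y = g y" "((%x. g (?y x)) has_real_derivative D) (at x)" for T g D
 by (rule DERIV_cong_ev[THEN iffD1, OF refl _ refl that(4)])
 (rule eventually_mono[OF ev[OF that(1,2)]], simp add: that(3))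
 consider "?y x < -1 \<or> ?y x > 1" | "-1 < ?y x" "?y x < 0" | "0 < ?y x" "?y x < 1" using n by linarith
 then show "((%x. hat (?y x)) has_real_derivative hat1 h (?y x)) (at x)"
 proof cases
 case 1
 show ?thesis by (rule d[of "- {-1..1}" "%y. 0"]) (use 1 in \<open>auto simp: hat_def hat1_def\<close>)
 next
 case 2
 show ?thesis by (rule d[of "{-1<..<0}" "%y. 1 + y"]) (use 2 h in \<open>auto simp: hat_def hat1_def intro!: derivative_eq_intros\<close>)
 next
 case 3
 show ?thesis by (rule d[of "{0<..<1}" "%y. 1 - y"]) (use 3 h in \<open>auto simp: hat_def hat1_def intro!: derivative_eq_intros\<close>)
 qed
next
 let ?y = "%x::real. x / h - of_int i"
 show m: "(%x. hat1 h (?y x)) \<in> borel_measurable borel" unfolding hat1_def by measurable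
 have mh: "(%x. hat (?y x)) \<in> borel_measurable borel" unfolding hat_def by measurable
 have ind: "integrable lborel (%x. C * indicator {(of_int i - 1) * h..(of_int i + 1) * h} x :: real)" for C
 by (rule integrable_mult_right) (use emeasure_bounded_finite[OF bounded_closed_interval] in \<open>simp add: integrable_indicator_iff\<close>)
 have out: "\<bar>?y x\<bar> <= 1 ==> x \<in> {(of_int i - 1) * h..(of_int i + 1) * h}" for x
 using h by (auto simp: abs_le_iff field_simps)
 show "integrable lborel (%x. (hat (?y x))\<^sup>2)"
 proof (rule Bochner_Integration.integrable_bound[OF ind[of 1]])
 show "AE x in lborel. norm ((hat (?y x))\<^sup>2) <= norm (1 * indicator {(of_int i - 1) * h..(of_int i + 1) * h} x :: real)"
 proof (rule AE_I2)
 fix x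
 show "norm ((hat (?y x))\<^sup>2) <= norm (1 * indicator {(of_int i - 1) * h..(of_int i + 1) * h} x :: real)"
 using out[of x] by (cases "\<bar>?y x\<bar> <= 1") (auto simp: hat_def power_le_one)
 qed
 qed (use mh in measurable)
 show "integrable lborel (%x. (hat1 h (?y x))\<^sup>2)"
 proof (rule Bochner_Integration.integrable_bound[OF ind[of "1 / h\<^sup>2"]])
 show "AE x in lborel. norm ((hat1 h (?y x))\<^sup>2) <= norm (1 / h\<^sup>2 * indicator {(of_int i - 1) * h..(of_int i + 1) * h} x :: real)"
 proof (rule AE_I2)
 fix x
 show "norm ((hat1 h (?y x))\<^sup>2) <= norm (1 / h\<^sup>2 * indicator {(of_int i - 1) * h..(of_int i + 1) * h} x :: real)"
 using out[of x] by (cases "\<bar>?y x\<bar> <= 1") (auto simp: hat1_def power_divide)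
 qed
 qed (use m in measurable)
 have z: "hat (?y x) = 0" if "x > (of_int i + 1) * h \<or> x < (of_int i - 1) * h" for x
 using that h by (auto simp: hat_def field_simps)
 have "eventually (%x. hat (?y x) = 0) at_top"
 by (rule eventually_mono[OF eventually_gt_at_top[of "(of_int i + 1) * h"]]) (simp add: z)
 then show "((%x. hat (?y x)) \<longlongrightarrow> 0) at_top" by (rule tendsto_eventually)
 have "eventually (%x. x < (of_int i - 1) * h) at_bot" by (simp add: eventually_at_bot_dense)
 then have "eventually (%x. hat (?y x) = 0) at_bot" by (rule eventually_mono) (simp add: z)
 then show "((%x. hat (?y x)) \<longlongrightarrow> 0) at_bot" by (rule tendsto_eventually)
qed

lemma W_sum:
 assumes "finite I" "!!i. i \<in> I ==> W (f i) (f' i)"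
 shows "W (%x. \<Sum>i\<in>I. c i * f i x) (%x. \<Sum>i\<in>I. c i * f' i x)"
 "eta_ip (%x. \<Sum>i\<in>I. c i * f i x) (%x. \<Sum>i\<in>I. c i * f' i x) = (\<Sum>i\<in>I. c i * eta_ip (f i) (f' i))"
proof -
 have "W (%x. \<Sum>i\<in>I. c i * f i x) (%x. \<Sum>i\<in>I. c i * f' i x) \<and>
 eta_ip (%x. \<Sum>i\<in>I. c i * f i x) (%x. \<Sum>i\<in>I. c i * f' i x) = (\<Sum>i\<in>I. c i * eta_ip (f i) (f' i))"
 using assms
 proof (induction I)
 case empty
 then show ?case by (auto simp: W_zero eta_ip_def bil_def)
 next
 case (insert i I)
 then have W: "W (%x. \<Sum>i\<in>I. c i * f i x) (%x. \<Sum>i\<in>I. c i * f' i x)" "W (f i) (f' i)" by auto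
 have "(%x. \<Sum>i\<in>insert i I. c i * f i x) = (%x. (\<Sum>i\<in>I. c i * f i x) + c i * f i x)"
 "(%x. \<Sum>i\<in>insert i I. c i * f' i x) = (%x. (\<Sum>i\<in>I. c i * f' i x) + c i * f' i x)"
 using insert.hyps by (auto simp: add.commute)
 then show ?case using W_add[OF W] bil_add[OF W W_eta] insert by (simp add: eta_ip_def)
 qed
 then show "W (%x. \<Sum>i\<in>I. c i * f i x) (%x. \<Sum>i\<in>I. c i * f' i x)"
 "eta_ip (%x. \<Sum>i\<in>I. c i * f i x) (%x. \<Sum>i\<in>I. c i * f' i x) = (\<Sum>i\<in>I. c i * eta_ip (f i) (f' i))" by auto
qed

lemma W_pl: "h > 0 ==> W (pl h K a) (pl' h K a)"
 unfolding pl_def[abs_def] pl'_def[abs_def] by (intro W_sum W_hat) auto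

lemma eta_ip_pl:
 "h > 0 ==> eta_ip (pl h K a) (pl' h K a) =
 (\<Sum>i=-int K..int K. a i * eta_ip (%x. hat (x / h - of_int i)) (%x. hat1 h (x / h - of_int i)))"
 unfolding pl_def[abs_def] pl'_def[abs_def] by (intro W_sum W_hat) auto

lemma two_term_sum:
 assumes "supp K (a :: int => real)"
 shows "(\<Sum>i=-int K..int K. a i * (if i = j then p else if i = j + 1 then q else 0)) = a j * p + a (j + 1) * q"
proof -
 have "(\<Sum>i=-int K..int K. a i * (if i = j then p else if i = j + 1 then q else 0))
 = (\<Sum>i=-int K..int K. (if i = j then a i * p else 0)) + (\<Sum>i=-int K..int K. (if i = j + 1 then a i * q else 0))"
 unfolding sum.distrib[symmetric] by (rule sum.cong) auto
 then show ?thesis using assms by (auto simp: sum.delta supp_def)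
qed

lemma pl_cell:
 assumes s: "supp K a" and h: "h > 0" and x: "of_int j <= x / h" "x / h <= of_int (j + 1)"
 shows "pl h K a x = a j + (x / h - of_int j) * (a (j + 1) - a j)"
proof -
 have "hat (x / h - of_int i) = (if i = j then 1 - (x / h - of_int j) else if i = j + 1 then x / h - of_int j else 0)" for i
 proof -
 consider "i = j" | "i = j + 1" | "i <= j - 1" | "i >= j + 2" by linarith
 then show ?thesis
 proof cases
 case 3
 then have "real_of_int i <= of_int (j - 1)" by (simp only: of_int_le_iff)
 then show ?thesis using x 3 by (auto simp: hat_def)
 next
 case 4
 then have "real_of_int (j + 2) <= of_int i" by (simp only: of_int_le_iff)
 then show ?thesis using x 4 by (auto simp: hat_def)
 qed (use x in \<open>auto simp: hat_def\<close>)
 qed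
 then show ?thesis unfolding pl_def using two_term_sum[OF s] by (simp add: algebra_simps)
qed

lemma pl'_cell:
 assumes s: "supp K a" and h: "h > 0" and x: "of_int j < x / h" "x / h < of_int (j + 1)"
 shows "pl' h K a x = (a (j + 1) - a j) / h"
proof -
 have "hat1 h (x / h - of_int i) = (if i = j then - 1 / h else if i = j + 1 then 1 / h else 0)" for i
 proof -
 consider "i = j" | "i = j + 1" | "i <= j - 1" | "i >= j + 2" by linarith
 then show ?thesis
 proof cases
 case 3
 then have "real_of_int i <= of_int (j - 1)" by (simp only: of_int_le_iff)
 then show ?thesis using x 3 by (auto simp: hat1_def)
 next
 case 4
 then have "real_of_int (j + 2) <= of_int i" by (simp only: of_int_le_iff)
 then show ?thesis using x 4 by (auto simp: hat1_def)
 qed (use x in \<open>auto simp: hat1_def\<close>)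
 qed
 then show ?thesis unfolding pl'_def using two_term_sum[OF s] by (simp add: diff_divide_distrib)
qed

lemma cell_integral:
 fixes f :: "real => real"
 assumes h: "h > 0" and m: "f \<in> borel_measurable borel" and I: "finite I"
 and cell: "!!j x. of_int j < x / h ==> x / h < of_int (j + 1) ==> f x = q j (x / h - of_int j)"
 and der: "!!j t. (Q j has_real_derivative q j t) (at t)" and cont: "!!j t. isCont (q j) t"
 and zero: "!!j t. j \<notin> I ==> q j t = 0"
 shows "(LINT x|lborel. f x) = h * (\<Sum>j\<in>I. Q j 1 - Q j 0)"
proof -
 define g where "g j x = q j (x / h - of_int j) * indicator {of_int j * h .. of_int (j + 1) * h} x" for j x
 have g: "has_bochner_integral lborel (g j) (h * (Q j 1 - Q j 0))" for j
 proof -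
 have "has_bochner_integral lborel (%x. q j (x / h - of_int j) * indicator {of_int j * h .. of_int (j + 1) * h} x)
 (h * Q j (of_int (j + 1) * h / h - of_int j) - h * Q j (of_int j * h / h - of_int j))"
 proof (rule has_bochner_integral_FTC_Icc_real)
 show "of_int j * h <= of_int (j + 1) * h" using h by simp
 fix x
 have "((%x. Q j (x / h - of_int j)) has_real_derivative q j (x / h - of_int j) * (1 / h)) (at x)"
 by (rule DERIV_chain2[OF der]) (use h in \<open>auto intro!: derivative_eq_intros\<close>)
 from DERIV_cmult[OF this, of h]
 show "((%x. h * Q j (x / h - of_int j)) has_real_derivative q j (x / h - of_int j)) (at x)" using h by simp
 show "isCont (%x. q j (x / h - of_int j)) x"
 by (rule continuous_within_compose3[OF cont]) (use h in \<open>auto intro!: continuous_intros\<close>)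
 qed
 then show ?thesis using h by (simp add: g_def[abs_def] right_diff_distrib)
 qed
 have "AE x in lborel. x \<notin> range (%j::int. of_int j * h)"
 by (intro AE_not_in countable_imp_null_set_lborel) auto
 then have ae: "AE x in lborel. f x = (\<Sum>j\<in>I. g j x)"
 proof eventually_elim
 case (elim x)
 define j where "j = \<lfloor>x / h\<rfloor>"
 have "x / h ~= of_int j" using elim h by (auto simp: field_simps)
 then have j: "of_int j < x / h" "x / h < of_int (j + 1)" unfolding j_def by linarith+
 have iff: "x \<in> {of_int i * h .. of_int (i + 1) * h} \<longleftrightarrow> i = j" for i
 proof -
 have "x \<in> {of_int i * h .. of_int (i + 1) * h} \<longleftrightarrow> of_int i <= x / h \<and> x / h <= of_int (i + 1)"
 using h by (simp add: field_simps)
 also have "... \<longleftrightarrow> i = j"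
 proof
 assume a: "of_int i <= x / h \<and> x / h <= of_int (i + 1)"
 have "real_of_int i < of_int (j + 1)" "real_of_int j < of_int (i + 1)" using a j by linarith+
 then show "i = j" unfolding of_int_less_iff by linarith
 qed (use j in auto)
 finally show ?thesis .
 qed
 have "(\<Sum>i\<in>I. g i x) = (\<Sum>i\<in>I. if i = j then q j (x / h - of_int j) else 0)"
 by (rule sum.cong) (auto simp: g_def indicator_def iff simp del: atLeastAtMost_iff of_int_add)
 also have "... = q j (x / h - of_int j)" using I zero[of j] by (simp add: sum.delta)
 finally show ?case using cell[OF j] by simp
 qed
 have gi: "integrable lborel (g j)" "integral\<^sup>L lborel (g j) = h * (Q j 1 - Q j 0)" for j
 using g[of j] by (auto simp: has_bochner_integral_iff)
 have "(LINT x|lborel. f x) = (LINT x|lborel. (\<Sum>j\<in>I. g j x))"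
 by (rule integral_cong_AE[OF _ _ ae]) (use m gi(1) in \<open>auto dest: borel_measurable_integrable\<close>)
 also have "... = (\<Sum>j\<in>I. h * (Q j 1 - Q j 0))" using gi by (subst Bochner_Integration.integral_sum) auto
 finally show ?thesis by (simp add: sum_distrib_left)
qed

text \<open>The cell j stands for the interval from j h to (j + 1) h. The leftmost one, -K - 1,
  carries the difference between the zero boundary value and the first node.\<close>

abbreviation cells :: "nat => int set" where "cells K \<equiv> {- int K - 1..int K}"

definition nK :: "real => nat => (int => complex) => real" where
 "nK h K \<psi> = h * (\<Sum>j\<in>cells K. (cmod (\<psi> j))\<^sup>2)"

definition dK :: "real => nat => (int => complex) => real" where
 "dK h K \<psi> = (\<Sum>j\<in>cells K. (cmod (\<psi> (j + 1) - \<psi> j))\<^sup>2) / h"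

definition qK :: "real => nat => (int => complex) => real" where
 "qK h K \<psi> = h * (\<Sum>j\<in>cells K. (cmod (\<psi> j)) ^ 4)"

lemma supp_shift:
 fixes f :: "int => 'a::comm_monoid_add"
 assumes "supp K f"
 shows "(\<Sum>j\<in>cells K. f (j + 1)) = (\<Sum>j\<in>cells K. f j)"
proof -
 have "(\<Sum>j\<in>cells K. f (j + 1)) = (\<Sum>j\<in>{- int K..int K + 1}. f j)"
 by (rule sum.reindex_bij_witness[of _ "%j. j - 1" "%j. j + 1"]) auto
 also have "... = (\<Sum>j\<in>{- int K..int K}. f j)"
 by (rule sum.mono_neutral_right) (use assms in \<open>auto simp: supp_def\<close>)
 also have "... = (\<Sum>j\<in>cells K. f j)"
 by (rule sum.mono_neutral_left) (use assms in \<open>auto simp: supp_def\<close>)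
 finally show ?thesis .
qed

lemma interp_pl:
 assumes s: "supp K \<psi>"
 shows "interp h \<psi> = (%x. Complex (pl h K (%j. Re (\<psi> j)) x) (pl h K (%j. Im (\<psi> j)) x))"
proof
 fix x
 have "interp h \<psi> x = (\<Sum>\<^sub>\<infinity>j\<in>{- int K..int K}. \<psi> j * of_real (hat (x / h - of_int j)))"
 unfolding interp_def by (rule infsum_cong_neutral) (use s in \<open>auto simp: supp_def\<close>)
 also have "... = (\<Sum>j=- int K..int K. \<psi> j * of_real (hat (x / h - of_int j)))" by simp
 finally show "interp h \<psi> x = Complex (pl h K (%j. Re (\<psi> j)) x) (pl h K (%j. Im (\<psi> j)) x)"
 by (simp add: complex_eq_iff pl_def)
qed

lemma pl_even:
 assumes "!!j. a (- j) = a j"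
 shows "pl h K a (- x) = pl h K a x"
proof -
 have "hat (- x / h - of_int i) = hat (x / h - of_int (- i))" for i
 by (simp add: hat_def abs_minus_commute[of "- (x / h)"])
 then have "pl h K a (- x) = (\<Sum>i=-int K..int K. a (- i) * hat (x / h - of_int (- i)))"
 unfolding pl_def by (simp only: assms)
 also have "... = pl h K a x" unfolding pl_def
 by (rule sum.reindex_bij_witness[of _ "%i. - i" "%i. - i"]) auto
 finally show ?thesis .
qed

locale grid =
 fixes h :: real and K :: nat and \<psi> :: "int => complex"
 assumes h: "h > 0" and s: "supp K \<psi>"
begin

text \<open>On cell j, with local coordinate t, the squared modulus of the interpolant is P + t Q +
  t^2 R.\<close>

definition "P j = (cmod (\<psi> j))\<^sup>2"
definition "R j = (cmod (\<psi> (j + 1) - \<psi> j))\<^sup>2"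
definition "Q j = 2 * (\<psi> j \<bullet> (\<psi> (j + 1) - \<psi> j))"

abbreviation "A \<equiv> pl h K (%j. Re (\<psi> j))"
abbreviation "A' \<equiv> pl' h K (%j. Re (\<psi> j))"
abbreviation "B \<equiv> pl h K (%j. Im (\<psi> j))"
abbreviation "B' \<equiv> pl' h K (%j. Im (\<psi> j))"

lemma sR: "supp K (%j. Re (\<psi> j))" and sI: "supp K (%j. Im (\<psi> j))"
 using s by (auto simp: supp_def)

lemma WA: "W A A'" and WB: "W B B'" by (rule W_pl[OF h])+

lemma meas [measurable]: "A \<in> borel_measurable borel" "A' \<in> borel_measurable borel" "B \<in> borel_measurable borel" "B' \<in> borel_measurable borel"
 using W_measurable WA WB by auto

lemma P_Suc: "P (j + 1) = P j + Q j + R j"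
 unfolding P_def Q_def R_def cmod_power2 inner_complex_def by (simp add: power2_eq_square algebra_simps)

lemma outside: "j \<notin> cells K ==> P j = 0" "j \<notin> cells K ==> Q j = 0" "j \<notin> cells K ==> R j = 0"
 using s by (auto simp: P_def Q_def R_def supp_def)

lemma PQR_nonneg: "P j >= 0" "R j >= 0"
 by (simp_all add: P_def R_def)

lemma Q_sq: "(Q j)\<^sup>2 <= 4 * (P j * R j)"
proof -
 have "\<bar>\<psi> j \<bullet> (\<psi> (j + 1) - \<psi> j)\<bar> <= cmod (\<psi> j) * cmod (\<psi> (j + 1) - \<psi> j)" by (rule Cauchy_Schwarz_ineq2)
 then have "\<bar>\<psi> j \<bullet> (\<psi> (j + 1) - \<psi> j)\<bar>\<^sup>2 <= (cmod (\<psi> j) * cmod (\<psi> (j + 1) - \<psi> j))\<^sup>2" by (rule power_mono) simp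
 then show ?thesis by (simp add: Q_def P_def R_def power_mult_distrib)
qed

lemma density_cell:
 assumes "of_int j < x / h" "x / h < of_int (j + 1)"
 shows "(A x)\<^sup>2 + (B x)\<^sup>2 = P j + (x / h - of_int j) * Q j + (x / h - of_int j)\<^sup>2 * R j"
 "(A' x)\<^sup>2 + (B' x)\<^sup>2 = R j / h\<^sup>2"
proof -
 have x: "of_int j <= x / h" "x / h <= of_int (j + 1)" using assms by auto
 have c: "(a + t * a1)\<^sup>2 + (b + t * b1)\<^sup>2 = (a\<^sup>2 + b\<^sup>2) + t * (2 * (a * a1 + b * b1)) + t\<^sup>2 * (a1\<^sup>2 + b1\<^sup>2)" for a b a1 b1 t :: real
 by (simp add: power2_eq_square algebra_simps)
 show "(A x)\<^sup>2 + (B x)\<^sup>2 = P j + (x / h - of_int j) * Q j + (x / h - of_int j)\<^sup>2 * R j"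
 unfolding pl_cell[OF sR h x] pl_cell[OF sI h x] c by (simp add: P_def Q_def R_def cmod_power2 inner_complex_def)
 show "(A' x)\<^sup>2 + (B' x)\<^sup>2 = R j / h\<^sup>2"
 unfolding pl'_cell[OF sR h assms] pl'_cell[OF sI h assms]
 by (simp add: R_def cmod_power2 power_divide add_divide_distrib)
qed

text \<open>Averaging each node with its right neighbour gives the trapezoidal rule, which agrees
  with the exact cell integral of the density up to R / 6.\<close>

lemma nK_avg: "nK h K \<psi> = h * (\<Sum>j\<in>cells K. P j + Q j / 2 + R j / 2)"
proof -
 have "supp K P" using s by (auto simp: supp_def P_def)
 then have "(\<Sum>j\<in>cells K. P j) = (\<Sum>j\<in>cells K. P j + Q j + R j)" using supp_shift[of K P] by (simp add: P_Suc)
 then have "2 * (\<Sum>j\<in>cells K. P j) = (\<Sum>j\<in>cells K. P j + (P j + Q j + R j))"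
 unfolding sum.distrib[of P "%j. P j + Q j + R j"] by linarith
 also have "... = 2 * (\<Sum>j\<in>cells K. P j + Q j / 2 + R j / 2)" unfolding sum_distrib_left by (rule sum.cong) auto
 finally show ?thesis by (simp add: nK_def P_def)
qed

lemma qK_avg: "qK h K \<psi> = h * (\<Sum>j\<in>cells K. ((P j)\<^sup>2 + (P j + Q j + R j)\<^sup>2) / 2)"
proof -
 have "supp K (%j. (P j)\<^sup>2)" using s by (auto simp: supp_def P_def)
 then have "(\<Sum>j\<in>cells K. (P j)\<^sup>2) = (\<Sum>j\<in>cells K. (P j + Q j + R j)\<^sup>2)" using supp_shift[of K "%j. (P j)\<^sup>2"] by (simp add: P_Suc)
 then have "(\<Sum>j\<in>cells K. (P j)\<^sup>2) = (\<Sum>j\<in>cells K. ((P j)\<^sup>2 + (P j + Q j + R j)\<^sup>2) / 2)"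
 unfolding sum_divide_distrib[symmetric] sum.distrib by simp
 then show ?thesis by (simp add: qK_def P_def power_mult[symmetric])
qed

lemma dK_R: "dK h K \<psi> = (\<Sum>j\<in>cells K. R j) / h" by (simp add: dK_def R_def)

lemma mass_eq: "mass A B = nK h K \<psi> - h\<^sup>2 * dK h K \<psi> / 6"
proof -
 have "mass A B = h * (\<Sum>j\<in>cells K. (P j * 1 + 1\<^sup>2 / 2 * Q j + 1 ^ 3 / 3 * R j) - (P j * 0 + 0\<^sup>2 / 2 * Q j + 0 ^ 3 / 3 * R j))"
 unfolding mass_def
 by (rule cell_integral[OF h, where q = "%j t. P j + t * Q j + t\<^sup>2 * R j" and Q = "%j t. P j * t + t\<^sup>2 / 2 * Q j + t ^ 3 / 3 * R j"])
 (use outside density_cell in \<open>auto intro!: derivative_eq_intros continuous_intros\<close>)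
 also have "... = h * (\<Sum>j\<in>cells K. (P j + Q j / 2 + R j / 2) - R j / 6)" by (simp add: algebra_simps)
 also have "... = nK h K \<psi> - h * (\<Sum>j\<in>cells K. R j) / 6"
 unfolding nK_avg sum_subtractf by (simp add: right_diff_distrib sum_divide_distrib[symmetric])
 finally show ?thesis using h by (simp add: dK_R power2_eq_square)
qed

lemma grad_eq: "(LINT x|lborel. (A' x)\<^sup>2 + (B' x)\<^sup>2) = dK h K \<psi>"
proof -
 have "(LINT x|lborel. (A' x)\<^sup>2 + (B' x)\<^sup>2) = h * (\<Sum>j\<in>cells K. R j / h\<^sup>2 * 1 - R j / h\<^sup>2 * 0)"
 proof (rule cell_integral[OF h, where q = "%j t. R j / h\<^sup>2" and Q = "%j t. R j / h\<^sup>2 * t"])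
 show "((%t. R j / h\<^sup>2 * t) has_real_derivative R j / h\<^sup>2) (at t)" for j t by (rule DERIV_cmult_Id)
 qed (use outside density_cell in \<open>auto intro: continuous_const\<close>)
 then show ?thesis using h by (simp add: dK_R sum_divide_distrib[symmetric] power2_eq_square)
qed

lemma quartic_eq: "(LINT x|lborel. ((A x)\<^sup>2 + (B x)\<^sup>2)\<^sup>2) =
 h * (\<Sum>j\<in>cells K. (P j)\<^sup>2 + P j * Q j + ((Q j)\<^sup>2 + 2 * (P j * R j)) / 3 + Q j * R j / 2 + (R j)\<^sup>2 / 5)"
proof -
 let ?Q = "%j t. (P j)\<^sup>2 * t + P j * Q j * t\<^sup>2 + ((Q j)\<^sup>2 + 2 * (P j * R j)) / 3 * t ^ 3 + Q j * R j / 2 * t ^ 4 + (R j)\<^sup>2 / 5 * t ^ 5"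
 have "(LINT x|lborel. ((A x)\<^sup>2 + (B x)\<^sup>2)\<^sup>2) = h * (\<Sum>j\<in>cells K. ?Q j 1 - ?Q j 0)"
 proof (rule cell_integral[OF h, where q = "%j t. (P j + t * Q j + t\<^sup>2 * R j)\<^sup>2"])
 fix j t
 have "((?Q j) has_real_derivative (P j)\<^sup>2 + P j * Q j * (2 * t) + ((Q j)\<^sup>2 + 2 * (P j * R j)) / 3 * (3 * t\<^sup>2)
 + Q j * R j / 2 * (4 * t ^ 3) + (R j)\<^sup>2 / 5 * (5 * t ^ 4)) (at t)"
 by (auto intro!: derivative_eq_intros)
 moreover have "(P j)\<^sup>2 + P j * Q j * (2 * t) + ((Q j)\<^sup>2 + 2 * (P j * R j)) / 3 * (3 * t\<^sup>2)
 + Q j * R j / 2 * (4 * t ^ 3) + (R j)\<^sup>2 / 5 * (5 * t ^ 4) = (P j + t * Q j + t\<^sup>2 * R j)\<^sup>2"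
 by (simp add: power2_eq_square power3_eq_cube power4_eq_xxxx field_simps)
 ultimately show "((?Q j) has_real_derivative (P j + t * Q j + t\<^sup>2 * R j)\<^sup>2) (at t)" by simp
 qed (use outside density_cell in \<open>auto intro!: continuous_intros\<close>)
 then show ?thesis by simp
qed

definition "X = nrm A A' + nrm B B'"

lemma X_eq: "X = mass A B + dK h K \<psi>"
proof -
 have "X = (LINT x|lborel. (A x)\<^sup>2) + (LINT x|lborel. (B x)\<^sup>2) + ((LINT x|lborel. (A' x)\<^sup>2) + (LINT x|lborel. (B' x)\<^sup>2))"
 unfolding X_def nrm_split[OF WA] nrm_split[OF WB] by simp
 also have "... = mass A B + (LINT x|lborel. (A' x)\<^sup>2 + (B' x)\<^sup>2)"
 unfolding mass_def using W_sq[OF WA] W_sq[OF WB] by simp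
 finally show ?thesis unfolding grad_eq .
qed

text \<open>Nodal values are values of the interpolant, so the one-dimensional sup bound transfers
  with a constant independent of \<open>h\<close> and \<open>K\<close>.\<close>

lemma P_le_X: "P j <= X"
proof -
 have e: "A (of_int j * h) = Re (\<psi> j)" "B (of_int j * h) = Im (\<psi> j)"
 using h pl_cell[OF sR h, of j "of_int j * h"] pl_cell[OF sI h, of j "of_int j * h"] by simp_all
 then show ?thesis using W_sup[OF WA, of "of_int j * h"] W_sup[OF WB, of "of_int j * h"]
 unfolding e by (simp add: X_def P_def cmod_power2)
qed

lemma dK_nonneg: "dK h K \<psi> >= 0" using h by (simp add: dK_def sum_nonneg)

lemma mass_nonneg: "mass A B >= 0" unfolding mass_def by (intro integral_nonneg_AE) auto

lemma dK_le_X: "dK h K \<psi> <= X" using X_eq mass_nonneg by simp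

text \<open>In the difference of the trapezoidal rule and the exact integral, the terms P^2 and P Q
  cancel. All others contain R or Q^2 <= 4 P R, and h times the sum of R is h^2 times the discrete
  gradient.\<close>

lemma quartic_error: "\<bar>qK h K \<psi> - (LINT x|lborel. ((A x)\<^sup>2 + (B x)\<^sup>2)\<^sup>2)\<bar> <= 5 * h\<^sup>2 * X * dK h K \<psi>"
proof -
 let ?e = "%j. P j * R j / 3 + (Q j)\<^sup>2 / 6 + Q j * R j / 2 + 3 * (R j)\<^sup>2 / 10"
 have pol: "((p)\<^sup>2 + (p + q + r)\<^sup>2) / 2 - (p\<^sup>2 + p * q + (q\<^sup>2 + 2 * (p * r)) / 3 + q * r / 2 + r\<^sup>2 / 5)
 = p * r / 3 + q\<^sup>2 / 6 + q * r / 2 + 3 * r\<^sup>2 / 10" for p q r :: real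
 by (simp add: power2_eq_square field_simps)
 then have eq: "qK h K \<psi> - (LINT x|lborel. ((A x)\<^sup>2 + (B x)\<^sup>2)\<^sup>2) = h * (\<Sum>j\<in>cells K. ?e j)"
 by (simp only: qK_avg quartic_eq right_diff_distrib[symmetric] sum_subtractf[symmetric] pol)
 have "\<bar>?e j\<bar> <= 5 * X * R j" for j
 proof -
 have X0: "X >= 0" using P_le_X[of j] PQR_nonneg(1)[of j] by linarith
 have pr: "P j * R j <= X * R j" using P_le_X PQR_nonneg(2) by (intro mult_right_mono)
 have pr0: "0 <= P j * R j" using PQR_nonneg by simp
 have r: "R j <= 4 * X"
 proof -
 have "cmod (\<psi> (j + 1) - \<psi> j) <= cmod (\<psi> (j + 1)) + cmod (\<psi> j)" by (rule norm_triangle_ineq4)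
 then have "R j <= (cmod (\<psi> (j + 1)) + cmod (\<psi> j))\<^sup>2" unfolding R_def by (rule power_mono) simp
 also have "... <= 2 * P (j + 1) + 2 * P j"
 using zero_le_power2[of "cmod (\<psi> (j + 1)) - cmod (\<psi> j)"] by (simp add: P_def power2_sum power2_diff)
 finally show ?thesis using P_le_X[of j] P_le_X[of "j + 1"] by linarith
 qed
 have rr: "(R j)\<^sup>2 <= 4 * X * R j" unfolding power2_eq_square using r PQR_nonneg(2) by (intro mult_right_mono)
 have "(Q j)\<^sup>2 <= 4 * (X * (4 * X))" using Q_sq[of j] mult_mono[OF P_le_X[of j] r X0 PQR_nonneg(2)] by linarith
 then have "(Q j)\<^sup>2 <= (4 * X)\<^sup>2" by (simp add: power2_eq_square)
 then have "\<bar>Q j\<bar> <= 4 * X" using X0 abs_le_square_iff[of "Q j" "4 * X"] by simp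
 then have qr: "\<bar>Q j * R j\<bar> <= 4 * X * R j" using PQR_nonneg(2) by (simp add: abs_mult mult_right_mono)
 have fin: "\<bar>a / 3 + b / 6 + c / 2 + 3 * d / 10\<bar> <= 5 * z"
 if "0 <= a" "a <= z" "0 <= b" "b <= 4 * a" "\<bar>c\<bar> <= 4 * z" "0 <= d" "d <= 4 * z" for a b c d z :: real
 using that by linarith
 show ?thesis using fin[OF pr0 pr zero_le_power2 Q_sq _ zero_le_power2] qr rr by (simp add: mult.assoc)
 qed
 then have "\<bar>\<Sum>j\<in>cells K. ?e j\<bar> <= (\<Sum>j\<in>cells K. 5 * X * R j)"
 by (intro order_trans[OF sum_abs] sum_mono)
 then have "h * \<bar>\<Sum>j\<in>cells K. ?e j\<bar> <= h * (5 * X * (\<Sum>j\<in>cells K. R j))"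
 using h by (simp add: sum_distrib_left[symmetric])
 then show ?thesis unfolding eq using h by (simp add: abs_mult dK_R power2_eq_square mult_ac)
qed

definition "FK = dK h K \<psi> - qK h K \<psi> / 2 + nK h K \<psi> / 16"

lemma action_eq: "action A A' B B' = dK h K \<psi> - (LINT x|lborel. ((A x)\<^sup>2 + (B x)\<^sup>2)\<^sup>2) / 2 + mass A B / 16"
proof -
 note i = W_sq[OF WA] W_sq[OF WB] quartic_int(1)[OF WA WB]
 have "action A A' B B' = (LINT x|lborel. (A' x)\<^sup>2 + (B' x)\<^sup>2) - (LINT x|lborel. ((A x)\<^sup>2 + (B x)\<^sup>2)\<^sup>2 / 2)
 + (LINT x|lborel. ((A x)\<^sup>2 + (B x)\<^sup>2) / 16)"
 unfolding action_def using i
 by (subst Bochner_Integration.integral_add, simp, simp, subst Bochner_Integration.integral_diff) simp_all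
 then show ?thesis unfolding grad_eq by (simp add: mass_def)
qed

lemma FK_action: "\<bar>FK - action A A' B B'\<bar> <= 3 * h\<^sup>2 * (X\<^sup>2 + X)"
proof -
 have X0: "X >= 0" using dK_le_X dK_nonneg by linarith
 have hX: "0 <= h\<^sup>2 * X" "0 <= h\<^sup>2 * X\<^sup>2" using X0 by auto
 have 1: "\<bar>qK h K \<psi> - (LINT x|lborel. ((A x)\<^sup>2 + (B x)\<^sup>2)\<^sup>2)\<bar> <= 5 * (h\<^sup>2 * X\<^sup>2)"
 by (rule order_trans[OF quartic_error]) (use X0 dK_le_X h in \<open>auto simp: power2_eq_square mult.assoc intro!: mult_left_mono\<close>)
 have 2: "0 <= h\<^sup>2 * dK h K \<psi>" "h\<^sup>2 * dK h K \<psi> <= h\<^sup>2 * X" using dK_nonneg dK_le_X by (auto intro: mult_left_mono)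
 have "FK - action A A' B B' = - (qK h K \<psi> - (LINT x|lborel. ((A x)\<^sup>2 + (B x)\<^sup>2)\<^sup>2)) / 2 + h\<^sup>2 * dK h K \<psi> / 96"
 unfolding FK_def action_eq mass_eq by (simp add: field_simps)
 moreover have fin: "\<bar>f\<bar> <= 3 * (a + b)" if "f = - q / 2 + e / 96" "\<bar>q\<bar> <= 5 * a" "0 <= e" "e <= b" "0 <= a" for f q e a b :: real
 using that by (simp add: abs_le_iff)
 ultimately show ?thesis using fin[OF _ 1 2 hX(2)] by (simp add: distrib_left mult.assoc)
qed

lemma nK_dK_le: assumes "h <= 1" shows "nK h K \<psi> + dK h K \<psi> <= 2 * X"
proof -
 have "h\<^sup>2 * dK h K \<psi> <= 1 * dK h K \<psi>" using assms h dK_nonneg by (intro mult_right_mono) (auto simp: power_le_one)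
 then show ?thesis using X_eq mass_eq dK_le_X dK_nonneg mass_nonneg by linarith
qed

lemma X_le: "X <= nK h K \<psi> + dK h K \<psi>"
 using X_eq mass_eq dK_nonneg by simp

end

section \<open>The discrete H1 norm and its bilinear and cubic estimates\<close>

definition hK :: "real => nat => (int => complex) => real" where
 "hK h K f = sqrt (nK h K f + dK h K f)"

definition ipK :: "nat => (int => complex) => (int => complex) => real" where
 "ipK K f g = (\<Sum>j\<in>cells K. f j \<bullet> g j)"

text \<open>The Dirichlet Laplacian without its diagonal: the diagonal is only a phase rotation, and
  removing it halves the norm bound from 4 to 2, on which the CFL condition depends.\<close>

definition shK :: "nat => (int => complex) => int => complex" where
 "shK K f j = (if \<bar>j\<bar> <= int K then f (j + 1) + f (j - 1) else 0)"

definition cubK :: "(int => complex) => (int => complex) => (int => complex) => int => complex" where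
 "cubK u v w j = u j * cnj (v j) * w j"

lemma nK_ip: "nK h K f = h * ipK K f f"
 by (simp add: nK_def ipK_def power2_norm_eq_inner)

lemma nK_nonneg: "h > 0 ==> nK h K f >= 0" by (simp add: nK_def sum_nonneg)

lemma dK_nonneg: "h > 0 ==> dK h K f >= 0" by (simp add: dK_def sum_nonneg)

lemma hK_nonneg: "h > 0 ==> hK h K f >= 0" by (simp add: hK_def nK_nonneg dK_nonneg)

lemma hK_sq: "h > 0 ==> (hK h K f)\<^sup>2 = nK h K f + dK h K f" by (simp add: hK_def nK_nonneg dK_nonneg)

lemma dK_le_hK: "h > 0 ==> dK h K f <= (hK h K f)\<^sup>2" "h > 0 ==> nK h K f <= (hK h K f)\<^sup>2"
 by (simp_all add: hK_sq nK_nonneg dK_nonneg)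

lemma cmod_le_hK: assumes "h > 0" "supp K f" shows "cmod (f j) <= hK h K f"
proof -
 interpret grid h K f by unfold_locales fact+
 have "(cmod (f j))\<^sup>2 <= (hK h K f)\<^sup>2" using P_le_X[of j] X_le assms by (simp add: hK_sq P_def)
 then show ?thesis by (rule power2_le_imp_le) (rule hK_nonneg[OF assms(1)])
qed

lemma sqrt_nK: "h > 0 ==> sqrt (nK h K f) = L2_set (%j. sqrt h * cmod (f j)) (cells K)"
 by (simp add: nK_def L2_set_def power_mult_distrib sum_distrib_left)

lemma sqrt_dK: "h > 0 ==> sqrt (dK h K f) = L2_set (%j. cmod (f (j + 1) - f j) / sqrt h) (cells K)"
 by (simp add: dK_def L2_set_def power_divide sum_divide_distrib)

lemma hK_triangle:
 assumes h: "h > 0" shows "hK h K (%j. f j + g j) <= hK h K f + hK h K g"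
proof -
 have 1: "sqrt (nK h K (%j. f j + g j)) <= sqrt (nK h K f) + sqrt (nK h K g)"
 proof -
 have "sqrt (nK h K (%j. f j + g j)) <= L2_set (%j. sqrt h * cmod (f j) + sqrt h * cmod (g j)) (cells K)"
 unfolding sqrt_nK[OF h]
 proof (rule L2_set_mono)
 fix j show "sqrt h * cmod (f j + g j) <= sqrt h * cmod (f j) + sqrt h * cmod (g j)"
 using mult_left_mono[OF norm_triangle_ineq[of "f j" "g j"], of "sqrt h"] h by (simp add: distrib_left)
 qed (use h in auto)
 also have "... <= sqrt (nK h K f) + sqrt (nK h K g)" unfolding sqrt_nK[OF h] by (rule L2_set_triangle_ineq)
 finally show ?thesis .
 qed
 have 2: "sqrt (dK h K (%j. f j + g j)) <= sqrt (dK h K f) + sqrt (dK h K g)"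
 proof -
 have "sqrt (dK h K (%j. f j + g j)) <= L2_set (%j. cmod (f (j + 1) - f j) / sqrt h + cmod (g (j + 1) - g j) / sqrt h) (cells K)"
 unfolding sqrt_dK[OF h]
 proof (rule L2_set_mono)
 fix j show "cmod (f (j + 1) + g (j + 1) - (f j + g j)) / sqrt h <= cmod (f (j + 1) - f j) / sqrt h + cmod (g (j + 1) - g j) / sqrt h"
 using divide_right_mono[OF norm_triangle_ineq[of "f (j + 1) - f j" "g (j + 1) - g j"], of "sqrt h"] h
 by (simp add: add_divide_distrib add_diff_add)
 qed (use h in auto)
 also have "... <= sqrt (dK h K f) + sqrt (dK h K g)" unfolding sqrt_dK[OF h] by (rule L2_set_triangle_ineq)
 finally show ?thesis .
 qed
 let ?a = "sqrt (nK h K f)" and ?b = "sqrt (dK h K f)" and ?c = "sqrt (nK h K g)" and ?d = "sqrt (dK h K g)"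
 have "hK h K (%j. f j + g j) = sqrt ((sqrt (nK h K (%j. f j + g j)))\<^sup>2 + (sqrt (dK h K (%j. f j + g j)))\<^sup>2)"
 using h by (simp add: hK_def nK_nonneg dK_nonneg)
 also have "... <= sqrt ((?a + ?c)\<^sup>2 + (?b + ?d)\<^sup>2)"
 using 1 2 h by (intro real_sqrt_le_mono add_mono power_mono) (auto simp: nK_nonneg dK_nonneg)
 also have "... <= sqrt (?a\<^sup>2 + ?b\<^sup>2) + sqrt (?c\<^sup>2 + ?d\<^sup>2)" by (rule real_sqrt_sum_squares_triangle_ineq)
 also have "... = hK h K f + hK h K g" using h by (simp add: hK_def nK_nonneg dK_nonneg)
 finally show ?thesis .
qed

lemma nK_mult: "nK h K (%j. c * f j) = (cmod c)\<^sup>2 * nK h K f"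
 by (simp add: nK_def norm_mult power_mult_distrib sum_distrib_left mult_ac)

lemma dK_mult: "dK h K (%j. c * f j) = (cmod c)\<^sup>2 * dK h K f"
 by (simp add: dK_def norm_mult power_mult_distrib sum_distrib_left flip: right_diff_distrib)

lemma hK_mult: "hK h K (%j. c * f j) = cmod c * hK h K f"
 by (simp add: hK_def nK_mult dK_mult real_sqrt_mult flip: distrib_left)

lemma supp_shK: "supp K (shK K f)" by (auto simp: supp_def shK_def)

lemma supp_cubK: "supp K u ==> supp K (cubK u v w)" by (auto simp: supp_def cubK_def)

lemma ip_shK:
 assumes "supp K f" "supp K g"
 shows "ipK K (shK K f) g = (\<Sum>j\<in>cells K. f (j + 1) \<bullet> g j + f j \<bullet> g (j + 1))"
proof -
 have s: "supp K (%j. f (j - 1) \<bullet> g j)" using assms by (auto simp: supp_def)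
 have "ipK K (shK K f) g = (\<Sum>j\<in>cells K. f (j + 1) \<bullet> g j + f (j - 1) \<bullet> g j)"
 unfolding ipK_def by (rule sum.cong) (use assms in \<open>auto simp: shK_def supp_def inner_add_left\<close>)
 also have "... = (\<Sum>j\<in>cells K. f (j + 1) \<bullet> g j) + (\<Sum>j\<in>cells K. f (j - 1) \<bullet> g j)" by (rule sum.distrib)
 also have "(\<Sum>j\<in>cells K. f (j - 1) \<bullet> g j) = (\<Sum>j\<in>cells K. f j \<bullet> g (j + 1))" using supp_shift[OF s] by simp
 finally show ?thesis by (simp add: sum.distrib)
qed

lemma ip_shK_sym: "supp K f ==> supp K g ==> ipK K (shK K f) g = ipK K (shK K g) f"
 by (simp add: ip_shK inner_commute add.commute)

lemma ip_commute: "ipK K f g = ipK K g f" by (simp add: ipK_def inner_commute)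

lemma ip_cmb: "ipK K (%j. a *\<^sub>R f j + b *\<^sub>R g j) w = a * ipK K f w + b * ipK K g w"
 by (simp add: ipK_def inner_add_left sum.distrib sum_distrib_left)

lemma ip_cmb2: "ipK K w (%j. a *\<^sub>R f j + b *\<^sub>R g j) = a * ipK K w f + b * ipK K w g"
 by (simp add: ipK_def inner_add_right sum.distrib sum_distrib_left)

text \<open>The sign -1 expresses the gradient through the shift sum; the sign 1 shows that 2 plus
  the shift sum is positive.\<close>

lemma sum_square_shift:
 assumes f: "supp K f" and s: "s = 1 \<or> s = (-1 :: real)"
 shows "(\<Sum>j\<in>cells K. (norm (f (j + 1) + s *\<^sub>R f j))\<^sup>2) = 2 * ipK K f f + s * ipK K (shK K f) f"
proof -
 have ff: "supp K (%j. f j \<bullet> f j)" using f by (auto simp: supp_def)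
 have "s * s = 1" using s by auto
 then have e: "(norm (x + s *\<^sub>R y))\<^sup>2 = x \<bullet> x + (s * (x \<bullet> y + y \<bullet> x) + y \<bullet> y)" for x y :: complex
 by (simp add: power2_norm_eq_inner inner_add_left inner_add_right algebra_simps mult.assoc[symmetric])
 have "(\<Sum>j\<in>cells K. (norm (f (j + 1) + s *\<^sub>R f j))\<^sup>2)
 = (\<Sum>j\<in>cells K. f (j + 1) \<bullet> f (j + 1)) + (s * (\<Sum>j\<in>cells K. f (j + 1) \<bullet> f j + f j \<bullet> f (j + 1)) + (\<Sum>j\<in>cells K. f j \<bullet> f j))"
 unfolding e sum.distrib sum_distrib_left[symmetric] ..
 then show ?thesis unfolding ip_shK[OF f f] supp_shift[OF ff] by (simp add: ipK_def)
qed

lemma dK_ip: "h > 0 ==> supp K f ==> h * dK h K f = 2 * ipK K f f - ipK K (shK K f) f"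
 using sum_square_shift[of K f "-1"] by (simp add: dK_def)

lemma ip_shK_le:
 assumes "supp K f"
 shows "ipK K (shK K f) (shK K f) <= 4 * ipK K f f"
proof -
 define m where "m j = (if \<bar>j\<bar> <= int K then (norm (f (j - 1)))\<^sup>2 else 0)" for j
 have sm: "supp K m" "supp K (%j. (norm (f j))\<^sup>2)" using assms by (auto simp: supp_def m_def)
 have "(norm (shK K f j))\<^sup>2 <= 2 * (norm (f (j + 1)))\<^sup>2 + 2 * m j" for j
 proof (cases "\<bar>j\<bar> <= int K")
 case True
 have "(norm (f (j + 1) + f (j - 1)))\<^sup>2 <= (norm (f (j + 1)) + norm (f (j - 1)))\<^sup>2" by (intro power_mono norm_triangle_ineq) auto
 also have "... <= 2 * (norm (f (j + 1)))\<^sup>2 + 2 * (norm (f (j - 1)))\<^sup>2"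
 using zero_le_power2[of "norm (f (j + 1)) - norm (f (j - 1))"] by (simp add: power2_sum power2_diff)
 finally show ?thesis using True by (simp add: shK_def m_def)
 qed (simp add: shK_def m_def)
 then have "ipK K (shK K f) (shK K f) <= (\<Sum>j\<in>cells K. 2 * (norm (f (j + 1)))\<^sup>2 + 2 * m j)"
 unfolding ipK_def power2_norm_eq_inner[symmetric] by (rule sum_mono)
 also have "... = 2 * (\<Sum>j\<in>cells K. (norm (f j))\<^sup>2) + 2 * (\<Sum>j\<in>cells K. m (j + 1))"
 unfolding sum.distrib sum_distrib_left[symmetric] supp_shift[OF sm(1)] supp_shift[OF sm(2)] ..
 also have "(\<Sum>j\<in>cells K. m (j + 1)) <= (\<Sum>j\<in>cells K. (norm (f j))\<^sup>2)"
 by (rule sum_mono) (simp add: m_def)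
 finally show ?thesis by (simp add: ipK_def power2_norm_eq_inner)
qed

text \<open>With \<open>S\<close> the Dirichlet shift sum, \<open>4 (2 - S) - S (2 - S) S = (2 - S) (2 + S) (2 - S)\<close> is positive.\<close>

lemma dK_shK_le:
 assumes h: "h > 0" and f: "supp K f"
 shows "dK h K (shK K f) <= 4 * dK h K f"
proof -
 let ?S = "shK K" let ?w = "%j. 2 *\<^sub>R f j + (-1) *\<^sub>R ?S f j"
 have sw: "supp K ?w" using f supp_shK[of K f] by (auto simp: supp_def)
 note sf = supp_shK[of K f]
 have Sw: "?S ?w = (%j. 2 *\<^sub>R ?S f j + (-1) *\<^sub>R ?S (?S f) j)"
 by (rule ext) (simp add: shK_def scaleR_add_right)
 have c1: "ipK K f (?S f) = ipK K (?S f) f" "ipK K (?S (?S f)) f = ipK K (?S f) (?S f)"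
 using ip_shK_sym[OF sf f] by (auto simp: ip_commute)
 have exp: "ipK K (%j. 2 *\<^sub>R f1 j + (-1) *\<^sub>R f2 j) ?w = 4 * ipK K f1 f - 2 * ipK K f1 (?S f) - 2 * ipK K f2 f + ipK K f2 (?S f)" for f1 f2
 unfolding ip_cmb ip_cmb2 by simp
 have "0 <= (\<Sum>j\<in>cells K. (norm (?w (j + 1) + 1 *\<^sub>R ?w j))\<^sup>2)" by (simp add: sum_nonneg)
 also have "... = 2 * ipK K ?w ?w + 1 * ipK K (?S ?w) ?w" by (rule sum_square_shift[OF sw]) simp
 also have "... = 4 * (2 * ipK K f f - ipK K (?S f) f) - (2 * ipK K (?S f) (?S f) - ipK K (?S (?S f)) (?S f))"
 unfolding Sw exp using c1 by simp
 also have "... = 4 * (h * dK h K f) - h * dK h K (?S f)" unfolding dK_ip[OF h f] dK_ip[OF h sf] ..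
 finally have "h * dK h K (?S f) <= h * (4 * dK h K f)" by simp
 then show ?thesis using h by simp
qed

lemma hK_shK_le:
 assumes "h > 0" "supp K f" shows "hK h K (shK K f) <= 2 * hK h K f"
proof -
 have "nK h K (shK K f) <= 4 * nK h K f" using ip_shK_le[OF assms(2)] assms(1) by (simp add: nK_ip)
 then have "(hK h K (shK K f))\<^sup>2 <= (2 * hK h K f)\<^sup>2"
 using dK_shK_le[OF assms] assms(1) by (simp add: hK_sq power_mult_distrib)
 then show ?thesis by (rule power2_le_imp_le) (simp add: hK_nonneg[OF assms(1)])
qed

lemma cub_diff:
 fixes a b c a1 b1 c1 :: complex
 shows "a1 * cnj b1 * c1 - a * cnj b * c = (a1 - a) * cnj b1 * c1 + a * cnj (b1 - b) * c1 + a * cnj b * (c1 - c)"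
 by (simp add: algebra_simps)

text \<open>Sup bounds on two factors and the l2 norm or the difference of the third. The mass part
  contributes 1 and the product rule 9 to the square, and 10 <= 4^2.\<close>

lemma hK_cubK_le:
 assumes h: "h > 0" and u: "supp K u" and v: "supp K v" and w: "supp K w"
 shows "hK h K (cubK u v w) <= 4 * (hK h K u * hK h K v * hK h K w)"
proof -
 define a b c where abc: "a = hK h K u" "b = hK h K v" "c = hK h K w"
 have pos: "a >= 0" "b >= 0" "c >= 0" using hK_nonneg[OF h] by (auto simp: abc)
 have le: "cmod (u j) <= a" "cmod (v j) <= b" "cmod (w j) <= c" for j
 using cmod_le_hK[OF h] u v w by (auto simp: abc)
 have "(cmod (cubK u v w j))\<^sup>2 <= (cmod (u j))\<^sup>2 * (b * c)\<^sup>2" for j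
 proof -
 have "cmod (v j) * cmod (w j) <= b * c" using le pos by (intro mult_mono) auto
 then have "(cmod (v j) * cmod (w j))\<^sup>2 <= (b * c)\<^sup>2" by (rule power_mono) simp
 then show ?thesis by (simp add: cubK_def norm_mult power_mult_distrib mult_left_mono mult.assoc)
 qed
 then have "(\<Sum>j\<in>cells K. (cmod (cubK u v w j))\<^sup>2) <= (\<Sum>j\<in>cells K. (cmod (u j))\<^sup>2 * (b * c)\<^sup>2)" by (rule sum_mono)
 then have "nK h K (cubK u v w) <= nK h K u * (b * c)\<^sup>2"
 using h by (simp add: nK_def sum_distrib_right[symmetric])
 also have "... <= a\<^sup>2 * (b * c)\<^sup>2" using dK_le_hK(2)[OF h] by (intro mult_right_mono) (auto simp: abc)
 finally have n: "nK h K (cubK u v w) <= (a * b * c)\<^sup>2" by (simp add: power_mult_distrib mult_ac)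
 let ?du = "%j. cmod (u (j + 1) - u j)" and ?dv = "%j. cmod (v (j + 1) - v j)" and ?dw = "%j. cmod (w (j + 1) - w j)"
 have *: "(cmod (cubK u v w (j + 1) - cubK u v w j))\<^sup>2 <= 3 * ((?du j)\<^sup>2 * (b * c)\<^sup>2 + (?dv j)\<^sup>2 * (a * c)\<^sup>2 + (?dw j)\<^sup>2 * (a * b)\<^sup>2)" for j
 proof -
 let ?x = "?du j * (b * c)" and ?y = "?dv j * (a * c)" and ?z = "?dw j * (a * b)"
 have t: "norm (p + q + r) <= x + y + z" if "norm p <= x" "norm q <= y" "norm r <= z" for p q r :: complex and x y z
 using norm_triangle_ineq[of "p + q" r] norm_triangle_ineq[of p q] that by linarith
 have "cmod (cubK u v w (j + 1) - cubK u v w j) <= ?x + ?y + ?z"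
 unfolding cubK_def cub_diff
 proof (rule t)
 show "cmod ((u (j + 1) - u j) * cnj (v (j + 1)) * w (j + 1)) <= ?x"
 unfolding norm_mult complex_mod_cnj mult.assoc using le pos by (intro mult_mono) auto
 have "cmod (u j) * ?dv j * cmod (w (j + 1)) <= a * ?dv j * c" using le pos by (intro mult_mono) auto
 then show "cmod (u j * cnj (v (j + 1) - v j) * w (j + 1)) <= ?y" unfolding norm_mult complex_mod_cnj by (simp add: mult_ac)
 have "cmod (u j) * cmod (v j) * ?dw j <= a * b * ?dw j" using le pos by (intro mult_mono) auto
 then show "cmod (u j * cnj (v j) * (w (j + 1) - w j)) <= ?z" unfolding norm_mult complex_mod_cnj by (simp add: mult_ac)
 qed
 then have "(cmod (cubK u v w (j + 1) - cubK u v w j))\<^sup>2 <= (?x + ?y + ?z)\<^sup>2" by (rule power_mono) simp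
 also have "... <= 3 * (?x\<^sup>2 + ?y\<^sup>2 + ?z\<^sup>2)"
 proof -
 have "0 <= (x - y)\<^sup>2 + (y - z)\<^sup>2 + (x - z)\<^sup>2" for x y z :: real by simp
 then have "(x + y + z)\<^sup>2 <= 3 * (x\<^sup>2 + y\<^sup>2 + z\<^sup>2)" for x y z :: real by (simp add: power2_eq_square algebra_simps)
 then show ?thesis .
 qed
 finally show ?thesis by (simp only: power_mult_distrib)
 qed
 have scale: "t / h <= 3 * (x / h * p + y / h * q + z / h * r)" if "t <= 3 * (x * p + y * q + z * r)" for t x y z p q r
 using divide_right_mono[OF that, of h] h by (simp add: add_divide_distrib)
 from * have "(\<Sum>j\<in>cells K. (cmod (cubK u v w (j + 1) - cubK u v w j))\<^sup>2)
 <= (\<Sum>j\<in>cells K. 3 * ((?du j)\<^sup>2 * (b * c)\<^sup>2 + (?dv j)\<^sup>2 * (a * c)\<^sup>2 + (?dw j)\<^sup>2 * (a * b)\<^sup>2))" by (rule sum_mono)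
 then have "dK h K (cubK u v w) <= 3 * (dK h K u * (b * c)\<^sup>2 + dK h K v * (a * c)\<^sup>2 + dK h K w * (a * b)\<^sup>2)"
 unfolding sum_distrib_left[symmetric] sum.distrib sum_distrib_right[symmetric] dK_def by (rule scale)
 also have "... <= 3 * (a\<^sup>2 * (b * c)\<^sup>2 + b\<^sup>2 * (a * c)\<^sup>2 + c\<^sup>2 * (a * b)\<^sup>2)"
 using dK_le_hK(1)[OF h] by (intro mult_left_mono add_mono mult_right_mono) (auto simp: abc)
 also have "... = 9 * (a * b * c)\<^sup>2" by (simp add: power_mult_distrib mult_ac)
 finally have "(hK h K (cubK u v w))\<^sup>2 <= 10 * (a * b * c)\<^sup>2" using n by (simp add: hK_sq[OF h])
 also have "... <= (4 * (a * b * c))\<^sup>2" by (simp add: power_mult_distrib)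
 finally show ?thesis unfolding abc[symmetric] by (rule power2_le_imp_le) (use pos in simp)
qed

definition omK :: "real => nat => (int => complex) => (int => complex) => real" where
 "omK h K f g = h * ipK K (%j. \<i> * f j) g"

lemma omK_anti: "omK h K f g = - omK h K g f"
proof -
 have "ipK K (%j. \<i> * f j) g = (\<Sum>j\<in>cells K. - ((\<i> * g j) \<bullet> f j))"
 unfolding ipK_def by (rule sum.cong) (auto simp: inner_complex_def)
 then show ?thesis by (simp add: omK_def ipK_def sum_negf)
qed

lemma omK_le:
 assumes h: "h > 0" shows "\<bar>omK h K f g\<bar> <= hK h K f * hK h K g"
proof -
 have "\<bar>ipK K (%j. \<i> * f j) g\<bar> <= (\<Sum>j\<in>cells K. \<bar>cmod (f j) * cmod (g j)\<bar>)" unfolding ipK_def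
 by (rule order_trans[OF sum_abs]) (rule sum_mono, rule order_trans[OF Cauchy_Schwarz_ineq2], simp add: norm_mult)
 also have "... <= L2_set (%j. cmod (f j)) (cells K) * L2_set (%j. cmod (g j)) (cells K)"
 using L2_set_mult_ineq[of "%j. cmod (f j)" "%j. cmod (g j)" "cells K"] by (simp add: abs_mult)
 finally have "\<bar>omK h K f g\<bar> <= h * (L2_set (%j. cmod (f j)) (cells K) * L2_set (%j. cmod (g j)) (cells K))"
 using h by (simp add: omK_def abs_mult)
 also have "... = sqrt (nK h K f) * sqrt (nK h K g)"
 proof -
 have "sqrt h * a * (sqrt h * b) = (sqrt h * sqrt h) * (a * b)" for a b by (simp only: mult_ac)
 then have "sqrt h * a * (sqrt h * b) = h * (a * b)" for a b using h by simp
 then show ?thesis unfolding nK_def L2_set_def real_sqrt_mult by (rule sym)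
 qed
 also have "... <= hK h K f * hK h K g"
 using h by (intro mult_mono) (auto simp: hK_def nK_nonneg dK_nonneg)
 finally show ?thesis .
qed

lemma omK_shK: "supp K f ==> supp K g ==> omK h K (%j. \<i> * of_real c * shK K f j) g = - h * c * ipK K (shK K f) g"
proof -
 have "(\<i> * (\<i> * of_real c * a)) \<bullet> b = - c * (a \<bullet> b)" for a b by (simp add: inner_complex_def algebra_simps)
 then show ?thesis unfolding omK_def ipK_def sum_distrib_left by (intro sum.cong) (simp_all only: mult.assoc mult_minus_left mult_minus_right)
qed

lemma diff_prod_sum:
 assumes h: "h > 0"
 shows "(\<Sum>j\<in>cells K. cmod (f (j + 1) - f j) * cmod (g (j + 1) - g j)) <= h * (hK h K f * hK h K g)"
proof -
 let ?a = "%f j. cmod (f (j + 1) - f j)"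
 have e: "L2_set (?a f) (cells K) = sqrt h * sqrt (dK h K f)" for f
 using h by (simp add: L2_set_def dK_def real_sqrt_mult[symmetric])
 have "(\<Sum>j\<in>cells K. ?a f j * ?a g j) <= L2_set (?a f) (cells K) * L2_set (?a g) (cells K)"
 using L2_set_mult_ineq[of "?a f" "?a g" "cells K"] by simp
 also have "... = h * (sqrt (dK h K f) * sqrt (dK h K g))" unfolding e using h by simp
 also have "... <= h * (hK h K f * hK h K g)"
 using h by (intro mult_left_mono mult_mono) (auto simp: hK_def nK_nonneg dK_nonneg)
 finally show ?thesis .
qed

text \<open>Shifting the two neighbours of the outer slots onto each other leaves only products of two differences.\<close>

lemma cub_pair:
 assumes h: "h > 0" and u: "supp K u" and v: "supp K v" and w: "supp K w" and x: "supp K x"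
 shows "\<bar>ipK K (cubK u v w) (%j. \<i> * shK K x j) + ipK K (%j. \<i> * cubK u v (shK K w) j) x\<bar>
 <= 4 * h * (hK h K u * hK h K v * hK h K w * hK h K x)"
proof -
 define a b c d where abcd: "a = hK h K u" "b = hK h K v" "c = hK h K w" "d = hK h K x"
 have pos: "a >= 0" "b >= 0" "c >= 0" "d >= 0" using hK_nonneg[OF h] by (auto simp: abcd)
 have le: "cmod (u j) <= a" "cmod (v j) <= b" "cmod (w j) <= c" "cmod (x j) <= d" for j
 using cmod_le_hK[OF h] u v w x by (auto simp: abcd)
 define g where "g j = u j * cnj (v j)" for j
 have sg: "g j = 0" if "\<not> \<bar>j\<bar> <= int K" for j using u that by (simp add: g_def supp_def)
 let ?F = "%j. (g j * w j) \<bullet> (\<i> * x (j - 1)) + (\<i> * g j * w (j - 1)) \<bullet> x j"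
 let ?G = "%j. (g j * w j) \<bullet> (\<i> * x (j + 1)) + (\<i> * g j * w (j + 1)) \<bullet> x j"
 have sF: "supp K ?F" using sg by (auto simp: supp_def)
 have "ipK K (cubK u v w) (%j. \<i> * shK K x j) + ipK K (%j. \<i> * cubK u v (shK K w) j) x = (\<Sum>j\<in>cells K. ?G j + ?F j)"
 unfolding ipK_def sum.distrib[symmetric]
 proof (rule sum.cong[OF refl])
 fix j
 show "cubK u v w j \<bullet> (\<i> * shK K x j) + (\<i> * cubK u v (shK K w) j) \<bullet> x j = ?G j + ?F j"
 proof (cases "\<bar>j\<bar> <= int K")
 case True
 then show ?thesis by (simp add: cubK_def shK_def g_def[symmetric] distrib_left inner_add_left inner_add_right mult.assoc)
 next
 case False
 then show ?thesis using sg[OF False] u by (simp add: cubK_def supp_def)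
 qed
 qed
 also have "... = (\<Sum>j\<in>cells K. ?G j) + (\<Sum>j\<in>cells K. ?F (j + 1))" unfolding supp_shift[OF sF] by (rule sum.distrib)
 also have "... = (\<Sum>j\<in>cells K. (\<i> * (g (j + 1) - g j) * w j) \<bullet> (x (j + 1) - x j) - (\<i> * (g (j + 1) - g j) * (w (j + 1) - w j)) \<bullet> x j)"
 unfolding sum.distrib[symmetric] by (rule sum.cong) (auto simp: inner_complex_def algebra_simps)
 finally have eq: "ipK K (cubK u v w) (%j. \<i> * shK K x j) + ipK K (%j. \<i> * cubK u v (shK K w) j) x = ..." .
 let ?u = "%j. cmod (u (j + 1) - u j)" and ?v = "%j. cmod (v (j + 1) - v j)" and ?w = "%j. cmod (w (j + 1) - w j)" and ?x = "%j. cmod (x (j + 1) - x j)"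
 have tm: "\<bar>(\<i> * (g (j + 1) - g j) * w j) \<bullet> (x (j + 1) - x j) - (\<i> * (g (j + 1) - g j) * (w (j + 1) - w j)) \<bullet> x j\<bar>
 <= (b * c) * (?u j * ?x j) + (a * c) * (?v j * ?x j) + (b * d) * (?u j * ?w j) + (a * d) * (?v j * ?w j)" for j
 proof -
 have "g (j + 1) - g j = (u (j + 1) - u j) * cnj (v (j + 1)) + u j * cnj (v (j + 1) - v j)" by (simp add: g_def algebra_simps)
 then have "cmod (g (j + 1) - g j) <= ?u j * cmod (v (j + 1)) + cmod (u j) * ?v j"
 by (metis complex_mod_cnj norm_mult norm_triangle_ineq)
 also have "... <= ?u j * b + a * ?v j" using le pos by (intro add_mono mult_mono) auto
 finally have dg: "cmod (g (j + 1) - g j) <= ?u j * b + a * ?v j" .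
 have "\<bar>(\<i> * (g (j + 1) - g j) * w j) \<bullet> (x (j + 1) - x j)\<bar> <= cmod (g (j + 1) - g j) * cmod (w j) * ?x j"
 by (rule order_trans[OF Cauchy_Schwarz_ineq2]) (simp add: norm_mult)
 also have "... <= (?u j * b + a * ?v j) * c * ?x j" using dg le pos by (intro mult_mono) auto
 finally have 1: "\<bar>(\<i> * (g (j + 1) - g j) * w j) \<bullet> (x (j + 1) - x j)\<bar> <= (?u j * b + a * ?v j) * c * ?x j" .
 have "\<bar>(\<i> * (g (j + 1) - g j) * (w (j + 1) - w j)) \<bullet> x j\<bar> <= cmod (g (j + 1) - g j) * ?w j * cmod (x j)"
 by (rule order_trans[OF Cauchy_Schwarz_ineq2]) (simp add: norm_mult)
 also have "... <= (?u j * b + a * ?v j) * ?w j * d" using dg le pos by (intro mult_mono) auto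
 finally have 2: "\<bar>(\<i> * (g (j + 1) - g j) * (w (j + 1) - w j)) \<bullet> x j\<bar> <= (?u j * b + a * ?v j) * ?w j * d" .
 have "\<bar>p - q\<bar> <= r + s" if "\<bar>p\<bar> <= r" "\<bar>q\<bar> <= s" for p q r s :: real using that by linarith
 from this[OF 1 2] show ?thesis by (simp add: algebra_simps)
 qed
 have "\<bar>ipK K (cubK u v w) (%j. \<i> * shK K x j) + ipK K (%j. \<i> * cubK u v (shK K w) j) x\<bar>
 <= (\<Sum>j\<in>cells K. (b * c) * (?u j * ?x j) + (a * c) * (?v j * ?x j) + (b * d) * (?u j * ?w j) + (a * d) * (?v j * ?w j))"
 unfolding eq by (rule order_trans[OF sum_abs sum_mono]) (rule tm)
 also have "... = (b * c) * (\<Sum>j\<in>cells K. ?u j * ?x j) + (a * c) * (\<Sum>j\<in>cells K. ?v j * ?x j)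
 + (b * d) * (\<Sum>j\<in>cells K. ?u j * ?w j) + (a * d) * (\<Sum>j\<in>cells K. ?v j * ?w j)"
 unfolding sum.distrib sum_distrib_left ..
 also have "... <= (b * c) * (h * (a * d)) + (a * c) * (h * (b * d)) + (b * d) * (h * (a * c)) + (a * d) * (h * (b * c))"
 unfolding abcd by (intro add_mono mult_left_mono diff_prod_sum[OF h]) (auto simp: hK_nonneg[OF h])
 also have "... = 4 * h * (a * b * c * d)" by (simp add: algebra_simps)
 finally show ?thesis unfolding abcd .
qed

section \<open>The grid as a kicked Hamiltonian system\<close>

definition msk :: "nat => (int => complex) => int => complex" where
 "msk K f j = (if \<bar>j\<bar> <= int K then f j else 0)"

text \<open>Sequences live in the dual of the bounded sequences, a Banach space in which coordinates are
 evaluations at the unit sequences.\<close>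

type_synonym space = "(int \<Rightarrow>\<^sub>C real) \<Rightarrow>\<^sub>L complex"

definition unit_seq :: "int => int \<Rightarrow>\<^sub>C real" where
 "unit_seq j = Bcontfun (%i. if i = j then 1 else 0)"

definition crd :: "space => int => complex" where
 "crd v j = blinfun_apply v (unit_seq j)"

definition state :: "nat => (int => complex) => space" where
 "state K f = Blinfun (%x. \<Sum>j=-int K..int K. apply_bcontfun x j *\<^sub>R f j)"

lemma supp_msk: "supp K (msk K f)" by (auto simp: supp_def msk_def)

lemma msk_supp: "supp K f ==> msk K f = f" by (auto simp: supp_def msk_def)

lemma msk_msk [simp]: "msk K (msk K f) = msk K f" by (auto simp: msk_def)

lemma apply_unit_seq: "apply_bcontfun (unit_seq j) = (%i. if i = j then 1 else 0)"
proof -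
 have "finite (range (%i. if i = j then 1 else 0 :: real))" by (rule finite_subset[of _ "{0, 1}"]) auto
 then have "(%i. if i = j then 1 else 0 :: real) \<in> bcontfun" by (auto simp: bcontfun_def finite_imp_bounded continuous_on_discrete)
 then show ?thesis by (simp add: unit_seq_def Bcontfun_inverse)
qed

lemma norm_unit_seq: "norm (unit_seq j) <= 1"
 by (rule norm_bound) (simp add: apply_unit_seq)

lemma norm_crd: "cmod (crd v j) <= norm v"
proof -
 have "cmod (crd v j) <= norm v * norm (unit_seq j)" unfolding crd_def by (rule norm_blinfun)
 also have "... <= norm v * 1" by (rule mult_left_mono[OF norm_unit_seq]) simp
 finally show ?thesis by simp
qed

lemma apply_state: "blinfun_apply (state K f) = (%x. \<Sum>j=-int K..int K. apply_bcontfun x j *\<^sub>R f j)"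
proof -
 have "bounded_linear (%x :: int \<Rightarrow>\<^sub>C real. apply_bcontfun x j)" for j
 proof (rule bounded_linear_intro[of _ 1])
 show "norm (apply_bcontfun x j) <= norm x * 1" for x :: "int \<Rightarrow>\<^sub>C real" using norm_bounded[of x j] by simp
 qed auto
 then have "bounded_linear (%x. \<Sum>j=-int K..int K. apply_bcontfun x j *\<^sub>R f j)"
 by (intro bounded_linear_sum bounded_linear_scaleR_const)
 then show ?thesis by (simp add: state_def bounded_linear_Blinfun_apply)
qed

lemma crd_state [simp]: "crd (state K f) = msk K f"
proof
 fix i
 have "(\<Sum>j=-int K..int K. (if j = i then 1 else 0) *\<^sub>R f j) = (\<Sum>j=-int K..int K. if j = i then f j else 0)"
 by (rule sum.cong) auto
 then show "crd (state K f) i = msk K f i" by (auto simp: crd_def apply_state apply_unit_seq msk_def abs_le_iff)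
qed

lemma state_msk [simp]: "state K (msk K f) = state K f"
 by (rule blinfun_eqI) (auto simp: apply_state msk_def intro!: sum.cong)

lemma msk_add: "msk K (%j. f j + g j) = (%j. msk K f j + msk K g j)" by (auto simp: msk_def)

lemma msk_mult: "msk K (%j. c * f j) = (%j. c * msk K f j)" by (auto simp: msk_def)

lemma state_add: "state K (%j. f j + g j) = state K f + state K g"
 by (rule blinfun_eqI) (simp add: apply_state blinfun.add_left scaleR_add_right sum.distrib)

lemma state_scale: "state K (%j. of_real c * f j) = c *\<^sub>R state K f"
 by (rule blinfun_eqI) (simp add: apply_state blinfun.scaleR_left scaleR_right.sum scaleR_conv_of_real mult_ac sum_distrib_left)

lemma crd_add: "crd (u + v) = (%j. crd u j + crd v j)"
 by (rule ext) (simp add: crd_def blinfun.add_left)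

lemma crd_scale: "crd (c *\<^sub>R u) = (%j. of_real c * crd u j)"
 by (rule ext) (simp add: crd_def blinfun.scaleR_left scaleR_conv_of_real)

lemma norm_state_le:
 assumes "!!j. cmod (f j) <= b" shows "norm (state K f) <= (2 * real K + 1) * b"
proof (rule norm_blinfun_bound)
 have b: "0 <= b" using assms[of 0] norm_ge_zero order_trans by blast
 then show "0 <= (2 * real K + 1) * b" by simp
 fix x
 have "norm (blinfun_apply (state K f) x) <= (\<Sum>j=-int K..int K. norm x * b)" unfolding apply_state
 proof (rule order_trans[OF norm_sum sum_mono])
 fix j
 show "norm (apply_bcontfun x j *\<^sub>R f j) <= norm x * b"
 using mult_mono[OF norm_bounded[of x j] assms[of j]] by simp
 qed
 then show "norm (blinfun_apply (state K f) x) <= (2 * real K + 1) * b * norm x" by (simp add: algebra_simps)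
qed

text \<open>The second summand measures what the coordinates from -K to K do not see, so this is a
  norm on all of \<open>space\<close>; on states it vanishes and the discrete H1 norm remains. One
  type thus serves every \<open>K\<close>.\<close>

definition hV :: "real => nat => space => real" where
 "hV h K v = hK h K (msk K (crd v)) + norm (v - state K (crd v))"

definition omV :: "real => nat => space => space => real" where
 "omV h K u v = omK h K (msk K (crd u)) (msk K (crd v))"

definition AV :: "real => nat => space => space" where
 "AV c K v = state K (%j. \<i> * of_real c * shK K (msk K (crd v)) j)"

definition PV :: "real => nat => space => space => space => space" where
 "PV \<tau> K u v w = state K (%j. \<i> * of_real \<tau> * cubK (msk K (crd u)) (msk K (crd v)) (msk K (crd w)) j)"

lemma hV_state: "hV h K (state K f) = hK h K (msk K f)"
 by (simp add: hV_def)

lemma msk_AV: "msk K (crd (AV c K v)) = (%j. \<i> * of_real c * shK K (msk K (crd v)) j)"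
 by (simp add: AV_def msk_mult msk_supp[OF supp_shK])

lemma msk_PV: "msk K (crd (PV \<tau> K u v w)) = (%j. \<i> * of_real \<tau> * cubK (msk K (crd u)) (msk K (crd v)) (msk K (crd w)) j)"
 by (simp add: PV_def msk_mult msk_supp[OF supp_cubK[OF supp_msk]])

lemma hV_le:
 assumes h: "h > 0"
 shows "hV h K u <= (sqrt ((2 * real K + 2) * (h + 4 / h)) + (2 * real K + 2)) * norm u"
proof -
 have b: "cmod (msk K (crd u) j) <= norm u" for j using norm_crd[of u j] by (auto simp: msk_def)
 have cd: "real (card (cells K)) = 2 * real K + 2" by simp
 have "nK h K (msk K (crd u)) <= h * (\<Sum>j\<in>cells K. (norm u)\<^sup>2)"
 unfolding nK_def using h b by (intro mult_left_mono sum_mono power_mono) auto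
 then have n: "nK h K (msk K (crd u)) <= (2 * real K + 2) * h * (norm u)\<^sup>2" unfolding sum_constant cd by (simp add: algebra_simps)
 have "(cmod (msk K (crd u) (j + 1) - msk K (crd u) j))\<^sup>2 <= (2 * norm u)\<^sup>2" for j
 by (rule power_mono) (use norm_triangle_ineq4[of "msk K (crd u) (j + 1)" "msk K (crd u) j"] b[of j] b[of "j + 1"] in linarith, simp)
 then have "dK h K (msk K (crd u)) <= (\<Sum>j\<in>cells K. (2 * norm u)\<^sup>2) / h"
 unfolding dK_def using h by (intro divide_right_mono sum_mono) auto
 then have d: "dK h K (msk K (crd u)) <= (2 * real K + 2) * (4 / h) * (norm u)\<^sup>2" unfolding sum_constant cd by (simp add: power_mult_distrib algebra_simps add_divide_distrib)
 have "nK h K (msk K (crd u)) + dK h K (msk K (crd u)) <= (2 * real K + 2) * (h + 4 / h) * (norm u)\<^sup>2"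
 using n d by (simp only: distrib_left distrib_right)
 then have "hK h K (msk K (crd u)) <= sqrt ((2 * real K + 2) * (h + 4 / h) * (norm u)\<^sup>2)" unfolding hK_def by (rule real_sqrt_le_mono)
 then have 1: "hK h K (msk K (crd u)) <= sqrt ((2 * real K + 2) * (h + 4 / h)) * norm u" by (simp add: real_sqrt_mult)
 have "norm (state K (crd u)) <= (2 * real K + 1) * norm u" by (rule norm_state_le[OF norm_crd])
 then have "norm (u - state K (crd u)) <= (2 * real K + 2) * norm u"
 using norm_triangle_ineq4[of u "state K (crd u)"] by (simp add: algebra_simps)
 then show ?thesis using 1 by (simp add: hV_def distrib_right)
qed

lemma norm_le_hV:
 assumes h: "h > 0"
 shows "norm u <= (2 * real K + 1) * hV h K u"
proof -
 have "norm (state K (msk K (crd u))) <= (2 * real K + 1) * hK h K (msk K (crd u))"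
 by (rule norm_state_le) (rule cmod_le_hK[OF h supp_msk])
 moreover have "norm (u - state K (crd u)) <= (2 * real K + 1) * norm (u - state K (crd u))"
 by (simp add: mult_le_cancel_right1)
 moreover have "norm u <= norm (state K (crd u)) + norm (u - state K (crd u))"
 using norm_triangle_ineq[of "state K (crd u)" "u - state K (crd u)"] by simp
 ultimately show ?thesis unfolding hV_def distrib_left state_msk by linarith
qed

lemma ipK_mult_right: "ipK K f (%j. of_real c * g j) = c * ipK K f g"
 by (simp add: ipK_def inner_mult_right sum_distrib_left scaleR_conv_of_real[symmetric])

lemma omK_add: "omK h K (%j. f j + g j) w = omK h K f w + omK h K g w"
 by (simp add: omK_def ipK_def distrib_left inner_add_left sum.distrib)

lemma omK_scale: "omK h K (%j. of_real c * f j) w = c * omK h K f w"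
proof -
 have "(\<i> * (of_real c * a)) \<bullet> b = c * ((\<i> * a) \<bullet> b)" for a b by (simp add: inner_complex_def algebra_simps)
 then show ?thesis unfolding omK_def ipK_def by (simp only: sum_distrib_left[symmetric] mult.left_commute)
qed

lemma omK_cubK: "omK h K (%j. \<i> * of_real \<tau> * cubK u v w j) x = - h * \<tau> * ipK K (cubK u v w) x"
proof -
 have "(\<i> * (\<i> * of_real \<tau> * a)) \<bullet> b = - \<tau> * (a \<bullet> b)" for a b by (simp add: inner_complex_def algebra_simps)
 then show ?thesis unfolding omK_def ipK_def by (simp only: sum_distrib_left[symmetric] mult.assoc mult_minus_left mult_minus_right sum_negf)
qed

text \<open>The kick \<tau> is written \<sigma>^2. In the paired estimate the factors are h from the
  symplectic form, \<tau> from the kick, \<tau> / h^2 from the linear field and 4 h from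
  \<open>cub_pair\<close>: the mesh size cancels and 4 \<tau>^2 = 4 \<sigma>^4 remains.\<close>

lemma kicked_grid:
 assumes h: "h > 0" and t: "0 < \<tau>" "\<tau> <= 1" and L: "L >= 3" and cfl: "real (L + 1) * (2 * (\<tau> / h\<^sup>2)) <= \<Omega>"
 and \<rho>: "1 <= \<rho>" "\<Omega> < \<rho>" and b: "summable (%n. \<bar>b n\<bar> * \<rho> ^ n)" "(\<Sum>n. \<bar>b n\<bar> * \<rho> ^ n) <= B"
 "!!n. (\<Sum>m\<le>n. b m / fact (Suc (n - m))) = (if n = 0 then 1 else (0::real))"
 shows "kicked (hV h K) (omV h K) (AV (\<tau> / h\<^sup>2) K) (PV \<tau> K) (sqrt ((2 * real K + 2) * (h + 4 / h)) + (2 * real K + 2)) (2 * real K + 1)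
 (2 * (\<tau> / h\<^sup>2)) 4 4 1 (sqrt \<tau>) \<Omega> \<rho> B b L"
proof (rule kicked.intro)
 fix u v w x :: space and c :: real
 note sm = supp_msk[of K]
 show "hV h K (u + v) <= hV h K u + hV h K v"
 proof -
 have "u + v - state K (crd (u + v)) = (u - state K (crd u)) + (v - state K (crd v))"
 unfolding crd_add state_add by simp
 then have "norm (u + v - state K (crd (u + v))) <= norm (u - state K (crd u)) + norm (v - state K (crd v))"
 by (simp only: norm_triangle_ineq)
 then show ?thesis using hK_triangle[OF h, of K "msk K (crd u)" "msk K (crd v)"] unfolding hV_def crd_add msk_add by linarith
 qed
 show "hV h K (c *\<^sub>R u) = \<bar>c\<bar> * hV h K u"
 proof -
 have "c *\<^sub>R u - state K (crd (c *\<^sub>R u)) = c *\<^sub>R (u - state K (crd u))"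
 unfolding crd_scale state_scale by (simp add: scaleR_diff_right)
 then show ?thesis unfolding hV_def crd_scale msk_mult hK_mult by (simp add: distrib_left)
 qed
 show "hV h K u <= (sqrt ((2 * real K + 2) * (h + 4 / h)) + (2 * real K + 2)) * norm u" by (rule hV_le[OF h])
 show "norm u <= (2 * real K + 1) * hV h K u" by (rule norm_le_hV[OF h])
 show "linear (%u. omV h K u v)"
 by (rule linearI) (simp_all only: omV_def crd_add msk_add crd_scale msk_mult omK_add omK_scale real_scaleR_def)
 show "omV h K u v = - omV h K v u" unfolding omV_def by (rule omK_anti)
 show "\<bar>omV h K u v\<bar> <= 1 * hV h K u * hV h K v"
 proof -
 have "\<bar>omV h K u v\<bar> <= hK h K (msk K (crd u)) * hK h K (msk K (crd v))" unfolding omV_def by (rule omK_le[OF h])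
 also have "... <= hV h K u * hV h K v" unfolding hV_def by (intro mult_mono) (auto simp: hK_nonneg[OF h])
 finally show ?thesis by simp
 qed
 show "linear (AV (\<tau> / h\<^sup>2) K)"
 proof (rule linearI)
 fix u v :: space and c :: real
 have "(%j. \<i> * of_real (\<tau> / h\<^sup>2) * shK K (msk K (crd (u + v))) j) =
 (%j. \<i> * of_real (\<tau> / h\<^sup>2) * shK K (msk K (crd u)) j + \<i> * of_real (\<tau> / h\<^sup>2) * shK K (msk K (crd v)) j)"
 unfolding crd_add msk_add by (rule ext) (simp add: shK_def algebra_simps add_divide_distrib)
 then show "AV (\<tau> / h\<^sup>2) K (u + v) = AV (\<tau> / h\<^sup>2) K u + AV (\<tau> / h\<^sup>2) K v"
 unfolding AV_def by (simp only: state_add)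
 have "(%j. \<i> * of_real (\<tau> / h\<^sup>2) * shK K (msk K (crd (c *\<^sub>R u))) j) =
 (%j. of_real c * (\<i> * of_real (\<tau> / h\<^sup>2) * shK K (msk K (crd u)) j))"
 unfolding crd_scale msk_mult by (rule ext) (simp add: shK_def algebra_simps add_divide_distrib)
 then show "AV (\<tau> / h\<^sup>2) K (c *\<^sub>R u) = c *\<^sub>R AV (\<tau> / h\<^sup>2) K u"
 unfolding AV_def by (simp only: state_scale)
 qed
 show "hV h K (AV (\<tau> / h\<^sup>2) K u) <= 2 * (\<tau> / h\<^sup>2) * hV h K u"
 proof -
 have "hV h K (AV (\<tau> / h\<^sup>2) K u) = \<tau> / h\<^sup>2 * hK h K (shK K (msk K (crd u)))"
 using t h unfolding AV_def hV_state msk_mult msk_supp[OF supp_shK] hK_mult by (simp add: norm_mult norm_divide norm_power)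
 also have "... <= \<tau> / h\<^sup>2 * (2 * hK h K (msk K (crd u)))" using t by (intro mult_left_mono hK_shK_le[OF h sm]) auto
 also have "... <= \<tau> / h\<^sup>2 * (2 * hV h K u)" using t unfolding hV_def by (intro mult_left_mono) auto
 finally show ?thesis by (simp add: mult_ac)
 qed
 show "omV h K (AV (\<tau> / h\<^sup>2) K u) v = omV h K (AV (\<tau> / h\<^sup>2) K v) u"
 unfolding omV_def msk_AV omK_shK[OF sm sm] ip_shK_sym[OF sm sm, of "crd u" "crd v"] ..
 have lin: "linear f" if "!!a b. f (a + b) = f a + f b" "!!c a. f (c *\<^sub>R a) = c *\<^sub>R f a" for f :: "space => space"
 using that by (rule linearI)
 have cadd: "(%j. \<i> * of_real \<tau> * cubK (%j. a j + a' j) b' c' j) = (%j. \<i> * of_real \<tau> * cubK a b' c' j + \<i> * of_real \<tau> * cubK a' b' c' j)"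
 "(%j. \<i> * of_real \<tau> * cubK b' (%j. a j + a' j) c' j) = (%j. \<i> * of_real \<tau> * cubK b' a c' j + \<i> * of_real \<tau> * cubK b' a' c' j)"
 "(%j. \<i> * of_real \<tau> * cubK b' c' (%j. a j + a' j) j) = (%j. \<i> * of_real \<tau> * cubK b' c' a j + \<i> * of_real \<tau> * cubK b' c' a' j)"
 for a a' b' c' :: "int => complex" by (auto simp: cubK_def algebra_simps)
 have cscale: "(%j. \<i> * of_real \<tau> * cubK (%j. of_real r * a j) b' c' j) = (%j. of_real r * (\<i> * of_real \<tau> * cubK a b' c' j))"
 "(%j. \<i> * of_real \<tau> * cubK b' (%j. of_real r * a j) c' j) = (%j. of_real r * (\<i> * of_real \<tau> * cubK b' a c' j))"
 "(%j. \<i> * of_real \<tau> * cubK b' c' (%j. of_real r * a j) j) = (%j. of_real r * (\<i> * of_real \<tau> * cubK b' c' a j))"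
 for a b' c' :: "int => complex" and r :: real by (auto simp: cubK_def algebra_simps)
 show "linear (%u. PV \<tau> K u v w)"
 by (rule lin; simp only: PV_def crd_add msk_add crd_scale msk_mult cadd cscale state_add state_scale)
 show "linear (%v. PV \<tau> K u v w)"
 by (rule lin; simp only: PV_def crd_add msk_add crd_scale msk_mult cadd cscale state_add state_scale)
 show "linear (%w. PV \<tau> K u v w)"
 by (rule lin; simp only: PV_def crd_add msk_add crd_scale msk_mult cadd cscale state_add state_scale)
 show "hV h K (PV \<tau> K u v w) <= 4 * (sqrt \<tau>)\<^sup>2 * (hV h K u * hV h K v * hV h K w)"
 proof -
 have "hV h K (PV \<tau> K u v w) = \<tau> * hK h K (cubK (msk K (crd u)) (msk K (crd v)) (msk K (crd w)))"
 using t unfolding PV_def hV_state msk_mult msk_supp[OF supp_cubK[OF sm]] hK_mult by (simp add: norm_mult)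
 also have "... <= \<tau> * (4 * (hK h K (msk K (crd u)) * hK h K (msk K (crd v)) * hK h K (msk K (crd w))))"
 using t by (intro mult_left_mono hK_cubK_le[OF h sm sm sm]) auto
 also have "... <= \<tau> * (4 * (hV h K u * hV h K v * hV h K w))"
 using t unfolding hV_def by (intro mult_left_mono mult_mono) (auto simp: hK_nonneg[OF h])
 finally show ?thesis using t by simp
 qed
 show "omV h K (PV \<tau> K u v w) x = omV h K (PV \<tau> K x u v) w"
 unfolding omV_def msk_PV omK_cubK unfolding ipK_def cubK_def
 by (intro arg_cong[of _ _ "%z. - h * \<tau> * z"] sum.cong) (auto simp: inner_complex_def algebra_simps)
 show "\<bar>omV h K (PV \<tau> K u v w) (AV (\<tau> / h\<^sup>2) K x) + omV h K (PV \<tau> K u v (AV (\<tau> / h\<^sup>2) K w)) x\<bar>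
 <= 4 * (sqrt \<tau>) ^ 4 * (hV h K u * hV h K v * hV h K w * hV h K x)"
 proof -
 let ?u = "msk K (crd u)" and ?v = "msk K (crd v)" and ?w = "msk K (crd w)" and ?x = "msk K (crd x)" and ?c = "\<tau> / h\<^sup>2"
 have e1: "ipK K (cubK ?u ?v ?w) (%j. \<i> * of_real ?c * shK K ?x j) = ?c * ipK K (cubK ?u ?v ?w) (%j. \<i> * shK K ?x j)"
 unfolding ipK_mult_right[symmetric] by (simp add: mult_ac)
 have "ipK K (cubK ?u ?v (%j. \<i> * of_real ?c * shK K ?w j)) ?x = ipK K ?x (%j. of_real ?c * (\<i> * cubK ?u ?v (shK K ?w) j))"
 unfolding ip_commute[of K ?x] by (rule arg_cong[of _ _ "%z. ipK K z ?x"]) (auto simp: cubK_def mult_ac)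
 also have "... = ?c * ipK K (%j. \<i> * cubK ?u ?v (shK K ?w) j) ?x" unfolding ipK_mult_right by (simp add: ip_commute)
 finally have e2: "ipK K (cubK ?u ?v (%j. \<i> * of_real ?c * shK K ?w j)) ?x = ?c * ipK K (%j. \<i> * cubK ?u ?v (shK K ?w) j) ?x" .
 have "omV h K (PV \<tau> K u v w) (AV ?c K x) + omV h K (PV \<tau> K u v (AV ?c K w)) x
 = - h * \<tau> * ?c * (ipK K (cubK ?u ?v ?w) (%j. \<i> * shK K ?x j) + ipK K (%j. \<i> * cubK ?u ?v (shK K ?w) j) ?x)"
 unfolding omV_def msk_PV msk_AV omK_cubK e1 e2 by (simp only: distrib_left mult.assoc)
 then have "\<bar>omV h K (PV \<tau> K u v w) (AV ?c K x) + omV h K (PV \<tau> K u v (AV ?c K w)) x\<bar>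
 = (h * \<tau> * ?c) * \<bar>ipK K (cubK ?u ?v ?w) (%j. \<i> * shK K ?x j) + ipK K (%j. \<i> * cubK ?u ?v (shK K ?w) j) ?x\<bar>"
 using h t by (simp add: abs_mult)
 also have "... <= (h * \<tau> * ?c) * (4 * h * (hK h K ?u * hK h K ?v * hK h K ?w * hK h K ?x))"
 using h t by (intro mult_left_mono cub_pair[OF h sm sm sm sm]) auto
 also have "... = 4 * \<tau>\<^sup>2 * (hK h K ?u * hK h K ?v * hK h K ?w * hK h K ?x)"
 using h by (simp add: power2_eq_square field_simps)
 also have "... <= 4 * \<tau>\<^sup>2 * (hV h K u * hV h K v * hV h K w * hV h K x)"
 unfolding hV_def by (intro mult_left_mono mult_mono) (auto simp: hK_nonneg[OF h])
 also have "\<tau>\<^sup>2 = (sqrt \<tau>) ^ 4"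
 proof -
 have "(sqrt \<tau>) ^ 4 = ((sqrt \<tau>)\<^sup>2)\<^sup>2" by (simp only: power_mult[symmetric]) simp
 then show ?thesis using t by simp
 qed
 finally show ?thesis .
 qed
qed (use assms in auto)

section \<open>The two flows on the grid\<close>

lemma state_path_derivative:
 assumes "!!j. ((%t. f t j) has_vector_derivative g j) (at t)"
 shows "((%t. state K (f t)) has_vector_derivative state K g) (at t)"
proof -
 define e where "e j z = state K (%i. if i = j then z else 0)" for j z
 have bl: "bounded_linear (e j)" for j
 proof (rule bounded_linear_intro[of _ "2 * real K + 1"])
 show "e j (x + y) = e j x + e j y" for x y unfolding e_def state_add[symmetric] by (rule arg_cong[of _ _ "state K"]) auto
 show "e j (r *\<^sub>R x) = r *\<^sub>R e j x" for r x
 unfolding e_def state_scale[symmetric] by (rule arg_cong[of _ _ "state K"]) (auto simp: scaleR_conv_of_real)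
 show "norm (e j x) <= norm x * (2 * real K + 1)" for x
 using norm_state_le[of "%i. if i = j then x else 0" "norm x"] by (simp add: e_def mult.commute)
 qed
 have st: "state K f = (\<Sum>j=-int K..int K. e j (f j))" for f
 proof (rule blinfun_eqI)
 fix x
 have "blinfun_apply (\<Sum>j=-int K..int K. e j (f j)) x = (\<Sum>j=-int K..int K. \<Sum>i=-int K..int K. if i = j then apply_bcontfun x i *\<^sub>R f j else 0)"
 unfolding e_def blinfun.sum_left apply_state by (intro sum.cong) auto
 then show "blinfun_apply (state K f) x = blinfun_apply (\<Sum>j=-int K..int K. e j (f j)) x" by (simp add: apply_state)
 qed
 show ?thesis unfolding st
 by (intro has_vector_derivative_sum bounded_linear.has_vector_derivative[OF bl] assms)
qed

lemma V_supp: "\<psi> \<in> V K ==> supp K \<psi>" by (auto simp: V_def supp_def)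

lemma Phi_A_solves:
 assumes "\<psi> \<in> V K"
 shows "solves_A h K (%t. Phi_A h K t \<psi>)" "Phi_A h K 0 \<psi> = \<psi>"
proof -
 have "solves_A h K (THE u. solves_A h K u \<and> u 0 = \<psi>) \<and> (THE u. solves_A h K u \<and> u 0 = \<psi>) 0 = \<psi>"
 by (rule theI'[OF solves_A_ex1[OF assms]])
 then show "solves_A h K (%t. Phi_A h K t \<psi>)" "Phi_A h K 0 \<psi> = \<psi>" by (simp_all add: Phi_A_def)
qed

lemma Phi_A_V: "\<psi> \<in> V K ==> Phi_A h K t \<psi> \<in> V K"
 using Phi_A_solves(1) by (auto simp: solves_A_def)

lemma gen_A_shK: "supp K \<psi> ==> gen_A h K \<psi> j = \<i> * of_real (1 / h\<^sup>2) * (shK K \<psi> j - 2 * \<psi> j)"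
 by (auto simp: gen_A_def shK_def supp_def)

lemma Phi_A_deriv:
 assumes "\<psi> \<in> V K"
 shows "((%t. Phi_A h K t \<psi> j) has_vector_derivative
 \<i> * of_real (1 / h\<^sup>2) * (shK K (Phi_A h K t \<psi>) j - 2 * Phi_A h K t \<psi> j)) (at t)"
 using Phi_A_solves(1)[OF assms, of h] gen_A_shK[OF V_supp[OF Phi_A_V[OF assms]], of h h t j]
 unfolding solves_A_iff by metis

lemma Phi_P_V: "\<psi> \<in> V K ==> Phi_P t \<psi> \<in> V K"
 by (auto simp: V_def Phi_P_def)

lemma cmod_Phi_P [simp]: "cmod (Phi_P t \<psi> j) = cmod (\<psi> j)"
 by (simp add: Phi_P_def norm_mult)

lemma Phi_P_phase: "cmod c = 1 ==> Phi_P t (%j. c * \<psi> j) = (%j. c * Phi_P t \<psi> j)"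
 by (rule ext) (simp add: Phi_P_def norm_mult)

lemma Phi_P_deriv:
 "((%t. Phi_P (t * \<tau>) \<psi> l) has_vector_derivative \<i> * of_real \<tau> * cubK (Phi_P (t * \<tau>) \<psi>) (Phi_P (t * \<tau>) \<psi>) (Phi_P (t * \<tau>) \<psi>) l) (at t)"
proof -
 define c :: real where "c = (cmod (\<psi> l))\<^sup>2"
 have "((%z. exp (\<i> * (z * of_real \<tau>) * of_real c) * \<psi> l) has_field_derivative
 (\<i> * of_real \<tau> * of_real c * (exp (\<i> * (of_real t * of_real \<tau>) * of_real c) * \<psi> l))) (at (of_real t))"
 by (auto intro!: derivative_eq_intros)
 from has_vector_derivative_real_field[OF this]
 have "((%t. Phi_P (t * \<tau>) \<psi> l) has_vector_derivative \<i> * of_real \<tau> * of_real c * Phi_P (t * \<tau>) \<psi> l) (at t)"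
 by (simp add: Phi_P_def c_def)
 moreover have "cubK w w w l = of_real ((cmod (w l))\<^sup>2) * w l" for w
 unfolding complex_norm_square by (simp add: cubK_def mult_ac)
 ultimately show ?thesis by (simp add: c_def mult.assoc)
qed

lemma shK_mult: "shK K (%j. c * f j) = (%j. c * shK K f j)"
 by (auto simp: shK_def algebra_simps)

lemma ip_i_shK:
 assumes "supp K f"
 shows "ipK K f (%j. \<i> * shK K f j) = 0"
proof -
 have s: "supp K (%j. \<i> * f j)" using assms by (auto simp: supp_def)
 have "ipK K f (%j. \<i> * shK K f j) = ipK K (shK K (%j. \<i> * f j)) f" by (simp add: shK_mult ip_commute)
 also have "... = ipK K (shK K f) (%j. \<i> * f j)" by (rule ip_shK_sym[OF s assms])
 also have "... = - ipK K f (%j. \<i> * shK K f j)"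
 unfolding ipK_def sum_negf[symmetric] by (rule sum.cong) (auto simp: inner_complex_def)
 finally show ?thesis by simp
qed

lemma ipK_sub_right: "ipK K f (%j. of_real c * (a j - b j)) = c * (ipK K f a - ipK K f b)"
 unfolding ipK_mult_right by (simp add: ipK_def inner_diff_right sum_subtractf)

lemma ip_path_deriv:
 assumes "!!j. ((%t. f t j) has_vector_derivative f' j) (at t)" "!!j. ((%t. g t j) has_vector_derivative g' j) (at t)"
 shows "((%t. ipK K (f t) (g t)) has_real_derivative (ipK K (f t) g' + ipK K f' (g t))) (at t)"
 unfolding ipK_def sum.distrib[symmetric]
proof (rule DERIV_sum)
 fix j
 show "((%t. f t j \<bullet> g t j) has_real_derivative f t j \<bullet> g' j + f' j \<bullet> g t j) (at t)"
 unfolding has_real_derivative_iff_has_vector_derivative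
 by (rule bounded_bilinear.has_vector_derivative[OF bounded_bilinear_inner assms])
qed

lemma ip_i_self: "ipK K f (%j. \<i> * f j) = 0"
 by (simp add: ipK_def inner_complex_def)

locale linear_flow =
 fixes h :: real and K :: nat and \<psi> :: "int => complex"
 assumes h: "h > 0" and psi: "\<psi> \<in> V K"
begin

abbreviation "u t \<equiv> Phi_A h K t \<psi>"
definition "u' t j = of_real (1 / h\<^sup>2) * (\<i> * shK K (u t) j - \<i> * (2 * u t j))" for t j

lemma s: "supp K (u t)" by (rule V_supp[OF Phi_A_V[OF psi]])

lemma du: "((%t. u t j) has_vector_derivative u' t j) (at t)"
proof -
 have "\<i> * c * (a - 2 * b) = c * (\<i> * a - \<i> * (2 * b))" for a b c :: complex by (simp add: algebra_simps)
 then show ?thesis using Phi_A_deriv[OF psi, of h j t] unfolding u'_def by (simp only:)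
qed

lemma ip_uu': "ipK K (u t) (u' t) = 0"
proof -
 have "ipK K (u t) (%j. \<i> * (2 * u t j)) = ipK K (u t) (%j. of_real 2 * (\<i> * u t j))"
 by (simp add: mult_ac)
 then show ?thesis unfolding u'_def[abs_def] ipK_sub_right ip_i_shK[OF s] by (simp only: ipK_mult_right ip_i_self) simp
qed

lemma ip_Suu': "ipK K (shK K (u t)) (u' t) = 0"
proof -
 have "ipK K (shK K (u t)) (%j. \<i> * (2 * u t j)) = - ipK K (u t) (%j. of_real 2 * (\<i> * shK K (u t) j))"
 unfolding ipK_def sum_negf[symmetric] by (rule sum.cong) (auto simp: inner_complex_def algebra_simps)
 then show ?thesis unfolding u'_def[abs_def] ipK_sub_right ip_i_self by (simp only: ipK_mult_right ip_i_shK[OF s]) simp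
qed

lemma nK_const: "nK h K (u t) = nK h K \<psi>"
proof -
 have "((%t. ipK K (u t) (u t)) has_real_derivative 0) (at t)" for t
 using ip_path_deriv[where f = u and g = u and f' = "u' t" and g' = "u' t" and t = t and K = K, OF du du] by (simp add: ip_uu' ip_commute[of K "u' t"])
 then have "ipK K (u t) (u t) = ipK K (u 0) (u 0)" using DERIV_isconst_all by blast
 then show ?thesis by (simp add: nK_ip Phi_A_solves[OF psi])
qed

lemma dK_const: "dK h K (u t) = dK h K \<psi>"
proof -
 have d: "((%t. shK K (u t) j) has_vector_derivative shK K (u' t) j) (at t)" for t j
 proof (cases "\<bar>j\<bar> <= int K")
 case True
 then show ?thesis using has_vector_derivative_add[OF du[of "j + 1" t] du[of "j - 1" t]] by (simp add: shK_def)
 qed (simp add: shK_def)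
 have u's: "supp K (u' t)" for t using s[of t] supp_shK[of K "u t"] by (auto simp: supp_def u'_def)
 have "((%t. ipK K (shK K (u t)) (u t)) has_real_derivative 0) (at t)" for t
 using ip_path_deriv[where f = "%t. shK K (u t)" and g = u and f' = "shK K (u' t)" and g' = "u' t" and t = t and K = K, OF d du] ip_shK_sym[OF u's[of t] s[of t]] by (simp add: ip_Suu')
 then have "ipK K (shK K (u t)) (u t) = ipK K (shK K (u 0)) (u 0)" using DERIV_isconst_all by blast
 moreover have "ipK K (u t) (u t) = ipK K (u 0) (u 0)" using nK_const[of t] nK_const[of 0] h by (simp add: nK_ip)
 ultimately have "h * dK h K (u t) = h * dK h K (u 0)" unfolding dK_ip[OF h s] by simp
 then show ?thesis using h by (simp add: Phi_A_solves[OF psi])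
qed

lemma hK_const: "hK h K (u t) = hK h K \<psi>"
 by (simp add: hK_def nK_const dK_const)

text \<open>The derivative is 4 / h times a pairing in which the two terms of
  \<open>cub_pair\<close> coincide, so each is at most 2 h times the fourth power of the norm, and
  no inverse power of \<open>h\<close> survives. A lower bound suffices for an upper bound on the
  energy, where \<open>qK\<close> enters with a minus sign.\<close>

lemma qK_lower:
 assumes "t >= 0" shows "qK h K \<psi> - 8 * hK h K \<psi> ^ 4 * t <= qK h K (u t)"
proof -
 let ?H = "hK h K \<psi>"
 let ?d = "%t. h * (4 * ipK K (cubK (u t) (u t) (u t)) (u' t))"
 have q: "qK h K f = h * (\<Sum>j\<in>cells K. (f j \<bullet> f j)\<^sup>2)" for f
 unfolding qK_def power2_norm_eq_inner[symmetric] by (simp add: power_mult[symmetric])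
 have cub: "cubK f f f j = (f j \<bullet> f j) *\<^sub>R f j" for f j
 by (simp add: cubK_def power2_norm_eq_inner[symmetric] scaleR_conv_of_real complex_norm_square[symmetric] del: of_real_power)
 have d: "((%t. qK h K (u t)) has_real_derivative ?d t) (at t)" for t
 proof -
 have dd: "((%t. u t j \<bullet> u t j) has_real_derivative 2 * (u t j \<bullet> u' t j)) (at t)" for j
 unfolding has_real_derivative_iff_has_vector_derivative
 using bounded_bilinear.has_vector_derivative[OF bounded_bilinear_inner du[of j t] du[of j t]] by (simp add: inner_commute)
 have "((%t. (u t j \<bullet> u t j)\<^sup>2) has_real_derivative 4 * (cubK (u t) (u t) (u t) j \<bullet> u' t j)) (at t)" for j
 using DERIV_power[OF dd[of j], where n = 2] by (simp add: cub mult_ac)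
 then show ?thesis unfolding q ipK_def sum_distrib_left[of 4] by (intro DERIV_cmult DERIV_sum)
 qed
 have b: "?d t >= - 8 * ?H ^ 4" for t
 proof -
 have 1: "ipK K (%j. \<i> * cubK (u t) (u t) (shK K (u t)) j) (u t) = ipK K (cubK (u t) (u t) (u t)) (%j. \<i> * shK K (u t) j)"
 unfolding ipK_def by (rule sum.cong) (auto simp: cubK_def inner_complex_def algebra_simps)
 have le: "\<bar>ipK K (cubK (u t) (u t) (u t)) (%j. \<i> * shK K (u t) j)\<bar> <= 2 * h * ?H ^ 4"
 using cub_pair[OF h s[of t] s[of t] s[of t] s[of t]] unfolding 1 hK_const by (simp add: power4_eq_xxxx)
 have "ipK K (cubK (u t) (u t) (u t)) (%j. \<i> * (2 * u t j)) = 0"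
 unfolding ipK_def cub inner_scaleR_left by (rule sum.neutral) (simp add: inner_complex_def)
 then have e: "?d t = 4 / h * ipK K (cubK (u t) (u t) (u t)) (%j. \<i> * shK K (u t) j)"
 unfolding u'_def[abs_def] ipK_sub_right by (simp only: power2_eq_square) (use h in \<open>simp add: field_simps\<close>)
 have gen: "- 8 * H <= 4 / h * I" if "\<bar>I\<bar> <= 2 * h * H" for I H :: real
 proof -
 have "- (2 * h * H) <= I" using that by linarith
 then have "4 / h * (- (2 * h * H)) <= 4 / h * I" by (rule mult_left_mono) (use h in simp)
 then show ?thesis using h by simp
 qed
 show ?thesis unfolding e by (rule gen[OF le])
 qed
 define g where "g t = qK h K (u t) + (8 * ?H ^ 4) * t" for t
 have dg: "(g has_real_derivative ?d x + 8 * ?H ^ 4) (at x)" for x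
 unfolding g_def[abs_def] by (rule DERIV_add[OF d DERIV_cmult_Id])
 have nn: "0 <= ?d x + 8 * ?H ^ 4" for x using b[of x] by (simp only: mult_minus_left)
 have "g 0 <= g t" by (rule DERIV_nonneg_imp_nondecreasing[OF assms]) (use dg nn in blast)
 then show ?thesis unfolding g_def Phi_A_solves(2)[OF psi] by simp
qed

end

lemma cis_diff_le: "cmod (exp (\<i> * of_real x) - exp (\<i> * of_real y)) <= \<bar>x - y\<bar>"
proof -
 have "exp (\<i> * of_real x) - exp (\<i> * of_real y) = exp (\<i> * of_real y) * (exp (\<i> * of_real (x - y)) - 1)"
 by (simp add: algebra_simps exp_add[symmetric])
 then have "cmod (exp (\<i> * of_real x) - exp (\<i> * of_real y)) = cmod (exp (\<i> * of_real (x - y)) - 1)" by (simp add: norm_mult)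
 also have "... = 2 * \<bar>sin ((x - y) / 2)\<bar>" using dist_exp_i_1[of "x - y"] by (simp add: dist_norm)
 also have "... <= \<bar>x - y\<bar>" using abs_sin_x_le_abs_x[of "(x - y) / 2"] by simp
 finally show ?thesis .
qed

text \<open>Neighbouring nodes are rotated by different phases. The phase difference is at most the
  time times the difference of squared moduli, which is again controlled by the difference of the
  nodal values.\<close>

lemma dK_Phi_P:
 assumes h: "h > 0" and \<psi>: "supp K \<psi>" and t: "t >= 0"
 shows "dK h K (Phi_P t \<psi>) <= (1 + 2 * t * (hK h K \<psi>)\<^sup>2)\<^sup>2 * dK h K \<psi>"
proof -
 let ?H = "hK h K \<psi>"
 have le: "cmod (\<psi> j) <= ?H" for j by (rule cmod_le_hK[OF h \<psi>])
 have "cmod (Phi_P t \<psi> (j + 1) - Phi_P t \<psi> j) <= (1 + 2 * t * ?H\<^sup>2) * cmod (\<psi> (j + 1) - \<psi> j)" for j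
 proof -
 let ?a = "\<psi> (j + 1)" and ?b = "\<psi> j"
 let ?x = "t * (cmod ?a)\<^sup>2" and ?y = "t * (cmod ?b)\<^sup>2"
 have P: "Phi_P t \<psi> i = exp (\<i> * of_real (t * (cmod (\<psi> i))\<^sup>2)) * \<psi> i" for i by (simp add: Phi_P_def mult.assoc)
 have "Phi_P t \<psi> (j + 1) - Phi_P t \<psi> j = exp (\<i> * of_real ?x) * (?a - ?b) + (exp (\<i> * of_real ?x) - exp (\<i> * of_real ?y)) * ?b"
 unfolding P by (simp add: algebra_simps)
 then have "cmod (Phi_P t \<psi> (j + 1) - Phi_P t \<psi> j) <= cmod (exp (\<i> * of_real ?x) * (?a - ?b)) + cmod ((exp (\<i> * of_real ?x) - exp (\<i> * of_real ?y)) * ?b)"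
 using norm_triangle_ineq by simp
 also have "... = cmod (?a - ?b) + cmod (exp (\<i> * of_real ?x) - exp (\<i> * of_real ?y)) * cmod ?b" by (simp add: norm_mult)
 also have "cmod (exp (\<i> * of_real ?x) - exp (\<i> * of_real ?y)) * cmod ?b <= (t * (2 * ?H) * cmod (?a - ?b)) * ?H"
 proof (rule mult_mono[OF _ le])
 have "\<bar>(cmod ?a)\<^sup>2 - (cmod ?b)\<^sup>2\<bar> = (cmod ?a + cmod ?b) * \<bar>cmod ?a - cmod ?b\<bar>"
 by (simp add: power2_eq_square abs_mult[symmetric] square_diff_square_factored) (simp add: abs_mult)
 also have "... <= (2 * ?H) * cmod (?a - ?b)"
 using le[of j] le[of "j + 1"] norm_triangle_ineq3[of ?a ?b] hK_nonneg[OF h] by (intro mult_mono) auto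
 finally have "t * \<bar>(cmod ?a)\<^sup>2 - (cmod ?b)\<^sup>2\<bar> <= t * (2 * ?H * cmod (?a - ?b))" using t by (rule mult_left_mono)
 moreover have "\<bar>?x - ?y\<bar> = t * \<bar>(cmod ?a)\<^sup>2 - (cmod ?b)\<^sup>2\<bar>" using t by (simp add: right_diff_distrib[symmetric] abs_mult)
 ultimately show "cmod (exp (\<i> * of_real ?x) - exp (\<i> * of_real ?y)) <= t * (2 * ?H) * cmod (?a - ?b)"
 using cis_diff_le[of ?x ?y] by (simp add: mult.assoc)
 qed (use t hK_nonneg[OF h] in auto)
 finally show ?thesis by (simp add: algebra_simps power2_eq_square)
 qed
 then have "(cmod (Phi_P t \<psi> (j + 1) - Phi_P t \<psi> j))\<^sup>2 <= ((1 + 2 * t * ?H\<^sup>2) * cmod (\<psi> (j + 1) - \<psi> j))\<^sup>2" for j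
 by (rule power_mono) simp
 then have "(\<Sum>j\<in>cells K. (cmod (Phi_P t \<psi> (j + 1) - Phi_P t \<psi> j))\<^sup>2) <= (\<Sum>j\<in>cells K. (1 + 2 * t * ?H\<^sup>2)\<^sup>2 * (cmod (\<psi> (j + 1) - \<psi> j))\<^sup>2)"
 unfolding power_mult_distrib by (rule sum_mono)
 from divide_right_mono[OF this, of h] h show ?thesis by (simp add: dK_def sum_distrib_left[symmetric])
qed

lemma nK_Phi_P [simp]: "nK h K (Phi_P t \<psi>) = nK h K \<psi>" and qK_Phi_P [simp]: "qK h K (Phi_P t \<psi>) = qK h K \<psi>"
 by (simp_all add: nK_def qK_def)

lemma hK_Phi_P:
 assumes h: "h > 0" and \<psi>: "supp K \<psi>" and t: "t >= 0"
 shows "hK h K (Phi_P t \<psi>) <= (1 + 2 * t * (hK h K \<psi>)\<^sup>2) * hK h K \<psi>"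
proof -
 let ?c = "1 + 2 * t * (hK h K \<psi>)\<^sup>2"
 have c: "1 <= ?c" using t by simp
 then have c2: "1 <= ?c\<^sup>2" by simp
 have "nK h K \<psi> <= ?c\<^sup>2 * nK h K \<psi>" using mult_right_mono[OF c2 nK_nonneg[OF h, of K \<psi>]] by simp
 then have "nK h K (Phi_P t \<psi>) + dK h K (Phi_P t \<psi>) <= ?c\<^sup>2 * nK h K \<psi> + ?c\<^sup>2 * dK h K \<psi>"
 unfolding nK_Phi_P using dK_Phi_P[OF assms] by (rule add_mono)
 then have "(hK h K (Phi_P t \<psi>))\<^sup>2 <= ?c\<^sup>2 * nK h K \<psi> + ?c\<^sup>2 * dK h K \<psi>" by (simp only: hK_sq[OF h, of K "Phi_P t \<psi>"])
 also have "... = (?c * hK h K \<psi>)\<^sup>2" by (simp only: power_mult_distrib hK_sq[OF h] distrib_left)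
 finally show ?thesis by (rule power2_le_imp_le) (use c hK_nonneg[OF h] in auto)
qed

definition Fs :: "real => nat => (int => complex) => real" where
 "Fs h K \<psi> = dK h K \<psi> - qK h K \<psi> / 2 + nK h K \<psi> / 16"

lemma qK_phase: "cmod c = 1 ==> qK h K (%j. c * f j) = qK h K f"
 by (simp add: qK_def norm_mult)

text \<open>The shift sum is 2 minus the gradient form, so the quadratic energy contains the mass
  with the large weight 2 / h^2. The mass is conserved, and only its combination with
  \<open>Fs\<close> matters.\<close>

lemma leading_energy:
 assumes h: "h > 0" and s: "supp K f"
 shows "omV h K (AV (\<tau> / h\<^sup>2) K (state K f)) (state K f) / 2 + omV h K (PV \<tau> K (state K f) (state K f) (state K f)) (state K f) / 4
 = \<tau> / 2 * (Fs h K f - (2 / h\<^sup>2 + 1 / 16) * nK h K f)"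
proof -
 have m: "msk K (crd (state K f)) = f" by (simp add: msk_supp[OF s])
 have 1: "omV h K (AV (\<tau> / h\<^sup>2) K (state K f)) (state K f) = - h * (\<tau> / h\<^sup>2) * ipK K (shK K f) f"
 unfolding omV_def msk_AV m by (rule omK_shK[OF s s])
 have 2: "ipK K (shK K f) f = 2 * (nK h K f / h) - h * dK h K f"
 using dK_ip[OF h s] h by (simp add: nK_ip)
 have "ipK K (cubK f f f) f = (\<Sum>j\<in>cells K. (cmod (f j)) ^ 4)"
 unfolding ipK_def
 proof (rule sum.cong[OF refl])
 fix j
 have "cubK f f f j = of_real ((cmod (f j))\<^sup>2) * f j" unfolding complex_norm_square by (simp add: cubK_def mult_ac)
 then show "cubK f f f j \<bullet> f j = (cmod (f j)) ^ 4"
 by (simp add: scaleR_conv_of_real[symmetric] power2_norm_eq_inner[symmetric] del: of_real_power)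
 qed
 then have 3: "omV h K (PV \<tau> K (state K f) (state K f) (state K f)) (state K f) = - \<tau> * qK h K f"
 unfolding omV_def msk_PV m omK_cubK by (simp add: qK_def)
 have alg: "- h * (t / h\<^sup>2) * (2 * (n / h) - h * d) / 2 + (- t * q) / 4 = t / 2 * (d - q / 2 + n / 16 - (2 / h\<^sup>2 + 1 / 16) * n)" for t n d q
 using h by (simp add: field_simps power2_eq_square)
 show ?thesis unfolding 1 2 3 Fs_def by (rule alg)
qed

text \<open>The modified energy belongs to the system without the diagonal of the Laplacian, whose
  orbit is the true one multiplied by a phase that grows with each step. The energy is evaluated at
  the rotated sequence and therefore indexed by the step number.\<close>

lemma splitting_energy:
 fixes Rb :: real and M :: nat
 assumes Rb: "1 <= Rb"
 obtains C where "C >= 0" "!!h \<tau> K. h > 0 ==> 0 < \<tau> ==> \<tau> <= 1 ==> (2 * real M + 3) * (\<tau> / h\<^sup>2) < 2 * pi / 3 ==>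
 \<exists>E. (\<forall>n. \<forall>\<psi>\<in>V K. hK h K \<psi> <= Rb --> \<bar>E n \<psi> - \<tau> / 2 * (Fs h K \<psi> - (2 / h\<^sup>2 + 1 / 16) * nK h K \<psi>)\<bar> <= C * \<tau>\<^sup>2) \<and>
 (\<forall>n. \<forall>\<psi>\<in>V K. (\<forall>s\<in>{0..1}. hK h K (Phi_P (s * \<tau>) \<psi>) <= Rb) -->
 \<bar>E (Suc n) (Phi_A h K \<tau> (Phi_P \<tau> \<psi>)) - E (n::nat) \<psi>\<bar> <= C * \<tau> ^ (M + 3))"
proof -
 \<comment> \<open>The product of 4/3, which bounds (2 M + 4) / (2 M + 3), the norm bound 2 of the
   shift sum, and the CFL limit 2 \<pi> / 3; being below 2 \<pi>, it can serve as
   \<open>\<Omega>\<close>.\<close>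
 have o: "0 <= 16 * pi / 9" "16 * pi / 9 < 2 * pi" using pi_gt_zero by auto
 show thesis
 proof (rule modified_energy[where 'v = space and p = 4 and \<kappa> = 4 and M = M, OF o Rb])
 fix C \<rho> B :: real and b :: "nat => real"
 assume C: "C >= 0"
 and main: "!!hn om A P C0 C1 \<alpha> co \<sigma>. kicked (hn :: space => real) om A P C0 C1 \<alpha> 4 4 co \<sigma> (16 * pi / 9) \<rho> B b (2 * M + 3) ==>
 \<exists>E. (\<forall>\<psi>. hn \<psi> <= Rb --> \<bar>E \<psi> - om (A \<psi>) \<psi> / 2 - om (P \<psi> \<psi> \<psi>) \<psi> / 4\<bar> <= C * \<sigma>^4) \<and>
 (\<forall>\<gamma> \<beta>. (\<forall>t. (\<gamma> has_vector_derivative A (\<gamma> t)) (at t)) -->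
 (\<forall>t. (\<beta> has_vector_derivative P (\<beta> t) (\<beta> t) (\<beta> t)) (at t)) -->
 \<gamma> 0 = \<beta> 1 --> (\<forall>t\<in>{0..1}. hn (\<beta> t) <= Rb) -->
 \<bar>E (\<gamma> 1) - E (\<beta> 0)\<bar> <= C * \<sigma> ^ (2 * M + 6))"
 and \<rho>: "\<rho> >= 1" "16 * pi / 9 < \<rho>"
 and b: "summable (%n. \<bar>b n\<bar> * \<rho> ^ n)" "(\<Sum>n. \<bar>b n\<bar> * \<rho> ^ n) <= B"
 "!!n. (\<Sum>m\<le>n. b m / fact (Suc (n - m))) = (if n = 0 then 1 else (0::real))"
 show thesis
 proof (rule that[OF C])
 fix h \<tau> :: real and K :: nat
 assume h: "h > 0" and t: "0 < \<tau>" "\<tau> <= 1" and cfl: "(2 * real M + 3) * (\<tau> / h\<^sup>2) < 2 * pi / 3"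
 define q where "q = \<tau> / h\<^sup>2"
 have q: "q > 0" using t h by (simp add: q_def)
 have "real M * q >= 0" using q by simp
 then have "(2 * real M + 4) * q <= 4 / 3 * ((2 * real M + 3) * q)" by (simp add: algebra_simps)
 then have "real (2 * M + 3 + 1) * (2 * (\<tau> / h\<^sup>2)) <= 16 * pi / 9"
 using cfl unfolding q_def[symmetric] by (simp add: algebra_simps)
 note cfl' = this
 have L: "3 <= 2 * M + 3" by simp
 obtain E where E: "(\<forall>\<psi>. hV h K \<psi> <= Rb --> \<bar>E \<psi> - omV h K (AV (\<tau> / h\<^sup>2) K \<psi>) \<psi> / 2 - omV h K (PV \<tau> K \<psi> \<psi> \<psi>) \<psi> / 4\<bar> <= C * (sqrt \<tau>) ^ 4) \<and>
 (\<forall>\<gamma> \<beta>. (\<forall>t. (\<gamma> has_vector_derivative AV (\<tau> / h\<^sup>2) K (\<gamma> t)) (at t)) -->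
 (\<forall>t. (\<beta> has_vector_derivative PV \<tau> K (\<beta> t) (\<beta> t) (\<beta> t)) (at t)) -->
 \<gamma> 0 = \<beta> 1 --> (\<forall>t\<in>{0..1}. hV h K (\<beta> t) <= Rb) -->
 \<bar>E (\<gamma> 1) - E (\<beta> 0)\<bar> <= C * (sqrt \<tau>) ^ (2 * M + 6))"
 using main[OF kicked_grid[where K = K, OF h t L cfl' \<rho> b]] by (rule exE)
 note E1 = conjunct1[OF E, rule_format] and E2 = conjunct2[OF E, THEN spec, THEN spec, THEN mp, THEN mp, THEN mp, THEN mp]
 have sq: "(sqrt \<tau>) ^ (2 * k) = \<tau> ^ k" for k using t by (simp add: power_mult)
 have sq4: "(sqrt \<tau>) ^ 4 = \<tau>\<^sup>2" "(sqrt \<tau>) ^ (2 * M + 6) = \<tau> ^ (M + 3)"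
 using sq[of 2] sq[of "M + 3"] by simp_all
 \<comment> \<open>One step contributes the phase 2 \<tau> / h^2, which undoes the rotation caused
   by the diagonal of the Laplacian.\<close>
 define c where "c n = exp (\<i> * of_real (real n * (2 * q)))" for n :: nat
 have c1: "cmod (c n) = 1" for n unfolding c_def by (rule norm_exp_i_times)
 define F where "F n \<psi> = E (state K (%j. c n * \<psi> j))" for n \<psi>
 have "\<bar>F n \<psi> - \<tau> / 2 * (Fs h K \<psi> - (2 / h\<^sup>2 + 1 / 16) * nK h K \<psi>)\<bar> <= C * \<tau>\<^sup>2"
 if \<psi>: "\<psi> \<in> V K" and b: "hK h K \<psi> <= Rb" for n \<psi>
 proof -
 let ?x = "%j. c n * \<psi> j"
 have s: "supp K ?x" using V_supp[OF \<psi>] by (auto simp: supp_def)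
 have "hV h K (state K ?x) <= Rb" unfolding hV_state msk_supp[OF s] hK_mult c1 using b by simp
 from E1[OF this] have "\<bar>F n \<psi> - (omV h K (AV (\<tau> / h\<^sup>2) K (state K ?x)) (state K ?x) / 2 + omV h K (PV \<tau> K (state K ?x) (state K ?x) (state K ?x)) (state K ?x) / 4)\<bar> <= C * \<tau>\<^sup>2"
 unfolding sq4 F_def by (simp add: diff_diff_eq)
 then show ?thesis unfolding leading_energy[OF h s] by (simp add: Fs_def dK_mult nK_mult qK_phase c1)
 qed
 moreover have "\<bar>F (Suc n) (Phi_A h K \<tau> (Phi_P \<tau> \<psi>)) - F n \<psi>\<bar> <= C * \<tau> ^ (M + 3)"
 if \<psi>: "\<psi> \<in> V K" and b: "\<forall>s\<in>{0..1}. hK h K (Phi_P (s * \<tau>) \<psi>) <= Rb" for n \<psi>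
 proof -
 define x where "x = (%j. c n * \<psi> j)"
 have sx: "supp K (Phi_P r x)" for r using V_supp[OF \<psi>] by (auto simp: supp_def x_def Phi_P_def)
 define \<beta> where "\<beta> r = state K (Phi_P (r * \<tau>) x)" for r
 have dB: "(\<beta> has_vector_derivative PV \<tau> K (\<beta> r) (\<beta> r) (\<beta> r)) (at r)" for r
 proof -
 have "msk K (crd (\<beta> r)) = Phi_P (r * \<tau>) x" by (simp add: \<beta>_def msk_supp[OF sx])
 then show ?thesis unfolding PV_def \<beta>_def[abs_def] by (simp only:) (rule state_path_derivative, rule Phi_P_deriv)
 qed
 define y where "y = Phi_P \<tau> \<psi>"
 have y: "y \<in> V K" unfolding y_def by (rule Phi_P_V[OF \<psi>])
 \<comment> \<open>The linear flow rescaled to unit time and multiplied by the phase that removes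
   the diagonal, starting from the phase already accumulated.\<close>
 define w where "w r j = exp (\<i> * of_real (r * (2 * q))) * c n * Phi_A h K (r * \<tau>) y j" for r j
 define \<gamma> where "\<gamma> r = state K (w r)" for r
 have sw: "supp K (w r)" for r using V_supp[OF Phi_A_V[OF y]] by (auto simp: supp_def w_def)
 have dw: "((%r. w r j) has_vector_derivative \<i> * of_real q * shK K (w r) j) (at r)" for r j
 proof -
 let ?u = "Phi_A h K (r * \<tau>) y" and ?e = "exp (\<i> * of_real (r * (2 * q)))"
 let ?v = "\<i> * of_real (1 / h\<^sup>2) * (shK K ?u j - 2 * ?u j)"
 have "((%z. exp (\<i> * (z * of_real (2 * q)))) has_field_derivative (\<i> * of_real (2 * q)) * exp (\<i> * (of_real r * of_real (2 * q)))) (at (of_real r))"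
 by (auto intro!: derivative_eq_intros)
 from has_vector_derivative_real_field[OF this]
 have d1: "((%r. exp (\<i> * of_real (r * (2 * q)))) has_vector_derivative \<i> * of_real (2 * q) * ?e) (at r)"
 by simp
 have "((%r. r * \<tau>) has_vector_derivative \<tau>) (at r)"
 unfolding has_real_derivative_iff_has_vector_derivative[symmetric] by (auto intro!: derivative_eq_intros)
 from vector_diff_chain_at[OF this Phi_A_deriv[OF y, of h j "r * \<tau>"]]
 have d2: "((%r. Phi_A h K (r * \<tau>) y j) has_vector_derivative \<tau> *\<^sub>R ?v) (at r)" by (simp only: o_def)
 have d3: "((%r. w r j) has_vector_derivative (?e * c n) * (\<tau> *\<^sub>R ?v) + (\<i> * of_real (2 * q) * ?e * c n) * ?u j) (at r)"
 unfolding w_def by (rule has_vector_derivative_mult[OF has_vector_derivative_mult_left[OF d1] d2])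
 have tq: "complex_of_real \<tau> * of_real (1 / h\<^sup>2) = of_real q" unfolding q_def of_real_mult[symmetric] by simp
 have "(?e * c n) * (\<tau> *\<^sub>R ?v) + (\<i> * of_real (2 * q) * ?e * c n) * ?u j
 = ?e * c n * (\<i> * (complex_of_real \<tau> * of_real (1 / h\<^sup>2)) * (shK K ?u j - 2 * ?u j)) + \<i> * (2 * of_real q) * ?e * c n * ?u j"
 unfolding scaleR_conv_of_real of_real_mult of_real_numeral by (simp only: mult_ac)
 also have "... = \<i> * of_real q * ((?e * c n) * shK K ?u j)"
 unfolding tq by algebra
 also have "(?e * c n) * shK K ?u j = shK K (w r) j"
 unfolding w_def[abs_def] by (simp only: shK_mult)
 finally show ?thesis using d3 by simp
 qed
 have dG: "(\<gamma> has_vector_derivative AV (\<tau> / h\<^sup>2) K (\<gamma> r)) (at r)" for r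
 proof -
 have "msk K (crd (\<gamma> r)) = w r" by (simp add: \<gamma>_def msk_supp[OF sw])
 then show ?thesis unfolding AV_def \<gamma>_def[abs_def] q_def[symmetric] by (simp only:) (rule state_path_derivative, rule dw)
 qed
 have j: "\<gamma> 0 = \<beta> 1"
 unfolding \<gamma>_def \<beta>_def w_def x_def Phi_P_phase[OF c1] by (simp add: Phi_A_solves(2)[OF y]) (simp add: y_def)
 have "hV h K (\<beta> r) <= Rb" if "r \<in> {0..1}" for r
 unfolding \<beta>_def hV_state msk_supp[OF sx] unfolding x_def Phi_P_phase[OF c1] hK_mult c1 using b that by simp
 then have "\<bar>E (\<gamma> 1) - E (\<beta> 0)\<bar> <= C * \<tau> ^ (M + 3)"
 unfolding sq4(2)[symmetric] by (intro E2 allI ballI dG dB j)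
 moreover have "\<beta> 0 = state K (%j. c n * \<psi> j)" unfolding \<beta>_def x_def by (simp add: Phi_P_flow(1))
 moreover have "\<gamma> 1 = state K (%j. c (Suc n) * Phi_A h K \<tau> (Phi_P \<tau> \<psi>) j)"
 proof -
 have "exp (\<i> * of_real (1 * (2 * q))) * c n = c (Suc n)"
 unfolding c_def exp_add[symmetric] by (simp add: algebra_simps)
 then show ?thesis unfolding \<gamma>_def w_def[abs_def] y_def[symmetric] by simp
 qed
 ultimately show ?thesis by (simp add: F_def)
 qed
 ultimately show "\<exists>E. (\<forall>n. \<forall>\<psi>\<in>V K. hK h K \<psi> <= Rb --> \<bar>E n \<psi> - \<tau> / 2 * (Fs h K \<psi> - (2 / h\<^sup>2 + 1 / 16) * nK h K \<psi>)\<bar> <= C * \<tau>\<^sup>2) \<and>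
 (\<forall>n. \<forall>\<psi>\<in>V K. (\<forall>s\<in>{0..1}. hK h K (Phi_P (s * \<tau>) \<psi>) <= Rb) -->
 \<bar>E (Suc n) (Phi_A h K \<tau> (Phi_P \<tau> \<psi>)) - E (n::nat) \<psi>\<bar> <= C * \<tau> ^ (M + 3))" by blast
 qed
 qed
qed

section \<open>Stability of grid sequences and the continuity argument\<close>

abbreviation dst :: "real => (int => complex) => real" where
 "dst h \<psi> \<equiv> H1_dist (interp h \<psi>) ground_orbit"

text \<open>\<open>R\<close> bounds the squared H1 norm of every interpolant within distance one of
  the orbit. The gradient is reproduced exactly by the interpolant, while mass and quartic term
  carry quadrature errors of order h^2 R^2.\<close>

lemma seq_stability:
 obtains c R :: real where "c > 0" "R >= 1"
 "!!h K \<psi>. 0 < h ==> h <= 1 ==> \<psi> \<in> V K ==> dst h \<psi> <= 1 ==>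
 0 <= dst h \<psi> \<and>
 c * (dst h \<psi>)\<^sup>2 <= Fs h K \<psi> - act_eta + (nK h K \<psi> - 1)\<^sup>2 + 7 * (h\<^sup>2 * R\<^sup>2) + 2 * dst h \<psi> ^ 3 + 2 * dst h \<psi> ^ 4 \<and>
 Fs h K \<psi> - act_eta <= 4 * (dst h \<psi>)\<^sup>2 + 6 * (h\<^sup>2 * R\<^sup>2) \<and>
 (nK h K \<psi> - 1)\<^sup>2 <= 18 * (dst h \<psi>)\<^sup>2 + 2 * (h\<^sup>2 * R\<^sup>2) \<and>
 hK h K \<psi> <= 2 * R"
proof (rule orbit_stability)
 fix c :: real
 assume c: "c > 0"
 and lower: "!!A A' B B' d. W A A' ==> W B B' ==> d = H1_dist (%x. Complex (A x) (B x)) ground_orbit ==>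
 (\<forall>x. A (- x) = A x) ==> (\<forall>x. B (- x) = B x) ==>
 c * d\<^sup>2 <= action A A' B B' - act_eta + (mass A B - 1)\<^sup>2 / 4 + 2 * d ^ 3 + 2 * d ^ 4"
 and upper: "!!A A' B B' d. W A A' ==> W B B' ==> d = H1_dist (%x. Complex (A x) (B x)) ground_orbit ==>
 0 <= d \<and> action A A' B B' - act_eta <= d\<^sup>2 + 2 * d ^ 3 + d ^ 4 \<and> \<bar>mass A B - 1\<bar> <= 2 * d + d\<^sup>2
 \<and> nrm A A' + nrm B B' <= 2 * nrm eta eta1 + 2 * d\<^sup>2"
 define R where "R = 2 * nrm eta eta1 + 2"
 note R_eq = R_def
 have R1: "R >= 1" using nrm_nonneg[of eta eta1] by (simp add: R_def)
 show thesis
 proof (rule that[OF c R1])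
 fix h K \<psi>
 assume hb: "0 < h" "h <= 1" and \<psi>: "\<psi> \<in> V K" and d1: "dst h \<psi> <= 1"
 interpret grid h K \<psi> by unfold_locales (use hb V_supp[OF \<psi>] in auto)
 define d where "d = dst h \<psi>"
 have dd: "d = H1_dist (%x. Complex (A x) (B x)) ground_orbit" unfolding d_def interp_pl[OF s] ..
 have ev: "\<psi> (- j) = \<psi> j" for j using \<psi> by (simp add: V_def)
 have even: "\<forall>x. A (- x) = A x" "\<forall>x. B (- x) = B x" by (auto intro!: pl_even simp: ev)
 note lo = lower[OF WA WB dd even] and up = upper[OF WA WB dd]
 have d: "0 <= d" "d <= 1" using up d1 by (auto simp: d_def)
 have dp: "d\<^sup>2 <= d" "d ^ 3 <= d\<^sup>2" "d ^ 4 <= d\<^sup>2"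
 using power_decreasing[of 1 2 d] power_decreasing[of 2 3 d] power_decreasing[of 2 4 d] d by auto
 have XR: "X <= R" using up dp d unfolding X_def R_eq by linarith
 have X0: "0 <= X" using dK_le_X dK_nonneg by linarith
 have hR: "0 <= h\<^sup>2 * R\<^sup>2" by simp
 have FA: "\<bar>Fs h K \<psi> - action A A' B B'\<bar> <= 6 * (h\<^sup>2 * R\<^sup>2)"
 proof -
 have "X\<^sup>2 <= R\<^sup>2" using XR X0 by (rule power_mono)
 moreover have "X <= R\<^sup>2" using XR R1 self_le_power[of R 2] by linarith
 ultimately have "3 * h\<^sup>2 * (X\<^sup>2 + X) <= 3 * h\<^sup>2 * (R\<^sup>2 + R\<^sup>2)" by (intro mult_left_mono add_mono) auto
 also have "... = 6 * (h\<^sup>2 * R\<^sup>2)" by simp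
 finally show ?thesis using FK_action unfolding FK_def Fs_def by linarith
 qed
 define m where "m = h\<^sup>2 * dK h K \<psi> / 6"
 have hh: "h\<^sup>2 <= 1" using hb by (simp add: power_le_one)
 have m: "0 <= m" "m\<^sup>2 <= h\<^sup>2 * R\<^sup>2 / 36" "m <= h\<^sup>2 * R / 6"
 proof -
 show "0 <= m" using dK_nonneg by (simp add: m_def)
 show m3: "m <= h\<^sup>2 * R / 6" unfolding m_def using dK_le_X XR by (simp add: mult_left_mono)
 have "m\<^sup>2 <= (h\<^sup>2 * R / 6)\<^sup>2" using m3 \<open>0 <= m\<close> by (rule power_mono)
 also have "... = h\<^sup>2 * (h\<^sup>2 * R\<^sup>2) / 36" by (simp add: power2_eq_square)
 also have "... <= 1 * (h\<^sup>2 * R\<^sup>2) / 36" using hh hR by (intro divide_right_mono mult_right_mono) auto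
 finally show "m\<^sup>2 <= h\<^sup>2 * R\<^sup>2 / 36" by simp
 qed
 have mm: "mass A B = nK h K \<psi> - m" using mass_eq by (simp add: m_def)
 have sq2: "(a + b)\<^sup>2 <= 2 * a\<^sup>2 + 2 * b\<^sup>2" for a b :: real
 using zero_le_power2[of "a - b"] by (simp add: power2_sum power2_diff)
 have M1: "(mass A B - 1)\<^sup>2 <= 2 * (nK h K \<psi> - 1)\<^sup>2 + 2 * m\<^sup>2"
 using sq2[of "nK h K \<psi> - 1" "- m"] by (simp add: mm algebra_simps)
 have M2: "(nK h K \<psi> - 1)\<^sup>2 <= 2 * (mass A B - 1)\<^sup>2 + 2 * m\<^sup>2"
 using sq2[of "mass A B - 1" m] by (simp add: mm)
 have "\<bar>mass A B - 1\<bar> <= 3 * d" using up dp by linarith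
 then have M3: "(mass A B - 1)\<^sup>2 <= 9 * d\<^sup>2"
 using power_mono[of "\<bar>mass A B - 1\<bar>" "3 * d" 2] by (simp add: power_mult_distrib)
 have "c * d\<^sup>2 <= Fs h K \<psi> - act_eta + (nK h K \<psi> - 1)\<^sup>2 + 7 * (h\<^sup>2 * R\<^sup>2) + 2 * d ^ 3 + 2 * d ^ 4"
 proof -
 have "c * d\<^sup>2 <= f - e + n + 7 * r + p + q"
 if "c * d\<^sup>2 <= a - e + k / 4 + p + q" "\<bar>f - a\<bar> <= 6 * r" "k <= 2 * n + 2 * l" "l <= r / 36" "0 <= n" "0 <= r" for f e n r p q a k l
 using that by linarith
 from this[OF lo FA M1 m(2) zero_le_power2 hR] show ?thesis .
 qed
 moreover have "Fs h K \<psi> - act_eta <= 4 * d\<^sup>2 + 6 * (h\<^sup>2 * R\<^sup>2)"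
 proof -
 have "f - e <= 4 * p + 6 * r" if "a - e <= p + 2 * p3 + p4" "p3 <= p" "p4 <= p" "\<bar>f - a\<bar> <= 6 * r" for f e p r a p3 p4 :: real
 using that by linarith
 from this[OF _ dp(2,3) FA] show ?thesis using up by blast
 qed
 moreover have "(nK h K \<psi> - 1)\<^sup>2 <= 18 * d\<^sup>2 + 2 * (h\<^sup>2 * R\<^sup>2)" using M2 M3 m(2) hR by linarith
 moreover have "hK h K \<psi> <= 2 * R"
 proof (rule power2_le_imp_le)
 have "(hK h K \<psi>)\<^sup>2 <= 2 * R" using nK_dK_le[OF hb(2)] XR by (simp add: hK_sq[OF hb(1)])
 also have "... <= (2 * R)\<^sup>2" using R1 self_le_power[of "2 * R" 2] by simp
 finally show "(hK h K \<psi>)\<^sup>2 <= (2 * R)\<^sup>2" .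
 qed (use R1 in simp)
 ultimately show "0 <= dst h \<psi> \<and>
 c * (dst h \<psi>)\<^sup>2 <= Fs h K \<psi> - act_eta + (nK h K \<psi> - 1)\<^sup>2 + 7 * (h\<^sup>2 * R\<^sup>2) + 2 * dst h \<psi> ^ 3 + 2 * dst h \<psi> ^ 4 \<and>
 Fs h K \<psi> - act_eta <= 4 * (dst h \<psi>)\<^sup>2 + 6 * (h\<^sup>2 * R\<^sup>2) \<and>
 (nK h K \<psi> - 1)\<^sup>2 <= 18 * (dst h \<psi>)\<^sup>2 + 2 * (h\<^sup>2 * R\<^sup>2) \<and>
 hK h K \<psi> <= 2 * R" using d(1) unfolding d_def by blast
 qed
qed

text \<open>The explicit formula for the distance writes it as a continuous function of finitely
  many coordinates.\<close>

lemma dst_continuous: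
 assumes h: "h > 0" and V: "!!t. f t \<in> V K" and c: "!!j. continuous_on S (%t. f t j)"
 shows "continuous_on S (%t. dst h (f t))"
proof -
 let ?e = "%i. eta_ip (%x. hat (x / h - of_int i)) (%x. hat1 h (x / h - of_int i))"
 have eq: "dst h (f t) = sqrt ((nK h K (f t) - h\<^sup>2 * dK h K (f t) / 6 + dK h K (f t)) + nrm eta eta1
 - 2 * sqrt ((\<Sum>i=-int K..int K. Re (f t i) * ?e i)\<^sup>2 + (\<Sum>i=-int K..int K. Im (f t i) * ?e i)\<^sup>2))" for t
 proof -
 interpret grid h K "f t" by unfold_locales (use h V_supp[OF V] in auto)
 show ?thesis unfolding interp_pl[OF s] orbit_dist_formula[OF WA WB] X_def[symmetric] X_eq mass_eq eta_ip_pl[OF h] ..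
 qed
 show ?thesis unfolding eq nK_def dK_def
 by (intro continuous_intros c) (use h in auto)
qed

text \<open>Values strictly between D / 2 and D are excluded. To leave the region the function would
  have to pass through 3 D / 4.\<close>

lemma barrier:
 fixes f :: "real => real"
 assumes c: "continuous_on {0..b} f" and b: "0 <= b" and f0: "f 0 <= D / 2" and D: "D > 0"
 and step: "!!t. t \<in> {0..b} ==> f t <= D ==> f t <= D / 2"
 shows "t \<in> {0..b} ==> f t <= D / 2"
proof (rule ccontr)
 assume t: "t \<in> {0..b}" and n: "\<not> f t <= D / 2"
 then have "f t > D" using step[OF t] by linarith
 moreover have "continuous_on {0..t} f" using t by (intro continuous_on_subset[OF c]) auto
 ultimately obtain s where s: "0 <= s" "s <= t" "f s = 3 / 4 * D"
 using IVT'[of f 0 "3 / 4 * D" t] f0 D t by auto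
 then show False using step[of s] t D by auto
qed

text \<open>Inside a single step a change of energy of order \<tau> is affordable. It does not
  accumulate, because at whole steps the modified energy takes over.\<close>

lemma step_energy:
 assumes h: "h > 0" and H: "1 <= H" and \<psi>: "\<psi> \<in> V K" and b: "hK h K \<psi> <= H" and t: "0 <= t" "t <= 1"
 shows "Fs h K (Phi_P t \<psi>) <= Fs h K \<psi> + 8 * H ^ 6 * t" "hK h K (Phi_P t \<psi>) <= (1 + 2 * H\<^sup>2) * H"
 "0 <= s ==> Fs h K (Phi_A h K s (Phi_P t \<psi>)) <= Fs h K (Phi_P t \<psi>) + 4 * ((1 + 2 * H\<^sup>2) * H) ^ 4 * s"
 "nK h K (Phi_A h K s (Phi_P t \<psi>)) = nK h K \<psi>"
proof -
 let ?k = "hK h K \<psi>"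
 have k0: "0 <= ?k" by (rule hK_nonneg[OF h])
 have k2: "?k\<^sup>2 <= H\<^sup>2" using b k0 by (rule power_mono)
 have tk: "2 * t * ?k\<^sup>2 <= 2 * t * H\<^sup>2" using k2 t by (intro mult_left_mono) auto
 have dle: "dK h K \<psi> <= H\<^sup>2" using dK_le_hK(1)[OF h, of K \<psi>] k2 by linarith
 have d0: "0 <= dK h K \<psi>" by (rule dK_nonneg[OF h])
 define a where "a = t * H\<^sup>2"
 have a0: "0 <= a" using t by (simp add: a_def)
 have "dK h K (Phi_P t \<psi>) <= (1 + 2 * t * ?k\<^sup>2)\<^sup>2 * dK h K \<psi>" by (rule dK_Phi_P[OF h V_supp[OF \<psi>] t(1)])
 also have "... <= (1 + 2 * a)\<^sup>2 * dK h K \<psi>"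
 using tk t d0 by (intro mult_right_mono power_mono) (auto simp: a_def)
 also have "... = dK h K \<psi> + (4 * a + 4 * a\<^sup>2) * dK h K \<psi>" by (simp add: power2_eq_square algebra_simps)
 also have "(4 * a + 4 * a\<^sup>2) * dK h K \<psi> <= (8 * t * H ^ 4) * H\<^sup>2"
 proof (rule mult_mono[OF _ dle])
 have "H\<^sup>2 <= H ^ 4" using H by (intro power_increasing) auto
 then have "4 * a <= 4 * (t * H ^ 4)" using t by (simp add: a_def mult_left_mono)
 moreover have "t\<^sup>2 <= t" using t by (simp add: power2_eq_square mult_left_le)
 then have "t\<^sup>2 * H ^ 4 <= t * H ^ 4" by (rule mult_right_mono) simp
 then have "a\<^sup>2 <= t * H ^ 4" by (simp add: a_def power_mult_distrib power_mult[symmetric])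
 ultimately show "4 * a + 4 * a\<^sup>2 <= 8 * t * H ^ 4" by (simp add: mult.assoc)
 qed (use t d0 in auto)
 also have "(8 * t * H ^ 4) * H\<^sup>2 = 8 * H ^ 6 * t" by (simp add: mult_ac power_add[symmetric])
 finally have "dK h K (Phi_P t \<psi>) <= dK h K \<psi> + 8 * H ^ 6 * t" by simp
 then show "Fs h K (Phi_P t \<psi>) <= Fs h K \<psi> + 8 * H ^ 6 * t" by (simp add: Fs_def)
 have "hK h K (Phi_P t \<psi>) <= (1 + 2 * t * ?k\<^sup>2) * ?k" by (rule hK_Phi_P[OF h V_supp[OF \<psi>] t(1)])
 also have "... <= (1 + 2 * H\<^sup>2) * H"
 proof (rule mult_mono[OF _ b])
 have "2 * t * H\<^sup>2 <= 2 * 1 * H\<^sup>2" using t by (intro mult_right_mono mult_left_mono) auto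
 then show "1 + 2 * t * ?k\<^sup>2 <= 1 + 2 * H\<^sup>2" using tk by simp
 qed (use k0 H in auto)
 finally show hP: "hK h K (Phi_P t \<psi>) <= (1 + 2 * H\<^sup>2) * H" .
 interpret linear_flow h K "Phi_P t \<psi>" by unfold_locales (use h Phi_P_V[OF \<psi>] in auto)
 show "nK h K (Phi_A h K s (Phi_P t \<psi>)) = nK h K \<psi>" using nK_const by simp
 assume s: "0 <= s"
 have "hK h K (Phi_P t \<psi>) ^ 4 <= ((1 + 2 * H\<^sup>2) * H) ^ 4" by (rule power_mono[OF hP hK_nonneg[OF h]])
 then have "8 * hK h K (Phi_P t \<psi>) ^ 4 * s <= 8 * ((1 + 2 * H\<^sup>2) * H) ^ 4 * s" using s by (intro mult_right_mono) auto
 moreover have "8 * z * s = 2 * (4 * z * s)" for z by simp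
 ultimately show "Fs h K (Phi_A h K s (Phi_P t \<psi>)) <= Fs h K (Phi_P t \<psi>) + 4 * ((1 + 2 * H\<^sup>2) * H) ^ 4 * s"
 using qK_lower[OF s] unfolding Fs_def dK_const nK_const by linarith
qed


theorem theorem2p4:
  fixes M :: nat
  shows "\<exists>C\<^sub>1 C\<^sub>2 \<delta>\<^sub>0 \<epsilon>\<^sub>0 :: real. C\<^sub>1 > 0 \<and> C\<^sub>2 > 0 \<and> \<delta>\<^sub>0 > 0 \<and> \<epsilon>\<^sub>0 > 0 \<and>
    (\<forall>(\<delta>::real) (h::real) (\<tau>::real) (K::nat).
      0 < \<delta> \<and> \<delta> < \<delta>\<^sub>0 \<and> h > 0 \<and> \<tau> > 0 \<and> K \<ge> 1 \<and>
      h + 1 / h\<^sup>2 * exp (- C\<^sub>1 * real K * h) \<le> \<epsilon>\<^sub>0 \<and>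
      (2 * real M + 3) * (\<tau> / h\<^sup>2) < 2 * pi / 3 \<longrightarrow>
      (\<forall>\<psi>\<^sub>0\<in>V K. H1_dist (interp h \<psi>\<^sub>0) ground_orbit \<le> \<delta> \<longrightarrow>
        (\<forall>n::nat. real n * \<tau> \<le> \<tau> powi (- int M) \<longrightarrow>
          H1_dist (interp h (((Phi_A h K \<tau> \<circ> Phi_P \<tau>) ^^ n) \<psi>\<^sub>0)) ground_orbit
            \<le> C\<^sub>2 * (\<delta> + h + \<tau> / h + 1 / h\<^sup>2 * exp (- C\<^sub>1 * real K * h)))))"
proof (rule seq_stability)
 fix c R :: real
 assume c: "c > 0" and R: "R >= 1"
 and stab: "!!h K \<psi>. 0 < h ==> h <= 1 ==> \<psi> \<in> V K ==> dst h \<psi> <= 1 ==>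
 0 <= dst h \<psi> \<and>
 c * (dst h \<psi>)\<^sup>2 <= Fs h K \<psi> - act_eta + (nK h K \<psi> - 1)\<^sup>2 + 7 * (h\<^sup>2 * R\<^sup>2) + 2 * dst h \<psi> ^ 3 + 2 * dst h \<psi> ^ 4 \<and>
 Fs h K \<psi> - act_eta <= 4 * (dst h \<psi>)\<^sup>2 + 6 * (h\<^sup>2 * R\<^sup>2) \<and>
 (nK h K \<psi> - 1)\<^sup>2 <= 18 * (dst h \<psi>)\<^sup>2 + 2 * (h\<^sup>2 * R\<^sup>2) \<and>
 hK h K \<psi> <= 2 * R"
 define H where "H = 2 * R"
 define Rb where "Rb = (1 + 2 * H\<^sup>2) * H"
 have H: "1 <= H" using R by (simp add: H_def)
 have HRb: "H <= Rb" unfolding Rb_def using H by (simp add: distrib_right)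
 have Rb: "1 <= Rb" using H HRb by linarith
 obtain Cg where Cg: "Cg >= 0" and split: "!!h \<tau> K. h > 0 ==> 0 < \<tau> ==> \<tau> <= 1 ==> (2 * real M + 3) * (\<tau> / h\<^sup>2) < 2 * pi / 3 ==>
 \<exists>E. (\<forall>n. \<forall>\<psi>\<in>V K. hK h K \<psi> <= Rb --> \<bar>E n \<psi> - \<tau> / 2 * (Fs h K \<psi> - (2 / h\<^sup>2 + 1 / 16) * nK h K \<psi>)\<bar> <= Cg * \<tau>\<^sup>2) \<and>
 (\<forall>n. \<forall>\<psi>\<in>V K. (\<forall>s\<in>{0..1}. hK h K (Phi_P (s * \<tau>) \<psi>) <= Rb) -->
 \<bar>E (Suc n) (Phi_A h K \<tau> (Phi_P \<tau> \<psi>)) - E (n::nat) \<psi>\<bar> <= Cg * \<tau> ^ (M + 3))"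
 using splitting_energy[OF Rb, of M] by metis
 define Cp where "Cp = 8 * H ^ 6 + 4 * Rb ^ 4"
 have Cp0: "0 <= 8 * H ^ 6" "0 <= 4 * Rb ^ 4" using H Rb by auto
 \<comment> \<open>The part 6 Cg covers the drift of the modified energy over all completed steps;
   Cp covers the current step, first the kick and then the linear flow.\<close>
 define Cd where "Cd = 6 * Cg + Cp"
 have Cd0: "Cd >= 0" using Cg Cp0 by (simp add: Cd_def Cp_def)
 \<comment> \<open>Collected from \<open>stab\<close>: 22 = 4 + 18 from the initial energy and mass
   defect, 15 = 7 + 6 + 2 from the quadrature errors.\<close>
 define Q where "Q = 22 + 15 * R\<^sup>2 + Cd"
 define C3 where "C3 = sqrt (2 * Q / c) + 1"
 have Q: "Q >= 22" using Cd0 by (simp add: Q_def)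
 have C3: "C3 >= 1" using Q c by (simp add: C3_def)
 \<comment> \<open>With distance d <= D <= 1, the terms 2 d^3 + 2 d^4 are at most 4 D d^2 <= c d^2 /
   2 and are absorbed by the coercive term.\<close>
 define D where "D = min 1 (c / 8)"
 have D: "D > 0" "D <= 1" "8 * D <= c" using c by (auto simp: D_def)
 \<comment> \<open>Makes C3 (\<delta> + h) at most D / 2, the inner level of the barrier.\<close>
 define e where "e = D / (4 * C3)"
 have e: "e > 0" "C3 * e <= D / 4" "e <= 1"
 proof -
 show "e > 0" "C3 * e <= D / 4" using D C3 by (auto simp: e_def)
 have "e <= D / (4 * 1)" unfolding e_def using C3 D by (intro divide_left_mono) auto
 then show "e <= 1" using D by simp
 qed
 have main: "dst h (((Phi_A h K \<tau> \<circ> Phi_P \<tau>) ^^ n) \<psi>0) <= C3 * (\<delta> + h)"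
 if \<delta>: "0 < \<delta>" "\<delta> < e" and h: "h > 0" "h <= e" and \<tau>: "\<tau> > 0" and cfl: "(2 * real M + 3) * (\<tau> / h\<^sup>2) < 2 * pi / 3"
 and \<psi>0: "\<psi>0 \<in> V K" "dst h \<psi>0 <= \<delta>" and n: "real n * \<tau> <= \<tau> powi (- int M)" for \<delta> h \<tau> :: real and K n :: nat and \<psi>0
 proof -
 have h1: "h <= 1" using h e by linarith
 have \<tau>h: "\<tau> <= h\<^sup>2"
 proof -
 have "0 <= real M * (\<tau> / h\<^sup>2)" using \<tau> by simp
 moreover have "(2 * real M + 3) * (\<tau> / h\<^sup>2) = 2 * (real M * (\<tau> / h\<^sup>2)) + 3 * (\<tau> / h\<^sup>2)" by (simp only: distrib_right mult.assoc)
 ultimately have "3 * (\<tau> / h\<^sup>2) < 2 * pi / 3" using cfl by linarith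
 then have "\<tau> / h\<^sup>2 < 1" using pi_less_4 by linarith
 then show ?thesis using h by (simp add: field_simps)
 qed
 have hh: "h\<^sup>2 <= 1" using h h1 by (simp add: power_le_one)
 have \<tau>1: "\<tau> <= 1" using \<tau>h hh by linarith
 obtain E where E: "(\<forall>n. \<forall>\<psi>\<in>V K. hK h K \<psi> <= Rb --> \<bar>E n \<psi> - \<tau> / 2 * (Fs h K \<psi> - (2 / h\<^sup>2 + 1 / 16) * nK h K \<psi>)\<bar> <= Cg * \<tau>\<^sup>2) \<and>
 (\<forall>n. \<forall>\<psi>\<in>V K. (\<forall>s\<in>{0..1}. hK h K (Phi_P (s * \<tau>) \<psi>) <= Rb) -->
 \<bar>E (Suc n) (Phi_A h K \<tau> (Phi_P \<tau> \<psi>)) - E (n::nat) \<psi>\<bar> <= Cg * \<tau> ^ (M + 3))"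
 using split[of h \<tau> K, OF h(1) \<tau> \<tau>1 cfl] by (rule exE)
 have d0: "dst h \<psi>0 <= 1" using \<psi>0 \<delta> e by linarith
 note s0 = stab[OF h(1) h1 \<psi>0(1) d0]
 have dsq: "(dst h \<psi>0)\<^sup>2 <= \<delta>\<^sup>2" using s0 \<psi>0(2) by (intro power_mono) auto
 have hR: "0 <= h\<^sup>2 * R\<^sup>2" by simp
 have small: "C3 * (\<delta> + h) <= D / 2"
 proof -
 have "C3 * (\<delta> + h) <= C3 * (e + e)" using \<delta> h C3 by (intro mult_left_mono) auto
 then show ?thesis using e by (simp add: distrib_left)
 qed
 \<comment> \<open>The improvement that feeds \<open>barrier\<close>: with the initial mass and
   almost the initial energy, distance at most \<open>D\<close> already forces distance at most C3
   (\<delta> + h), hence at most D / 2.\<close>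
 have est: "dst h \<phi> <= C3 * (\<delta> + h)"
 if \<phi>: "\<phi> \<in> V K" "dst h \<phi> <= D" "nK h K \<phi> = nK h K \<psi>0" "Fs h K \<phi> <= Fs h K \<psi>0 + Cd * h\<^sup>2" for \<phi>
 proof -
 define d where "d = dst h \<phi>"
 have "dst h \<phi> <= 1" using \<phi>(2) D by linarith
 note sx = stab[OF h(1) h1 \<phi>(1) this, folded d_def]
 have d: "0 <= d" "d <= D" using sx \<phi>(2) by (auto simp: d_def)
 have d2: "0 <= d\<^sup>2" by simp
 have p3: "d ^ 3 <= D * d\<^sup>2" using mult_right_mono[OF d(2) d2] by (simp add: power3_eq_cube power2_eq_square mult.assoc)
 have "d * d <= D * 1" using d D by (intro mult_mono) auto
 then have p4: "d ^ 4 <= D * d\<^sup>2" using mult_right_mono[OF _ d2, of "d * d" D] by (simp add: power4_eq_xxxx power2_eq_square mult.assoc)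
 have "8 * D * d\<^sup>2 <= c * d\<^sup>2" using D(3) d2 by (rule mult_right_mono)
 then have "c * d\<^sup>2 / 2 <= 22 * \<delta>\<^sup>2 + (15 * (h\<^sup>2 * R\<^sup>2) + Cd * h\<^sup>2)"
 using sx s0 \<phi>(3,4) dsq p3 p4 by (simp only: mult.assoc) linarith
 also have "... <= Q * (\<delta> + h)\<^sup>2"
 proof -
 have "\<delta>\<^sup>2 + h\<^sup>2 <= (\<delta> + h)\<^sup>2" using \<delta> h by (simp add: power2_sum)
 then have "Q * (\<delta>\<^sup>2 + h\<^sup>2) <= Q * (\<delta> + h)\<^sup>2" using Q by (intro mult_left_mono) auto
 moreover have "22 * \<delta>\<^sup>2 <= Q * \<delta>\<^sup>2" using Q by (intro mult_right_mono) auto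
 moreover have "15 * (h\<^sup>2 * R\<^sup>2) + Cd * h\<^sup>2 <= Q * h\<^sup>2" by (simp add: Q_def algebra_simps)
 ultimately show ?thesis by (simp add: distrib_left)
 qed
 finally have "d\<^sup>2 <= (2 * Q / c) * (\<delta> + h)\<^sup>2" using c by (simp add: field_simps)
 then have "sqrt (d\<^sup>2) <= sqrt ((2 * Q / c) * (\<delta> + h)\<^sup>2)" by (rule real_sqrt_le_mono)
 then have "d <= sqrt (2 * Q / c) * (\<delta> + h)" unfolding real_sqrt_mult[of "2 * Q / c"] using d \<delta> h by simp
 also have "... <= C3 * (\<delta> + h)" using \<delta> h by (intro mult_right_mono) (auto simp: C3_def)
 finally show ?thesis by (simp add: d_def)
 qed
 let ?\<psi> = "%n. ((Phi_A h K \<tau> \<circ> Phi_P \<tau>) ^^ n) \<psi>0"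
 have "?\<psi> n \<in> V K \<and> nK h K (?\<psi> n) = nK h K \<psi>0 \<and> dst h (?\<psi> n) <= C3 * (\<delta> + h) \<and> \<bar>E n (?\<psi> n) - E 0 \<psi>0\<bar> <= real n * (Cg * \<tau> ^ (M + 3))"
 using n
 proof (induction n)
 case 0
 have "1 * (\<delta> + 0) <= C3 * (\<delta> + h)" using C3 \<delta> h by (intro mult_mono) auto
 then show ?case using \<psi>0 by simp
 next
 case (Suc n)
 have "real n * \<tau> <= real (Suc n) * \<tau>" using \<tau> by simp
 then have nt: "real n * \<tau> <= \<tau> powi (- int M)" using Suc.prems by linarith
 define \<psi> where "\<psi> = ?\<psi> n"
 note IH = Suc.IH[OF nt, folded \<psi>_def]
 have \<psi>: "\<psi> \<in> V K" "nK h K \<psi> = nK h K \<psi>0" "dst h \<psi> <= C3 * (\<delta> + h)" "\<bar>E n \<psi> - E 0 \<psi>0\<bar> <= real n * (Cg * \<tau> ^ (M + 3))"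
 using IH by auto
 have dD: "dst h \<psi> <= D / 2" using \<psi>(3) small by linarith
 have d1: "dst h \<psi> <= 1" using dD D by linarith
 have kH: "hK h K \<psi> <= H" "hK h K \<psi>0 <= H" using stab[OF h(1) h1 \<psi>(1) d1] s0 by (auto simp: H_def)
 \<comment> \<open>The time restriction gives n \<tau>^(M + 1) <= 1, so the drifts of all steps add
   up to Cg \<tau>^2, the size of each of the two comparison errors. The mass term, large as it is,
   cancels by exact conservation, and division by \<tau> / 2 turns 3 Cg \<tau>^2 into 6 Cg
   \<tau>.\<close>
 have drift: "Fs h K \<psi> <= Fs h K \<psi>0 + 6 * Cg * \<tau>"
 proof -
 let ?k = "(2 / h\<^sup>2 + 1 / 16) * nK h K \<psi>0"
 have 1: "\<bar>E n \<psi> - \<tau> / 2 * (Fs h K \<psi> - ?k)\<bar> <= Cg * \<tau>\<^sup>2"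
 using conjunct1[OF E, rule_format, OF \<psi>(1), of n] kH(1) HRb \<psi>(2) by simp
 have 2: "\<bar>E 0 \<psi>0 - \<tau> / 2 * (Fs h K \<psi>0 - ?k)\<bar> <= Cg * \<tau>\<^sup>2"
 using conjunct1[OF E, rule_format, OF \<psi>0(1), of 0] kH(2) HRb by simp
 have "real n * \<tau> * \<tau> ^ M <= 1"
 proof -
 have "real n * \<tau> * \<tau> ^ M <= \<tau> powi (- int M) * \<tau> ^ M" using nt \<tau> by (intro mult_right_mono) auto
 also have "... = 1" using \<tau> by (simp add: power_int_minus)
 finally show ?thesis .
 qed
 then have "(real n * \<tau> * \<tau> ^ M) * (Cg * \<tau>\<^sup>2) <= 1 * (Cg * \<tau>\<^sup>2)" using Cg by (intro mult_right_mono) auto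
 moreover have "real n * (Cg * \<tau> ^ (M + 3)) = (real n * \<tau> * \<tau> ^ M) * (Cg * \<tau>\<^sup>2)"
 by (simp add: power_add power2_eq_square power3_eq_cube mult_ac)
 ultimately have 3: "\<bar>E n \<psi> - E 0 \<psi>0\<bar> <= Cg * \<tau>\<^sup>2" using \<psi>(4) by linarith
 have "\<tau> / 2 * (Fs h K \<psi> - ?k) - \<tau> / 2 * (Fs h K \<psi>0 - ?k) <= 3 * (Cg * \<tau>\<^sup>2)" using 1 2 3 by linarith
 then have "\<tau> / 2 * (Fs h K \<psi>) <= \<tau> / 2 * (Fs h K \<psi>0 + 6 * Cg * \<tau>)" by (simp add: power2_eq_square algebra_simps)
 then show ?thesis using \<tau> by simp
 qed
 have \<tau>Cd: "6 * Cg * \<tau> + 8 * H ^ 6 * t + 4 * Rb ^ 4 * s <= Cd * h\<^sup>2" if "t <= \<tau>" "s <= \<tau>" for s t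
 proof -
 have "8 * H ^ 6 * t <= 8 * H ^ 6 * \<tau>" "4 * Rb ^ 4 * s <= 4 * Rb ^ 4 * \<tau>" using that Cp0 by (auto intro!: mult_left_mono)
 moreover have "Cd * \<tau> <= Cd * h\<^sup>2" using \<tau>h Cd0 by (rule mult_left_mono)
 ultimately show ?thesis by (simp add: Cd_def Cp_def distrib_right)
 qed
 have PV: "Phi_P t \<psi> \<in> V K" for t by (rule Phi_P_V[OF \<psi>(1)])
 note st = step_energy[OF h(1) H \<psi>(1) kH(1), folded Rb_def]
 \<comment> \<open>The barrier argument runs along the kick and then along the linear flow, because
   a discrete step alone could jump over the gap.\<close>
 have leg1: "dst h (Phi_P t \<psi>) <= D / 2" if "t \<in> {0..\<tau>}" for t
 proof (rule barrier[of \<tau> "%t. dst h (Phi_P t \<psi>)", OF _ _ _ D(1) _ that])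
 show "continuous_on {0..\<tau>} (%t. dst h (Phi_P t \<psi>))"
 by (rule dst_continuous[OF h(1) PV]) (unfold Phi_P_def, intro continuous_intros)
 show "dst h (Phi_P 0 \<psi>) <= D / 2" using dD by (simp add: Phi_P_flow(1))
 fix r assume r: "r \<in> {0..\<tau>}" and "dst h (Phi_P r \<psi>) <= D"
 moreover have "Fs h K (Phi_P r \<psi>) <= Fs h K \<psi>0 + Cd * h\<^sup>2"
 using st(1)[of r] drift \<tau>Cd[of r 0] r \<tau> \<tau>1 by (simp add: algebra_simps)
 ultimately show "dst h (Phi_P r \<psi>) <= D / 2"
 using est[OF PV, of r] small \<psi>(2) by simp
 qed (use \<tau> in simp)
 let ?y = "Phi_P \<tau> \<psi>"
 have AV: "Phi_A h K t ?y \<in> V K" for t by (rule Phi_A_V[OF PV])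
 have good: "Fs h K (Phi_A h K r ?y) <= Fs h K \<psi>0 + Cd * h\<^sup>2" "nK h K (Phi_A h K r ?y) = nK h K \<psi>0" if r: "r \<in> {0..\<tau>}" for r
 using st(1)[of \<tau>] st(3)[of \<tau> r] st(4)[of \<tau> r] drift \<tau>Cd[of \<tau> r] r \<tau> \<tau>1 \<psi>(2) by (auto simp: algebra_simps)
 have leg2: "dst h (Phi_A h K t ?y) <= D / 2" if "t \<in> {0..\<tau>}" for t
 proof (rule barrier[of \<tau> "%t. dst h (Phi_A h K t ?y)", OF _ _ _ D(1) _ that])
 show "continuous_on {0..\<tau>} (%t. dst h (Phi_A h K t ?y))"
 by (rule dst_continuous[OF h(1) AV])
 (rule continuous_on_vector_derivative[OF has_vector_derivative_at_within[OF Phi_A_deriv[OF PV]]])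
 show "dst h (Phi_A h K 0 ?y) <= D / 2" using leg1[of \<tau>] \<tau> by (simp add: Phi_A_solves(2)[OF PV])
 fix r assume r: "r \<in> {0..\<tau>}" and "dst h (Phi_A h K r ?y) <= D"
 then show "dst h (Phi_A h K r ?y) <= D / 2"
 using est[OF AV, of r] good[OF r] small by simp
 qed (use \<tau> in simp)
 have \<tau>\<tau>: "\<tau> \<in> {0..\<tau>}" using \<tau> by simp
 have S: "?\<psi> (Suc n) = Phi_A h K \<tau> ?y" by (simp add: \<psi>_def)
 have dS: "dst h (Phi_A h K \<tau> ?y) <= C3 * (\<delta> + h)"
 by (rule est[OF AV _ good(2)[OF \<tau>\<tau>] good(1)[OF \<tau>\<tau>]]) (use leg2[OF \<tau>\<tau>] D in linarith)
 have "\<bar>E (Suc n) (Phi_A h K \<tau> ?y) - E n \<psi>\<bar> <= Cg * \<tau> ^ (M + 3)"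
 proof (rule conjunct2[OF E, rule_format, OF \<psi>(1)])
 fix s :: real assume s: "s \<in> {0..1}"
 have "s * \<tau> <= 1 * 1" using s \<tau> \<tau>1 by (intro mult_mono) auto
 then show "hK h K (Phi_P (s * \<tau>) \<psi>) <= Rb" using st(2)[of "s * \<tau>"] s \<tau> by simp
 qed
 then have "\<bar>E (Suc n) (Phi_A h K \<tau> ?y) - E 0 \<psi>0\<bar> <= real (Suc n) * (Cg * \<tau> ^ (M + 3))"
 using \<psi>(4) by (simp add: distrib_right)
 then show ?case unfolding S using AV good(2)[OF \<tau>\<tau>] dS by blast
 qed
 then show ?thesis by blast
 qed
 show ?thesis
 proof (rule exI[of _ 1], rule exI[of _ C3], rule exI[of _ e], rule exI[of _ e], intro conjI allI impI ballI)
 fix \<delta> h \<tau> :: real and K n :: nat and \<psi>0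
 assume a: "0 < \<delta> \<and> \<delta> < e \<and> h > 0 \<and> \<tau> > 0 \<and> K >= 1 \<and>
 h + 1 / h\<^sup>2 * exp (- 1 * real K * h) <= e \<and> (2 * real M + 3) * (\<tau> / h\<^sup>2) < 2 * pi / 3"
 and \<psi>0: "\<psi>0 \<in> V K" "dst h \<psi>0 <= \<delta>" and n: "real n * \<tau> <= \<tau> powi (- int M)"
 have p: "0 <= 1 / h\<^sup>2 * exp (- 1 * real K * h)" by simp
 then have "h <= e" using a by linarith
 then have "dst h (((Phi_A h K \<tau> \<circ> Phi_P \<tau>) ^^ n) \<psi>0) <= C3 * (\<delta> + h)"
 using main[OF _ _ _ _ _ _ \<psi>0 n] a by blast
 also have "... <= C3 * (\<delta> + h + \<tau> / h + 1 / h\<^sup>2 * exp (- 1 * real K * h))"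
 using C3 p a by (intro mult_left_mono) auto
 finally show "dst h (((Phi_A h K \<tau> \<circ> Phi_P \<tau>) ^^ n) \<psi>0) <= C3 * (\<delta> + h + \<tau> / h + 1 / h\<^sup>2 * exp (- 1 * real K * h))" .
 qed (use C3 e in auto)
qed

end
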